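(* Let $g>0$, $\omega\in\mathbb{R}$, and let $p_\pm$, $l,m>0$ and the steady density $\rho_0$ be as in the context. The linear problem $$\left\{\begin{array}{l}\partial_t\eta=v,\\ \partial_t q+\rho_0\,\mathrm{div}\,v=0,\\ \rho_0\partial_t v+\nabla(p'(\rho_0)q)=-gq\,e_3-g\rho_0\nabla\eta_3+2\rho_0\omega v_2e_1-2\rho_0\omega v_1e_2\end{array}\right.$$ in $\Omega_+\cup\Omega_-$, with jump conditions $\llbracket v\cdot e_3\rrbracket=0$, $\llbracket p'(\rho_0)q\rrbracket=0$ on $\{x_3=0\}$ and boundary conditions $v_-(t,x',-m)\cdot e_3=v_+(t,x',l)\cdot e_3=0$, is ill-posed in the sense of Hadamard in $H^k(\Omega)$ for every $k$. More precisely: for any $k,j\in\mathbb{N}$ with $j\ge k$ and any $T_0>0$, $\alpha>0$, there exists a sequence $\{(\eta_n,v_n,q_n)\}_{n=1}^\infty$ of solutions of this linear problem (including the jump and boundary conditions) such that $$\|\eta_n(0)\|_{H^j}+\|v_n(0)\|_{H^j}+\|q_n(0)\|_{H^j}\le\frac1n,$$ but $$\|v_n(t)\|_{H^k}\ge\|\eta_n(t)\|_{H^k}\ge\alpha\quad\text{for all }t\ge T_0.$$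
   Context: Setting. $p_\pm\in C^\infty(0,\infty)$ are nonnegative, strictly increasing pressure laws with $1/p_\pm'\in L^\infty_{\rm loc}(0,\infty)$, and $\{z\in(0,\infty): p_-(z)>p_+(z),\ p_-(z)\in p_+(0,\infty)\}\ne\emptyset$. The constants $l,m>0$ and the function $\rho_0=\rho_0(x_3)$ on $(-m,l)$ satisfy: $\rho_0$ is bounded above and below by positive constants, is smooth on each of $(-m,0)$ and $(0,l)$, solves $\frac{d}{dx_3}p_+(\rho_0)=-g\rho_0$ on $(0,l)$ and $\frac{d}{dx_3}p_-(\rho_0)=-g\rho_0$ on $(-m,0)$, with $p_+(\rho_0^+)=p_-(\rho_0^-)$ at $x_3=0$, and $\llbracket\rho_0\rrbracket>0$. Notation. $\Omega=\mathbb{R}^2\times(-m,l)$, $\Omega_+=\mathbb{R}^2\times(0,l)$, $\Omega_-=\mathbb{R}^2\times(-m,0)$, $x=(x',x_3)$; $f_\pm$ is the restriction of $f$ to $\Omega_\pm$; $\llbracket f\rrbracket=f_+|_{x_3=0}-f_-|_{x_3=0}$; $p'(\rho_0)$ means $p_+'(\rho_0)$ for $x_3>0$ and $p_-'(\rho_0)$ for $x_3<0$. The unknowns are real-valued: $\eta,v:[0,\infty)\times(\Omega_+\cup\Omega_-)\to\mathbb{R}^3$ and $q:[0,\infty)\times(\Omega_+\cup\Omega_-)\to\mathbb{R}$. $H^k(\Omega)$ is the piecewise Sobolev space $\{f: f_\pm\in H^k(\Omega_\pm)\}$ with $\|f\|_{H^k}^2=\|f\|^2_{H^k(\Omega_+)}+\|f\|^2_{H^k(\Omega_-)}$,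 where $$\|f\|^2_{H^k(\Omega_\pm)}=\sum_{j=0}^k\int_{\mathbb{R}^2}(1+|\xi|^2)^{k-j}\|\partial_{x_3}^j\hat f_\pm(\xi,\cdot)\|^2_{L^2(I_\pm)}\,d\xi,$$ $I_+=(0,l)$, $I_-=(-m,0)$, and $\hat f(\xi,x_3)=\int_{\mathbb{R}^2}f(x',x_3)e^{-ix'\cdot\xi}dx'$. *)

theory Defs
  imports "HOL-Analysis.Analysis"
begin

section \<open>Pressure laws and the steady density\<close>

definition smooth_on :: "real set \<Rightarrow> (real \<Rightarrow> real) \<Rightarrow> bool" where
  "smooth_on S f \<longleftrightarrow> (\<forall>n. \<forall>x\<in>S. ((deriv ^^ n) f) field_differentiable (at x))"

text \<open>
  In the condition that the reciprocal of the derivative is locally essentially bounded, the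
  derivative is required to be nonzero almost everywhere, because \<open>1 / 0 = 0\<close> in HOL.
\<close>
definition pressure_law :: "(real \<Rightarrow> real) \<Rightarrow> bool" where
  "pressure_law p \<longleftrightarrow>
     smooth_on {0<..} p \<and>
     (\<forall>z>0. 0 \<le> p z) \<and>
     strict_mono_on {0<..} p \<and>
     (\<forall>K. compact K \<and> K \<subseteq> {0<..} \<longrightarrow>
       (\<exists>C. AE z in lborel. z \<in> K \<longrightarrow> deriv p z \<noteq> 0 \<and> \<bar>1 / deriv p z\<bar> \<le> C))"

text \<open>The value of \<open>\<rho>0\<close> at the interface 0 is never used; only its one-sided limits are.\<close>
definition steady_density ::
  "real \<Rightarrow> (real \<Rightarrow> real) \<Rightarrow> (real \<Rightarrow> real) \<Rightarrow> real \<Rightarrow> real \<Rightarrow> (real \<Rightarrow> real) \<Rightarrow> bool" where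
  "steady_density g pp pm l m \<rho>0 \<longleftrightarrow>
     (\<exists>a>0. \<exists>b. \<forall>s\<in>{-m<..<0} \<union> {0<..<l}. a \<le> \<rho>0 s \<and> \<rho>0 s \<le> b) \<and>
     smooth_on {-m<..<0} \<rho>0 \<and> smooth_on {0<..<l} \<rho>0 \<and>
     (\<forall>s\<in>{0<..<l}. ((\<lambda>r. pp (\<rho>0 r)) has_real_derivative (- g * \<rho>0 s)) (at s)) \<and>
     (\<forall>s\<in>{-m<..<0}. ((\<lambda>r. pm (\<rho>0 r)) has_real_derivative (- g * \<rho>0 s)) (at s)) \<and>
     (\<exists>\<rho>p \<rho>m. (\<rho>0 \<longlongrightarrow> \<rho>p) (at_right 0) \<and> (\<rho>0 \<longlongrightarrow> \<rho>m) (at_left 0) \<and>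
        pp \<rho>p = pm \<rho>m \<and> \<rho>p - \<rho>m > 0)"


section \<open>The domain\<close>

definition slab :: "real set \<Rightarrow> (real^3) set" where
  "slab I = {x. x $ 3 \<in> I}"

definition point :: "real^2 \<Rightarrow> real \<Rightarrow> real^3" where
  "point x' s = vector [x' $ 1, x' $ 2, s]"


section \<open>The piecewise Sobolev spaces\<close>

text \<open>Square-integrable functions on a slab, given by Borel representatives.\<close>
definition L2_slab :: "real set \<Rightarrow> (real^3 \<Rightarrow> real) \<Rightarrow> bool" where
  "L2_slab I f \<longleftrightarrow>
     set_borel_measurable borel (slab I) f \<and>
     (\<integral>\<^sup>+x\<in>slab I. ennreal ((f x)\<^sup>2) \<partial>lborel) < \<infinity>"

definition truncated_ft :: "real \<Rightarrow> (real^3 \<Rightarrow> real) \<Rightarrow> real^2 \<Rightarrow> real \<Rightarrow> complex" where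
  "truncated_ft R f \<xi> s =
     (LINT x':cball 0 R|lborel. complex_of_real (f (point x' s)) * cis (- (x' \<bullet> \<xi>)))"

text \<open>
  The horizontal Fourier transform of a square-integrable function need not be given by an
  absolutely convergent integral. As in Plancherel's theorem, it is the limit in the mean
  square, as \<open>R \<rightarrow> \<infinity>\<close>, of the integrals over \<open>\<bar>x'\<bar> \<le> R\<close>; this
  determines it up to null sets, on which nothing below depends.
\<close>
definition is_horizontal_ft ::
  "real set \<Rightarrow> (real^3 \<Rightarrow> real) \<Rightarrow> (real^2 \<Rightarrow> real \<Rightarrow> complex) \<Rightarrow> bool" where
  "is_horizontal_ft I f F \<longleftrightarrow>
     (\<lambda>z. F (fst z) (snd z)) \<in> borel_measurable borel \<and>
     ((\<lambda>R. \<integral>\<^sup>+z\<in>UNIV \<times> I.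
          ennreal ((cmod (F (fst z) (snd z) - truncated_ft R f (fst z) (snd z)))\<^sup>2) \<partial>lborel)
        \<longlongrightarrow> 0) at_top"

definition horizontal_ft :: "real set \<Rightarrow> (real^3 \<Rightarrow> real) \<Rightarrow> real^2 \<Rightarrow> real \<Rightarrow> complex" where
  "horizontal_ft I f = (SOME F. is_horizontal_ft I f F)"

definition test_function :: "real set \<Rightarrow> (real \<Rightarrow> real) \<Rightarrow> bool" where
  "test_function I \<phi> \<longleftrightarrow>
     smooth_on UNIV \<phi> \<and> (\<exists>K. compact K \<and> K \<subseteq> I \<and> (\<forall>s. s \<notin> K \<longrightarrow> \<phi> s = 0))"

definition locally_integrable :: "real set \<Rightarrow> (real \<Rightarrow> complex) \<Rightarrow> bool" where
  "locally_integrable I u \<longleftrightarrow> (\<forall>K. compact K \<and> K \<subseteq> I \<longrightarrow> set_integrable lborel K u)"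

definition is_weak_deriv ::
  "real set \<Rightarrow> nat \<Rightarrow> (real \<Rightarrow> complex) \<Rightarrow> (real \<Rightarrow> complex) \<Rightarrow> bool" where
  "is_weak_deriv I j u h \<longleftrightarrow>
     locally_integrable I u \<and> locally_integrable I h \<and>
     (\<forall>\<phi>. test_function I \<phi> \<longrightarrow>
       (LINT s:I|lborel. u s * complex_of_real ((deriv ^^ j) \<phi> s)) =
       (-1) ^ j * (LINT s:I|lborel. h s * complex_of_real (\<phi> s)))"

definition weak_deriv :: "real set \<Rightarrow> nat \<Rightarrow> (real \<Rightarrow> complex) \<Rightarrow> real \<Rightarrow> complex" where
  "weak_deriv I j u = (SOME h. is_weak_deriv I j u h)"

definition Hk_slab_sqnorm :: "real set \<Rightarrow> nat \<Rightarrow> (real^3 \<Rightarrow> real) \<Rightarrow> ennreal" where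
  "Hk_slab_sqnorm I k f =
     (\<Sum>j\<le>k. \<integral>\<^sup>+\<xi>. ennreal ((1 + (norm \<xi>)\<^sup>2) ^ (k - j)) *
        (\<integral>\<^sup>+s\<in>I. ennreal ((cmod (weak_deriv I j (horizontal_ft I f \<xi>) s))\<^sup>2) \<partial>lborel)
      \<partial>lborel)"

definition in_Hk_slab :: "real set \<Rightarrow> nat \<Rightarrow> (real^3 \<Rightarrow> real) \<Rightarrow> bool" where
  "in_Hk_slab I k f \<longleftrightarrow>
     L2_slab I f \<and>
     (\<exists>F. is_horizontal_ft I f F) \<and>
     (\<forall>j\<le>k. AE \<xi> in lborel. \<exists>h. is_weak_deriv I j (horizontal_ft I f \<xi>) h) \<and>
     Hk_slab_sqnorm I k f < \<infinity>"

definition in_Hk :: "real \<Rightarrow> real \<Rightarrow> nat \<Rightarrow> (real^3 \<Rightarrow> real) \<Rightarrow> bool" where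
  "in_Hk l m k f \<longleftrightarrow> in_Hk_slab {0<..<l} k f \<and> in_Hk_slab {-m<..<0} k f"

text \<open>Only meaningful for elements of the space: infinite values are sent to 0 by \<open>enn2real\<close>.\<close>
definition Hk_norm :: "real \<Rightarrow> real \<Rightarrow> nat \<Rightarrow> (real^3 \<Rightarrow> real) \<Rightarrow> real" where
  "Hk_norm l m k f =
     sqrt (enn2real (Hk_slab_sqnorm {0<..<l} k f + Hk_slab_sqnorm {-m<..<0} k f))"

definition in_Hk_vec :: "real \<Rightarrow> real \<Rightarrow> nat \<Rightarrow> (real^3 \<Rightarrow> real^3) \<Rightarrow> bool" where
  "in_Hk_vec l m k f \<longleftrightarrow> (\<forall>i. in_Hk l m k (\<lambda>x. f x $ i))"

definition Hk_norm_vec :: "real \<Rightarrow> real \<Rightarrow> nat \<Rightarrow> (real^3 \<Rightarrow> real^3) \<Rightarrow> real" where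
  "Hk_norm_vec l m k f = sqrt (\<Sum>i\<in>UNIV. (Hk_norm l m k (\<lambda>x. f x $ i))\<^sup>2)"


section \<open>The linearized problem\<close>

definition partial_deriv :: "3 \<Rightarrow> (real^3 \<Rightarrow> real) \<Rightarrow> real^3 \<Rightarrow> real" where
  "partial_deriv i f x = frechet_derivative f (at x) (axis i 1)"

definition gradient :: "(real^3 \<Rightarrow> real) \<Rightarrow> real^3 \<Rightarrow> real^3" where
  "gradient f x = (\<chi> i. partial_deriv i f x)"

definition divergence :: "(real^3 \<Rightarrow> real^3) \<Rightarrow> real^3 \<Rightarrow> real" where
  "divergence u x = (\<Sum>i\<in>UNIV. partial_deriv i (\<lambda>y. u y $ i) x)"

definition C1_on :: "'a::real_normed_vector set \<Rightarrow> ('a \<Rightarrow> 'b::real_normed_vector) \<Rightarrow> bool" where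
  "C1_on S f \<longleftrightarrow>
     (\<exists>f'. continuous_on S f' \<and>
        (\<forall>z\<in>S. (f has_derivative blinfun_apply (f' z)) (at z within S)))"

text \<open>The function \<open>p'(\<rho>0)\<close> of the vertical variable.\<close>
definition dp :: "(real \<Rightarrow> real) \<Rightarrow> (real \<Rightarrow> real) \<Rightarrow> (real \<Rightarrow> real) \<Rightarrow> real \<Rightarrow> real" where
  "dp pp pm \<rho>0 s = (if s > 0 then deriv pp (\<rho>0 s) else deriv pm (\<rho>0 s))"

text \<open>
  Traces are limits from inside the respective slab. A jump vanishes if both traces exist
  and coincide.
\<close>
definition zero_jump :: "real \<Rightarrow> real \<Rightarrow> (real^3 \<Rightarrow> real) \<Rightarrow> bool" where
  "zero_jump l m f \<longleftrightarrow>
     (\<forall>x'. \<exists>L. (f \<longlongrightarrow> L) (at (point x' 0) within slab {0<..<l}) \<and>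
                (f \<longlongrightarrow> L) (at (point x' 0) within slab {-m<..<0}))"

text \<open>
  Classical solutions, continuously differentiable in time and space on each slab. The unknowns
  are total functions of \<open>t\<close> and \<open>x\<close>, of which only the values for
  \<open>t \<ge> 0\<close> and \<open>x\<close> in one of the two open slabs matter.
\<close>
definition solves_linear_problem ::
  "real \<Rightarrow> real \<Rightarrow> (real \<Rightarrow> real) \<Rightarrow> (real \<Rightarrow> real) \<Rightarrow> real \<Rightarrow> real \<Rightarrow> (real \<Rightarrow> real) \<Rightarrow>
   (real \<Rightarrow> real^3 \<Rightarrow> real^3) \<Rightarrow> (real \<Rightarrow> real^3 \<Rightarrow> real^3) \<Rightarrow> (real \<Rightarrow> real^3 \<Rightarrow> real) \<Rightarrow> bool" where
  "solves_linear_problem g \<omega> pp pm l m \<rho>0 \<eta> v q \<longleftrightarrow>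
     (let \<Omega> = slab {0<..<l} \<union> slab {-m<..<0} in
       C1_on ({0..} \<times> \<Omega>) (\<lambda>z. \<eta> (fst z) (snd z)) \<and>
       C1_on ({0..} \<times> \<Omega>) (\<lambda>z. v (fst z) (snd z)) \<and>
       C1_on ({0..} \<times> \<Omega>) (\<lambda>z. q (fst z) (snd z)) \<and>
       (\<forall>t\<ge>0. \<forall>x\<in>\<Omega>.
          ((\<lambda>\<tau>. \<eta> \<tau> x) has_vector_derivative v t x) (at t within {0..}) \<and>
          (\<exists>qt. ((\<lambda>\<tau>. q \<tau> x) has_real_derivative qt) (at t within {0..}) \<and>
             qt + \<rho>0 (x $ 3) * divergence (v t) x = 0) \<and>
          (\<exists>vt. ((\<lambda>\<tau>. v \<tau> x) has_vector_derivative vt) (at t within {0..}) \<and>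
             \<rho>0 (x $ 3) *\<^sub>R vt + gradient (\<lambda>y. dp pp pm \<rho>0 (y $ 3) * q t y) x =
               - (g * q t x) *\<^sub>R axis 3 1
               - (g * \<rho>0 (x $ 3)) *\<^sub>R gradient (\<lambda>y. \<eta> t y $ 3) x
               + (2 * \<rho>0 (x $ 3) * \<omega> * (v t x $ 2)) *\<^sub>R axis 1 1
               - (2 * \<rho>0 (x $ 3) * \<omega> * (v t x $ 1)) *\<^sub>R axis 2 1)) \<and>
       (\<forall>t\<ge>0.
          zero_jump l m (\<lambda>x. v t x $ 3) \<and>
          zero_jump l m (\<lambda>x. dp pp pm \<rho>0 (x $ 3) * q t x) \<and>
          (\<forall>x'. ((\<lambda>x. v t x $ 3) \<longlongrightarrow> 0) (at (point x' (- m)) within slab {-m<..<0}) \<and>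
                 ((\<lambda>x. v t x $ 3) \<longlongrightarrow> 0) (at (point x' l) within slab {0<..<l}))))"

end

theory Submission
  imports Defs "HOL-Probability.Probability" "HOL-Real_Asymp.Real_Asymp"
begin

text \<open>
  Rotation changes a normal mode of growth rate \<open>\<lambda>\<close> and horizontal wave number \<open>r\<close> only by replacing \<open>r\<^sup>2\<close>
  by \<open>\<lambda>\<^sup>2 r\<^sup>2 / (\<lambda>\<^sup>2 + 4 \<omega>\<^sup>2)\<close>. In the enthalpy \<open>H\<close> and the flux \<open>U = \<rho>0 H'\<close> a mode solves a linear first
  order system in each layer. The condition at the interface is a scalar equation between Riccati quotients,
  monotone in \<open>\<lambda>\<^sup>2\<close>; since the heavier fluid lies on top it has a unique root, which
  depends continuously on \<open>r\<close> and satisfies \<open>\<theta> r \<le> \<lambda>\<^sup>2 \<le> r\<^sup>2\<close>. Superposing the modes with wave vectors in an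
  annulus \<open>r < \<bar>\<xi>\<bar> < r + 2\<close> gives square-integrable solutions. Their initial Sobolev norms are polynomial in
  \<open>r\<close>, because vertical derivatives can be traded for powers of \<open>r\<close> by the system, whereas at time \<open>t\<close> they have
  grown by at least \<open>exp (sqrt (\<theta> r) t)\<close>. As \<open>r\<close> tends to infinity, the growth beats every polynomial.
\<close>

section \<open>Smooth functions of one real variable\<close>

text \<open>One scalar suffices because of hydrostatic balance, p'(\<rho>0) \<rho>0' = - g \<rho>0:
  with H = p'(\<rho>0) q / \<rho>0 + g \<eta>_3, the pressure and gravity terms of the momentum
  equation add up to \<rho>0 times the gradient of H, so velocity is driven by grad H and the
  Coriolis force alone. At the interface the quotient U / H is of order r in each layer, which makes
  \<lambda>^2 of order r, the Rayleigh-Taylor rate. Two obstacles shape the rest. The layers are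
  horizontally unbounded, so a single plane wave has infinite norm; superposing modes asks for
  growth rates and profiles that are continuous in the wave vector, hence for initial value problems
  with parameters. Moreover the Sobolev norm rests on two choices, an L2 limit of truncated Fourier
  integrals and a weak derivative, and can be evaluated only after both are shown unique up to null
  sets. As the packets are built on the Fourier side from compactly supported data, Plancherel for
  bounded functions of bounded support is enough.\<close>

lemma smooth_on_cong_iterate:
  assumes "open S" "\<And>x. x \<in> S \<Longrightarrow> f x = g x" "x \<in> S"
  shows "(deriv ^^ n) f x = (deriv ^^ n) (g :: real \<Rightarrow> real) x"
  using assms(3)
proof (induction n arbitrary: x)
  case (Suc n)
  have "\<forall>\<^sub>F y in nhds x. (deriv ^^ n) f y = (deriv ^^ n) g y"
    using eventually_nhds_in_open[OF assms(1) Suc.prems] by eventually_elim (rule Suc.IH)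
  then show ?case by (simp add: deriv_cong_ev)
qed (use assms in simp)

text \<open>Finite order is the form in which closure under products and reciprocals can be proved
  by induction: the derivative of such an expression contains the functions themselves again, but
  then with one order less to be supplied.\<close>

definition ndiff :: "nat \<Rightarrow> real set \<Rightarrow> (real \<Rightarrow> real) \<Rightarrow> bool" where
  "ndiff n S f \<longleftrightarrow> (\<forall>i<n. \<forall>x\<in>S. ((deriv ^^ i) f) field_differentiable (at x))"

lemma smooth_on_iff_ndiff: "smooth_on S f \<longleftrightarrow> (\<forall>n. ndiff n S f)"
  unfolding smooth_on_def ndiff_def by blast

lemma ndiff_0 [simp]: "ndiff 0 S f"
  by (simp add: ndiff_def)

lemma ndiff_mono: "ndiff n S f \<Longrightarrow> m \<le> n \<Longrightarrow> ndiff m S f"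
  by (simp add: ndiff_def)

text \<open>\<open>deriv f\<close> equals \<open>f'\<close> only on \<open>S\<close>; because
  \<open>S\<close> is open, the equality holds near each point and so survives further
  differentiation.\<close>

lemma ndiff_SucI:
  assumes "open S" "\<And>x. x \<in> S \<Longrightarrow> (f has_real_derivative f' x) (at x)" "ndiff n S f'"
  shows "ndiff (Suc n) S f"
  unfolding ndiff_def
proof (intro allI impI ballI)
  fix i x assume i: "i < Suc n" and x: "x \<in> S"
  show "(deriv ^^ i) f field_differentiable at x"
  proof (cases i)
    case 0
    then show ?thesis using assms(2)[OF x] by (auto simp: field_differentiable_def)
  next
    case (Suc k)
    have eq: "deriv f y = f' y" if "y \<in> S" for y using assms(2)[OF that] by (rule DERIV_imp_deriv)
    have ev: "\<forall>\<^sub>F y in nhds x. (deriv ^^ k) (deriv f) y = (deriv ^^ k) f' y"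
      using eventually_nhds_in_open[OF assms(1) x]
      by eventually_elim (rule smooth_on_cong_iterate[OF assms(1) eq])
    have "(deriv ^^ k) f' field_differentiable at x" using assms(3) i x Suc by (simp add: ndiff_def)
    then obtain d where "((deriv ^^ k) f' has_field_derivative d) (at x)" by (auto simp: field_differentiable_def)
    then have "((deriv ^^ k) (deriv f) has_field_derivative d) (at x)"
      using DERIV_cong_ev[OF refl ev refl] by simp
    then show ?thesis using Suc by (auto simp: field_differentiable_def funpow_Suc_right simp del: funpow.simps)
  qed
qed

lemma ndiff_SucD:
  assumes "ndiff (Suc n) S f"
  shows "x \<in> S \<Longrightarrow> (f has_real_derivative deriv f x) (at x)" and "ndiff n S (deriv f)"
proof -
  show "x \<in> S \<Longrightarrow> (f has_real_derivative deriv f x) (at x)"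
    using assms unfolding ndiff_def
    by (metis field_differentiable_derivI funpow_0 zero_less_Suc)
  show "ndiff n S (deriv f)"
    unfolding ndiff_def
  proof (intro allI impI ballI)
    fix i x assume "i < n" "x \<in> S"
    then have "(deriv ^^ Suc i) f field_differentiable at x" using assms unfolding ndiff_def by blast
    then show "(deriv ^^ i) (deriv f) field_differentiable at x"
      by (simp add: funpow_Suc_right del: funpow.simps)
  qed
qed

lemma ndiff_const: "open S \<Longrightarrow> ndiff n S (\<lambda>_. c)"
proof (induction n arbitrary: c)
  case (Suc n)
  show ?case by (rule ndiff_SucI[OF Suc.prems _ Suc.IH[OF Suc.prems, of 0]]) (auto intro!: derivative_eq_intros)
qed simp

lemma ndiff_add: "open S \<Longrightarrow> ndiff n S f \<Longrightarrow> ndiff n S g \<Longrightarrow> ndiff n S (\<lambda>x. f x + g x)"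
proof (induction n arbitrary: f g)
  case (Suc n)
  note d = ndiff_SucD[OF Suc.prems(2)] ndiff_SucD[OF Suc.prems(3)]
  show ?case
    by (rule ndiff_SucI[OF Suc.prems(1) _ Suc.IH[OF Suc.prems(1) d(2,4)]]) (auto intro!: derivative_eq_intros d)
qed simp

lemma ndiff_mult: "open S \<Longrightarrow> ndiff n S f \<Longrightarrow> ndiff n S g \<Longrightarrow> ndiff n S (\<lambda>x. f x * g x)"
proof (induction n arbitrary: f g)
  case (Suc n)
  note d = ndiff_SucD[OF Suc.prems(2)] ndiff_SucD[OF Suc.prems(3)]
  have "ndiff n S f" "ndiff n S g" using Suc.prems by (auto intro: ndiff_mono)
  then have "ndiff n S (\<lambda>x. deriv f x * g x + deriv g x * f x)"
    using Suc d by (intro ndiff_add) auto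
  then show ?case
    by (rule ndiff_SucI[OF Suc.prems(1), rotated]) (auto intro!: derivative_eq_intros d)
qed simp

lemma ndiff_inverse:
  assumes "open S" "\<And>x. x \<in> S \<Longrightarrow> f x \<noteq> 0"
  shows "ndiff n S f \<Longrightarrow> ndiff n S (\<lambda>x. inverse (f x))"
proof (induction n)
  case (Suc n)
  note d = ndiff_SucD[OF Suc.prems]
  have "ndiff n S f" using Suc.prems by (auto intro: ndiff_mono)
  then have "ndiff n S (\<lambda>x. ((-1) * deriv f x) * (inverse (f x) * inverse (f x)))"
    using Suc.IH d assms(1) by (intro ndiff_mult ndiff_const) auto
  then show ?case
    by (rule ndiff_SucI[OF assms(1), rotated]) (use assms(2) in \<open>auto intro!: derivative_eq_intros d\<close>)
qed simp

lemma ndiff_affine: "ndiff n UNIV f \<Longrightarrow> ndiff n UNIV (\<lambda>x. f (a * x + b))"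
proof (induction n arbitrary: f)
  case (Suc n)
  note d = ndiff_SucD[OF Suc.prems]
  have "ndiff n UNIV (\<lambda>x. a * deriv f (a * x + b))"
    using Suc.IH[OF d(2)] by (intro ndiff_mult ndiff_const) auto
  then show ?case
  proof (rule ndiff_SucI[OF open_UNIV, rotated])
    fix x
    have "((\<lambda>x. a * x + b) has_real_derivative a) (at x)" by (auto intro!: derivative_eq_intros)
    from DERIV_chain2[OF d(1) this]
    show "((\<lambda>x. f (a * x + b)) has_real_derivative a * deriv f (a * x + b)) (at x)"
      by (simp add: mult.commute)
  qed
qed simp

lemma ndiff_ident: "open S \<Longrightarrow> ndiff n S (\<lambda>x. x)"
proof (cases n)
  case (Suc m)
  assume "open S"
  then show ?thesis unfolding Suc by (intro ndiff_SucI[of S _ "\<lambda>_. 1"] ndiff_const) (auto intro!: derivative_eq_intros)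
qed simp

lemma smooth_on_const [intro]: "open S \<Longrightarrow> smooth_on S (\<lambda>_. c)"
  by (simp add: smooth_on_iff_ndiff ndiff_const)

lemma smooth_on_ident [intro]: "open S \<Longrightarrow> smooth_on S (\<lambda>x. x)"
  by (simp add: smooth_on_iff_ndiff ndiff_ident)

lemma smooth_on_mult [intro]: "open S \<Longrightarrow> smooth_on S f \<Longrightarrow> smooth_on S g \<Longrightarrow> smooth_on S (\<lambda>x. f x * g x)"
  by (simp add: smooth_on_iff_ndiff ndiff_mult)

lemma smooth_on_inverse:
  "open S \<Longrightarrow> (\<And>x. x \<in> S \<Longrightarrow> f x \<noteq> 0) \<Longrightarrow> smooth_on S f \<Longrightarrow> smooth_on S (\<lambda>x. inverse (f x))"
  by (simp add: smooth_on_iff_ndiff ndiff_inverse)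

lemma smooth_on_affine: "smooth_on UNIV f \<Longrightarrow> smooth_on UNIV (\<lambda>x. f (a * x + b))"
  by (simp add: smooth_on_iff_ndiff ndiff_affine)

lemma smooth_on_deriv [intro]: "smooth_on S f \<Longrightarrow> smooth_on S (deriv f)"
  unfolding smooth_on_iff_ndiff by (intro allI ndiff_SucD(2)) simp

lemma smooth_on_DERIV: "smooth_on S f \<Longrightarrow> x \<in> S \<Longrightarrow> (f has_real_derivative deriv f x) (at x)"
  unfolding smooth_on_iff_ndiff by (rule ndiff_SucD(1)[of 0]) auto

lemma smooth_on_imp_continuous_on: "smooth_on S f \<Longrightarrow> continuous_on S f"
  by (rule continuous_at_imp_continuous_on) (blast intro: DERIV_isCont smooth_on_DERIV)

section \<open>Flat functions, bumps, and functions whose integrals over all rays vanish\<close>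

text \<open>The case \<open>k = 0\<close> is the classical flat function. The negative powers are
  carried along because the derivative of a member is then a linear combination of members, so that
  one induction gives smoothness of the whole family.\<close>

definition flat_exp :: "nat \<Rightarrow> real \<Rightarrow> real" where
  "flat_exp k x = (if x > 0 then inverse x ^ k * exp (- inverse x) else 0)"

lemma flat_tendsto_0: "(flat_exp k \<longlongrightarrow> 0) (at 0)"
proof -
  have "((\<lambda>x. inverse x ^ k / exp (inverse x)) \<longlongrightarrow> 0) (at_right (0::real))"
    by (rule filterlim_compose[OF tendsto_power_div_exp_0 filterlim_inverse_at_top_right])
  then have "(flat_exp k \<longlongrightarrow> 0) (at_right 0)"
    by (rule Lim_transform_eventually)
      (auto simp: eventually_at_right_less flat_exp_def exp_minus field_simps intro!: eventually_at_rightI[of 0 1])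
  moreover have "(flat_exp k \<longlongrightarrow> 0) (at_left 0)"
    by (rule tendsto_eventually) (auto simp: flat_exp_def intro!: eventually_at_leftI[of "-1"])
  ultimately show ?thesis by (simp add: filterlim_split_at)
qed

lemma flat_has_derivative:
  "(flat_exp k has_real_derivative - real k * flat_exp (Suc k) x + flat_exp (k + 2) x) (at x)"
proof (cases "x = 0")
  case True
  \<comment> \<open>The difference quotient at 0 is itself a member of the family, namely
    \<open>flat_exp (Suc k)\<close>.\<close>
  have "((\<lambda>h. (flat_exp k (0 + h) - flat_exp k 0) / h) \<longlongrightarrow> 0) (at 0)"
    by (rule Lim_transform_eventually[OF flat_tendsto_0[of "Suc k"]])
      (auto simp: flat_exp_def field_simps intro!: always_eventually)
  then show ?thesis unfolding True DERIV_def by (simp add: flat_exp_def)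
next
  case False
  consider "x > 0" | "x < 0" using False by linarith
  then show ?thesis
  proof cases
    case 1
    have "((\<lambda>x. inverse x ^ k * exp (- inverse x)) has_real_derivative
        real k * inverse x ^ (k - 1) * (- inverse (x ^ 2)) * exp (- inverse x) + inverse x ^ k * (exp (- inverse x) * inverse (x ^ 2))) (at x)"
      using 1 by (auto intro!: derivative_eq_intros simp: power2_eq_square)
    moreover have "real k * inverse x ^ (k - 1) * (- inverse (x ^ 2)) * exp (- inverse x) + inverse x ^ k * (exp (- inverse x) * inverse (x ^ 2))
      = - real k * flat_exp (Suc k) x + flat_exp (k + 2) x"
      using 1 by (cases k) (auto simp: flat_exp_def power2_eq_square field_simps)
    ultimately have "((\<lambda>x. inverse x ^ k * exp (- inverse x)) has_real_derivative - real k * flat_exp (Suc k) x + flat_exp (k + 2) x) (at x)" by simp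
    moreover have ev: "\<forall>\<^sub>F y in nhds x. inverse y ^ k * exp (- inverse y) = flat_exp k y"
      using eventually_nhds_in_open[of "{0<..}" x] 1 by (auto simp: flat_exp_def elim!: eventually_mono)
    ultimately show ?thesis using DERIV_cong_ev[OF refl ev refl] by simp
  next
    case 2
    have ev: "\<forall>\<^sub>F y in nhds x. 0 = flat_exp k y"
      using eventually_nhds_in_open[of "{..<0}" x] 2 by (auto simp: flat_exp_def elim!: eventually_mono)
    moreover have "((\<lambda>_. 0) has_real_derivative - real k * flat_exp (Suc k) x + flat_exp (k + 2) x) (at x)"
      using 2 by (simp add: flat_exp_def)
    ultimately show ?thesis using DERIV_cong_ev[OF refl ev refl] by simp
  qed
qed

lemma smooth_on_flat: "smooth_on UNIV (flat_exp k)"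
  unfolding smooth_on_iff_ndiff
proof
  fix n show "ndiff n UNIV (flat_exp k)"
  proof (induction n arbitrary: k)
    case (Suc n)
    show ?case
      by (rule ndiff_SucI[OF open_UNIV flat_has_derivative])
        (intro ndiff_add ndiff_mult ndiff_const Suc.IH; simp)
  qed simp
qed

text \<open>The factor \<open>N\<close> sits inside the flat functions: the support stays in the
  interval from \<open>a\<close> to \<open>b\<close> while the values tend to 1 in its interior.
  This gives bounded convergence to an indicator function.\<close>

definition bump :: "real \<Rightarrow> real \<Rightarrow> nat \<Rightarrow> real \<Rightarrow> real" where
  "bump a b N x = flat_exp 0 (real N * (x - a)) * flat_exp 0 (real N * (b - x))"

lemma test_function_bump:
  assumes "{a..b} \<subseteq> I"
  shows "test_function I (bump a b N)"
  unfolding test_function_def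
proof
  have "bump a b N = (\<lambda>x. flat_exp 0 (real N * x + (- real N * a)) * flat_exp 0 ((- real N) * x + real N * b))"
    by (auto simp: bump_def algebra_simps)
  then show "smooth_on UNIV (bump a b N)"
    by (simp only:) (intro smooth_on_mult smooth_on_affine smooth_on_flat open_UNIV)
  show "\<exists>K. compact K \<and> K \<subseteq> I \<and> (\<forall>s. s \<notin> K \<longrightarrow> bump a b N s = 0)"
    using assms by (intro exI[of _ "{a..b}"]) (auto simp: bump_def flat_exp_def zero_less_mult_iff)
qed

lemma bump_le_1: "norm (bump a b N x) \<le> 1"
proof -
  have "0 \<le> flat_exp 0 y \<and> flat_exp 0 y \<le> 1" for y by (auto simp: flat_exp_def)
  then show ?thesis unfolding bump_def by (simp add: abs_mult mult_le_one)
qed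

lemma bump_tendsto: "(\<lambda>N. bump a b N x) \<longlonglongrightarrow> indicator {a<..<b} x"
proof (cases "x \<in> {a<..<b}")
  case True
  have "(\<lambda>N. flat_exp 0 (real N * y)) \<longlonglongrightarrow> 1" if "y > 0" for y
  proof -
    have lim: "(\<lambda>N. exp (- inverse (real N * y))) \<longlonglongrightarrow> exp (- 0)"
    proof (intro tendsto_intros)
      have "(\<lambda>N. inverse (real N) * inverse y) \<longlonglongrightarrow> 0 * inverse y"
        by (intro tendsto_intros lim_inverse_n)
      then show "(\<lambda>N. inverse (real N * y)) \<longlonglongrightarrow> 0" by simp
    qed
    have ev: "\<forall>\<^sub>F N in sequentially. exp (- inverse (real N * y)) = flat_exp 0 (real N * y)"
      using eventually_gt_at_top[of 0] by eventually_elim (use that in \<open>simp add: flat_exp_def\<close>)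
    from Lim_transform_eventually[OF lim ev] show ?thesis by simp
  qed
  from tendsto_mult[OF this this, of "x - a" "b - x"] True show ?thesis
    by (simp add: bump_def)
next
  case False
  then have "bump a b N x = 0" for N by (auto simp: bump_def flat_exp_def zero_less_mult_iff)
  then show ?thesis using False by simp
qed

text \<open>The positive and the negative part of \<open>w\<close> are densities of two finite
  measures that agree on all rays, hence on all Borel sets; densities are unique almost
  everywhere.\<close>

lemma AE_zero_if_integral_lessThan_zero:
  fixes w :: "real \<Rightarrow> real"
  assumes w: "integrable lborel w" and 0: "\<And>x. (LINT s|lborel. indicator {x<..} s * w s) = 0"
  shows "AE s in lborel. w s = 0"
proof -
  have [measurable]: "w \<in> borel_measurable borel" using w by auto
  define p n where "p = (\<lambda>s. max (w s) 0)" and "n = (\<lambda>s. max (- w s) 0)"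
  have pn: "w s = p s - n s" "0 \<le> p s" "0 \<le> n s" for s by (auto simp: p_def n_def)
  have p: "integrable lborel p" and n: "integrable lborel n" using w by (auto simp: p_def n_def)
  have int: "integrable lborel (\<lambda>s. indicator {x<..} s * p s)" "integrable lborel (\<lambda>s. indicator {x<..} s * n s)" for x
    using integrable_mult_indicator[OF _ p, of "{x<..}"] integrable_mult_indicator[OF _ n, of "{x<..}"] by simp_all
  have em: "emeasure (density lborel (\<lambda>s. ennreal (p s))) {x<..} = ennreal (LINT s|lborel. indicator {x<..} s * p s)"
    "emeasure (density lborel (\<lambda>s. ennreal (n s))) {x<..} = ennreal (LINT s|lborel. indicator {x<..} s * n s)" for x
    using p n pn int[of x]
    by (auto simp: emeasure_density nn_integral_eq_integral[symmetric] ennreal_mult'' ennreal_indicator mult.commute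
        intro!: nn_integral_cong)
  have "(LINT s|lborel. indicator {x<..} s * p s) = (LINT s|lborel. indicator {x<..} s * n s)" for x
    using 0[of x] int[of x] by (simp add: pn(1) right_diff_distrib)
  then have "emeasure (density lborel (\<lambda>s. ennreal (p s))) {x<..} = emeasure (density lborel (\<lambda>s. ennreal (n s))) {x<..}" for x
    unfolding em by simp
  then have "density lborel (\<lambda>s. ennreal (p s)) = density lborel (\<lambda>s. ennreal (n s))"
    by (intro measure_eqI_lessThan) (auto simp: em)
  then have "AE s in lborel. ennreal (p s) = ennreal (n s)"
    using p n by (intro sigma_finite_measure.density_unique[OF sigma_finite_lborel]) auto
  then show ?thesis
    by eventually_elim (use pn in \<open>simp add: ennreal_inj\<close>)
qed

section \<open>Plancherel's theorem for bounded functions\<close>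

text \<open>The kernel is left without normalisation to match \<open>truncated_ft\<close>;
  Plancherel therefore carries the factor \<open>(2 * pi) ^ DIM('a)\<close>.\<close>

definition fourier :: "('a::euclidean_space \<Rightarrow> complex) \<Rightarrow> 'a \<Rightarrow> complex" where
  "fourier g \<xi> = (LINT x|lborel. g x * cis (- (x \<bullet> \<xi>)))"

definition gaussian :: "'a::euclidean_space \<Rightarrow> real" where
  "gaussian x = exp (- (norm x)\<^sup>2 / 2)"

lemma borel_measurable_cis [measurable]: "cis \<in> borel_measurable borel"
  by (intro borel_measurable_continuous_onI continuous_intros)

lemma borel_measurable_cnj [measurable]: "cnj \<in> borel_measurable borel"
  by (intro borel_measurable_continuous_onI continuous_intros)

lemma borel_measurable_gaussian [measurable]: "gaussian \<in> borel_measurable borel"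
  unfolding gaussian_def by measurable

lemma gaussian_nonneg [simp]: "0 \<le> gaussian x"
  by (simp add: gaussian_def)

lemma borel_measurable_fourier [measurable]:
  assumes [measurable]: "g \<in> borel_measurable borel"
  shows "fourier g \<in> borel_measurable borel"
  unfolding fourier_def by measurable

lemma norm_fourier_le:
  assumes "integrable lborel g"
  shows "norm (fourier g \<xi>) \<le> (LINT x|lborel. norm (g x))"
  unfolding fourier_def by (rule order_trans[OF integral_norm_bound]) (simp add: norm_mult)

lemma integrable_mult_cis:
  assumes g: "integrable lborel (g :: 'a::euclidean_space \<Rightarrow> complex)"
    and [measurable]: "h \<in> borel_measurable borel"
  shows "integrable lborel (\<lambda>x. g x * cis (h x))"
  by (rule Bochner_Integration.integrable_bound[OF g]) (use g in \<open>auto simp: norm_mult\<close>)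

text \<open>Up to the factor \<open>sqrt (2 * pi)\<close> this is the characteristic function of the
  standard normal distribution at \<open>- t\<close>.\<close>

lemma gaussian_integral_real:
  shows "integrable lborel (\<lambda>x::real. complex_of_real (exp (- x\<^sup>2 / 2)) * cis (- (x * t)))"
    and "(LINT x|lborel. complex_of_real (exp (- x\<^sup>2 / 2)) * cis (- (x * t)))
      = complex_of_real (sqrt (2 * pi) * exp (- t\<^sup>2 / 2))"
proof -
  have eq: "complex_of_real (exp (- x\<^sup>2 / 2)) * cis (- (x * t))
    = complex_of_real (sqrt (2 * pi)) * (std_normal_density x *\<^sub>R iexp (- t * x))" for x
    by (simp add: std_normal_density_def scaleR_conv_of_real cis_conv_exp mult.commute)
  have i: "integrable lborel (\<lambda>x. std_normal_density x *\<^sub>R iexp (- t * x))"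
  proof (rule Bochner_Integration.integrable_bound)
    show "integrable lborel std_normal_density" by simp
    show "AE x in lborel. norm (std_normal_density x *\<^sub>R iexp (- t * x)) \<le> norm (std_normal_density x)"
      by (simp add: norm_mult)
  qed simp_all
  then show "integrable lborel (\<lambda>x::real. complex_of_real (exp (- x\<^sup>2 / 2)) * cis (- (x * t)))"
    unfolding eq by (rule integrable_mult_right)
  have "(LINT x|lborel. std_normal_density x *\<^sub>R iexp (- t * x)) = char std_normal_distribution (- t)"
    unfolding char_def by (subst integral_density) simp_all
  then show "(LINT x|lborel. complex_of_real (exp (- x\<^sup>2 / 2)) * cis (- (x * t)))
      = complex_of_real (sqrt (2 * pi) * exp (- t\<^sup>2 / 2))"
    unfolding eq integral_mult_right_zero by (simp add: char_std_normal_distribution)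
qed

text \<open>The Gaussian and the character both factor over the coordinates, and Lebesgue measure is
  the image of a product measure, so the one-dimensional formula is multiplied up.\<close>

lemma gaussian_fourier:
  fixes z :: "'a::euclidean_space"
  shows "integrable lborel (\<lambda>x::'a. complex_of_real (gaussian x) * cis (- (x \<bullet> z)))"
    and "fourier (\<lambda>x. complex_of_real (gaussian x)) z
      = complex_of_real (sqrt (2 * pi) ^ DIM('a) * gaussian z)"
proof -
  define \<phi> where "\<phi> = (\<lambda>b::'a. \<lambda>x::real. complex_of_real (exp (- x\<^sup>2 / 2)) * cis (- (x * (z \<bullet> b))))"
  interpret product_sigma_finite "\<lambda>_::'a. lborel :: real measure" ..
  have \<phi>: "integrable lborel (\<phi> b)" for b
    unfolding \<phi>_def by (rule gaussian_integral_real)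
  have cis_sum: "cis (sum h A) = (\<Prod>b\<in>A. cis (h b))" if "finite A" for A :: "'a set" and h
    using that by (induction A) (simp_all add: cis_mult[symmetric])
  have gsum: "gaussian x = (\<Prod>b\<in>Basis. exp (- (x \<bullet> b)\<^sup>2 / 2))" for x :: 'a
  proof -
    have "(norm x)\<^sup>2 = (\<Sum>b\<in>Basis. (x \<bullet> b)\<^sup>2)"
      unfolding power2_norm_eq_inner euclidean_inner[of x x] by (simp add: power2_eq_square)
    then show ?thesis
      by (simp add: gaussian_def exp_sum[symmetric] sum_negf sum_divide_distrib[symmetric])
  qed
  have prod: "complex_of_real (gaussian x) * cis (- (x \<bullet> z)) = (\<Prod>b\<in>Basis. \<phi> b (x \<bullet> b))" for x :: 'a
    unfolding gsum \<phi>_def euclidean_inner[of x z]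
    by (simp add: prod.distrib cis_sum[symmetric] sum_negf)
  have lb: "(lborel :: 'a measure) = distr (\<Pi>\<^sub>M b\<in>Basis. lborel) borel (\<lambda>f. \<Sum>b\<in>Basis. f b *\<^sub>R b)"
    by (simp add: lborel_def[where 'a='a] lborel_eq_real)
  have inn: "(\<Prod>b\<in>Basis. \<phi> b ((\<Sum>c\<in>Basis. f c *\<^sub>R c) \<bullet> b)) = (\<Prod>b\<in>Basis. \<phi> b (f b))" for f
    by (intro prod.cong refl) (simp add: inner_sum_left inner_Basis if_distrib cong: if_cong)
  have [measurable]: "\<phi> b \<in> borel_measurable borel" for b
    unfolding \<phi>_def by measurable
  show "integrable lborel (\<lambda>x::'a. complex_of_real (gaussian x) * cis (- (x \<bullet> z)))"
    unfolding prod lb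
    by (subst integrable_distr_eq) (simp_all add: inn product_integrable_prod \<phi>)
  have "fourier (\<lambda>x. complex_of_real (gaussian x)) z = (\<Prod>b\<in>Basis. integral\<^sup>L lborel (\<phi> b))"
    unfolding fourier_def prod
    by (subst lb, subst integral_distr) (simp_all add: inn product_integral_prod \<phi>)
  also have "\<dots> = (\<Prod>b\<in>(Basis::'a set). complex_of_real (sqrt (2 * pi) * exp (- (z \<bullet> b)\<^sup>2 / 2)))"
    unfolding \<phi>_def gaussian_integral_real(2) ..
  also have "\<dots> = complex_of_real (sqrt (2 * pi) ^ DIM('a) * gaussian z)"
    by (simp add: prod.distrib gsum)
  finally show "fourier (\<lambda>x. complex_of_real (gaussian x)) z
      = complex_of_real (sqrt (2 * pi) ^ DIM('a) * gaussian z)" .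
qed

lemma integrable_gaussian: "integrable lborel (gaussian :: 'a::euclidean_space \<Rightarrow> real)"
  using integrable_norm[OF gaussian_fourier(1)[of 0]] by simp

lemma integral_gaussian:
  "(LINT x|lborel. gaussian (x::'a::euclidean_space)) = sqrt (2 * pi) ^ DIM('a)"
proof -
  have "complex_of_real (LINT x|lborel. gaussian (x::'a)) = fourier (\<lambda>x. complex_of_real (gaussian x)) (0::'a)"
    unfolding fourier_def by simp
  also have "\<dots> = complex_of_real (sqrt (2 * pi) ^ DIM('a))"
    unfolding gaussian_fourier(2) by (simp add: gaussian_def)
  finally show ?thesis by (simp only: of_real_eq_iff)
qed

text \<open>Fubini, applied to an integrand whose Fourier kernel is symmetric in the two
  variables.\<close>

lemma fourier_mult_formula:
  fixes g k :: "'a::euclidean_space \<Rightarrow> complex"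
  assumes g: "integrable lborel g" and k: "integrable lborel k"
  shows "(LINT \<xi>|lborel. fourier g \<xi> * k \<xi>) = (LINT x|lborel. g x * fourier k x)"
proof -
  have [measurable]: "g \<in> borel_measurable borel" "k \<in> borel_measurable borel"
    using g k by auto
  define F where "F = (\<lambda>x \<xi>. g x * cis (- (x \<bullet> \<xi>)) * k \<xi>)"
  have F: "integrable (lborel \<Otimes>\<^sub>M lborel) (case_prod F)"
  proof (rule lborel_pair.Fubini_integrable)
    show "case_prod F \<in> borel_measurable (lborel \<Otimes>\<^sub>M lborel)"
      unfolding F_def by measurable
    have "integrable lborel (\<lambda>x. norm (g x) * (LINT \<xi>|lborel. norm (k \<xi>)))"
      using g by simp
    then show "integrable lborel (\<lambda>x. LINT y|lborel. norm (case (x, y) of (x, y) \<Rightarrow> F x y))"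
      by (simp add: F_def norm_mult)
    have "integrable lborel (F x)" for x
      by (rule Bochner_Integration.integrable_bound[of _ "\<lambda>\<xi>. g x * k \<xi>"])
        (use k in \<open>auto simp: F_def norm_mult\<close>)
    then show "AE x in lborel. integrable lborel (\<lambda>y. case (x, y) of (x, y) \<Rightarrow> F x y)"
      by simp
  qed
  have "(LINT \<xi>|lborel. fourier g \<xi> * k \<xi>) = (LINT \<xi>|lborel. LINT x|lborel. F x \<xi>)"
    unfolding fourier_def F_def by simp
  also have "\<dots> = (LINT x|lborel. LINT \<xi>|lborel. F x \<xi>)"
    by (rule lborel_pair.Fubini_integral[OF F])
  also have "\<dots> = (LINT x|lborel. g x * fourier k x)"
    unfolding fourier_def F_def
    by (simp add: mult.assoc inner_commute mult.commute[of "cis _"])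
  finally show ?thesis .
qed

lemma lborel_integral_affine:
  fixes f :: "'a::euclidean_space \<Rightarrow> 'b::{banach, second_countable_topology}"
  assumes [measurable]: "f \<in> borel_measurable borel" and c: "c \<noteq> 0"
  shows "(LINT x|lborel. f x) = \<bar>c\<bar> ^ DIM('a) *\<^sub>R (LINT x|lborel. f (t + c *\<^sub>R x))"
  by (subst lborel_affine[OF c, of t], subst integral_density, simp_all)
    (subst integral_distr, simp_all)

lemma lborel_integral_uminus:
  fixes f :: "'a::euclidean_space \<Rightarrow> 'b::{banach, second_countable_topology}"
  assumes [measurable]: "f \<in> borel_measurable borel"
  shows "(LINT x|lborel. f (- x)) = (LINT x|lborel. f x)"
  using lborel_integral_affine[OF assms, of "-1" 0] by simp

lemma lborel_nn_integral_uminus: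
  fixes f :: "'a::euclidean_space \<Rightarrow> ennreal"
  assumes [measurable]: "f \<in> borel_measurable borel"
  shows "(\<integral>\<^sup>+x. f (- x) \<partial>lborel) = (\<integral>\<^sup>+x. f x \<partial>lborel)"
proof -
  have "lborel = distr lborel borel (uminus :: 'a \<Rightarrow> 'a)"
    using lborel_affine[of "-1" "0::'a"] by (simp add: density_1 one_ennreal_def[symmetric])
  then have "(\<integral>\<^sup>+x. f x \<partial>lborel) = (\<integral>\<^sup>+x. f x \<partial>distr lborel borel uminus)" by simp
  also have "\<dots> = (\<integral>\<^sup>+x. f (- x) \<partial>lborel)"
    by (subst nn_integral_distr) simp_all
  finally show ?thesis by simp
qed

lemma lborel_integrable_affine:
  fixes f :: "'a::euclidean_space \<Rightarrow> 'b::{banach, second_countable_topology}"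
  assumes f: "integrable lborel f" and c: "c \<noteq> 0"
  shows "integrable lborel (\<lambda>x. f (t + c *\<^sub>R x))"
proof -
  have [measurable]: "f \<in> borel_measurable borel" using f by auto
  have "integrable (density (distr lborel borel (\<lambda>x. t + c *\<^sub>R x)) (\<lambda>_. ennreal (\<bar>c\<bar>^DIM('a)))) f"
    using f lborel_affine[OF c, of t] by simp
  then have "integrable (distr lborel borel (\<lambda>x. t + c *\<^sub>R x)) (\<lambda>x. \<bar>c\<bar>^DIM('a) *\<^sub>R f x)"
    by (subst (asm) integrable_density) simp_all
  then have "integrable lborel (\<lambda>x. \<bar>c\<bar>^DIM('a) *\<^sub>R f (t + c *\<^sub>R x))"
    by (simp add: integrable_distr_eq)
  then have "integrable lborel (\<lambda>x. inverse (\<bar>c\<bar>^DIM('a)) *\<^sub>R \<bar>c\<bar>^DIM('a) *\<^sub>R f (t + c *\<^sub>R x))"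
    by (rule integrable_scaleR_right[OF _])
  moreover have "inverse (\<bar>c\<bar>^DIM('a)) *\<^sub>R \<bar>c\<bar>^DIM('a) *\<^sub>R f (t + c *\<^sub>R x) = f (t + c *\<^sub>R x)" for x
    using c by simp
  ultimately show ?thesis by (simp only:)
qed

text \<open>Plancherel's theorem is obtained by damping the left-hand side with \<open>gaussian (\<xi> / n)\<close>:
  by the multiplication formula the damped integral pairs \<open>g\<close> with its own Gaussian mollification.\<close>
theorem plancherel:
  fixes g :: "'a::euclidean_space \<Rightarrow> complex"
  assumes g[measurable]: "g \<in> borel_measurable borel"
    and bound: "\<And>x. norm (g x) \<le> C"
    and supp: "\<And>x. x \<notin> cball 0 B \<Longrightarrow> g x = 0"
    and cont: "AE x in lborel. isCont g x"
  shows "(\<integral>\<^sup>+\<xi>. ennreal ((norm (fourier g \<xi>))\<^sup>2) \<partial>lborel)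
    = ennreal ((2 * pi) ^ DIM('a)) * (\<integral>\<^sup>+x. ennreal ((norm (g x))\<^sup>2) \<partial>lborel)"
proof -
  define \<kappa> where "\<kappa> = sqrt (2 * pi) ^ DIM('a)"
  have \<kappa>2: "\<kappa> * \<kappa> = (2 * pi) ^ DIM('a)"
    unfolding \<kappa>_def power_mult_distrib[symmetric] by simp
  have C: "0 \<le> C" using bound[of 0] norm_ge_zero order_trans by blast
  have int_dom: "integrable lborel (\<lambda>x::'a. D * indicator (cball 0 B) x)" for D :: real
    using emeasure_bounded_finite[of "cball (0::'a) B"]
    by (intro integrable_mult_right integrable_real_indicator) auto
  have g_int: "integrable lborel g"
    by (rule Bochner_Integration.integrable_bound[OF int_dom[of C]])
      (use bound supp C in \<open>auto simp: indicator_def\<close>)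
  define T where "T = (LINT x|lborel. norm (g x))"
  have T: "norm (fourier g \<xi>) \<le> T" for \<xi> unfolding T_def by (rule norm_fourier_le[OF g_int])
  define e where "e = (\<lambda>n. 1 / real (Suc n))"
  have e: "e n > 0" for n by (simp add: e_def)
  have e0: "e \<longlonglongrightarrow> 0" unfolding e_def using LIMSEQ_inverse_real_of_nat by (simp add: inverse_eq_divide)
  have gs_int: "integrable lborel (\<lambda>\<xi>::'a. complex_of_real (gaussian (e n *\<^sub>R \<xi>)))" for n
    using integrable_of_real[OF lborel_integrable_affine[OF integrable_gaussian, of "e n" 0]] e[of n] by simp
  \<comment> \<open>This is the inversion integral of \<open>g\<close> at \<open>x\<close>, damped
    by a Gaussian. It equals \<open>\<kappa>\<close> times the mean of \<open>g\<close> near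
    \<open>x\<close> against a Gaussian of width \<open>e n\<close>, so that it converges to
    \<open>\<kappa> * \<kappa> * g x\<close> wherever \<open>g\<close> is continuous.\<close>
  define G where "G = (\<lambda>n x. LINT \<xi>|lborel. fourier g \<xi> * (complex_of_real (gaussian (e n *\<^sub>R \<xi>)) * cis (x \<bullet> \<xi>)))"
  have fg: "fourier (\<lambda>\<xi>. complex_of_real (gaussian (e n *\<^sub>R \<xi>)) * cis (x \<bullet> \<xi>)) y
      = complex_of_real ((1 / e n) ^ DIM('a) * \<kappa> * gaussian ((y - x) /\<^sub>R e n))" for n and x y :: 'a
  proof -
    have "fourier (\<lambda>\<xi>. complex_of_real (gaussian (e n *\<^sub>R \<xi>)) * cis (x \<bullet> \<xi>)) y
      = (LINT \<xi>|lborel. complex_of_real (gaussian (e n *\<^sub>R \<xi>)) * cis (- (\<xi> \<bullet> (y - x))))"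
      unfolding fourier_def
      by (simp add: mult.assoc cis_mult inner_diff_right inner_commute[of x])
    also have "\<dots> = (1 / e n) ^ DIM('a) *\<^sub>R (LINT \<xi>|lborel. complex_of_real (gaussian \<xi>) * cis (- (\<xi> \<bullet> ((y - x) /\<^sub>R e n))))"
      using e[of n] by (subst lborel_integral_affine[of _ "1 / e n" 0]) (simp_all add: divide_inverse)
    also have "\<dots> = complex_of_real ((1 / e n) ^ DIM('a) * \<kappa> * gaussian ((y - x) /\<^sub>R e n))"
      using gaussian_fourier(2)[of "(y - x) /\<^sub>R e n"] unfolding fourier_def \<kappa>_def
      by (simp add: scaleR_conv_of_real)
    finally show ?thesis .
  qed
  have G_eq: "G n x = complex_of_real \<kappa> * (LINT w|lborel. g (x + e n *\<^sub>R w) * complex_of_real (gaussian w))" for n x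
  proof -
    have "G n x = (LINT y|lborel. g y * complex_of_real ((1 / e n) ^ DIM('a) * \<kappa> * gaussian ((y - x) /\<^sub>R e n)))"
      unfolding G_def fg[symmetric]
      by (rule fourier_mult_formula[OF g_int integrable_mult_cis[OF gs_int]]) simp
    also have "\<dots> = e n ^ DIM('a) *\<^sub>R (LINT w|lborel. g (x + e n *\<^sub>R w) * complex_of_real ((1 / e n) ^ DIM('a) * \<kappa> * gaussian w))"
      using e[of n] by (subst lborel_integral_affine[of _ "e n" x]) simp_all
    also have "(LINT w|lborel. g (x + e n *\<^sub>R w) * complex_of_real ((1 / e n) ^ DIM('a) * \<kappa> * gaussian w))
       = complex_of_real ((1 / e n) ^ DIM('a) * \<kappa>) * (LINT w|lborel. g (x + e n *\<^sub>R w) * complex_of_real (gaussian w))"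
      by (subst Bochner_Integration.integral_mult_right_zero[symmetric]) (simp add: mult_ac)
    finally show ?thesis using e[of n] by (simp add: scaleR_conv_of_real field_simps)
  qed
  have dom_int: "integrable lborel (\<lambda>w. C * gaussian (w::'a))" using integrable_gaussian[where 'a='a] by simp
  have nbd: "norm (g (x + e n *\<^sub>R w) * complex_of_real (gaussian w)) \<le> C * gaussian w" for n x w
    using bound[of "x + e n *\<^sub>R w"] by (simp add: norm_mult mult_right_mono)
  have G_bound: "norm (G n x) \<le> \<kappa> * (C * \<kappa>)" for n x
  proof -
    have "norm (LINT w|lborel. g (x + e n *\<^sub>R w) * complex_of_real (gaussian w)) \<le> (LINT w|lborel. C * gaussian (w::'a))"
    proof (rule Bochner_Integration.integral_norm_bound_integral[OF _ dom_int nbd])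
      show "integrable lborel (\<lambda>w. g (x + e n *\<^sub>R w) * complex_of_real (gaussian w))"
      proof (rule Bochner_Integration.integrable_bound[OF dom_int])
        show "AE w in lborel. norm (g (x + e n *\<^sub>R w) * complex_of_real (gaussian w)) \<le> norm (C * gaussian w)"
          using nbd C by (simp add: abs_mult)
      qed measurable
    qed
    also have "\<dots> = C * \<kappa>" by (simp add: integral_gaussian \<kappa>_def)
    finally have "norm (LINT w|lborel. g (x + e n *\<^sub>R w) * complex_of_real (gaussian w)) \<le> C * \<kappa>" .
    moreover have "0 \<le> \<kappa>" by (simp add: \<kappa>_def)
    ultimately show ?thesis unfolding G_eq norm_mult by (simp add: mult_left_mono)
  qed
  have G_lim: "(\<lambda>n. G n x) \<longlonglongrightarrow> complex_of_real (\<kappa> * \<kappa>) * g x" if "isCont g x" for x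
  proof -
    have "(\<lambda>n. LINT w|lborel. g (x + e n *\<^sub>R w) * complex_of_real (gaussian w))
       \<longlonglongrightarrow> (LINT w|lborel. g x * complex_of_real (gaussian (w::'a)))"
    proof (rule integral_dominated_convergence[OF _ _ dom_int])
      have "(\<lambda>n. g (x + e n *\<^sub>R w) * complex_of_real (gaussian w)) \<longlonglongrightarrow> g x * complex_of_real (gaussian w)" for w
      proof (intro tendsto_intros isCont_tendsto_compose[OF that])
        show "(\<lambda>n. x + e n *\<^sub>R w) \<longlonglongrightarrow> x" by (auto intro!: tendsto_eq_intros e0)
      qed
      then show "AE w in lborel. (\<lambda>n. g (x + e n *\<^sub>R w) * complex_of_real (gaussian w)) \<longlonglongrightarrow> g x * complex_of_real (gaussian w)"
        by simp
    qed (use nbd in auto)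
    then have "(\<lambda>n. G n x) \<longlonglongrightarrow> complex_of_real \<kappa> * (LINT w|lborel. g x * complex_of_real (gaussian (w::'a)))"
      unfolding G_eq by (intro tendsto_intros)
    also have "(LINT w|lborel. g x * complex_of_real (gaussian (w::'a))) = g x * complex_of_real \<kappa>"
      by (simp add: integral_gaussian \<kappa>_def)
    finally show ?thesis by (simp add: mult_ac)
  qed
  \<comment> \<open>The multiplication formula is used with the damped conjugate transform of
    \<open>g\<close> as second function; the transform of that function is the conjugate of
    \<open>G n\<close>.\<close>
  have damped: "(LINT \<xi>|lborel. (norm (fourier g \<xi>))\<^sup>2 * gaussian (e n *\<^sub>R \<xi>)) = (LINT x|lborel. Re (g x * cnj (G n x)))" for n
  proof -
    define k where "k = (\<lambda>\<xi>. complex_of_real (gaussian (e n *\<^sub>R \<xi>)) * cnj (fourier g \<xi>))"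
    have [measurable]: "k \<in> borel_measurable borel" unfolding k_def by measurable
    have k_int: "integrable lborel k"
      by (rule Bochner_Integration.integrable_bound[OF integrable_mult_right[OF gs_int[of n], of "complex_of_real T"]])
        (use T in \<open>auto simp: k_def norm_mult abs_of_nonneg[OF order_trans[OF norm_ge_zero T]] mult_left_mono mult.commute[of T]\<close>)
    have fk: "fourier k x = cnj (G n x)" for x
      unfolding fourier_def G_def k_def
      by (subst Bochner_Integration.integral_cnj[symmetric])
        (simp add: mult_ac cis_cnj inner_commute)
    have eq: "fourier g \<xi> * k \<xi> = complex_of_real ((norm (fourier g \<xi>))\<^sup>2 * gaussian (e n *\<^sub>R \<xi>))" for \<xi>
      unfolding k_def using complex_norm_square[of "fourier g \<xi>"] by (simp add: mult_ac)
    have "complex_of_real (LINT \<xi>|lborel. (norm (fourier g \<xi>))\<^sup>2 * gaussian (e n *\<^sub>R \<xi>)) = (LINT \<xi>|lborel. fourier g \<xi> * k \<xi>)"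
      unfolding eq by (rule integral_complex_of_real[symmetric])
    also have "\<dots> = (LINT x|lborel. g x * cnj (G n x))"
      unfolding fourier_mult_formula[OF g_int k_int] fk ..
    finally have "(LINT \<xi>|lborel. (norm (fourier g \<xi>))\<^sup>2 * gaussian (e n *\<^sub>R \<xi>)) = Re (LINT x|lborel. g x * cnj (G n x))"
      by (metis Re_complex_of_real)
    moreover have "integrable lborel (\<lambda>x. g x * cnj (G n x))"
    proof -
      have Gm [measurable]: "G n \<in> borel_measurable borel" unfolding G_def by measurable
      show ?thesis
      proof (rule Bochner_Integration.integrable_bound[OF integrable_mult_right[OF g_int, of "complex_of_real (\<kappa> * (C * \<kappa>))"]])
        have "norm (g x * cnj (G n x)) \<le> norm (complex_of_real (\<kappa> * (C * \<kappa>)) * g x)" for x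
          using mult_right_mono[OF order_trans[OF G_bound[of n x] abs_ge_self] norm_ge_zero[of "g x"]]
          by (simp only: norm_mult norm_of_real complex_mod_cnj mult.commute[of "norm (g x)"])
        then show "AE x in lborel. norm (g x * cnj (G n x)) \<le> norm (complex_of_real (\<kappa> * (C * \<kappa>)) * g x)"
          by simp
      qed measurable
    qed
    ultimately show ?thesis unfolding integral_Re[OF \<open>integrable lborel (\<lambda>x. g x * cnj (G n x))\<close>] by simp
  qed
  have lim1: "(\<lambda>n. LINT \<xi>|lborel. (norm (fourier g \<xi>))\<^sup>2 * gaussian (e n *\<^sub>R \<xi>)) \<longlonglongrightarrow> (LINT x|lborel. \<kappa> * \<kappa> * (norm (g x))\<^sup>2)"
    unfolding damped
  proof (rule integral_dominated_convergence[OF _ _ int_dom[of "C * (\<kappa> * (C * \<kappa>))"]])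
    have Gm: "G n \<in> borel_measurable borel" for n unfolding G_def by measurable
    show "(\<lambda>x. Re (g x * cnj (G n x))) \<in> borel_measurable lborel" for n using Gm[of n] by measurable
    show "(\<lambda>x. \<kappa> * \<kappa> * (norm (g x))\<^sup>2) \<in> borel_measurable lborel" by measurable
    show "AE x in lborel. (\<lambda>n. Re (g x * cnj (G n x))) \<longlonglongrightarrow> \<kappa> * \<kappa> * (norm (g x))\<^sup>2"
      using cont
    proof eventually_elim
      case (elim x)
      have "(\<lambda>n. Re (g x * cnj (G n x))) \<longlonglongrightarrow> Re (g x * cnj (complex_of_real (\<kappa> * \<kappa>) * g x))"
        by (intro tendsto_intros G_lim elim)
      also have "g x * cnj (complex_of_real (\<kappa> * \<kappa>) * g x) = complex_of_real (\<kappa> * \<kappa> * (norm (g x))\<^sup>2)"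
        using complex_norm_square[of "g x"] by (simp add: mult_ac)
      finally show ?case by simp
    qed
    show "AE x in lborel. norm (Re (g x * cnj (G n x))) \<le> C * (\<kappa> * (C * \<kappa>)) * indicator (cball 0 B) x" for n
    proof (rule AE_I2)
      fix x
      have "\<bar>Re (g x * cnj (G n x))\<bar> \<le> norm (g x) * norm (G n x)"
        using abs_Re_le_cmod[of "g x * cnj (G n x)"] by (simp add: norm_mult)
      also have "\<dots> \<le> C * (\<kappa> * (C * \<kappa>)) * indicator (cball 0 B) x"
        using bound[of x] G_bound[of n x] supp[of x] C by (auto simp: indicator_def intro!: mult_mono)
      finally show "norm (Re (g x * cnj (G n x))) \<le> C * (\<kappa> * (C * \<kappa>)) * indicator (cball 0 B) x" by simp
    qed
  qed
  have gauss_lim: "(\<lambda>n. gaussian (e n *\<^sub>R \<xi>)) \<longlonglongrightarrow> 1" for \<xi> :: 'a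
  proof -
    have "(\<lambda>n. exp (- (norm (e n *\<^sub>R \<xi>))\<^sup>2 / 2)) \<longlonglongrightarrow> exp (- (norm (0 *\<^sub>R \<xi>))\<^sup>2 / 2)"
      by (intro tendsto_intros e0) simp
    then show ?thesis by (simp add: gaussian_def)
  qed
  \<comment> \<open>On the frequency side no integrable majorant is at hand before the theorem is
    proved. The damping factors increase to 1 as \<open>e n\<close> decreases, so monotone
    convergence takes its place.\<close>
  have inc: "incseq (\<lambda>n \<xi>. ennreal ((norm (fourier g \<xi>))\<^sup>2 * gaussian (e n *\<^sub>R \<xi>)))"
  proof (rule incseq_SucI, rule le_funI)
    fix n and \<xi> :: 'a
    have "e (Suc n) \<le> e n" by (simp add: e_def frac_le)
    then have "(norm (e (Suc n) *\<^sub>R \<xi>))\<^sup>2 \<le> (norm (e n *\<^sub>R \<xi>))\<^sup>2"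
      using e[of "Suc n"] by (intro power_mono) (auto intro!: mult_right_mono)
    then show "ennreal ((norm (fourier g \<xi>))\<^sup>2 * gaussian (e n *\<^sub>R \<xi>)) \<le> ennreal ((norm (fourier g \<xi>))\<^sup>2 * gaussian (e (Suc n) *\<^sub>R \<xi>))"
      by (intro ennreal_leI mult_left_mono) (auto simp: gaussian_def)
  qed
  have "(\<lambda>n. \<integral>\<^sup>+\<xi>. ennreal ((norm (fourier g \<xi>))\<^sup>2 * gaussian (e n *\<^sub>R \<xi>)) \<partial>lborel) \<longlonglongrightarrow> (\<integral>\<^sup>+\<xi>. ennreal ((norm (fourier g \<xi>))\<^sup>2) \<partial>lborel)"
  proof (rule nn_integral_LIMSEQ[OF inc])
    show "(\<lambda>n. ennreal ((norm (fourier g \<xi>))\<^sup>2 * gaussian (e n *\<^sub>R \<xi>))) \<longlonglongrightarrow> ennreal ((norm (fourier g \<xi>))\<^sup>2)" for \<xi>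
      using tendsto_mult[OF tendsto_const gauss_lim[of \<xi>], of "(norm (fourier g \<xi>))\<^sup>2"] by (intro tendsto_ennrealI) simp
  qed measurable
  moreover have "(\<integral>\<^sup>+\<xi>. ennreal ((norm (fourier g \<xi>))\<^sup>2 * gaussian (e n *\<^sub>R \<xi>)) \<partial>lborel)
     = ennreal (LINT \<xi>|lborel. (norm (fourier g \<xi>))\<^sup>2 * gaussian (e n *\<^sub>R \<xi>))" for n
  proof (rule nn_integral_eq_integral)
    have T2: "(norm (fourier g \<xi>))\<^sup>2 \<le> T\<^sup>2" for \<xi> using T[of \<xi>] by (intro power_mono) auto
    show "integrable lborel (\<lambda>\<xi>. (norm (fourier g \<xi>))\<^sup>2 * gaussian (e n *\<^sub>R \<xi>))"
    proof (rule Bochner_Integration.integrable_bound[OF integrable_mult_right[OF gs_int[of n], of "complex_of_real (T\<^sup>2)"]])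
      have "norm ((norm (fourier g \<xi>))\<^sup>2 * gaussian (e n *\<^sub>R \<xi>)) \<le> norm (complex_of_real (T\<^sup>2) * complex_of_real (gaussian (e n *\<^sub>R \<xi>)))" for \<xi>
        using mult_right_mono[OF T2[of \<xi>] gaussian_nonneg[of "e n *\<^sub>R \<xi>"]] by (simp add: norm_mult norm_power)
      then show "AE \<xi> in lborel. norm ((norm (fourier g \<xi>))\<^sup>2 * gaussian (e n *\<^sub>R \<xi>)) \<le> norm (complex_of_real (T\<^sup>2) * complex_of_real (gaussian (e n *\<^sub>R \<xi>)))"
        by simp
    qed measurable
  qed auto
  ultimately have "(\<lambda>n. ennreal (LINT \<xi>|lborel. (norm (fourier g \<xi>))\<^sup>2 * gaussian (e n *\<^sub>R \<xi>))) \<longlonglongrightarrow> (\<integral>\<^sup>+\<xi>. ennreal ((norm (fourier g \<xi>))\<^sup>2) \<partial>lborel)"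
    by simp
  from LIMSEQ_unique[OF this tendsto_ennrealI[OF lim1]]
  have "(\<integral>\<^sup>+\<xi>. ennreal ((norm (fourier g \<xi>))\<^sup>2) \<partial>lborel) = ennreal (LINT x|lborel. \<kappa> * \<kappa> * (norm (g x))\<^sup>2)" .
  also have "\<dots> = (\<integral>\<^sup>+x. ennreal (\<kappa> * \<kappa> * (norm (g x))\<^sup>2) \<partial>lborel)"
  proof (rule nn_integral_eq_integral[symmetric])
    have "(norm (g x))\<^sup>2 \<le> C * C * indicator (cball 0 B) x" for x
      using bound[of x] supp[of x] C by (auto simp: indicator_def power2_eq_square intro!: mult_mono)
    then have "integrable lborel (\<lambda>x. (norm (g x))\<^sup>2)"
      by (intro Bochner_Integration.integrable_bound[OF int_dom[of "C * C"]])
        (auto intro: order_trans[OF _ abs_ge_self])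
    then show "integrable lborel (\<lambda>x. \<kappa> * \<kappa> * (norm (g x))\<^sup>2)" by simp
  qed auto
  also have "\<dots> = ennreal (\<kappa> * \<kappa>) * (\<integral>\<^sup>+x. ennreal ((norm (g x))\<^sup>2) \<partial>lborel)"
    by (subst nn_integral_cmult[symmetric]) (auto simp: ennreal_mult')
  finally show ?thesis unfolding \<kappa>2 .
qed


text \<open>The cross term is evaluated by the multiplication formula, so that no inversion theorem is
  needed.\<close>
lemma fourier_truncation_error:
  fixes F f :: "'a::euclidean_space \<Rightarrow> complex"
  defines "f \<equiv> \<lambda>x. fourier F (- x)" and "c \<equiv> (2 * pi) ^ DIM('a)"
  assumes cont: "continuous_on UNIV F"
    and bound: "\<And>x. norm (F x) \<le> C"
    and supp: "\<And>x. x \<notin> cball 0 B \<Longrightarrow> F x = 0"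
    and f_cont: "continuous_on UNIV f"
  shows "(\<integral>\<^sup>+x. ennreal ((norm (f x))\<^sup>2) \<partial>lborel) = ennreal c * (\<integral>\<^sup>+\<xi>. ennreal ((norm (F \<xi>))\<^sup>2) \<partial>lborel)"
    and "(\<integral>\<^sup>+\<xi>. ennreal ((norm (complex_of_real c * F \<xi> - (LINT x:cball 0 R|lborel. f x * cis (- (x \<bullet> \<xi>)))))\<^sup>2) \<partial>lborel)
      = ennreal c * (\<integral>\<^sup>+x\<in>- cball 0 R. ennreal ((norm (f x))\<^sup>2) \<partial>lborel)"
proof -
  have c: "c > 0" by (simp add: c_def)
  have [measurable]: "F \<in> borel_measurable borel" using cont by (rule borel_measurable_continuous_onI)
  have f_meas[measurable]: "f \<in> borel_measurable borel" using f_cont by (rule borel_measurable_continuous_onI)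
  have C: "0 \<le> C" using bound[of 0] norm_ge_zero order_trans by blast
  have int_dom: "integrable lborel (\<lambda>x::'a. D * indicator (cball 0 B) x)" for D B :: real
    using emeasure_bounded_finite[of "cball (0::'a) B"]
    by (intro integrable_mult_right integrable_real_indicator) auto
  have F_int: "integrable lborel F"
    by (rule Bochner_Integration.integrable_bound[OF int_dom[of C B]])
      (use bound supp C in \<open>auto simp: indicator_def\<close>)
  have F2_int: "integrable lborel (\<lambda>\<xi>. (norm (F \<xi>))\<^sup>2)"
  proof (rule Bochner_Integration.integrable_bound[OF int_dom[of "C * C" B]])
    have "(norm (F x))\<^sup>2 \<le> C * C * indicator (cball 0 B) x" for x
      using bound[of x] supp[of x] C by (auto simp: indicator_def power2_eq_square intro!: mult_mono)
    then show "AE x in lborel. norm ((norm (F x))\<^sup>2) \<le> norm (C * C * indicator (cball 0 B) x)"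
      by (auto intro!: AE_I2 order_trans[OF _ abs_ge_self])
  qed measurable
  have "AE x in lborel. isCont F x" using cont by (auto simp: continuous_on_eq_continuous_at)
  from plancherel[OF _ bound supp this] 
  have "(\<integral>\<^sup>+x. ennreal ((norm (fourier F x))\<^sup>2) \<partial>lborel) = ennreal c * (\<integral>\<^sup>+\<xi>. ennreal ((norm (F \<xi>))\<^sup>2) \<partial>lborel)"
    by (simp add: c_def)
  then show nn_f: "(\<integral>\<^sup>+x. ennreal ((norm (f x))\<^sup>2) \<partial>lborel) = ennreal c * (\<integral>\<^sup>+\<xi>. ennreal ((norm (F \<xi>))\<^sup>2) \<partial>lborel)"
    unfolding f_def by (subst lborel_nn_integral_uminus[where f="\<lambda>x. ennreal ((norm (fourier F x))\<^sup>2)"]) simp_all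
  have f2_nn: "(\<integral>\<^sup>+x. ennreal ((norm (f x))\<^sup>2) \<partial>lborel) = ennreal (c * (LINT \<xi>|lborel. (norm (F \<xi>))\<^sup>2))"
    unfolding nn_f using c by (subst nn_integral_eq_integral[OF F2_int]) (simp_all add: ennreal_mult')
  have f2_int: "integrable lborel (\<lambda>x. (norm (f x))\<^sup>2)"
    by (rule integrableI_nonneg) (use f2_nn in auto)
  have f2_eq: "(LINT x|lborel. (norm (f x))\<^sup>2) = c * (LINT \<xi>|lborel. (norm (F \<xi>))\<^sup>2)"
    using f2_nn c unfolding nn_integral_eq_integral[OF f2_int AE_I2, simplified]
    by (subst (asm) ennreal_inj) auto
  have f_bd: "norm (f x) \<le> (LINT x|lborel. norm (F x))" for x
    unfolding f_def by (rule norm_fourier_le[OF F_int])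
  define D where "D = (LINT x|lborel. norm (F x))"
  have D: "0 \<le> D" "norm (f x) \<le> D" for x using f_bd unfolding D_def by auto
  define g where "g = (\<lambda>x. indicator (cball 0 R) x *\<^sub>R f x)"
  have g_meas[measurable]: "g \<in> borel_measurable borel"
    unfolding g_def using f_meas by (intro borel_measurable_scaleR borel_measurable_indicator) auto
  have g_bd: "norm (g x) \<le> D" and g_supp: "x \<notin> cball 0 R \<Longrightarrow> g x = 0" for x
    using D by (auto simp: g_def indicator_def)
  have g_int: "integrable lborel g"
    by (rule Bochner_Integration.integrable_bound[OF int_dom[of D R]])
      (use D in \<open>auto simp: g_def indicator_def\<close>)
  \<comment> \<open>Truncation makes \<open>g\<close> jump across a sphere, which is a null set.
    This is the reason why \<open>plancherel\<close> asks for continuity only almost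
    everywhere.\<close>
  have g_cont: "AE x in lborel. isCont g x"
  proof -
    have "negligible (frontier (cball (0::'a) R))" by (intro negligible_convex_frontier) simp
    then have "AE x in lborel. x \<notin> frontier (cball (0::'a) R)"
      by (intro AE_not_in) (auto simp: null_sets_def negligible_iff_null_sets null_sets_completion_iff)
    then show ?thesis
    proof eventually_elim
      case (elim x)
      show ?case
      proof (cases "norm x < R")
        case True
        have "isCont f x" using f_cont by (simp add: continuous_on_eq_continuous_at)
        moreover have "\<forall>\<^sub>F y in nhds x. g y = f y"
          using eventually_nhds_in_open[OF open_ball, of x 0 R] True
          by (auto simp: g_def elim!: eventually_mono)
        ultimately show ?thesis by (subst isCont_cong)
      next
        case False
        with elim have "x \<in> - cball 0 R" by (auto simp: frontier_cball sphere_def split: if_splits)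
        then have "\<forall>\<^sub>F y in nhds x. g y = 0"
          using eventually_nhds_in_open[OF open_Compl[OF closed_cball], of x 0 R]
          by (auto simp: g_def elim!: eventually_mono)
        then have "isCont g x \<longleftrightarrow> isCont (\<lambda>_. 0 :: complex) x" by (rule isCont_cong)
        then show ?thesis by simp
      qed
    qed
  qed
  have FR: "(LINT x:cball 0 R|lborel. f x * cis (- (x \<bullet> \<xi>))) = fourier g \<xi>" for \<xi>
    unfolding set_lebesgue_integral_def fourier_def g_def by simp
  have g2_le: "(norm (g x))\<^sup>2 \<le> (norm (f x))\<^sup>2" for x by (auto simp: g_def indicator_def)
  have g2_int: "integrable lborel (\<lambda>x. (norm (g x))\<^sup>2)"
    by (rule Bochner_Integration.integrable_bound[OF f2_int]) (use g2_le in auto)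
  have pl_g: "(\<integral>\<^sup>+\<xi>. ennreal ((norm (fourier g \<xi>))\<^sup>2) \<partial>lborel) = ennreal c * (\<integral>\<^sup>+x. ennreal ((norm (g x))\<^sup>2) \<partial>lborel)"
    unfolding c_def by (rule plancherel[where B = R and C = D]) (use g_bd g_supp g_cont in auto)
  have nn_g: "(\<integral>\<^sup>+\<xi>. ennreal ((norm (fourier g \<xi>))\<^sup>2) \<partial>lborel) = ennreal (c * (LINT x|lborel. (norm (g x))\<^sup>2))"
    using c unfolding pl_g
    by (simp add: nn_integral_eq_integral[OF g2_int] ennreal_mult')
  have fg2_int: "integrable lborel (\<lambda>\<xi>. (norm (fourier g \<xi>))\<^sup>2)"
    by (rule integrableI_nonneg) (use nn_g in auto)
  have fg2_eq: "(LINT \<xi>|lborel. (norm (fourier g \<xi>))\<^sup>2) = c * (LINT x|lborel. (norm (g x))\<^sup>2)"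
    using nn_g c unfolding nn_integral_eq_integral[OF fg2_int AE_I2, simplified]
    by (subst (asm) ennreal_inj) auto
  have Fc_int: "integrable lborel (\<lambda>\<xi>. cnj (F \<xi>))" using F_int by simp
  have fFc: "fourier (\<lambda>\<xi>. cnj (F \<xi>)) x = cnj (f x)" for x
    unfolding fourier_def f_def
    by (subst Bochner_Integration.integral_cnj[symmetric]) (simp add: cis_cnj)
  have [measurable]: "(\<lambda>\<xi>. cnj (F \<xi>)) \<in> borel_measurable borel"
    by (intro borel_measurable_continuous_onI continuous_intros cont)
  have cross_int: "integrable lborel (\<lambda>\<xi>. fourier g \<xi> * cnj (F \<xi>))"
    by (rule Bochner_Integration.integrable_bound[OF integrable_mult_right[OF F_int, of "complex_of_real (LINT x|lborel. norm (g x))"]])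
      (use norm_fourier_le[OF g_int] in \<open>auto simp: norm_mult abs_of_nonneg intro!: mult_right_mono\<close>)
  have gf: "g x * cnj (f x) = complex_of_real ((norm (g x))\<^sup>2)" for x
    using complex_norm_square[of "f x"] by (auto simp: g_def indicator_def)
  have "(LINT \<xi>|lborel. fourier g \<xi> * cnj (F \<xi>)) = complex_of_real (LINT x|lborel. (norm (g x))\<^sup>2)"
    unfolding fourier_mult_formula[OF g_int Fc_int] fFc gf by (rule integral_complex_of_real)
  then have cross: "(LINT \<xi>|lborel. Re (fourier g \<xi> * cnj (F \<xi>))) = (LINT x|lborel. (norm (g x))\<^sup>2)"
    unfolding integral_Re[OF cross_int] by (simp only: Re_complex_of_real)
  have expand: "(norm (complex_of_real c * F \<xi> - fourier g \<xi>))\<^sup>2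
     = c\<^sup>2 * (norm (F \<xi>))\<^sup>2 + (norm (fourier g \<xi>))\<^sup>2 - 2 * c * Re (fourier g \<xi> * cnj (F \<xi>))" for \<xi>
    unfolding cmod_power2 by (simp add: power2_eq_square algebra_simps)
  have err_int: "integrable lborel (\<lambda>\<xi>. (norm (complex_of_real c * F \<xi> - fourier g \<xi>))\<^sup>2)"
    unfolding expand using F2_int fg2_int cross_int by (intro Bochner_Integration.integrable_diff Bochner_Integration.integrable_add integrable_mult_right integrable_Re)
  have "(LINT \<xi>|lborel. (norm (complex_of_real c * F \<xi> - fourier g \<xi>))\<^sup>2)
    = c\<^sup>2 * (LINT \<xi>|lborel. (norm (F \<xi>))\<^sup>2) + (LINT \<xi>|lborel. (norm (fourier g \<xi>))\<^sup>2) - 2 * c * (LINT \<xi>|lborel. Re (fourier g \<xi> * cnj (F \<xi>)))"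
    unfolding expand using F2_int fg2_int integrable_Re[OF cross_int] by simp
  \<comment> \<open>The integral of \<open>c\<^sup>2 * (norm (F \<xi>))\<^sup>2\<close> is c times
    the mass of \<open>f\<close>; the other two terms contribute c and - 2 c times the mass of
    \<open>g\<close>. What remains is c times the mass that the truncation cuts off.\<close>
  also have "\<dots> = c * (LINT x|lborel. (norm (f x))\<^sup>2 - (norm (g x))\<^sup>2)"
    unfolding fg2_eq cross using f2_int g2_int f2_eq by (simp add: power2_eq_square algebra_simps)
  finally have eq: "(LINT \<xi>|lborel. (norm (complex_of_real c * F \<xi> - fourier g \<xi>))\<^sup>2) = \<dots>" .
  have "(\<integral>\<^sup>+\<xi>. ennreal ((norm (complex_of_real c * F \<xi> - fourier g \<xi>))\<^sup>2) \<partial>lborel)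
      = ennreal (c * (LINT x|lborel. (norm (f x))\<^sup>2 - (norm (g x))\<^sup>2))"
    unfolding nn_integral_eq_integral[OF err_int AE_I2, simplified] eq ..
  also have "\<dots> = ennreal c * (\<integral>\<^sup>+x. ennreal ((norm (f x))\<^sup>2 - (norm (g x))\<^sup>2) \<partial>lborel)"
    using c f2_int g2_int g2_le by (subst nn_integral_eq_integral) (auto simp: ennreal_mult')
  also have "(\<integral>\<^sup>+x. ennreal ((norm (f x))\<^sup>2 - (norm (g x))\<^sup>2) \<partial>lborel) = (\<integral>\<^sup>+x\<in>- cball 0 R. ennreal ((norm (f x))\<^sup>2) \<partial>lborel)"
    by (intro nn_integral_cong) (auto simp: g_def indicator_def)
  finally show "(\<integral>\<^sup>+\<xi>. ennreal ((norm (complex_of_real c * F \<xi> - (LINT x:cball 0 R|lborel. f x * cis (- (x \<bullet> \<xi>)))))\<^sup>2) \<partial>lborel)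
      = ennreal c * (\<integral>\<^sup>+x\<in>- cball 0 R. ennreal ((norm (f x))\<^sup>2) \<partial>lborel)"
    unfolding FR .
qed

section \<open>Coordinates on a slab, and synthesis of functions from horizontal Fourier
  coefficients\<close>

lemma point_eq: "point x' s = (\<chi> i. if i = 1 then x' $ 1 else if i = 2 then x' $ 2 else s)"
proof -
  have "point x' s $ i = (if i = 1 then x' $ 1 else if i = 2 then x' $ 2 else s)" for i
    using exhaust_3[of i] by (auto simp: point_def)
  then show ?thesis by (simp add: vec_eq_iff)
qed

lemma point_nth [simp]: "point x' s $ 1 = x' $ 1" "point x' s $ 2 = x' $ 2" "point x' s $ 3 = s"
  by (simp_all add: point_def)

lemma point_in_slab [simp]: "point x' s \<in> slab I \<longleftrightarrow> s \<in> I"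
  by (simp add: slab_def)

lemma continuous_on_point [continuous_intros]:
  assumes "continuous_on S f" "continuous_on S h"
  shows "continuous_on S (\<lambda>z. point (f z) (h z))"
  unfolding point_eq
proof (rule continuous_on_vec_lambda)
  fix i :: 3
  show "continuous_on S (\<lambda>z. if i = 1 then f z $ 1 else if i = 2 then f z $ 2 else h z)"
    using assms by (cases "i = 1"; cases "i = 2") (auto intro!: continuous_intros)
qed

lemma open_slab: "open I \<Longrightarrow> open (slab I)"
  unfolding slab_def by (rule open_vimage_vec_nth[unfolded vimage_def])

lemma borel_measurable_point [measurable]: "(\<lambda>z. point (fst z) (snd z)) \<in> borel_measurable borel"
  by (intro borel_measurable_continuous_onI continuous_intros)

lemma prod_Basis_vec: "(\<Prod>b\<in>Basis. f b) = (\<Prod>i\<in>UNIV. f (axis i 1))"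
  for f :: "real ^ 'n \<Rightarrow> 'b::comm_monoid_mult"
proof -
  have B: "Basis = range (\<lambda>i::'n. axis i (1::real))" by (auto simp: Basis_vec_def)
  have inj: "inj (\<lambda>i::'n. axis i (1::real))" by (auto simp: inj_def axis_eq_axis)
  show ?thesis unfolding B prod.reindex[OF inj] by (simp add: o_def)
qed

lemma prod_UNIV_3: "prod f (UNIV :: 3 set) = f 1 * f 2 * f 3" for f :: "3 \<Rightarrow> 'a::comm_monoid_mult"
  unfolding UNIV_3 by (simp add: ac_simps)

text \<open>Lebesgue measure is determined by its values on boxes, and the preimage of a box under
  \<open>point\<close> is a product of two boxes.\<close>

lemma lborel_distr_point: "distr lborel borel (\<lambda>z. point (fst z) (snd z)) = lborel"
proof (rule lborel_eqI[symmetric])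
  fix l u :: "real^3" assume le: "\<And>b. b \<in> Basis \<Longrightarrow> l \<bullet> b \<le> u \<bullet> b"
  define l' u' :: "real^2" where "l' = vector [l $ 1, l $ 2]" and "u' = vector [u $ 1, u $ 2]"
  have lu: "l $ i \<le> u $ i" for i using le[of "axis i 1"] by (simp add: inner_axis axis_in_Basis_iff)
  have lu': "l' $ i \<le> u' $ i" for i
    using exhaust_2[of i] lu[of 1] lu[of 2] by (auto simp: l'_def u'_def)
  have ax: "v \<bullet> axis i 1 = v $ i" for v :: "real ^ 'n" and i by (simp add: inner_axis)
  have "(\<lambda>z. point (fst z) (snd z)) -` box l u = box l' u' \<times> box (l $ 3) (u $ 3)"
    by (auto simp: mem_box_cart forall_3 forall_2 l'_def u'_def)
  then have "emeasure (distr lborel borel (\<lambda>z. point (fst z) (snd z))) (box l u)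
      = emeasure (lborel \<Otimes>\<^sub>M lborel) (box l' u' \<times> box (l $ 3) (u $ 3))"
    by (subst emeasure_distr) (auto simp: lborel_prod)
  also have "\<dots> = emeasure lborel (box l' u') * emeasure lborel (box (l $ 3) (u $ 3))"
    by (rule lborel.emeasure_pair_measure_Times) auto
  also have "emeasure lborel (box l' u') = ennreal ((u $ 1 - l $ 1) * (u $ 2 - l $ 2))"
  proof (subst emeasure_lborel_box)
    show "\<And>b. b \<in> Basis \<Longrightarrow> l' \<bullet> b \<le> u' \<bullet> b"
      using lu' by (auto simp: Basis_vec_def inner_axis)
    show "ennreal (\<Prod>b\<in>Basis. (u' - l') \<bullet> b) = ennreal ((u $ 1 - l $ 1) * (u $ 2 - l $ 2))"
      unfolding prod_Basis_vec ax by (simp add: UNIV_2 l'_def u'_def)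
  qed
  also have "emeasure lborel (box (l $ 3) (u $ 3)) = ennreal (u $ 3 - l $ 3)"
    using lu[of 3] by (simp add: box_real)
  also have "ennreal ((u $ 1 - l $ 1) * (u $ 2 - l $ 2)) * ennreal (u $ 3 - l $ 3) = ennreal (\<Prod>b\<in>Basis. (u - l) \<bullet> b)"
  proof -
    have "(\<Prod>b\<in>Basis. (u - l) \<bullet> b) = (u $ 1 - l $ 1) * (u $ 2 - l $ 2) * (u $ 3 - l $ 3)"
      unfolding prod_Basis_vec ax prod_UNIV_3 by simp
    moreover have "0 \<le> u $ 3 - l $ 3" "0 \<le> (u $ 1 - l $ 1) * (u $ 2 - l $ 2)"
      using lu[of 1] lu[of 2] lu[of 3] by simp_all
    ultimately show ?thesis by (simp only: ennreal_mult)
  qed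
  finally show "emeasure (distr lborel borel (\<lambda>z. point (fst z) (snd z))) (box l u) = ennreal (\<Prod>b\<in>Basis. (u - l) \<bullet> b)" .
qed simp

lemma nn_integral_point:
  assumes [measurable]: "f \<in> borel_measurable borel"
  shows "(\<integral>\<^sup>+x. f x \<partial>lborel) = (\<integral>\<^sup>+z. f (point (fst z) (snd z)) \<partial>lborel)"
  by (subst lborel_distr_point[symmetric], subst nn_integral_distr) simp_all

lemma nn_integral_lborel_snd:
  fixes h :: "'a::euclidean_space \<times> 'b::euclidean_space \<Rightarrow> ennreal"
  assumes "h \<in> borel_measurable borel"
  shows "(\<integral>\<^sup>+z. h z \<partial>lborel) = (\<integral>\<^sup>+s. (\<integral>\<^sup>+x. h (x, s) \<partial>lborel) \<partial>lborel)"
  using lborel_pair.nn_integral_snd[of h] assms by (simp add: lborel_prod)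

lemma borel_measurable_indicator_fst:
  fixes A :: "'a::euclidean_space set"
  assumes "A \<in> sets borel"
  shows "(\<lambda>z::'a \<times> 'b::euclidean_space. indicator A (fst z) :: ennreal) \<in> borel_measurable borel"
  by (rule measurable_compose[OF borel_measurable_continuous_onI borel_measurable_indicator];
      use assms in \<open>auto intro!: continuous_intros\<close>)

lemma borel_measurable_indicator_snd:
  fixes B :: "'b::euclidean_space set"
  assumes "B \<in> sets borel"
  shows "(\<lambda>z::'a::euclidean_space \<times> 'b. indicator B (snd z) :: ennreal) \<in> borel_measurable borel"
  by (rule measurable_compose[OF borel_measurable_continuous_onI borel_measurable_indicator];
      use assms in \<open>auto intro!: continuous_intros\<close>)

lemma borel_measurable_truncated_ft:
  assumes f0_meas: "f0 \<in> borel_measurable borel"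
  shows "(\<lambda>z. truncated_ft R f0 (fst z) (snd z)) \<in> borel_measurable borel"
proof -
  have 1: "(\<lambda>w::((real^2) \<times> real) \<times> (real^2). f0 (point (snd w) (snd (fst w)))) \<in> borel_measurable borel"
    by (rule measurable_compose[OF borel_measurable_continuous_onI f0_meas]) (intro continuous_intros)
  have 2: "(\<lambda>w::((real^2) \<times> real) \<times> (real^2). cis (- (snd w \<bullet> fst (fst w)))) \<in> borel_measurable borel"
    by (intro borel_measurable_continuous_onI continuous_intros)
  have 3: "(\<lambda>w::((real^2) \<times> real) \<times> (real^2). indicator (cball 0 R) (snd w) :: real) \<in> borel_measurable borel"
    by (rule measurable_compose[OF borel_measurable_continuous_onI[OF continuous_on_snd[OF continuous_on_id]]])
      (rule borel_measurable_indicator, simp)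
  have 4: "(\<lambda>w::((real^2) \<times> real) \<times> (real^2). complex_of_real (f0 (point (snd w) (snd (fst w))))) \<in> borel_measurable borel"
    by (rule measurable_compose[OF 1 borel_measurable_continuous_onI]) (intro continuous_intros)
  have sts: "sets ((borel :: ((real^2) \<times> real) measure) \<Otimes>\<^sub>M (lborel :: (real^2) measure)) = sets borel"
    by (simp add: borel_prod[symmetric] cong: sets_pair_measure_cong)
  have "(\<lambda>w. indicator (cball 0 R) (snd w) *\<^sub>R (complex_of_real (f0 (point (snd w) (snd (fst w)))) * cis (- (snd w \<bullet> fst (fst w)))))
    \<in> borel_measurable ((borel :: ((real^2) \<times> real) measure) \<Otimes>\<^sub>M lborel)"
    unfolding measurable_cong_sets[OF sts refl]
    by (rule borel_measurable_scaleR[OF 3 borel_measurable_times[OF 4 2]])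
  then have "(\<lambda>z. LINT x|lborel. indicator (cball 0 R) x *\<^sub>R (complex_of_real (f0 (point x (snd z))) * cis (- (x \<bullet> fst z))))
    \<in> borel_measurable (borel :: ((real^2) \<times> real) measure)"
    by (intro lborel.borel_measurable_lebesgue_integral) (simp add: case_prod_unfold)
  then show ?thesis unfolding truncated_ft_def set_lebesgue_integral_def .
qed

text \<open>The bridge from an inverse Fourier integral to \<open>is_horizontal_ft\<close>. On each
  slice \<open>fourier_truncation_error\<close> identifies the squared error of the truncated
  transform with the mass of \<open>f\<close> outside a ball; integrated over the bounded set
  \<open>I\<close>, this tail tends to 0 by dominated convergence. The factor
  \<open>(2 * pi)\<^sup>2\<close> appears because \<open>f\<close> is synthesised without
  normalisation in two dimensions.\<close>

lemma slab_synthesis: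
  fixes F :: "real^2 \<Rightarrow> real \<Rightarrow> complex" and f :: "real^3 \<Rightarrow> real"
  assumes I: "open I" "bounded I"
    and F_cont: "continuous_on (UNIV \<times> I) (\<lambda>z. F (fst z) (snd z))"
    and bound: "\<And>\<xi> s. s \<in> I \<Longrightarrow> norm (F \<xi> s) \<le> C"
    and supp: "\<And>\<xi> s. s \<in> I \<Longrightarrow> \<xi> \<notin> cball 0 B \<Longrightarrow> F \<xi> s = 0"
    and f_cont: "continuous_on (slab I) f"
    and f: "\<And>x' s. s \<in> I \<Longrightarrow> complex_of_real (f (point x' s)) = (LINT \<xi>|lborel. F \<xi> s * cis (x' \<bullet> \<xi>))"
  shows "L2_slab I f"
    and "is_horizontal_ft I f (\<lambda>\<xi> s. indicator I s *\<^sub>R (complex_of_real ((2 * pi)\<^sup>2) * F \<xi> s))"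
proof -
  define c where "c = (2 * pi)\<^sup>2"
  \<comment> \<open>Nothing is known about \<open>f\<close> and \<open>F\<close> off the slab;
    extension by zero makes them Borel functions on the whole space without changing the integrals
    over the slab.\<close>
  define f0 where "f0 = (\<lambda>x. indicator (slab I) x *\<^sub>R f x)"
  define F0 where "F0 = (\<lambda>\<xi> s. indicator I s *\<^sub>R F \<xi> s)"
  have f0_meas [measurable]: "f0 \<in> borel_measurable borel"
    unfolding f0_def by (rule borel_measurable_continuous_on_indicator[OF _ f_cont]) (use open_slab[OF I(1)] in auto)
  have F0_meas [measurable]: "(\<lambda>z. F0 (fst z) (snd z)) \<in> borel_measurable borel"
  proof -
    have "(\<lambda>z. indicator (UNIV \<times> I) z *\<^sub>R F (fst z) (snd z)) \<in> borel_measurable borel"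
      by (rule borel_measurable_continuous_on_indicator[OF _ F_cont]) (use I(1) in \<open>auto intro!: borel_open open_Times\<close>)
    then show ?thesis unfolding F0_def by (simp add: indicator_def of_bool_def mem_Times_iff)
  qed
  have C: "0 \<le> C" if "s \<in> I" for s using bound[OF that, of 0] norm_ge_zero order_trans by blast
  define fs where "fs = (\<lambda>s x. fourier (\<lambda>\<xi>. F \<xi> s) (- x))"
  have fs: "fs s x = complex_of_real (f (point x s))" if "s \<in> I" for s x
    unfolding fs_def fourier_def f[OF that] by (simp add: inner_commute)
  have sect: "continuous_on UNIV (\<lambda>\<xi>. F \<xi> s)" if "s \<in> I" for s
  proof -
    have "continuous_on UNIV (\<lambda>\<xi>. (\<lambda>z. F (fst z) (snd z)) (\<xi>, s))"
      by (rule continuous_on_compose2[OF F_cont]) (use that in \<open>auto intro!: continuous_intros\<close>)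
    then show ?thesis by simp
  qed
  have fs_cont: "continuous_on UNIV (fs s)" if "s \<in> I" for s
  proof -
    have "fs s = (\<lambda>x. complex_of_real (f (point x s)))" using fs[OF that] by auto
    moreover have "continuous_on UNIV (\<lambda>x. f (point x s))"
      by (rule continuous_on_compose2[OF f_cont]) (use that in \<open>auto intro!: continuous_intros\<close>)
    ultimately show ?thesis by (simp add: continuous_on_of_real)
  qed
  have cD: "(2 * pi) ^ DIM(real^2) = c" by (simp add: c_def)
  have trunc:
    "(\<integral>\<^sup>+x. ennreal ((norm (fs s x))\<^sup>2) \<partial>lborel) = ennreal c * (\<integral>\<^sup>+\<xi>. ennreal ((norm (F \<xi> s))\<^sup>2) \<partial>lborel)"
    "(\<integral>\<^sup>+\<xi>. ennreal ((norm (complex_of_real c * F \<xi> s - (LINT x:cball 0 R|lborel. fs s x * cis (- (x \<bullet> \<xi>)))))\<^sup>2) \<partial>lborel)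
      = ennreal c * (\<integral>\<^sup>+x\<in>- cball 0 R. ennreal ((norm (fs s x))\<^sup>2) \<partial>lborel)" if "s \<in> I" for s R
    unfolding fs_def cD[symmetric]
    by (rule fourier_truncation_error[where C = C and B = B];
      use that sect bound supp fs_cont[unfolded fs_def] in blast)+
  have nrm: "ennreal ((f0 (point x s))\<^sup>2) = indicator I s * ennreal ((norm (fs s x))\<^sup>2)" for x s
    using fs[of s x] by (auto simp: f0_def indicator_def)
  have ball: "emeasure lborel (cball (0::real^2) B) < \<infinity>" by (rule emeasure_bounded_finite) simp
  have Ifin: "emeasure lborel I < \<infinity>" by (rule emeasure_bounded_finite[OF I(2)])
  have mass: "(\<integral>\<^sup>+z. ennreal ((f0 (point (fst z) (snd z)))\<^sup>2) \<partial>lborel) < \<infinity>"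
  proof -
    have "(\<integral>\<^sup>+z. ennreal ((f0 (point (fst z) (snd z)))\<^sup>2) \<partial>lborel) = (\<integral>\<^sup>+s. (\<integral>\<^sup>+x. ennreal ((f0 (point x s))\<^sup>2) \<partial>lborel) \<partial>lborel)"
      by (subst nn_integral_lborel_snd) simp_all
    also have "\<dots> \<le> (\<integral>\<^sup>+s. ennreal c * (ennreal (C\<^sup>2) * emeasure lborel (cball (0::real^2) B)) * indicator I s \<partial>lborel)"
    proof (rule nn_integral_mono)
      fix s :: real
      show "(\<integral>\<^sup>+x. ennreal ((f0 (point x s))\<^sup>2) \<partial>lborel) \<le> ennreal c * (ennreal (C\<^sup>2) * emeasure lborel (cball (0::real^2) B)) * indicator I s"
      proof (cases "s \<in> I")
        case True
        have "(\<integral>\<^sup>+x. ennreal ((f0 (point x s))\<^sup>2) \<partial>lborel) = ennreal c * (\<integral>\<^sup>+\<xi>. ennreal ((norm (F \<xi> s))\<^sup>2) \<partial>lborel)"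
          unfolding nrm using trunc(1)[OF True] True by simp
        also have "(\<integral>\<^sup>+\<xi>. ennreal ((norm (F \<xi> s))\<^sup>2) \<partial>lborel) \<le> (\<integral>\<^sup>+\<xi>. ennreal (C\<^sup>2) * indicator (cball (0::real^2) B) \<xi> \<partial>lborel)"
          using bound[OF True] supp[OF True] C[OF True]
          by (intro nn_integral_mono) (auto simp: indicator_def intro!: ennreal_leI power_mono)
        also have "\<dots> = ennreal (C\<^sup>2) * emeasure lborel (cball (0::real^2) B)"
          by (simp add: nn_integral_cmult_indicator)
        finally show ?thesis using True by (simp add: mult_left_mono)
      qed (simp add: nrm)
    qed
    also have "\<dots> = ennreal c * (ennreal (C\<^sup>2) * emeasure lborel (cball (0::real^2) B)) * emeasure lborel I"
      using I(1) by (simp add: nn_integral_cmult_indicator)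
    also have "\<dots> < \<infinity>" using ball Ifin by (simp add: ennreal_mult_less_top)
    finally show ?thesis .
  qed
  show "L2_slab I f"
    unfolding L2_slab_def
  proof
    show "set_borel_measurable borel (slab I) f" using f0_meas by (simp add: set_borel_measurable_def f0_def)
    have "(\<integral>\<^sup>+x\<in>slab I. ennreal ((f x)\<^sup>2) \<partial>lborel) = (\<integral>\<^sup>+x. ennreal ((f0 x)\<^sup>2) \<partial>lborel)"
      by (intro nn_integral_cong) (auto simp: f0_def indicator_def)
    also have "\<dots> = (\<integral>\<^sup>+z. ennreal ((f0 (point (fst z) (snd z)))\<^sup>2) \<partial>lborel)"
      by (rule nn_integral_point) simp
    finally show "(\<integral>\<^sup>+x\<in>slab I. ennreal ((f x)\<^sup>2) \<partial>lborel) < \<infinity>" using mass by simp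
  qed
  show "is_horizontal_ft I f (\<lambda>\<xi> s. indicator I s *\<^sub>R (complex_of_real ((2 * pi)\<^sup>2) * F \<xi> s))"
    unfolding is_horizontal_ft_def
  proof
    have "(\<lambda>z. complex_of_real c * F0 (fst z) (snd z)) \<in> borel_measurable borel" by measurable
    then show "(\<lambda>z. indicator I (snd z) *\<^sub>R (complex_of_real ((2 * pi)\<^sup>2) * F (fst z) (snd z))) \<in> borel_measurable borel"
      by (simp add: F0_def c_def mult.commute)
    \<comment> \<open>Exact for every radius: the error of the truncated transform is a multiple of
      the mass of \<open>f\<close> over horizontal distances larger than \<open>R\<close>.\<close>
    have err: "(\<integral>\<^sup>+z\<in>UNIV \<times> I. ennreal ((cmod (indicator I (snd z) *\<^sub>R (complex_of_real ((2 * pi)\<^sup>2) * F (fst z) (snd z))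
          - truncated_ft R f (fst z) (snd z)))\<^sup>2) \<partial>lborel)
       = ennreal c * (\<integral>\<^sup>+z. ennreal ((f0 (point (fst z) (snd z)))\<^sup>2) * indicator (- cball 0 R) (fst z) \<partial>lborel)" for R
    proof -
      have tf: "truncated_ft R f \<xi> s = truncated_ft R f0 \<xi> s" if "s \<in> I" for \<xi> s
        using that by (simp add: truncated_ft_def f0_def)
      note [measurable] = borel_measurable_truncated_ft[OF f0_meas]
      define E where "E = (\<lambda>z. ennreal ((cmod (complex_of_real c * F0 (fst z) (snd z) - truncated_ft R f0 (fst z) (snd z)))\<^sup>2))"
      define N where "N = (\<lambda>z::(real^2) \<times> real. ennreal ((f0 (point (fst z) (snd z)))\<^sup>2) * indicator (- cball 0 R) (fst z))"
      have E_meas: "E \<in> borel_measurable borel" unfolding E_def by measurable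
      have N_meas: "N \<in> borel_measurable borel"
        unfolding N_def
        by (rule borel_measurable_times_ennreal[OF _ borel_measurable_indicator_fst]) simp_all
      have e1: "(\<integral>\<^sup>+z\<in>UNIV \<times> I. ennreal ((cmod (indicator I (snd z) *\<^sub>R (complex_of_real ((2 * pi)\<^sup>2) * F (fst z) (snd z))
          - truncated_ft R f (fst z) (snd z)))\<^sup>2) \<partial>lborel)
        = (\<integral>\<^sup>+z. E z * indicator I (snd z) \<partial>lborel)"
      proof (rule nn_integral_cong)
        fix z :: "(real^2) \<times> real"
        show "ennreal ((cmod (indicator I (snd z) *\<^sub>R (complex_of_real ((2 * pi)\<^sup>2) * F (fst z) (snd z))
          - truncated_ft R f (fst z) (snd z)))\<^sup>2) * indicator (UNIV \<times> I) z = E z * indicator I (snd z)"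
        proof (cases "snd z \<in> I")
          case True
          have "E z = ennreal ((cmod (indicator I (snd z) *\<^sub>R (complex_of_real ((2 * pi)\<^sup>2) * F (fst z) (snd z))
            - truncated_ft R f (fst z) (snd z)))\<^sup>2)"
            unfolding E_def F0_def c_def tf[OF True] using True by simp
          then show ?thesis using True by (simp add: mem_Times_iff)
        qed (simp add: mem_Times_iff)
      qed
      have e2: "(\<integral>\<^sup>+z. E z * indicator I (snd z) \<partial>lborel) = (\<integral>\<^sup>+s. (\<integral>\<^sup>+\<xi>. E (\<xi>, s) * indicator I s \<partial>lborel) \<partial>lborel)"
        using nn_integral_lborel_snd[OF borel_measurable_times_ennreal[OF E_meas borel_measurable_indicator_snd[OF borel_open[OF I(1)]]]]
        by simp
      have e3: "(\<integral>\<^sup>+\<xi>. E (\<xi>, s) * indicator I s \<partial>lborel) = ennreal c * (\<integral>\<^sup>+x. N (x, s) \<partial>lborel)" for s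
      proof (cases "s \<in> I")
        case True
        have t: "truncated_ft R f0 \<xi> s = (LINT x:cball 0 R|lborel. fs s x * cis (- (x \<bullet> \<xi>)))" for \<xi>
          unfolding tf[OF True, symmetric] unfolding truncated_ft_def fs[OF True] ..
        have 1: "E (\<xi>, s) = ennreal ((norm (complex_of_real c * F \<xi> s - (LINT x:cball 0 R|lborel. fs s x * cis (- (x \<bullet> \<xi>)))))\<^sup>2)" for \<xi>
          unfolding E_def F0_def fst_conv snd_conv t using True by simp
        have 2: "N (x, s) = ennreal ((norm (fs s x))\<^sup>2) * indicator (- cball 0 R) x" for x
          unfolding N_def fst_conv snd_conv nrm using True by simp
        show ?thesis unfolding 1 2 using trunc(2)[OF True, of R] True by simp
      qed (simp add: nrm N_def)
      have e4: "(\<integral>\<^sup>+s. ennreal c * (\<integral>\<^sup>+x. N (x, s) \<partial>lborel) \<partial>lborel) = ennreal c * (\<integral>\<^sup>+z. N z \<partial>lborel)"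
      proof -
        have "(\<lambda>s. \<integral>\<^sup>+x. N (x, s) \<partial>lborel) \<in> borel_measurable lborel"
        proof (intro lborel.borel_measurable_nn_integral)
          have "(\<lambda>w::real \<times> (real^2). N (snd w, fst w)) \<in> borel_measurable borel"
            by (rule measurable_compose[OF borel_measurable_continuous_onI N_meas]) (intro continuous_intros)
          then show "(\<lambda>(s, x). N (x, s)) \<in> borel_measurable (lborel \<Otimes>\<^sub>M lborel)"
            by (simp add: lborel_prod case_prod_unfold)
        qed
        then show ?thesis
          by (simp only: nn_integral_cmult nn_integral_lborel_snd[OF N_meas])
      qed
      show ?thesis unfolding e1 e2 e3 e4 unfolding N_def ..
    qed
    show "((\<lambda>R. \<integral>\<^sup>+z\<in>UNIV \<times> I. ennreal ((cmod (indicator I (snd z) *\<^sub>R (complex_of_real ((2 * pi)\<^sup>2) * F (fst z) (snd z))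
          - truncated_ft R f (fst z) (snd z)))\<^sup>2) \<partial>lborel) \<longlongrightarrow> 0) at_top"
      unfolding err
    proof (rule tendsto_at_topI_sequentially)
      fix X :: "nat \<Rightarrow> real" assume X: "filterlim X at_top sequentially"
      define w where "w = (\<lambda>z::(real^2) \<times> real. ennreal ((f0 (point (fst z) (snd z)))\<^sup>2))"
      define v where "v = (\<lambda>n (z::(real^2) \<times> real). w z * indicator (- cball 0 (X n)) (fst z))"
      have w_meas: "w \<in> borel_measurable lborel" unfolding w_def by simp
      have v_meas: "v n \<in> borel_measurable lborel" for n
        unfolding v_def measurable_lborel2
        by (rule borel_measurable_times_ennreal[OF w_meas[unfolded measurable_lborel2] borel_measurable_indicator_fst]) simp
      have "v n z \<le> w z" for n z
        by (cases "fst z \<in> - cball 0 (X n)") (simp_all add: v_def)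
      then have v_le: "AE z in lborel. v n z \<le> w z" for n by simp
      have "(\<lambda>n. v n z) \<longlonglongrightarrow> 0" for z
      proof -
        have "\<forall>\<^sub>F n in sequentially. norm (fst z) \<le> X n" using X by (auto simp: filterlim_at_top)
        then have "\<forall>\<^sub>F n in sequentially. v n z = 0"
          by eventually_elim (simp add: v_def)
        then show ?thesis by (rule tendsto_eventually)
      qed
      then have v_lim: "AE z in lborel. (\<lambda>n. v n z) \<longlonglongrightarrow> 0" by simp
      have "(\<integral>\<^sup>+z. w z \<partial>lborel) < \<infinity>" using mass by (simp add: w_def)
      with nn_integral_dominated_convergence[OF v_meas _ w_meas v_le _ v_lim]
      have "(\<lambda>n. \<integral>\<^sup>+z. v n z \<partial>lborel) \<longlonglongrightarrow> 0" by simp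
      from ennreal_tendsto_cmult[OF _ this, of "ennreal c"]
      have "(\<lambda>n. ennreal c * (\<integral>\<^sup>+z. v n z \<partial>lborel)) \<longlonglongrightarrow> 0" by simp
      then show "(\<lambda>n. ennreal c * (\<integral>\<^sup>+z. ennreal ((f0 (point (fst z) (snd z)))\<^sup>2) * indicator (- cball 0 (X n)) (fst z) \<partial>lborel)) \<longlonglongrightarrow> 0"
        unfolding v_def w_def .
    qed
  qed
qed

section \<open>Piecewise Sobolev norms of synthesised functions\<close>

text \<open>The fundamental lemma of the calculus of variations. Bumps converge boundedly to
  indicators of intervals, intervals inside a compact interval yield its intersections with rays,
  and countably many compact intervals exhaust the open one.\<close>

lemma AE_zero_if_weakly_zero:
  fixes u :: "real \<Rightarrow> real"
  assumes loc: "\<And>K. compact K \<Longrightarrow> K \<subseteq> {a0<..<b0} \<Longrightarrow> set_integrable lborel K u"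
    and 0: "\<And>\<phi>. test_function {a0<..<b0} \<phi> \<Longrightarrow> (LINT s:{a0<..<b0}|lborel. u s * \<phi> s) = 0"
  shows "AE s in lborel. s \<in> {a0<..<b0} \<longrightarrow> u s = 0"
proof -
  have interval: "(LINT s|lborel. indicator {a<..<b} s * (indicator {a..b} s * u s)) = 0"
    if ab: "{a..b} \<subseteq> {a0<..<b0}" for a b
  proof -
    have int: "integrable lborel (\<lambda>s. indicator {a..b} s * u s)"
      using loc[OF _ ab] by (simp add: set_integrable_def)
    have "(\<lambda>N. LINT s|lborel. bump a b N s * (indicator {a..b} s * u s))
       \<longlonglongrightarrow> (LINT s|lborel. indicator {a<..<b} s * (indicator {a..b} s * u s))"
    proof (rule integral_dominated_convergence[OF _ _ integrable_norm[OF int]])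
      have [measurable]: "(\<lambda>s. indicator {a..b} s * u s) \<in> borel_measurable borel" using int by auto
      have [measurable]: "bump a b N \<in> borel_measurable borel" for N
        using test_function_bump[OF ab, of N]
        by (auto simp: test_function_def intro!: borel_measurable_continuous_onI smooth_on_imp_continuous_on)
      show "(\<lambda>s. bump a b N s * (indicator {a..b} s * u s)) \<in> borel_measurable lborel" for N by measurable
      have "(\<lambda>s. indicator {a<..<b} s * (indicator {a..b} s * u s)) \<in> borel_measurable borel" by measurable
      then show "(\<lambda>s. indicator {a<..<b} s * (indicator {a..b} s * u s)) \<in> borel_measurable lborel" by simp
      show "AE s in lborel. (\<lambda>N. bump a b N s * (indicator {a..b} s * u s)) \<longlonglongrightarrow> indicator {a<..<b} s * (indicator {a..b} s * u s)"
        by (intro AE_I2 tendsto_intros bump_tendsto)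
      show "AE s in lborel. norm (bump a b N s * (indicator {a..b} s * u s)) \<le> norm (indicator {a..b} s * u s)" for N
      proof (rule AE_I2)
        fix s
        show "norm (bump a b N s * (indicator {a..b} s * u s)) \<le> norm (indicator {a..b} s * u s)"
          using mult_right_mono[OF bump_le_1[of a b N s] norm_ge_zero[of "indicator {a..b} s * u s"]]
          by (simp only: norm_mult mult_1)
      qed
    qed
    moreover have "(LINT s|lborel. bump a b N s * (indicator {a..b} s * u s)) = 0" for N
    proof -
      have eq: "bump a b N s * (indicator {a..b} s * u s) = indicator {a0<..<b0} s *\<^sub>R (u s * bump a b N s)" for s
      proof (cases "s \<in> {a..b}")
        case True
        then show ?thesis using subsetD[OF ab True] by simp
      next
        case False
        then have "bump a b N s = 0" by (auto simp: bump_def flat_exp_def zero_less_mult_iff)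
        then show ?thesis by simp
      qed
      show ?thesis unfolding eq using 0[OF test_function_bump[OF ab, of N]] by (simp only: set_lebesgue_integral_def)
    qed
    ultimately show ?thesis by (simp add: LIMSEQ_const_iff)
  qed
  have piece: "AE s in lborel. s \<in> {a..b} \<longrightarrow> u s = 0" if ab: "{a..b} \<subseteq> {a0<..<b0}" for a b
  proof -
    have int: "integrable lborel (\<lambda>s. indicator {a..b} s * u s)"
      using loc[OF _ ab] by (simp add: set_integrable_def)
    have "AE s in lborel. indicator {a..b} s * u s = 0"
    proof (rule AE_zero_if_integral_lessThan_zero[OF int])
      fix x
      \<comment> \<open>Cutting the interval from \<open>a\<close> to \<open>b\<close> by the ray
        beyond \<open>x\<close> leaves another interval, up to the null set of its
        endpoints.\<close>
      define a' where "a' = max a x"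
      have "(LINT s|lborel. indicator {x<..} s * (indicator {a..b} s * u s)) = (LINT s|lborel. indicator {a'<..<b} s * (indicator {a'..b} s * u s))"
      proof (rule integral_cong_AE)
        have [measurable]: "(\<lambda>s. indicator {a..b} s * u s) \<in> borel_measurable borel" using int by auto
        have "(\<lambda>s. indicator {x<..} s * (indicator {a..b} s * u s)) \<in> borel_measurable borel" by measurable
        then show "(\<lambda>s. indicator {x<..} s * (indicator {a..b} s * u s)) \<in> borel_measurable lborel" by simp
        have "integrable lborel (\<lambda>s. indicator {a'..b} s * u s)"
          using loc[of "{a'..b}"] ab by (auto simp: set_integrable_def a'_def subset_eq)
        then have [measurable]: "(\<lambda>s. indicator {a'..b} s * u s) \<in> borel_measurable borel" by auto
        have "(\<lambda>s. indicator {a'<..<b} s * (indicator {a'..b} s * u s)) \<in> borel_measurable borel" by measurable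
        then show "(\<lambda>s. indicator {a'<..<b} s * (indicator {a'..b} s * u s)) \<in> borel_measurable lborel" by simp
        show "AE s in lborel. indicator {x<..} s * (indicator {a..b} s * u s) = indicator {a'<..<b} s * (indicator {a'..b} s * u s)"
          using AE_lborel_singleton[of a] AE_lborel_singleton[of b]
          by eventually_elim (auto simp: indicator_def a'_def)
      qed
      also have "\<dots> = 0" using ab by (intro interval) (auto simp: a'_def)
      finally show "(LINT s|lborel. indicator {x<..} s * (indicator {a..b} s * u s)) = 0" .
    qed
    then show ?thesis by eventually_elim (simp add: indicator_def)
  qed
  \<comment> \<open>A countable family of compact intervals is needed here, so that the exceptional
    null sets can be united.\<close>
  have "AE s in lborel. \<forall>n::nat. s \<in> {a0 + 1 / real (Suc n)..b0 - 1 / real (Suc n)} \<longrightarrow> u s = 0"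
    unfolding AE_all_countable
  proof (intro allI piece subsetI)
    fix n :: nat and x assume "x \<in> {a0 + 1 / real (Suc n)..b0 - 1 / real (Suc n)}"
    moreover have "1 / real (Suc n) > 0" by simp
    ultimately show "x \<in> {a0<..<b0}" unfolding atLeastAtMost_iff greaterThanLessThan_iff by linarith
  qed
  then show ?thesis
  proof eventually_elim
    case (elim s)
    show ?case
    proof
      assume s: "s \<in> {a0<..<b0}"
      then obtain n where "inverse (real (Suc n)) < min (s - a0) (b0 - s)"
        using reals_Archimedean[of "min (s - a0) (b0 - s)"] by auto
      then show "u s = 0" using elim[rule_format, of n] by (auto simp: inverse_eq_divide)
    qed
  qed
qed

text \<open>Makes the choice in \<open>weak_deriv\<close> harmless. The difference of two candidates
  vanishes against every test function, and its real and imaginary parts fall under the fundamental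
  lemma.\<close>

lemma weak_deriv_unique:
  assumes "is_weak_deriv {a0<..<b0} j u h1" "is_weak_deriv {a0<..<b0} j u h2"
  shows "AE s in lborel. s \<in> {a0<..<b0} \<longrightarrow> h1 s = h2 s"
proof -
  let ?I = "{a0<..<b0}"
  have loc: "set_integrable lborel K (\<lambda>s. h1 s - h2 s)" if "compact K" "K \<subseteq> ?I" for K
    using assms that by (auto simp: is_weak_deriv_def locally_integrable_def intro!: set_integral_diff)
  have cont: "continuous_on UNIV \<phi>" if "test_function ?I \<phi>" for \<phi>
    using that smooth_on_imp_continuous_on by (auto simp: test_function_def)
  have intI: "set_integrable lborel ?I (\<lambda>s. h s * complex_of_real (\<phi> s))"
    if t: "test_function ?I \<phi>" and h: "locally_integrable ?I h" for h \<phi>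
  proof -
    obtain K where K: "compact K" "K \<subseteq> ?I" "\<And>s. s \<notin> K \<Longrightarrow> \<phi> s = 0" using t by (auto simp: test_function_def)
    then have hK: "integrable lborel (\<lambda>s. indicator K s *\<^sub>R h s)" using h by (auto simp: locally_integrable_def set_integrable_def)
    have "compact (\<phi> ` K)" using K(1) cont[OF t] by (metis compact_continuous_image continuous_on_subset subset_UNIV)
    then obtain B where B: "\<And>s. s \<in> K \<Longrightarrow> norm (\<phi> s) \<le> B" by (metis bounded_iff compact_imp_bounded imageI)
    have [measurable]: "\<phi> \<in> borel_measurable borel" using cont[OF t] by (rule borel_measurable_continuous_onI)
    have "integrable lborel (\<lambda>s. (indicator K s *\<^sub>R h s) * complex_of_real (\<phi> s))"
    proof (rule Bochner_Integration.integrable_bound[OF integrable_mult_left[OF hK, of "complex_of_real B"]])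
      have [measurable]: "(\<lambda>s. indicator K s *\<^sub>R h s) \<in> borel_measurable borel" using hK by auto
      have "(\<lambda>s. (indicator K s *\<^sub>R h s) * complex_of_real (\<phi> s)) \<in> borel_measurable borel" by measurable
      then show "(\<lambda>s. (indicator K s *\<^sub>R h s) * complex_of_real (\<phi> s)) \<in> borel_measurable lborel" by simp
      show "AE s in lborel. norm ((indicator K s *\<^sub>R h s) * complex_of_real (\<phi> s)) \<le> norm ((indicator K s *\<^sub>R h s) * complex_of_real B)"
        using B by (intro AE_I2) (force simp: norm_mult indicator_def intro!: mult_left_mono)
    qed
    moreover have eq: "(indicator K s *\<^sub>R h s) * complex_of_real (\<phi> s) = indicator ?I s *\<^sub>R (h s * complex_of_real (\<phi> s))" for s
      using K by (auto simp: indicator_def)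
    ultimately show ?thesis unfolding set_integrable_def eq[symmetric] by simp
  qed
  have zero: "(LINT s:?I|lborel. (h1 s - h2 s) * complex_of_real (\<phi> s)) = 0" if t: "test_function ?I \<phi>" for \<phi>
  proof -
    have "(-1) ^ j * (LINT s:?I|lborel. h1 s * complex_of_real (\<phi> s)) = (-1) ^ j * (LINT s:?I|lborel. h2 s * complex_of_real (\<phi> s))"
    proof -
      have "(LINT s:?I|lborel. u s * complex_of_real ((deriv ^^ j) \<phi> s)) = (-1) ^ j * (LINT s:?I|lborel. h1 s * complex_of_real (\<phi> s))"
        and "(LINT s:?I|lborel. u s * complex_of_real ((deriv ^^ j) \<phi> s)) = (-1) ^ j * (LINT s:?I|lborel. h2 s * complex_of_real (\<phi> s))"
        using assms t unfolding is_weak_deriv_def by blast+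
      then show ?thesis by (rule trans[OF sym])
    qed
    then have "(LINT s:?I|lborel. h1 s * complex_of_real (\<phi> s)) = (LINT s:?I|lborel. h2 s * complex_of_real (\<phi> s))"
      by simp
    then show ?thesis
      using intI[OF t, of h1] intI[OF t, of h2] assms
      by (simp add: left_diff_distrib is_weak_deriv_def set_integral_diff(2))
  qed
  have int: "set_integrable lborel ?I (\<lambda>s. (h1 s - h2 s) * complex_of_real (\<phi> s))" if t: "test_function ?I \<phi>" for \<phi>
    using intI[OF t, of h1] intI[OF t, of h2] assms
    by (simp add: left_diff_distrib is_weak_deriv_def set_integral_diff(1))
  have part: "AE s in lborel. s \<in> ?I \<longrightarrow> p (h1 s - h2 s) = 0"
    if p: "p = Re \<or> p = Im" for p :: "complex \<Rightarrow> real"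
  proof (rule AE_zero_if_weakly_zero)
    have bl: "bounded_linear p" using p by (auto intro: bounded_linear_Re bounded_linear_Im)
    show "set_integrable lborel K (\<lambda>s. p (h1 s - h2 s))" if "compact K" "K \<subseteq> ?I" for K
      using integrable_bounded_linear[OF bl loc[OF that, unfolded set_integrable_def]] p
      by (auto simp: set_integrable_def)
    fix \<phi> assume t: "test_function ?I \<phi>"
    have "(LINT s:?I|lborel. p (h1 s - h2 s) * \<phi> s) = p (LINT s:?I|lborel. (h1 s - h2 s) * complex_of_real (\<phi> s))"
      unfolding set_lebesgue_integral_def
      using integral_bounded_linear[OF bl int[OF t, unfolded set_integrable_def]] p by auto
    then show "(LINT s:?I|lborel. p (h1 s - h2 s) * \<phi> s) = 0"
      unfolding zero[OF t] using p by auto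
  qed
  from part[of Re] part[of Im] have "AE s in lborel. s \<in> ?I \<longrightarrow> Re (h1 s - h2 s) = 0" "AE s in lborel. s \<in> ?I \<longrightarrow> Im (h1 s - h2 s) = 0"
    by auto
  then show ?thesis by eventually_elim (auto simp: complex_eq_iff)
qed

lemma test_function_deriv:
  assumes "test_function I \<phi>"
  shows "test_function I (deriv \<phi>)"
proof -
  obtain K where K: "compact K" "K \<subseteq> I" "\<And>s. s \<notin> K \<Longrightarrow> \<phi> s = 0" using assms by (auto simp: test_function_def)
  have "deriv \<phi> s = 0" if "s \<notin> K" for s
  proof -
    have "\<forall>\<^sub>F y in nhds s. \<phi> y = 0"
      using eventually_nhds_in_open[OF open_Compl[OF compact_imp_closed[OF K(1)]], of s] that
      by (auto elim!: eventually_mono intro: K(3))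
    then have "deriv \<phi> s = deriv (\<lambda>_. 0) s" by (intro deriv_cong_ev) auto
    then show ?thesis by simp
  qed
  then show ?thesis using assms K by (auto simp: test_function_def smooth_on_deriv)
qed

lemma locally_integrable_continuous:
  assumes "continuous_on I (u :: real \<Rightarrow> complex)"
  shows "locally_integrable I u"
  unfolding locally_integrable_def set_integrable_def
proof (intro allI impI)
  fix K assume "compact K \<and> K \<subseteq> I"
  then show "integrable lborel (\<lambda>s. indicator K s *\<^sub>R u s)"
    using continuous_on_subset[OF assms] by (intro borel_integrable_compact) auto
qed

lemma integral_by_parts_test:
  fixes u u' :: "real \<Rightarrow> complex"
  assumes t: "test_function {a0<..<b0} \<phi>"
    and u: "\<And>s. s \<in> {a0<..<b0} \<Longrightarrow> (u has_vector_derivative u' s) (at s)"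
    and u': "continuous_on {a0<..<b0} u'"
  shows "(LINT s:{a0<..<b0}|lborel. u s * complex_of_real (deriv \<phi> s)) = - (LINT s:{a0<..<b0}|lborel. u' s * complex_of_real (\<phi> s))"
proof -
  let ?I = "{a0<..<b0}"
  obtain K where K: "compact K" "K \<subseteq> ?I" "\<And>s. s \<notin> K \<Longrightarrow> \<phi> s = 0" using t by (auto simp: test_function_def)
  obtain K' where K': "compact K'" "K' \<subseteq> ?I" "\<And>s. s \<notin> K' \<Longrightarrow> deriv \<phi> s = 0"
    using test_function_deriv[OF t] by (auto simp: test_function_def)
  show ?thesis
  proof (cases "a0 < b0")
    case False
    then show ?thesis by (simp add: set_lebesgue_integral_def)
  next
    case True
    \<comment> \<open>\<open>u\<close> need not extend to the endpoints, so the fundamental theorem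
      is applied on a compact subinterval that contains the supports of \<phi> and of its derivative
      in its interior. If both supports are empty, any subinterval will do.\<close>
    obtain a b where ab: "a0 < a" "a < b" "b < b0" "K \<union> K' \<subseteq> {a<..<b}"
    proof (cases "K \<union> K' = {}")
      case True
      obtain a where "a0 < a" "a < b0" using dense[OF \<open>a0 < b0\<close>] by auto
      moreover obtain b where "a < b" "b < b0" using dense[OF \<open>a < b0\<close>] by auto
      ultimately show ?thesis using that True by auto
    next
      case False
      have c: "compact (K \<union> K')" using K K' by (intro compact_Un)
      obtain x where x: "x \<in> K \<union> K'" "\<And>y. y \<in> K \<union> K' \<Longrightarrow> x \<le> y"
        using compact_attains_inf[OF c False] by auto
      obtain y where y: "y \<in> K \<union> K'" "\<And>z. z \<in> K \<union> K' \<Longrightarrow> z \<le> y"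
        using compact_attains_sup[OF c False] by auto
      have "a0 < x" "y < b0" "x \<le> y" using x y K(2) K'(2) by auto
      then obtain a b where "a0 < a" "a < x" "y < b" "b < b0" using dense by meson
      then show ?thesis using that[of a b] x y \<open>x \<le> y\<close> by force
    qed
    have sub: "{a..b} \<subseteq> ?I" using ab by auto
    have \<phi>D: "(\<phi> has_real_derivative deriv \<phi> s) (at s)" for s
      using t by (auto simp: test_function_def intro: smooth_on_DERIV)
    have \<phi>c: "continuous_on UNIV \<phi>" "continuous_on UNIV (deriv \<phi>)"
      using t by (auto simp: test_function_def intro!: smooth_on_imp_continuous_on)
    have uc: "continuous_on ?I u"
      using u by (meson continuous_at_imp_continuous_on has_vector_derivative_continuous)
    have c1: "continuous_on {a..b} (\<lambda>s. u s * complex_of_real (deriv \<phi> s))"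
      and c2: "continuous_on {a..b} (\<lambda>s. u' s * complex_of_real (\<phi> s))"
      using sub \<phi>c uc u' by (auto intro!: continuous_intros intro: continuous_on_subset)
    have "(LINT s|lborel. indicator {a..b} s *\<^sub>R (u s * complex_of_real (deriv \<phi> s) + u' s * complex_of_real (\<phi> s)))
      = u b * complex_of_real (\<phi> b) - u a * complex_of_real (\<phi> a)"
    proof (rule integral_FTC_atLeastAtMost)
      fix s assume s: "a \<le> s" "s \<le> b"
      have "((\<lambda>s. u s * complex_of_real (\<phi> s)) has_vector_derivative (u s * complex_of_real (deriv \<phi> s) + u' s * complex_of_real (\<phi> s))) (at s)"
        by (intro has_vector_derivative_mult u has_vector_derivative_of_real)
          (use s sub \<phi>D in \<open>auto simp: has_real_derivative_iff_has_vector_derivative[symmetric]\<close>)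
      then show "((\<lambda>s. u s * complex_of_real (\<phi> s)) has_vector_derivative (u s * complex_of_real (deriv \<phi> s) + u' s * complex_of_real (\<phi> s))) (at s within {a..b})"
        by (rule has_vector_derivative_at_within)
    qed (use ab c1 c2 in \<open>auto intro!: continuous_intros\<close>)
    also have "\<dots> = 0"
    proof -
      have "a \<notin> K" "b \<notin> K" using ab(4) by auto
      then show ?thesis by (simp add: K(3))
    qed
    finally have "(LINT s:{a..b}|lborel. u s * complex_of_real (deriv \<phi> s)) + (LINT s:{a..b}|lborel. u' s * complex_of_real (\<phi> s)) = 0"
      using borel_integrable_compact[OF compact_Icc c1] borel_integrable_compact[OF compact_Icc c2]
      by (simp add: set_lebesgue_integral_def scaleR_add_right)
    moreover have "(LINT s:{a..b}|lborel. u s * complex_of_real (deriv \<phi> s)) = (LINT s:?I|lborel. u s * complex_of_real (deriv \<phi> s))"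
      unfolding set_lebesgue_integral_def
      by (intro Bochner_Integration.integral_cong) (use ab K'(3) in \<open>auto simp: indicator_def\<close>, (metis greaterThanLessThan_iff le_supE less_imp_le subsetD)+)
    moreover have "(LINT s:{a..b}|lborel. u' s * complex_of_real (\<phi> s)) = (LINT s:?I|lborel. u' s * complex_of_real (\<phi> s))"
      unfolding set_lebesgue_integral_def
      by (intro Bochner_Integration.integral_cong) (use ab K(3) in \<open>auto simp: indicator_def\<close>, (metis greaterThanLessThan_iff le_supE less_imp_le subsetD)+)
    ultimately show ?thesis by (simp add: add_eq_0_iff)
  qed
qed

lemma is_weak_deriv_classical:
  fixes D :: "nat \<Rightarrow> real \<Rightarrow> complex"
  assumes D: "\<And>i s. s \<in> {a0<..<b0} \<Longrightarrow> (D i has_vector_derivative D (Suc i) s) (at s)"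
  shows "is_weak_deriv {a0<..<b0} j (D 0) (D j)"
proof -
  have c: "continuous_on {a0<..<b0} (D i)" for i
    using D by (meson continuous_at_imp_continuous_on has_vector_derivative_continuous)
  have "(LINT s:{a0<..<b0}|lborel. D 0 s * complex_of_real ((deriv ^^ j) \<phi> s)) = (-1) ^ j * (LINT s:{a0<..<b0}|lborel. D j s * complex_of_real (\<phi> s))"
    if "test_function {a0<..<b0} \<phi>" for \<phi>
    using that
  proof (induction j arbitrary: \<phi>)
    case (Suc j)
    have "(LINT s:{a0<..<b0}|lborel. D 0 s * complex_of_real ((deriv ^^ Suc j) \<phi> s)) = (-1) ^ j * (LINT s:{a0<..<b0}|lborel. D j s * complex_of_real (deriv \<phi> s))"
      using Suc.IH[OF test_function_deriv[OF Suc.prems]] by (simp add: funpow_Suc_right del: funpow.simps)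
    then show ?case
      using integral_by_parts_test[OF Suc.prems D c, of j] by simp
  qed simp
  then show ?thesis using c by (simp add: is_weak_deriv_def locally_integrable_continuous)
qed


text \<open>Moves weak derivatives from an explicit transform to the version picked by
  \<open>horizontal_ft\<close>, which agrees with it only almost everywhere on a slice.\<close>

lemma is_weak_deriv_cong_AE:
  assumes eq: "AE s in lborel. s \<in> I \<longrightarrow> u s = v s" and I: "open I"
    and u[measurable]: "u \<in> borel_measurable borel" and v[measurable]: "v \<in> borel_measurable borel"
    and w: "is_weak_deriv I j u h"
  shows "is_weak_deriv I j v h"
proof -
  have "set_integrable lborel K v" if K: "compact K" "K \<subseteq> I" for K
  proof -
    have K_b: "K \<in> sets borel" using K(1) by (simp add: borel_compact)
    have "integrable lborel (\<lambda>s. indicator K s *\<^sub>R u s)"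
      using w K by (auto simp: is_weak_deriv_def locally_integrable_def set_integrable_def)
    then show ?thesis
      unfolding set_integrable_def
      by (rule integrable_cong_AE_imp)
        (use K_b in measurable, use eq K(2) in \<open>auto simp: indicator_def elim!: eventually_mono\<close>)
  qed
  moreover have "(LINT s:I|lborel. v s * complex_of_real ((deriv ^^ j) \<phi> s)) = (LINT s:I|lborel. u s * complex_of_real ((deriv ^^ j) \<phi> s))"
    if t: "test_function I \<phi>" for \<phi>
    unfolding set_lebesgue_integral_def
  proof (rule integral_cong_AE)
    have "test_function I ((deriv ^^ j) \<phi>)" using t by (induction j) (auto intro: test_function_deriv)
    then have [measurable]: "(deriv ^^ j) \<phi> \<in> borel_measurable borel"
      by (auto simp: test_function_def intro!: borel_measurable_continuous_onI smooth_on_imp_continuous_on)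
    have [measurable]: "I \<in> sets borel" using I by simp
    have "(\<lambda>s. indicator I s *\<^sub>R (v s * complex_of_real ((deriv ^^ j) \<phi> s))) \<in> borel_measurable borel"
      "(\<lambda>s. indicator I s *\<^sub>R (u s * complex_of_real ((deriv ^^ j) \<phi> s))) \<in> borel_measurable borel"
      by measurable
    then show "(\<lambda>s. indicator I s *\<^sub>R (v s * complex_of_real ((deriv ^^ j) \<phi> s))) \<in> borel_measurable lborel"
      "(\<lambda>s. indicator I s *\<^sub>R (u s * complex_of_real ((deriv ^^ j) \<phi> s))) \<in> borel_measurable lborel"
      by simp_all
    show "AE s in lborel. indicator I s *\<^sub>R (v s * complex_of_real ((deriv ^^ j) \<phi> s)) = indicator I s *\<^sub>R (u s * complex_of_real ((deriv ^^ j) \<phi> s))"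
      using eq by eventually_elim (auto simp: indicator_def)
  qed
  ultimately show ?thesis using w by (simp add: is_weak_deriv_def locally_integrable_def)
qed

text \<open>Two mean square limits of the same truncated integrals coincide almost everywhere on the
  product, and Fubini turns this into a statement about almost every slice.\<close>

lemma horizontal_ft_unique:
  assumes L2: "L2_slab I f" and I: "open I"
    and F1: "is_horizontal_ft I f F1" and F2: "is_horizontal_ft I f F2"
  shows "AE \<xi> in lborel. AE s in lborel. s \<in> I \<longrightarrow> F1 \<xi> s = F2 \<xi> s"
proof -
  define f0 where "f0 = (\<lambda>x. indicator (slab I) x *\<^sub>R f x)"
  have f0: "f0 \<in> borel_measurable borel" using L2 by (simp add: L2_slab_def set_borel_measurable_def f0_def)
  have tf: "truncated_ft R f \<xi> s = truncated_ft R f0 \<xi> s" if "s \<in> I" for R \<xi> s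
    using that by (simp add: truncated_ft_def f0_def)
  define T where "T = (\<lambda>R z. truncated_ft R f0 (fst z) (snd z))"
  define d where "d = (\<lambda>F R (z::(real^2) \<times> real). ennreal ((cmod (F (fst z) (snd z) - T R z))\<^sup>2) * indicator I (snd z))"
  have [measurable]: "T R \<in> borel_measurable borel" for R
    unfolding T_def by (rule borel_measurable_truncated_ft[OF f0])
  have Fm [measurable]: "(\<lambda>z. F1 (fst z) (snd z)) \<in> borel_measurable borel" "(\<lambda>z. F2 (fst z) (snd z)) \<in> borel_measurable borel"
    using F1 F2 by (auto simp: is_horizontal_ft_def)
  have dm: "d F R \<in> borel_measurable borel" if [measurable]: "(\<lambda>z. F (fst z) (snd z)) \<in> borel_measurable borel" for F R
    unfolding d_def by (rule borel_measurable_times_ennreal[OF _ borel_measurable_indicator_snd[OF borel_open[OF I]]]) measurable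
  have lim: "((\<lambda>R. \<integral>\<^sup>+z. d F R z \<partial>lborel) \<longlongrightarrow> 0) at_top" if "is_horizontal_ft I f F" for F
  proof -
    have "d F R z = ennreal ((cmod (F (fst z) (snd z) - truncated_ft R f (fst z) (snd z)))\<^sup>2) * indicator (UNIV \<times> I) z" for R z
      by (cases "snd z \<in> I") (simp_all add: d_def T_def tf mem_Times_iff)
    then show ?thesis using that by (simp add: is_horizontal_ft_def)
  qed
  define e where "e = (\<lambda>z::(real^2) \<times> real. ennreal ((cmod (F1 (fst z) (snd z) - F2 (fst z) (snd z)))\<^sup>2) * indicator I (snd z))"
  have em: "e \<in> borel_measurable borel"
    unfolding e_def by (rule borel_measurable_times_ennreal[OF _ borel_measurable_indicator_snd[OF borel_open[OF I]]]) measurable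
  have le: "(\<integral>\<^sup>+z. e z \<partial>lborel) \<le> 2 * ((\<integral>\<^sup>+z. d F1 R z \<partial>lborel) + (\<integral>\<^sup>+z. d F2 R z \<partial>lborel))" for R
  proof -
    have "e z \<le> 2 * (d F1 R z + d F2 R z)" for z
    proof (cases "snd z \<in> I")
      case True
      have "(cmod (a - b))\<^sup>2 \<le> 2 * ((cmod (a - c))\<^sup>2 + (cmod (b - c))\<^sup>2)" for a b c :: complex
      proof -
        have "cmod (a - b) \<le> cmod (a - c) + cmod (b - c)" by (metis norm_minus_commute norm_triangle_sub dist_norm dist_triangle2)
        then have "(cmod (a - b))\<^sup>2 \<le> (cmod (a - c) + cmod (b - c))\<^sup>2" by (intro power_mono) auto
        also have "\<dots> \<le> 2 * ((cmod (a - c))\<^sup>2 + (cmod (b - c))\<^sup>2)"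
          using zero_le_power2[of "cmod (a - c) - cmod (b - c)"] by (simp add: power2_eq_square algebra_simps)
        finally show ?thesis .
      qed
      note tri = this
      have two: "ennreal (2 * (x + y)) = 2 * (ennreal x + ennreal y)" if "0 \<le> x" "0 \<le> y" for x y
        using that by (simp add: ennreal_mult')
      show ?thesis using True ennreal_leI[OF tri, of "F1 (fst z) (snd z)" "F2 (fst z) (snd z)" "T R z"]
        by (simp only: e_def d_def two zero_le_power2 indicator_simps mult_1_right)
    qed (simp add: e_def)
    then have "(\<integral>\<^sup>+z. e z \<partial>lborel) \<le> (\<integral>\<^sup>+z. 2 * (d F1 R z + d F2 R z) \<partial>lborel)"
      by (intro nn_integral_mono)
    also have "\<dots> = 2 * ((\<integral>\<^sup>+z. d F1 R z \<partial>lborel) + (\<integral>\<^sup>+z. d F2 R z \<partial>lborel))"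
      using dm[OF Fm(1), of R] dm[OF Fm(2), of R] by (simp add: nn_integral_cmult nn_integral_add)
    finally show ?thesis .
  qed
  have "((\<lambda>R. 2 * ((\<integral>\<^sup>+z. d F1 R z \<partial>lborel) + (\<integral>\<^sup>+z. d F2 R z \<partial>lborel))) \<longlongrightarrow> 2 * (0 + 0)) at_top"
    by (intro ennreal_tendsto_cmult tendsto_add lim F1 F2) simp
  then have "(\<integral>\<^sup>+z. e z \<partial>lborel) \<le> 2 * (0 + 0)"
  proof (rule tendsto_lowerbound)
    show "\<forall>\<^sub>F R in at_top. (\<integral>\<^sup>+z. e z \<partial>lborel) \<le> 2 * ((\<integral>\<^sup>+z. d F1 R z \<partial>lborel) + (\<integral>\<^sup>+z. d F2 R z \<partial>lborel))"
      by (rule always_eventually, rule allI, rule le)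
  qed simp
  then have "(\<integral>\<^sup>+z. e z \<partial>lborel) = 0" by simp
  then have "AE z in lborel. e z = 0" using em by (simp add: nn_integral_0_iff_AE)
  then have "AE z in lborel \<Otimes>\<^sub>M lborel. snd z \<in> I \<longrightarrow> F1 (fst z) (snd z) = F2 (fst z) (snd z)"
    unfolding lborel_prod by eventually_elim (auto simp: e_def indicator_def split: if_splits)
  from lborel_pair.AE_pair[OF this] show ?thesis by simp
qed

text \<open>Removes both choice operators from the norm: by the two uniqueness results, an explicit
  transform and its classical vertical derivatives may be inserted in their place.\<close>

theorem Hk_slab_characterisation:
  fixes D :: "real^2 \<Rightarrow> nat \<Rightarrow> real \<Rightarrow> complex"
  assumes L2: "L2_slab {a0<..<b0} f" and F: "is_horizontal_ft {a0<..<b0} f F"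
    and FD: "\<And>\<xi> s. s \<in> {a0<..<b0} \<Longrightarrow> F \<xi> s = D \<xi> 0 s"
    and D: "\<And>\<xi> i s. s \<in> {a0<..<b0} \<Longrightarrow> (D \<xi> i has_vector_derivative D \<xi> (Suc i) s) (at s)"
  shows "Hk_slab_sqnorm {a0<..<b0} k f = (\<Sum>j\<le>k. \<integral>\<^sup>+\<xi>. ennreal ((1 + (norm \<xi>)\<^sup>2) ^ (k - j)) *
        (\<integral>\<^sup>+s\<in>{a0<..<b0}. ennreal ((cmod (D \<xi> j s))\<^sup>2) \<partial>lborel) \<partial>lborel)" (is "_ = ?S")
    and "Hk_slab_sqnorm {a0<..<b0} k f < \<infinity> \<Longrightarrow> in_Hk_slab {a0<..<b0} k f"
proof -
  let ?I = "{a0<..<b0}"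
  define H where "H = horizontal_ft ?I f"
  have H: "is_horizontal_ft ?I f H" unfolding H_def horizontal_ft_def by (rule someI[of _ F]) (rule F)
  have Fs: "(\<lambda>s. F \<xi> s) \<in> borel_measurable borel" "(\<lambda>s. H \<xi> s) \<in> borel_measurable borel" for \<xi>
  proof -
    have p: "(\<lambda>s::real. (\<xi>, s)) \<in> borel_measurable borel" by (intro borel_measurable_continuous_onI continuous_intros)
    have "(\<lambda>z. F (fst z) (snd z)) \<in> borel_measurable borel" "(\<lambda>z. H (fst z) (snd z)) \<in> borel_measurable borel"
      using F H by (auto simp: is_horizontal_ft_def)
    from measurable_compose[OF p this(1)] measurable_compose[OF p this(2)]
    show "(\<lambda>s. F \<xi> s) \<in> borel_measurable borel" "(\<lambda>s. H \<xi> s) \<in> borel_measurable borel" by simp_all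
  qed
  have wF: "is_weak_deriv ?I j (F \<xi>) (D \<xi> j)" for \<xi> j
  proof -
    have "is_weak_deriv ?I j (D \<xi> 0) (D \<xi> j)" by (rule is_weak_deriv_classical[of _ _ "D \<xi>"]) (rule D)
    moreover have "locally_integrable ?I (F \<xi>)"
    proof (rule locally_integrable_continuous)
      have "continuous_on ?I (D \<xi> 0)"
        using D by (meson continuous_at_imp_continuous_on has_vector_derivative_continuous)
      then show "continuous_on ?I (F \<xi>)" by (rule continuous_on_eq) (simp add: FD)
    qed
    moreover have "(LINT s:?I|lborel. F \<xi> s * complex_of_real ((deriv ^^ j) \<phi> s)) = (LINT s:?I|lborel. D \<xi> 0 s * complex_of_real ((deriv ^^ j) \<phi> s))" for \<phi>
      unfolding set_lebesgue_integral_def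
      by (intro Bochner_Integration.integral_cong) (auto simp: indicator_def FD)
    ultimately show ?thesis by (simp add: is_weak_deriv_def)
  qed
  have HF: "AE \<xi> in lborel. AE s in lborel. s \<in> ?I \<longrightarrow> H \<xi> s = F \<xi> s"
    by (rule horizontal_ft_unique[OF L2 _ H F]) simp
  have wH: "AE \<xi> in lborel. \<forall>j. is_weak_deriv ?I j (H \<xi>) (D \<xi> j)"
    using HF
  proof eventually_elim
    case (elim \<xi>)
    then have "AE s in lborel. s \<in> ?I \<longrightarrow> F \<xi> s = H \<xi> s" by eventually_elim simp
    then show ?case by (intro allI is_weak_deriv_cong_AE[OF _ _ Fs wF]) simp_all
  qed
  have eq: "AE \<xi> in lborel. \<forall>j. (\<integral>\<^sup>+s\<in>?I. ennreal ((cmod (weak_deriv ?I j (H \<xi>) s))\<^sup>2) \<partial>lborel) = (\<integral>\<^sup>+s\<in>?I. ennreal ((cmod (D \<xi> j s))\<^sup>2) \<partial>lborel)"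
    using wH
  proof eventually_elim
    case (elim \<xi>)
    show ?case
    proof
      fix j
      have "is_weak_deriv ?I j (H \<xi>) (weak_deriv ?I j (H \<xi>))"
        unfolding weak_deriv_def[of ?I j] by (rule someI_ex[of "is_weak_deriv ?I j (H \<xi>)"]) (use elim in blast)
      from weak_deriv_unique[OF this elim[rule_format, of j]]
      show "(\<integral>\<^sup>+s\<in>?I. ennreal ((cmod (weak_deriv ?I j (H \<xi>) s))\<^sup>2) \<partial>lborel) = (\<integral>\<^sup>+s\<in>?I. ennreal ((cmod (D \<xi> j s))\<^sup>2) \<partial>lborel)"
        by (intro nn_integral_cong_AE) (auto simp: indicator_def elim!: eventually_mono)
    qed
  qed
  show n: "Hk_slab_sqnorm ?I k f = ?S"
    unfolding Hk_slab_sqnorm_def H_def[symmetric]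
  proof (intro sum.cong refl nn_integral_cong_AE)
    fix j
    show "AE \<xi> in lborel. ennreal ((1 + (norm \<xi>)\<^sup>2) ^ (k - j)) * (\<integral>\<^sup>+s\<in>?I. ennreal ((cmod (weak_deriv ?I j (H \<xi>) s))\<^sup>2) \<partial>lborel)
      = ennreal ((1 + (norm \<xi>)\<^sup>2) ^ (k - j)) * (\<integral>\<^sup>+s\<in>?I. ennreal ((cmod (D \<xi> j s))\<^sup>2) \<partial>lborel)"
      using eq by eventually_elim (simp only:)
  qed
  assume "Hk_slab_sqnorm ?I k f < \<infinity>"
  then show "in_Hk_slab ?I k f"
    unfolding in_Hk_slab_def H_def[symmetric] using L2 F wH by (auto elim!: eventually_mono)
qed

section \<open>Linear initial value problems with parameters\<close>

text \<open>Rescaling to a fixed interval moves the upper limit into the integrand, where continuity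
  of parametric integrals applies to it.\<close>

lemma integral_upper_scale:
  fixes g :: "real \<Rightarrow> 'a::banach"
  assumes "0 \<le> s" "continuous_on {0..s} g"
  shows "integral {0..s} g = s *\<^sub>R integral {0..1} (\<lambda>\<theta>. g (s * \<theta>))"
proof (cases "s = 0")
  case False
  then have s: "s > 0" using assms by auto
  have "(g has_integral integral {0..s} g) (cbox 0 s)"
    using integrable_continuous_real[OF assms(2)] by (simp add: cbox_interval integrable_integral)
  from has_integral_affinity[OF this, of s 0]
  have "((\<lambda>x. g (s * x)) has_integral (1 / s) *\<^sub>R integral {0..s} g) ((\<lambda>x. x / s) ` {0..s})"
    using s by (simp add: divide_inverse mult.commute)
  moreover have "(\<lambda>x. x / s) ` {0..s} = {0..1}"
    using s by (simp add: image_divide_atLeastAtMost)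
  ultimately show ?thesis using s by (simp add: integral_unique)
qed simp

lemma continuous_on_integral_upper:
  fixes g :: "'p::topological_space \<Rightarrow> real \<Rightarrow> 'a::banach"
  assumes "continuous_on (P \<times> {0..L}) (\<lambda>(p, s). g p s)"
  shows "continuous_on (P \<times> {0..L}) (\<lambda>(p, s). integral {0..s} (g p))"
proof -
  have sect: "continuous_on {0..s} (g p)" if "p \<in> P" "s \<in> {0..L}" for p s
  proof -
    have "continuous_on {0..s} ((\<lambda>(p, s). g p s) \<circ> (\<lambda>s. (p, s)))"
      by (rule continuous_on_compose[OF _ continuous_on_subset[OF assms]])
        (use that in \<open>auto intro!: continuous_intros\<close>)
    then show ?thesis by (simp add: o_def)
  qed
  have "continuous_on ((P \<times> {0..L}) \<times> cbox 0 (1::real)) ((\<lambda>(p, s). g p s) \<circ> (\<lambda>(z, \<theta>). (fst z, snd z * \<theta>)))"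
    by (rule continuous_on_compose[OF _ continuous_on_subset[OF assms]])
      (auto intro!: continuous_intros simp: case_prod_unfold mult_left_le order_trans[OF mult_left_le])
  then have "continuous_on (P \<times> {0..L}) (\<lambda>z. snd z *\<^sub>R integral (cbox 0 1) (\<lambda>\<theta>. g (fst z) (snd z * \<theta>)))"
    by (intro continuous_intros integral_continuous_on_param) (simp add: case_prod_unfold o_def)
  then show ?thesis
    by (rule continuous_on_eq)
      (use sect in \<open>auto simp: cbox_interval integral_upper_scale\<close>)
qed

primrec picard :: "(real \<Rightarrow> 'a::banach \<Rightarrow> 'a) \<Rightarrow> 'a \<Rightarrow> nat \<Rightarrow> real \<Rightarrow> 'a" where
  "picard f x0 0 s = x0"
| "picard f x0 (Suc n) s = x0 + integral {0..s} (\<lambda>r. f r (picard f x0 n r))"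

definition flow :: "(real \<Rightarrow> 'a::banach \<Rightarrow> 'a) \<Rightarrow> 'a \<Rightarrow> real \<Rightarrow> 'a" where
  "flow f x0 s = lim (\<lambda>n. picard f x0 n s)"

context
  fixes f :: "'p::topological_space \<Rightarrow> real \<Rightarrow> 'a::banach \<Rightarrow> 'a"
    and P :: "'p set" and L K M :: real and x0 :: 'a
  assumes cont: "continuous_on (P \<times> {0..L} \<times> UNIV) (\<lambda>(p, r, x). f p r x)"
    and lip: "\<And>p r x y. p \<in> P \<Longrightarrow> r \<in> {0..L} \<Longrightarrow> norm (f p r x - f p r y) \<le> K * norm (x - y)"
    and bnd: "\<And>p r. p \<in> P \<Longrightarrow> r \<in> {0..L} \<Longrightarrow> norm (f p r x0) \<le> M"
    and K: "0 \<le> K" and M: "0 \<le> M"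
begin

lemma continuous_on_rhs:
  assumes "continuous_on (P \<times> {0..L}) (\<lambda>(p, s). y p s)"
  shows "continuous_on (P \<times> {0..L}) (\<lambda>(p, s). f p s (y p s))"
proof -
  have "continuous_on (P \<times> {0..L}) ((\<lambda>(p, r, x). f p r x) \<circ> (\<lambda>z. (fst z, snd z, y (fst z) (snd z))))"
    by (rule continuous_on_compose[OF _ continuous_on_subset[OF cont]])
      (use assms in \<open>auto intro!: continuous_intros simp: case_prod_unfold\<close>)
  then show ?thesis by (simp add: o_def case_prod_unfold)
qed

lemma continuous_on_section:
  assumes "continuous_on (P \<times> {0..L}) (\<lambda>(p, s). y p s)" "p \<in> P" "s \<le> L"
  shows "continuous_on {0..s} (y p)"
proof -
  have "continuous_on {0..s} ((\<lambda>(p, s). y p s) \<circ> (\<lambda>s. (p, s)))"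
    by (rule continuous_on_compose[OF _ continuous_on_subset[OF assms(1)]])
      (use assms in \<open>auto intro!: continuous_intros\<close>)
  then show ?thesis by (simp add: o_def)
qed

lemma continuous_on_picard:
  "continuous_on (P \<times> {0..L}) (\<lambda>(p, s). picard (f p) x0 n s)"
proof (induction n)
  case 0
  then show ?case by (simp add: case_prod_unfold)
next
  case (Suc n)
  have "continuous_on (P \<times> {0..L}) (\<lambda>(p, s). integral {0..s} (\<lambda>r. f p r (picard (f p) x0 n r)))"
    by (rule continuous_on_integral_upper[OF continuous_on_rhs[OF Suc]])
  then show ?case by (simp add: case_prod_unfold continuous_on_add)
qed

lemma integrable_rhs:
  assumes "continuous_on (P \<times> {0..L}) (\<lambda>(p, s). y p s)" "p \<in> P" "s \<le> L"
  shows "(\<lambda>r. f p r (y p r)) integrable_on {0..s}"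
  using continuous_on_section[OF continuous_on_rhs[OF assms(1)] assms(2,3)]
  by (rule integrable_continuous_real)

lemma picard_increment:
  assumes "p \<in> P" "s \<in> {0..L}"
  shows "norm (picard (f p) x0 (Suc n) s - picard (f p) x0 n s) \<le> M * K ^ n * s ^ Suc n / fact (Suc n)"
  using assms(2)
proof (induction n arbitrary: s)
  case 0
  have "norm (integral {0..s} (\<lambda>r. f p r x0)) \<le> M * (s - 0)"
    by (rule integral_bound)
      (use 0 bnd[OF assms(1)] continuous_on_section[OF continuous_on_rhs[OF continuous_on_picard[of 0]] assms(1), of s]
       in auto)
  then show ?case by simp
next
  case (Suc n)
  have "norm (picard (f p) x0 (Suc (Suc n)) s - picard (f p) x0 (Suc n) s)
     = norm (integral {0..s} (\<lambda>r. f p r (picard (f p) x0 (Suc n) r) - f p r (picard (f p) x0 n r)))"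
    using Suc.prems
    by (subst integral_diff)
      (auto intro!: integrable_rhs[OF continuous_on_picard assms(1), simplified] integrable_rhs[OF continuous_on_picard[of "Suc n"] assms(1), simplified])
  also have "\<dots> \<le> integral {0..s} (\<lambda>r. K * (M * K ^ n * r ^ Suc n / fact (Suc n)))"
  proof (rule integral_norm_bound_integral)
    show "(\<lambda>r. f p r (picard (f p) x0 (Suc n) r) - f p r (picard (f p) x0 n r)) integrable_on {0..s}"
      using Suc.prems
      by (intro integrable_diff integrable_rhs[OF continuous_on_picard assms(1)]) auto
    show "(\<lambda>r. K * (M * K ^ n * r ^ Suc n / fact (Suc n))) integrable_on {0..s}"
      by (intro integrable_continuous_real continuous_intros) auto
    fix r assume r: "r \<in> {0..s}"
    then have "norm (f p r (picard (f p) x0 (Suc n) r) - f p r (picard (f p) x0 n r))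
      \<le> K * norm (picard (f p) x0 (Suc n) r - picard (f p) x0 n r)"
      using Suc.prems by (intro lip[OF assms(1)]) auto
    also have "\<dots> \<le> K * (M * K ^ n * r ^ Suc n / fact (Suc n))"
      using r Suc.prems K by (intro mult_left_mono Suc.IH) auto
    finally show "norm (f p r (picard (f p) x0 (Suc n) r) - f p r (picard (f p) x0 n r)) \<le> \<dots>" .
  qed
  also have "\<dots> = M * K ^ Suc n * s ^ Suc (Suc n) / fact (Suc (Suc n))"
  proof -
    have "((\<lambda>r. K * (M * K ^ n * r ^ Suc n / fact (Suc n))) has_integral
       M * K ^ Suc n * s ^ Suc (Suc n) / fact (Suc (Suc n)) - M * K ^ Suc n * 0 ^ Suc (Suc n) / fact (Suc (Suc n))) {0..s}"
    proof (rule fundamental_theorem_of_calculus)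
      fix x :: real
      have "((\<lambda>a. M * K ^ Suc n * a ^ Suc (Suc n) / fact (Suc (Suc n))) has_real_derivative
          M * K ^ Suc n * (real (Suc (Suc n)) * x ^ Suc n) / fact (Suc (Suc n))) (at x within {0..s})"
        by (rule derivative_eq_intros refl | simp)+
      moreover have "M * K ^ Suc n * (real (Suc (Suc n)) * x ^ Suc n) / fact (Suc (Suc n))
          = K * (M * K ^ n * x ^ Suc n / fact (Suc n))"
        by (subst fact_Suc[of "Suc n"]) (simp add: divide_simps del: fact_Suc of_nat_Suc)
      ultimately show "((\<lambda>a. M * K ^ Suc n * a ^ Suc (Suc n) / fact (Suc (Suc n))) has_vector_derivative
          K * (M * K ^ n * x ^ Suc n / fact (Suc n))) (at x within {0..s})"
        by (simp only: has_real_derivative_iff_has_vector_derivative)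
    qed (use Suc.prems in auto)
    from integral_unique[OF this] show ?thesis by (simp only:) simp
  qed
  finally show ?case .
qed

text \<open>The Lipschitz bound is global in the state, so the iteration converges on the whole
  interval: its increments are dominated by an exponential series that depends neither on the
  parameter nor on the time. The uniform limit inherits joint continuity, which is the purpose of
  carrying the parameter along.\<close>

lemma picard_uniform_limit:
  "uniform_limit (P \<times> {0..L}) (\<lambda>n (p, s). picard (f p) x0 n s) (\<lambda>(p, s). flow (f p) x0 s) sequentially"
proof -
  define d where "d = (\<lambda>n (p, s). picard (f p) x0 (Suc n) s - picard (f p) x0 n s)"
  have tele: "(\<Sum>i<n. d i (p, s)) = picard (f p) x0 n s - x0" for n p s
    by (induction n) (simp_all add: d_def)
  have sm: "summable (\<lambda>n. M * L * ((K * L) ^ n /\<^sub>R fact n))"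
    by (intro summable_mult summable_exp_generic)
  have "norm (d n z) \<le> M * L * ((K * L) ^ n /\<^sub>R fact n)" if zin: "z \<in> P \<times> {0..L}" for n z
  proof -
    obtain p s where z: "z = (p, s)" "p \<in> P" "s \<in> {0..L}" using zin by (cases z) auto
    have "norm (d n z) \<le> M * K ^ n * s ^ Suc n / fact (Suc n)"
      using picard_increment[OF z(2,3), of n] by (simp add: d_def z)
    also have "\<dots> \<le> M * K ^ n * L ^ Suc n / fact n"
      using z K M by (intro frac_le mult_left_mono power_mono fact_mono) (auto intro!: mult_nonneg_nonneg)
    also have "\<dots> = M * L * ((K * L) ^ n /\<^sub>R fact n)"
      by (simp add: divide_simps power_mult_distrib)
    finally show ?thesis .
  qed
  from Weierstrass_m_test[OF this sm]
  have u: "uniform_limit (P \<times> {0..L}) (\<lambda>n z. \<Sum>i<n. d i z) (\<lambda>z. suminf (\<lambda>i. d i z)) sequentially" .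
  then have u2: "uniform_limit (P \<times> {0..L}) (\<lambda>n z. x0 + (\<Sum>i<n. d i z)) (\<lambda>z. x0 + suminf (\<lambda>i. d i z)) sequentially"
    by (intro uniform_limit_intros)
  have eq: "x0 + (\<Sum>i<n. d i z) = (\<lambda>(p, s). picard (f p) x0 n s) z" for n z
    by (cases z) (simp add: tele)
  have lim_eq: "x0 + suminf (\<lambda>i. d i z) = (\<lambda>(p, s). flow (f p) x0 s) z" if "z \<in> P \<times> {0..L}" for z
    using tendsto_uniform_limitI[OF u2 that] unfolding eq
    by (cases z) (auto simp: flow_def dest: limI)
  show ?thesis
    by (rule uniform_limit_cong'[THEN iffD1, OF _ _ u2[unfolded eq]]) (use lim_eq in auto)
qed

lemma continuous_on_flow: "continuous_on (P \<times> {0..L}) (\<lambda>(p, s). flow (f p) x0 s)"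
  by (rule uniform_limit_theorem[OF _ picard_uniform_limit])
    (auto intro!: always_eventually continuous_on_picard)

lemma flow_integral:
  assumes "p \<in> P" "s \<in> {0..L}"
  shows "flow (f p) x0 s = x0 + integral {0..s} (\<lambda>r. f p r (flow (f p) x0 r))"
proof -
  have lim: "(\<lambda>n. picard (f p) x0 n r) \<longlonglongrightarrow> flow (f p) x0 r" if "r \<in> {0..L}" for r
    using tendsto_uniform_limitI[OF picard_uniform_limit, of "(p, r)"] that assms by auto
  have u: "uniform_limit {0..s} (\<lambda>n r. f p r (picard (f p) x0 n r)) (\<lambda>r. f p r (flow (f p) x0 r)) sequentially"
  proof (rule uniform_limitI)
    fix e :: real assume e: "e > 0"
    have "\<forall>\<^sub>F n in sequentially. \<forall>z\<in>P \<times> {0..L}. dist ((\<lambda>(p, s). picard (f p) x0 n s) z) ((\<lambda>(p, s). flow (f p) x0 s) z) < e / (K + 1)"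
      using uniform_limitD[OF picard_uniform_limit, of "e / (K + 1)"] e K by simp
    then show "\<forall>\<^sub>F n in sequentially. \<forall>r\<in>{0..s}. dist (f p r (picard (f p) x0 n r)) (f p r (flow (f p) x0 r)) < e"
    proof eventually_elim
      case (elim n)
      show ?case
      proof
        fix r assume r: "r \<in> {0..s}"
        then have "(p, r) \<in> P \<times> {0..L}" using assms by auto
        with elim have "norm (picard (f p) x0 n r - flow (f p) x0 r) < e / (K + 1)"
          by (force simp: dist_norm)
        then have "K * norm (picard (f p) x0 n r - flow (f p) x0 r) \<le> K * (e / (K + 1))"
          using K by (intro mult_left_mono) auto
        also have "\<dots> < e" using K e by (simp add: field_simps)
        finally show "dist (f p r (picard (f p) x0 n r)) (f p r (flow (f p) x0 r)) < e"
          using lip[OF assms(1), of r "picard (f p) x0 n r" "flow (f p) x0 r"] r assms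
          by (auto simp: dist_norm)
      qed
    qed
  qed
  have "\<And>n. continuous_on {0..s} (\<lambda>r. f p r (picard (f p) x0 n r))"
    using continuous_on_section[OF continuous_on_rhs[OF continuous_on_picard] assms(1)] assms by auto
  from uniform_limit_integral[OF u this] obtain I J where
    I: "\<And>n. ((\<lambda>r. f p r (picard (f p) x0 n r)) has_integral I n) {0..s}"
    and J: "((\<lambda>r. f p r (flow (f p) x0 r)) has_integral J) {0..s}"
    and IJ: "I \<longlonglongrightarrow> J" by auto
  have "(\<lambda>n. picard (f p) x0 (Suc n) s) \<longlonglongrightarrow> x0 + J"
    using tendsto_add[OF tendsto_const[of x0] IJ] I by (simp add: integral_unique[OF I])
  moreover have "(\<lambda>n. picard (f p) x0 (Suc n) s) \<longlonglongrightarrow> flow (f p) x0 s"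
    using lim[OF assms(2)] by (rule LIMSEQ_Suc)
  ultimately have "flow (f p) x0 s = x0 + J" by (rule LIMSEQ_unique[THEN sym])
  then show ?thesis using J by (simp add: integral_unique)
qed

lemma flow_0: "p \<in> P \<Longrightarrow> 0 \<le> L \<Longrightarrow> flow (f p) x0 0 = x0"
  by (subst flow_integral) auto

lemma flow_has_vector_derivative:
  assumes "p \<in> P" "0 < s" "s < L"
  shows "(flow (f p) x0 has_vector_derivative f p s (flow (f p) x0 s)) (at s)"
proof -
  have "continuous_on {0..L} (\<lambda>r. f p r (flow (f p) x0 r))"
    using continuous_on_section[OF continuous_on_rhs[OF continuous_on_flow] assms(1)] by auto
  from integral_has_vector_derivative[OF this, of s]
  have "((\<lambda>u. x0 + integral {0..u} (\<lambda>r. f p r (flow (f p) x0 r))) has_vector_derivative f p s (flow (f p) x0 s)) (at s within {0..L})"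
    using assms by (auto intro!: derivative_eq_intros)
  then have "(flow (f p) x0 has_vector_derivative f p s (flow (f p) x0 s)) (at s within {0..L})"
    by (rule has_vector_derivative_transform[rotated 2]) (use assms flow_integral in auto)
  then show ?thesis using assms by (simp add: at_within_Icc_at)
qed

end

section \<open>Dispersion relation and normal modes\<close>

text \<open>The variable is the distance from the rigid wall. \<open>u 0 = 0\<close> expresses that
  there is no flow through the wall, and \<open>h 0 = 1\<close> fixes the amplitude.\<close>

definition layer_solution ::
  "real \<Rightarrow> (real \<Rightarrow> real) \<Rightarrow> (real \<Rightarrow> real) \<Rightarrow> (real \<Rightarrow> real) \<Rightarrow> (real \<Rightarrow> real) \<Rightarrow> bool" where
  "layer_solution L \<rho> \<beta> h u \<longleftrightarrow>
     h 0 = 1 \<and> u 0 = 0 \<and> continuous_on {0..L} h \<and> continuous_on {0..L} u \<and>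
     (\<forall>s\<in>{0<..<L}. (h has_real_derivative u s / \<rho> s) (at s) \<and> (u has_real_derivative \<beta> s * h s) (at s))"

lemma DERIV_nonneg_imp_le:
  fixes f :: "real \<Rightarrow> real"
  assumes "continuous_on {0..L} f" "s \<le> t" "s \<in> {0..L}" "t \<in> {0..L}"
    and "\<And>x. x \<in> {0<..<L} \<Longrightarrow> (f has_real_derivative f' x) (at x)"
    and "\<And>x. x \<in> {0<..<L} \<Longrightarrow> 0 \<le> f' x"
  shows "f s \<le> f t"
proof (rule DERIV_nonneg_imp_increasing_open[OF assms(2)])
  fix x assume "s < x" "x < t"
  then have "x \<in> {0<..<L}" using assms(3,4) by auto
  then show "\<exists>y. (f has_real_derivative y) (at x) \<and> 0 \<le> y" using assms(5,6) by blast
qed (rule continuous_on_subset[OF assms(1)], use assms in auto)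

context
  fixes L a b :: real and \<rho> \<beta> h u :: "real \<Rightarrow> real"
  assumes L: "0 < L" and a: "0 < a"
    and \<rho>: "\<And>s. s \<in> {0..L} \<Longrightarrow> a \<le> \<rho> s \<and> \<rho> s \<le> b"
    and \<beta>: "\<And>s. s \<in> {0..L} \<Longrightarrow> 0 \<le> \<beta> s"
    and sol: "layer_solution L \<rho> \<beta> h u"
begin

lemma layer_init: "h 0 = 1" "u 0 = 0"
  and layer_cont: "continuous_on {0..L} h" "continuous_on {0..L} u"
  using sol by (auto simp: layer_solution_def)

lemma layer_DERIV:
  assumes "s \<in> {0<..<L}"
  shows "(h has_real_derivative u s / \<rho> s) (at s)" "(u has_real_derivative \<beta> s * h s) (at s)" "0 < \<rho> s" "0 \<le> \<beta> s" "\<rho> s \<le> b"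
  using sol \<rho>[of s] \<beta>[of s] a assms by (auto simp: layer_solution_def)

text \<open>No sign is known beforehand, so quadratic quantities are used: the derivative of h u is
  a sum of squares with nonnegative weights, hence h u is nonnegative and h^2 increases from 1. A
  sign change of h would require a zero, which is thereby excluded.\<close>

lemma layer_pos:
  assumes s: "s \<in> {0..L}"
  shows "1 \<le> h s" "0 \<le> u s"
proof -
  have hu: "0 \<le> h t * u t" if t: "t \<in> {0..L}" for t
  proof -
    have "h 0 * u 0 \<le> h t * u t"
    proof (rule DERIV_nonneg_imp_le[where f = "\<lambda>s. h s * u s" and L = L and f' = "\<lambda>s. u s * u s / \<rho> s + \<beta> s * (h s * h s)"])
      fix x assume x: "x \<in> {0<..<L}"
      show "((\<lambda>s. h s * u s) has_real_derivative u x * u x / \<rho> x + \<beta> x * (h x * h x)) (at x)"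
        by (rule DERIV_cong[OF DERIV_mult[OF layer_DERIV(1,2)[OF x]]]) simp
      show "0 \<le> u x * u x / \<rho> x + \<beta> x * (h x * h x)"
        using layer_DERIV(3,4)[OF x] by simp
    qed (use t layer_cont in \<open>auto intro!: continuous_intros\<close>)
    then show ?thesis by (simp add: layer_init)
  qed
  have h2: "1 \<le> h t * h t" if t: "t \<in> {0..L}" for t
  proof -
    have "h 0 * h 0 \<le> h t * h t"
    proof (rule DERIV_nonneg_imp_le[where f = "\<lambda>s. h s * h s" and L = L and f' = "\<lambda>s. 2 * (h s * u s) / \<rho> s"])
      fix x assume x: "x \<in> {0<..<L}"
      show "((\<lambda>s. h s * h s) has_real_derivative 2 * (h x * u x) / \<rho> x) (at x)"
        by (rule DERIV_cong[OF DERIV_mult[OF layer_DERIV(1,1)[OF x]]]) simp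
      show "0 \<le> 2 * (h x * u x) / \<rho> x"
        using layer_DERIV(3)[OF x] hu[of x] x by simp
    qed (use t layer_cont in \<open>auto intro!: continuous_intros\<close>)
    then show ?thesis by (simp add: layer_init)
  qed
  have "0 < h s"
  proof (rule ccontr)
    assume neg: "\<not> 0 < h s"
    have "\<exists>x\<ge>0. x \<le> s \<and> h x = 0"
      using neg s layer_init continuous_on_subset[OF layer_cont(1), of "{0..s}"] by (intro IVT2') auto
    then show False using h2 s by force
  qed
  with h2[OF s] show 1: "1 \<le> h s" using mult_strict_mono[of "h s" 1 "h s" 1] by fastforce
  with hu[OF s] show "0 \<le> u s" by (simp add: zero_le_mult_iff)
qed

lemma layer_mono:
  assumes "s \<in> {0..L}" "t \<in> {0..L}" "s \<le> t"
  shows "h s \<le> h t"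
proof (rule DERIV_nonneg_imp_le[OF layer_cont(1) assms(3,1,2) layer_DERIV(1)])
  fix x assume "x \<in> {0<..<L}"
  then show "0 \<le> u x / \<rho> x" using layer_DERIV(3)[of x] layer_pos(2)[of x] by simp
qed

text \<open>A bound on the Riccati quotient u / h: the form M^2 h^2 - u^2 is nonnegative at the
  wall, and it increases since its derivative is a positive multiple of M^2 - \<rho>
  \<beta>.\<close>

lemma layer_upper:
  assumes s: "s \<in> {0..L}" and M: "0 \<le> M" "\<And>s. s \<in> {0<..<L} \<Longrightarrow> \<rho> s * \<beta> s \<le> M\<^sup>2"
  shows "u s \<le> M * h s"
proof -
  have "M\<^sup>2 * (h 0 * h 0) - u 0 * u 0 \<le> M\<^sup>2 * (h s * h s) - u s * u s"
  proof (rule DERIV_nonneg_imp_le[where f = "\<lambda>s. M\<^sup>2 * (h s * h s) - u s * u s" and L = L and f' = "\<lambda>s. 2 * (h s * u s) * ((M\<^sup>2 - \<rho> s * \<beta> s) / \<rho> s)"])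
    fix x assume x: "x \<in> {0<..<L}"
    show "((\<lambda>s. M\<^sup>2 * (h s * h s) - u s * u s) has_real_derivative 2 * (h x * u x) * ((M\<^sup>2 - \<rho> x * \<beta> x) / \<rho> x)) (at x)"
      by (rule DERIV_cong[OF DERIV_diff[OF DERIV_cmult[OF DERIV_mult[OF layer_DERIV(1,1)[OF x]]] DERIV_mult[OF layer_DERIV(2,2)[OF x]]]])
        (use layer_DERIV(3)[OF x] in \<open>simp add: field_simps\<close>)
    show "0 \<le> 2 * (h x * u x) * ((M\<^sup>2 - \<rho> x * \<beta> x) / \<rho> x)"
      using layer_DERIV(3)[OF x] M(2)[OF x] layer_pos[of x] x by (intro mult_nonneg_nonneg divide_nonneg_pos) auto
  qed (use s layer_cont in \<open>auto intro!: continuous_intros\<close>)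
  then have "u s * u s \<le> M\<^sup>2 * (h s * h s)"
    using zero_le_power2[of M] unfolding layer_init by linarith
  also have "\<dots> = (M * h s) * (M * h s)" by (simp add: power2_eq_square)
  finally have "(u s)\<^sup>2 \<le> (M * h s)\<^sup>2" by (simp only: power2_eq_square)
  moreover have "0 \<le> M * h s" using M(1) layer_pos(1)[OF s] by simp
  ultimately show ?thesis by (rule power2_le_imp_le)
qed

text \<open>Integrating the system twice, starting from h \<ge> 1. For large wave numbers this lifts
  \<open>h L\<close> above 3/2, as \<open>layer_lower\<close> requires.\<close>

lemma layer_growth:
  assumes s: "s \<in> {0..L}" and \<beta>0: "0 \<le> \<beta>0" "\<And>s. s \<in> {0<..<L} \<Longrightarrow> \<beta>0 \<le> \<beta> s"
  shows "\<beta>0 * s \<le> u s" "1 + \<beta>0 * s\<^sup>2 / (2 * b) \<le> h s"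
proof -
  have u: "\<beta>0 * t \<le> u t" if t: "t \<in> {0..L}" for t
  proof -
    have "u 0 - \<beta>0 * 0 \<le> u t - \<beta>0 * t"
    proof (rule DERIV_nonneg_imp_le[where f = "\<lambda>s. u s - \<beta>0 * s" and L = L and f' = "\<lambda>s. \<beta> s * h s - \<beta>0"])
      fix x assume x: "x \<in> {0<..<L}"
      show "((\<lambda>s. u s - \<beta>0 * s) has_real_derivative \<beta> x * h x - \<beta>0) (at x)"
        by (auto intro!: derivative_eq_intros layer_DERIV[OF x])
      have "\<beta>0 * 1 \<le> \<beta> x * h x" using \<beta>0 layer_pos(1)[of x] x layer_DERIV(4)[OF x] by (intro mult_mono) auto
      then show "0 \<le> \<beta> x * h x - \<beta>0" by simp
    qed (use t layer_cont in \<open>auto intro!: continuous_intros\<close>)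
    then show ?thesis by (simp add: layer_init)
  qed
  then show "\<beta>0 * s \<le> u s" using s by blast
  have b: "0 < b" using \<rho>[of 0] a L by auto
  have "h 0 - \<beta>0 * 0\<^sup>2 / (2 * b) \<le> h s - \<beta>0 * s\<^sup>2 / (2 * b)"
  proof (rule DERIV_nonneg_imp_le[where f = "\<lambda>s. h s - \<beta>0 * s\<^sup>2 / (2 * b)" and L = L and f' = "\<lambda>s. u s / \<rho> s - \<beta>0 * s / b"])
    fix x assume x: "x \<in> {0<..<L}"
    show "((\<lambda>s. h s - \<beta>0 * s\<^sup>2 / (2 * b)) has_real_derivative u x / \<rho> x - \<beta>0 * x / b) (at x)"
      by (rule DERIV_cong[OF DERIV_diff[OF layer_DERIV(1)[OF x] DERIV_cdivide[OF DERIV_cmult[OF DERIV_power[OF DERIV_ident]]]]])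
        (use b in \<open>simp add: field_simps\<close>)
    have "\<beta>0 * x / b \<le> u x / \<rho> x"
      using u[of x] x layer_DERIV(3,5)[OF x] layer_pos(2)[of x] by (intro frac_le) auto
    then show "0 \<le> u x / \<rho> x - \<beta>0 * x / b" by simp
  qed (use s layer_cont b in \<open>auto intro!: continuous_intros\<close>)
  then show "1 + \<beta>0 * s\<^sup>2 / (2 * b) \<le> h s" by (simp add: layer_init)
qed

text \<open>The counterpart of \<open>layer_upper\<close>. The quotient u / h vanishes at the wall,
  so h^2 has to be compared through h^2 - 1, and a bound proportional to h is available only at some
  distance from the wall. There h \<ge> 3/2 gives h^2 - 1 \<ge> h^2 / 4.\<close>

lemma layer_lower:
  assumes N: "0 \<le> N" "\<And>s. s \<in> {0<..<L} \<Longrightarrow> N\<^sup>2 \<le> \<rho> s * \<beta> s" and hL: "3 / 2 \<le> h L"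
  shows "N * h L / 2 \<le> u L"
proof -
  have "u 0 * u 0 - N\<^sup>2 * (h 0 * h 0 - 1) \<le> u L * u L - N\<^sup>2 * (h L * h L - 1)"
  proof (rule DERIV_nonneg_imp_le[where f = "\<lambda>s. u s * u s - N\<^sup>2 * (h s * h s - 1)" and L = L and f' = "\<lambda>s. 2 * (h s * u s) * ((\<rho> s * \<beta> s - N\<^sup>2) / \<rho> s)"])
    fix x assume x: "x \<in> {0<..<L}"
    show "((\<lambda>s. u s * u s - N\<^sup>2 * (h s * h s - 1)) has_real_derivative 2 * (h x * u x) * ((\<rho> x * \<beta> x - N\<^sup>2) / \<rho> x)) (at x)"
      by (rule DERIV_cong[OF DERIV_diff[OF DERIV_mult[OF layer_DERIV(2,2)[OF x]] DERIV_cmult[OF DERIV_diff[OF DERIV_mult[OF layer_DERIV(1,1)[OF x]] DERIV_const]]]])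
        (use layer_DERIV(3)[OF x] in \<open>simp add: field_simps\<close>)
    show "0 \<le> 2 * (h x * u x) * ((\<rho> x * \<beta> x - N\<^sup>2) / \<rho> x)"
      using layer_DERIV(3)[OF x] N(2)[OF x] layer_pos[of x] x by (intro mult_nonneg_nonneg divide_nonneg_pos) auto
  qed (use L layer_cont in \<open>auto intro!: continuous_intros\<close>)
  then have "N\<^sup>2 * (h L * h L - 1) \<le> u L * u L" by (simp add: layer_init)
  moreover have "h L * h L / 4 \<le> h L * h L - 1"
    using mult_mono[OF hL hL] hL by simp
  then have "N\<^sup>2 * (h L * h L / 4) \<le> N\<^sup>2 * (h L * h L - 1)" by (intro mult_left_mono) auto
  ultimately have "(N * h L / 2)\<^sup>2 \<le> (u L)\<^sup>2" by (simp add: power2_eq_square field_simps)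
  moreover have "0 \<le> u L" using layer_pos(2)[of L] L by simp
  ultimately show ?thesis by (rule power2_le_imp_le)
qed

end

text \<open>The cross-multiplied difference of the two Riccati quotients \<open>u / (B h)\<close> is increasing.\<close>
lemma layer_compare:
  assumes L: "0 < L" and a: "0 < a"
    and \<rho>: "\<And>s. s \<in> {0..L} \<Longrightarrow> a \<le> \<rho> s \<and> \<rho> s \<le> b"
    and \<beta>1: "\<And>s. s \<in> {0..L} \<Longrightarrow> 0 \<le> \<beta>1 s" and \<beta>2: "\<And>s. s \<in> {0..L} \<Longrightarrow> 0 \<le> \<beta>2 s"
    and sol1: "layer_solution L \<rho> \<beta>1 h1 u1" and sol2: "layer_solution L \<rho> \<beta>2 h2 u2"
    and B: "B1 < B2" and \<beta>: "\<And>s. s \<in> {0<..<L} \<Longrightarrow> B1 * \<beta>2 s < B2 * \<beta>1 s"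
  shows "B1 * u2 L * h1 L < B2 * u1 L * h2 L"
proof -
  have D1: "(h1 has_real_derivative u1 s / \<rho> s) (at s)" "(u1 has_real_derivative \<beta>1 s * h1 s) (at s)" "0 < \<rho> s"
    and D2: "(h2 has_real_derivative u2 s / \<rho> s) (at s)" "(u2 has_real_derivative \<beta>2 s * h2 s) (at s)"
    if "s \<in> {0<..<L}" for s
    using sol1 sol2 \<rho>[of s] a that by (auto simp: layer_solution_def)
  have P1: "1 \<le> h1 s \<and> 0 \<le> u1 s" if "s \<in> {0..L}" for s
  proof
    show "1 \<le> h1 s"
      by (rule layer_pos(1)[where L = L and a = a and b = b and \<rho> = \<rho> and \<beta> = \<beta>1 and h = h1 and u = u1]) fact+
    show "0 \<le> u1 s"
      by (rule layer_pos(2)[where L = L and a = a and b = b and \<rho> = \<rho> and \<beta> = \<beta>1 and h = h1 and u = u1]) fact+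
  qed
  have P2: "1 \<le> h2 s \<and> 0 \<le> u2 s" if "s \<in> {0..L}" for s
  proof
    show "1 \<le> h2 s"
      by (rule layer_pos(1)[where L = L and a = a and b = b and \<rho> = \<rho> and \<beta> = \<beta>2 and h = h2 and u = u2]) fact+
    show "0 \<le> u2 s"
      by (rule layer_pos(2)[where L = L and a = a and b = b and \<rho> = \<rho> and \<beta> = \<beta>2 and h = h2 and u = u2]) fact+
  qed
  have C1: "continuous_on {0..L} h1" "continuous_on {0..L} u1" and C2: "continuous_on {0..L} h2" "continuous_on {0..L} u2"
    and I: "u1 0 = 0" "u2 0 = 0"
    using sol1 sol2 by (auto simp: layer_solution_def)
  have "B2 * (u1 0 * h2 0) - B1 * (u2 0 * h1 0) < B2 * (u1 L * h2 L) - B1 * (u2 L * h1 L)"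
  proof (rule DERIV_pos_imp_increasing_open[where f = "\<lambda>x. B2 * (u1 x * h2 x) - B1 * (u2 x * h1 x)", OF L])
    fix x assume "0 < x" "x < L"
    then have x: "x \<in> {0<..<L}" "x \<in> {0..L}" by auto
    \<comment> \<open>The source terms carry the sign of the hypothesis relating \<open>B1\<close>,
      \<open>B2\<close> and the two coefficients, the flux terms that of
      \<open>B2 - B1\<close>.\<close>
    define d where "d = (B2 * \<beta>1 x - B1 * \<beta>2 x) * (h1 x * h2 x) + (B2 - B1) * (u1 x * u2 x / \<rho> x)"
    have "((\<lambda>x. B2 * (u1 x * h2 x) - B1 * (u2 x * h1 x)) has_real_derivative d) (at x)"
      by (rule DERIV_cong[OF DERIV_diff[OF DERIV_cmult[OF DERIV_mult[OF D1(2)[OF x(1)] D2(1)[OF x(1)]]] DERIV_cmult[OF DERIV_mult[OF D2(2)[OF x(1)] D1(1)[OF x(1)]]]]])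
        (use D1(3)[OF x(1)] in \<open>auto simp: d_def field_simps\<close>)
    moreover have "0 < d"
    proof -
      have "0 < (B2 * \<beta>1 x - B1 * \<beta>2 x) * (h1 x * h2 x)"
        using \<beta>[OF x(1)] P1[of x] P2[of x] x by (intro mult_pos_pos) auto
      moreover have "0 \<le> (B2 - B1) * (u1 x * u2 x / \<rho> x)"
        using B P1[of x] P2[of x] x \<rho>[OF x(2)] a by (intro mult_nonneg_nonneg divide_nonneg_pos) auto
      ultimately show ?thesis by (simp add: d_def)
    qed
    ultimately show "\<exists>y. ((\<lambda>x. B2 * (u1 x * h2 x) - B1 * (u2 x * h1 x)) has_real_derivative y) (at x) \<and> 0 < y" by blast
  qed (use C1 C2 in \<open>auto intro!: continuous_intros\<close>)
  then show ?thesis by (simp add: I mult.assoc)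
qed

section \<open>Existence of layer solutions and two-sided bounds on their quotient at the
  interface\<close>

text \<open>The two parameters are the effective squared wave number and the squared growth rate;
  \<open>c\<close> will be 1 / p'(\<rho>0), the reciprocal of the squared sound speed.\<close>

definition layer_rhs :: "(real \<Rightarrow> real) \<Rightarrow> (real \<Rightarrow> real) \<Rightarrow> real \<times> real \<Rightarrow> real \<Rightarrow> real \<times> real \<Rightarrow> real \<times> real" where
  "layer_rhs \<rho> c p s x = (snd x / \<rho> s, \<rho> s * (fst p + snd p * c s) * fst x)"

lemma layer_existence:
  fixes \<rho> c :: "real \<Rightarrow> real"
  assumes L: "0 < L" and a: "0 < a"
    and \<rho>: "\<And>s. s \<in> {0..L} \<Longrightarrow> a \<le> \<rho> s \<and> \<rho> s \<le> b" and \<rho>_cont: "continuous_on {0..L} \<rho>"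
    and c: "\<And>s. s \<in> {0..L} \<Longrightarrow> 0 \<le> c s \<and> c s \<le> C" and c_cont: "continuous_on {0..L} c"
  obtains h u :: "real \<times> real \<Rightarrow> real \<Rightarrow> real" where
    "\<And>p. layer_solution L \<rho> (\<lambda>s. \<rho> s * (fst p + snd p * c s)) (h p) (u p)"
    "continuous_on (UNIV \<times> {0..L}) (\<lambda>(p, s). h p s)" "continuous_on (UNIV \<times> {0..L}) (\<lambda>(p, s). u p s)"
proof -
  define f where "f = layer_rhs \<rho> c"
  define x where "x = (\<lambda>p. flow (f p) (1, 0))"
  have b: "0 < b" using \<rho>[of 0] a L by auto
  have C: "0 \<le> C" using c[of 0] L by auto
  have pos: "0 < \<rho> s" if "s \<in> {0..L}" for s using \<rho>[OF that] a by auto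
  \<comment> \<open>The Lipschitz constant grows with the parameter, so the theory of
    \<open>flow\<close> is applied on unit balls of parameters. \<open>flow\<close> itself does not
    mention the ball, so the local statements glue to joint continuity on the whole plane.\<close>
  have flow_assms: "continuous_on (cball q 1 \<times> {0..L} \<times> UNIV) (\<lambda>(p, s, x). f p s x)"
    "\<And>p s x y. dist q p \<le> 1 \<Longrightarrow> s \<in> {0..L} \<Longrightarrow> norm (f p s x - f p s y) \<le> (1 / a + b * ((norm q + 1) * (1 + C))) * norm (x - y)"
    "\<And>p s. dist q p \<le> 1 \<Longrightarrow> s \<in> {0..L} \<Longrightarrow> norm (f p s (1, 0)) \<le> b * ((norm q + 1) * (1 + C))"
    for q :: "real \<times> real"
  proof -
    show "continuous_on (cball q 1 \<times> {0..L} \<times> UNIV) (\<lambda>(p, s, x). f p s x)"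
      unfolding f_def layer_rhs_def case_prod_unfold
      using pos
      by (intro continuous_intros continuous_on_compose2[OF \<rho>_cont] continuous_on_compose2[OF c_cont]) (auto, fastforce)
    have co: "\<bar>\<rho> s * (fst p + snd p * c s)\<bar> \<le> b * ((norm q + 1) * (1 + C))" if p: "dist q p \<le> 1" and s: "s \<in> {0..L}" for p s
    proof -
      have np: "norm p \<le> norm q + 1"
        using p norm_triangle_ineq2[of p q] by (auto simp: dist_norm norm_minus_commute)
      have fs: "\<bar>fst p\<bar> \<le> norm q + 1" "\<bar>snd p\<bar> \<le> norm q + 1"
        using np norm_fst_le[of "fst p" "snd p"] norm_snd_le[of "snd p" "fst p"] by auto
      then have "\<bar>fst p\<bar> + \<bar>snd p\<bar> * c s \<le> (norm q + 1) + (norm q + 1) * C"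
        using c[OF s] by (intro add_mono[OF fs(1) mult_mono[OF fs(2)]]) auto
      then have "\<bar>fst p + snd p * c s\<bar> \<le> (norm q + 1) * (1 + C)"
        using abs_triangle_ineq[of "fst p" "snd p * c s"] c[OF s] by (simp add: abs_mult algebra_simps)
      then show ?thesis unfolding abs_mult using pos[OF s] \<rho>[OF s] by (intro mult_mono) auto
    qed
    fix p s assume p: "dist q p \<le> 1" and s: "s \<in> {0..L}"
    show "norm (f p s (1, 0)) \<le> b * ((norm q + 1) * (1 + C))"
      using co[OF p s] by (simp add: f_def layer_rhs_def norm_Pair)
    fix x y
    have "f p s x - f p s y = (snd (x - y) / \<rho> s, \<rho> s * (fst p + snd p * c s) * fst (x - y))"
      by (simp add: f_def layer_rhs_def diff_divide_distrib right_diff_distrib)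
    then have "norm (f p s x - f p s y) \<le> \<bar>snd (x - y) / \<rho> s\<bar> + \<bar>\<rho> s * (fst p + snd p * c s) * fst (x - y)\<bar>"
      using norm_Pair_le[of "snd (x - y) / \<rho> s" "\<rho> s * (fst p + snd p * c s) * fst (x - y)"] by simp
    also have "\<bar>snd (x - y) / \<rho> s\<bar> \<le> norm (x - y) / a"
      unfolding abs_divide using norm_snd_le[of "snd (x - y)" "fst (x - y)", unfolded prod.collapse] \<rho>[OF s] pos[OF s] a by (intro frac_le) (auto simp del: fst_diff snd_diff)
    also have "\<bar>\<rho> s * (fst p + snd p * c s) * fst (x - y)\<bar> \<le> b * ((norm q + 1) * (1 + C)) * norm (x - y)"
      unfolding abs_mult[of _ "fst (x - y)"] using co[OF p s] norm_fst_le[of "fst (x - y)" "snd (x - y)", unfolded prod.collapse] by (intro mult_mono) (auto simp: C b less_imp_le simp del: fst_diff snd_diff)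
    finally show "norm (f p s x - f p s y) \<le> (1 / a + b * ((norm q + 1) * (1 + C))) * norm (x - y)"
      by (simp add: algebra_simps)
  qed
  have K: "0 \<le> 1 / a + b * ((norm q + 1) * (1 + C))" "0 \<le> b * ((norm q + 1) * (1 + C))" for q :: "real \<times> real"
    using a b C by auto
  have lip: "\<And>p s x y. p \<in> cball q 1 \<Longrightarrow> s \<in> {0..L} \<Longrightarrow> norm (f p s x - f p s y) \<le> (1 / a + b * ((norm q + 1) * (1 + C))) * norm (x - y)"
    and bnd: "\<And>p s. p \<in> cball q 1 \<Longrightarrow> s \<in> {0..L} \<Longrightarrow> norm (f p s (1, 0)) \<le> b * ((norm q + 1) * (1 + C))" for q
    using flow_assms(2,3) by simp_all
  have loc: "continuous_on (cball q 1 \<times> {0..L}) (\<lambda>(p, s). x p s)" for q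
    unfolding x_def by (rule continuous_on_flow[OF flow_assms(1) lip bnd K])
  have cont: "continuous_on (UNIV \<times> {0..L}) (\<lambda>(p, s). x p s)"
    unfolding continuous_on_eq_continuous_within
  proof
    fix z :: "(real \<times> real) \<times> real" assume z: "z \<in> UNIV \<times> {0..L}"
    have "continuous (at z within cball (fst z) 1 \<times> {0..L}) (\<lambda>(p, s). x p s)"
      by (rule bspec[OF loc[of "fst z", unfolded continuous_on_eq_continuous_within]])
        (use z in \<open>auto simp: mem_Times_iff\<close>)
    moreover have "at z within cball (fst z) 1 \<times> {0..L} = at z within UNIV \<times> {0..L}"
    proof (rule at_within_nhd)
      show "z \<in> ball (fst z) 1 \<times> UNIV" by (simp add: mem_Times_iff)
      show "open (ball (fst z) 1 \<times> (UNIV :: real set))" by (intro open_Times) auto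
      have "ball (fst z) 1 \<subseteq> cball (fst z) 1" by (rule ball_subset_cball)
      then show "cball (fst z) 1 \<times> {0..L} \<inter> ball (fst z) 1 \<times> UNIV - {z} = UNIV \<times> {0..L} \<inter> ball (fst z) 1 \<times> UNIV - {z}"
        by blast
    qed
    ultimately show "continuous (at z within UNIV \<times> {0..L}) (\<lambda>(p, s). x p s)" by simp
  qed
  have x0: "x p 0 = (1, 0)" for p 
    unfolding x_def by (rule flow_0[OF flow_assms(1) lip bnd K, of p p]) (use L in simp_all)
  have xD: "(x p has_vector_derivative f p s (x p s)) (at s)" if "s \<in> {0<..<L}" for p s
    unfolding x_def by (rule flow_has_vector_derivative[OF flow_assms(1) lip bnd K, of p p]) (use that in simp_all)
  have sect: "continuous_on {0..L} (x p)" for p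
  proof -
    have "continuous_on {0..L} (\<lambda>s. (\<lambda>(p, s). x p s) (p, s))"
      by (rule continuous_on_compose2[OF cont]) (auto intro!: continuous_intros)
    then show ?thesis by simp
  qed
  show ?thesis
  proof
    show "layer_solution L \<rho> (\<lambda>s. \<rho> s * (fst p + snd p * c s)) (\<lambda>s. fst (x p s)) (\<lambda>s. snd (x p s))" for p
      unfolding layer_solution_def
    proof (intro conjI ballI)
      fix s assume s: "s \<in> {0<..<L}"
      show "((\<lambda>s. fst (x p s)) has_real_derivative snd (x p s) / \<rho> s) (at s)"
        using bounded_linear.has_vector_derivative[OF bounded_linear_fst xD[OF s, of p]]
        by (simp add: has_real_derivative_iff_has_vector_derivative f_def layer_rhs_def)
      show "((\<lambda>s. snd (x p s)) has_real_derivative \<rho> s * (fst p + snd p * c s) * fst (x p s)) (at s)"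
        using bounded_linear.has_vector_derivative[OF bounded_linear_snd xD[OF s, of p]]
        by (simp add: has_real_derivative_iff_has_vector_derivative f_def layer_rhs_def)
    qed (use sect[of p] x0[of p] in \<open>auto intro!: continuous_intros\<close>)
    show "continuous_on (UNIV \<times> {0..L}) (\<lambda>(p, s). fst (x p s))" "continuous_on (UNIV \<times> {0..L}) (\<lambda>(p, s). snd (x p s))"
      using continuous_on_fst[OF cont] continuous_on_snd[OF cont] by (simp_all only: case_prod_unfold)
  qed
qed

text \<open>For B \<ge> 1 the effective squared wave number lies between r^2 / (1 + w) and r^2.
  Hence \<rho> \<beta> is bounded below by a multiple of r^2, and above as well once B \<le> r^2;
  the quotient u / h at the interface is therefore of order r.\<close>

lemma layer_bounds:
  fixes \<rho> c h u :: "real \<Rightarrow> real"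
  assumes L: "0 < L" and a: "0 < a"
    and \<rho>: "\<And>s. s \<in> {0..L} \<Longrightarrow> a \<le> \<rho> s \<and> \<rho> s \<le> b"
    and c: "\<And>s. s \<in> {0..L} \<Longrightarrow> 0 \<le> c s \<and> c s \<le> C"
    and sol: "layer_solution L \<rho> (\<lambda>s. \<rho> s * (A + B * c s)) h u"
    and A: "A = B * r\<^sup>2 / (B + w)" and B: "1 \<le> B" and r: "1 \<le> r" and w: "0 \<le> w"
  shows "B \<le> r\<^sup>2 \<Longrightarrow> s \<in> {0..L} \<Longrightarrow> u s \<le> b * sqrt (1 + C) * r * h s"
    and "b * (1 + w) \<le> a * L\<^sup>2 * r\<^sup>2 \<Longrightarrow> 3 / 2 \<le> h L"
    and "b * (1 + w) \<le> a * L\<^sup>2 * r\<^sup>2 \<Longrightarrow> a / (2 * sqrt (1 + w)) * r * h L \<le> u L"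
    and "s \<in> {0..L} \<Longrightarrow> 1 \<le> h s" "s \<in> {0..L} \<Longrightarrow> 0 \<le> u s"
    and "s \<in> {0..L} \<Longrightarrow> h s \<le> h L"
    and "s \<in> {0..L} \<Longrightarrow> 0 \<le> \<rho> s * (A + B * c s)"
proof -
  have b: "0 < b" using \<rho>[of 0] a L by auto
  have C: "0 \<le> C" using c[of 0] L by auto
  have A1: "A \<le> r\<^sup>2" unfolding A using B w by (simp add: divide_le_eq mult_mono' field_simps)
  have A2: "r\<^sup>2 / (1 + w) \<le> A"
  proof -
    have "r\<^sup>2 * (B + w) \<le> B * r\<^sup>2 * (1 + w)"
      using mult_left_mono[of "B + w" "B + B * w" "r\<^sup>2"] B w mult_right_mono[of 1 B w] by (simp add: algebra_simps)
    then show ?thesis unfolding A using B w by (simp add: field_simps)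
  qed
  have A0: "0 \<le> r\<^sup>2 / (1 + w)" using w by simp
  have bc: "0 \<le> B * c s" if "s \<in> {0..L}" for s using B c[OF that] by simp
  have \<beta>: "0 \<le> \<rho> s * (A + B * c s)" if "s \<in> {0..L}" for s
    using \<rho>[OF that] a bc[OF that] A0 A2 by (intro mult_nonneg_nonneg) auto
  have \<beta>low: "a * (r\<^sup>2 / (1 + w)) \<le> \<rho> s * (A + B * c s)" if "s \<in> {0..L}" for s
    using \<rho>[OF that] a bc[OF that] A0 A2 by (intro mult_mono) auto
  show "0 \<le> \<rho> s * (A + B * c s)" if "s \<in> {0..L}" using \<beta>[OF that] .
  have pos: "1 \<le> h s" "0 \<le> u s" if "s \<in> {0..L}" for s
  proof -
    show "1 \<le> h s"
      by (rule layer_pos(1)[where L = L and a = a and b = b and \<rho> = \<rho> and \<beta> = "\<lambda>s. \<rho> s * (A + B * c s)" and u = u]; fact)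
    show "0 \<le> u s"
      by (rule layer_pos(2)[where L = L and a = a and b = b and \<rho> = \<rho> and \<beta> = "\<lambda>s. \<rho> s * (A + B * c s)" and h = h]; fact)
  qed
  show "1 \<le> h s" "0 \<le> u s" if "s \<in> {0..L}" using pos[OF that] .
  show "h s \<le> h L" if "s \<in> {0..L}"
    by (rule layer_mono[where L = L and a = a and b = b and \<rho> = \<rho> and \<beta> = "\<lambda>s. \<rho> s * (A + B * c s)" and h = h and u = u and s = s and t = L])
      (fact | use that L in simp)+
  show "u s \<le> b * sqrt (1 + C) * r * h s" if Br: "B \<le> r\<^sup>2" and s: "s \<in> {0..L}"
  proof (rule layer_upper[where L = L and a = a and b = b and \<rho> = \<rho> and \<beta> = "\<lambda>s. \<rho> s * (A + B * c s)" and h = h and u = u and s = s and M = "b * sqrt (1 + C) * r"])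
    fix t assume "t \<in> {0<..<L}"
    then have t: "t \<in> {0..L}" by auto
    have "A + B * c t \<le> r\<^sup>2 + r\<^sup>2 * C" using A1 Br c[OF t] B by (intro add_mono mult_mono) auto
    then have "\<rho> t * (\<rho> t * (A + B * c t)) \<le> b * (b * (r\<^sup>2 + r\<^sup>2 * C))"
      using \<rho>[OF t] a b \<beta>[OF t] bc[OF t] A0 A2 by (intro mult_mono) auto
    also have "\<dots> = (b * sqrt (1 + C) * r)\<^sup>2" using C by (simp add: power_mult_distrib power2_eq_square[of b] algebra_simps)
    finally show "\<rho> t * (\<rho> t * (A + B * c t)) \<le> (b * sqrt (1 + C) * r)\<^sup>2" .
  next
    show "0 \<le> b * sqrt (1 + C) * r" using b C r by simp
  qed (fact | use b C r in simp)+
  show hL: "3 / 2 \<le> h L" if big: "b * (1 + w) \<le> a * L\<^sup>2 * r\<^sup>2"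
  proof -
    have "1 + a * (r\<^sup>2 / (1 + w)) * L\<^sup>2 / (2 * b) \<le> h L"
    proof (rule layer_growth(2)[where L = L and a = a and b = b and \<rho> = \<rho> and \<beta> = "\<lambda>s. \<rho> s * (A + B * c s)" and h = h and u = u and s = L])
      show "a * (r\<^sup>2 / (1 + w)) \<le> \<rho> t * (A + B * c t)" if "t \<in> {0<..<L}" for t
        using \<beta>low[of t] that by auto
      show "0 \<le> a * (r\<^sup>2 / (1 + w))" by (rule mult_nonneg_nonneg[OF less_imp_le[OF a] A0])
    qed (fact | use L in simp)+
    \<comment> \<open>The hypothesis \<open>big\<close> says exactly that this increment is at least
      1/2.\<close>
    moreover have "1 / 2 \<le> a * (r\<^sup>2 / (1 + w)) * L\<^sup>2 / (2 * b)"
    proof -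
      have one: "1 \<le> (a * L\<^sup>2 * r\<^sup>2) / (b * (1 + w))" using big b w by (subst pos_le_divide_eq) auto
      have eq: "a * (r\<^sup>2 / (1 + w)) * L\<^sup>2 / (2 * b) = (a * L\<^sup>2 * r\<^sup>2) / (b * (1 + w)) / 2"
        by (simp add: mult_ac)
      show ?thesis unfolding eq using one by (intro divide_right_mono) auto
    qed
    ultimately show ?thesis by linarith
  qed
  show "a / (2 * sqrt (1 + w)) * r * h L \<le> u L" if big: "b * (1 + w) \<le> a * L\<^sup>2 * r\<^sup>2"
  proof -
    have "(a / sqrt (1 + w) * r) * h L / 2 \<le> u L"
    proof (rule layer_lower[where L = L and a = a and b = b and \<rho> = \<rho> and \<beta> = "\<lambda>s. \<rho> s * (A + B * c s)" and h = h and u = u and N = "a / sqrt (1 + w) * r"])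
      fix t assume "t \<in> {0<..<L}"
      then have t: "t \<in> {0..L}" by auto
      have "(a / sqrt (1 + w) * r)\<^sup>2 = a * (a * (r\<^sup>2 / (1 + w)))"
        using w by (simp add: power_mult_distrib power_divide power2_eq_square[of a])
      also have "\<dots> \<le> \<rho> t * (\<rho> t * (A + B * c t))"
      proof (rule mult_mono[OF conjunct1[OF \<rho>[OF t]] \<beta>low[OF t]])
        show "0 \<le> \<rho> t" using \<rho>[OF t] a by linarith
        show "0 \<le> a * (r\<^sup>2 / (1 + w))" by (rule mult_nonneg_nonneg[OF less_imp_le[OF a] A0])
      qed
      finally show "(a / sqrt (1 + w) * r)\<^sup>2 \<le> \<rho> t * (\<rho> t * (A + B * c t))" .
    next
      show "0 \<le> a / sqrt (1 + w) * r" using a w r by simp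
    next
      show "3 / 2 \<le> h L" by (rule hL[OF big])
    qed (fact | use a w r in simp)+
    then show ?thesis by (simp add: field_simps)
  qed
qed

text \<open>An implicit function theorem without derivatives. If X lies strictly below G at some y
  under the root, it stays below for nearby r, and by monotonicity the roots for these r cannot drop
  to y; likewise from above.\<close>

lemma monotone_implicit_continuous:
  fixes X :: "real \<Rightarrow> real \<Rightarrow> real"
  assumes cont: "\<And>y. 1 \<le> y \<Longrightarrow> continuous_on {R..} (\<lambda>r. X r y)"
    and mono: "\<And>r y z. R \<le> r \<Longrightarrow> 1 \<le> y \<Longrightarrow> y < z \<Longrightarrow> X r y < X r z"
    and f: "\<And>r. R \<le> r \<Longrightarrow> 1 < f r" and eq: "\<And>r. R \<le> r \<Longrightarrow> X r (f r) = G"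
  shows "continuous_on {R..} f"
  unfolding continuous_on_def
proof
  fix r assume r: "r \<in> {R..}"
  show "(f \<longlongrightarrow> f r) (at r within {R..})"
  proof (rule order_tendstoI)
    fix y assume y: "y < f r"
    \<comment> \<open>Monotonicity is available only from 1 on, and the root lies above 1.\<close>
    define y' where "y' = max y 1"
    have y': "1 \<le> y'" "y' < f r" using y f[of r] r by (auto simp: y'_def)
    have "((\<lambda>r. X r y') \<longlongrightarrow> X r y') (at r within {R..})" using cont[OF y'(1)] r by (auto simp: continuous_on_def)
    moreover have "X r y' < G" using mono[of r y' "f r"] y' r eq[of r] by auto
    ultimately have "\<forall>\<^sub>F x in at r within {R..}. X x y' < G" by (rule order_tendstoD)
    moreover have "\<forall>\<^sub>F x in at r within {R..}. x \<in> {R..}" by (simp add: eventually_at_filter)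
    ultimately show "\<forall>\<^sub>F x in at r within {R..}. y < f x"
    proof eventually_elim
      case (elim x)
      have "y' < f x"
      proof (rule ccontr)
        assume "\<not> y' < f x"
        then have "X x (f x) \<le> X x y'" using mono[of x "f x" y'] f[of x] elim by (cases "f x = y'") auto
        then show False using elim eq[of x] by auto
      qed
      then show ?case by (simp add: y'_def)
    qed
  next
    fix y assume y: "f r < y"
    then have y1: "1 \<le> y" using f[of r] r by auto
    have "((\<lambda>r. X r y) \<longlongrightarrow> X r y) (at r within {R..})" using cont[OF y1] r by (auto simp: continuous_on_def)
    moreover have "G < X r y" using mono[of r "f r" y] y f[of r] r eq[of r] by auto
    ultimately have "\<forall>\<^sub>F x in at r within {R..}. G < X x y" by (rule order_tendstoD)
    moreover have "\<forall>\<^sub>F x in at r within {R..}. x \<in> {R..}" by (simp add: eventually_at_filter)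
    ultimately show "\<forall>\<^sub>F x in at r within {R..}. f x < y"
    proof eventually_elim
      case (elim x)
      show ?case
      proof (rule ccontr)
        assume "\<not> f x < y"
        then have "X x y \<le> X x (f x)" using mono[of x y "f x"] y1 elim by (cases "f x = y") auto
        then show False using elim eq[of x] by auto
      qed
    qed
  qed
qed

section \<open>The dispersion relation and its root\<close>

text \<open>The effective squared wave number under rotation: \<open>w\<close> will be
  \<open>4 * \<omega>\<^sup>2\<close> and \<open>B\<close> the squared growth rate.\<close>

definition wave_square :: "real \<Rightarrow> real \<Rightarrow> real \<Rightarrow> real" where
  "wave_square w r B = B * r\<^sup>2 / (B + w)"

definition is_layer :: "real \<Rightarrow> real \<Rightarrow> real \<Rightarrow> real \<Rightarrow> (real \<Rightarrow> real) \<Rightarrow> (real \<Rightarrow> real) \<Rightarrow> (real \<times> real \<Rightarrow> real \<Rightarrow> real) \<Rightarrow> (real \<times> real \<Rightarrow> real \<Rightarrow> real) \<Rightarrow> bool" where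
  "is_layer L a b C \<rho> c h u \<longleftrightarrow> 0 < L \<and> 0 < a \<and> (\<forall>s\<in>{0..L}. a \<le> \<rho> s \<and> \<rho> s \<le> b \<and> 0 \<le> c s \<and> c s \<le> C) \<and>
     (\<forall>p. layer_solution L \<rho> (\<lambda>s. \<rho> s * (fst p + snd p * c s)) (h p) (u p)) \<and>
     continuous_on (UNIV \<times> {0..L}) (\<lambda>(p, s). h p s) \<and> continuous_on (UNIV \<times> {0..L}) (\<lambda>(p, s). u p s)"

lemma is_layerD:
  assumes lay: "is_layer L a b C \<rho> c h u" and B: "1 \<le> B" and r: "1 \<le> r" and w: "0 \<le> w"
    and big: "b * (1 + w) \<le> a * L\<^sup>2 * r\<^sup>2"
    and p: "p = (wave_square w r B, B)"
  shows "B \<le> r\<^sup>2 \<Longrightarrow> s \<in> {0..L} \<Longrightarrow> u p s \<le> b * sqrt (1 + C) * r * h p s"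
    and "3 / 2 \<le> h p L"
    and "a / (2 * sqrt (1 + w)) * r * h p L \<le> u p L"
    and "s \<in> {0..L} \<Longrightarrow> 1 \<le> h p s" "s \<in> {0..L} \<Longrightarrow> 0 \<le> u p s"
    and "s \<in> {0..L} \<Longrightarrow> h p s \<le> h p L" and "0 < u p L"
    and "s \<in> {0..L} \<Longrightarrow> 0 \<le> \<rho> s * (wave_square w r B + B * c s)"
proof -
  have D: "0 < L" "0 < a" "\<And>s. s \<in> {0..L} \<Longrightarrow> a \<le> \<rho> s \<and> \<rho> s \<le> b" "\<And>s. s \<in> {0..L} \<Longrightarrow> 0 \<le> c s \<and> c s \<le> C"
    and sol: "layer_solution L \<rho> (\<lambda>s. \<rho> s * (wave_square w r B + B * c s)) (h p) (u p)"
    using lay spec[of "\<lambda>p. layer_solution L \<rho> (\<lambda>s. \<rho> s * (fst p + snd p * c s)) (h p) (u p)" p] by (auto simp: is_layer_def p)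
  note bd = layer_bounds[where L = L and a = a and b = b and \<rho> = \<rho> and c = c and C = C and A = "wave_square w r B" and B = B
      and h = "h p" and u = "u p" and r = r and w = w, OF D(1,2) _ _ sol _ B r w]
  show "B \<le> r\<^sup>2 \<Longrightarrow> s \<in> {0..L} \<Longrightarrow> u p s \<le> b * sqrt (1 + C) * r * h p s"
    by (rule bd(1)) (use D in \<open>auto simp: wave_square_def\<close>)
  show "3 / 2 \<le> h p L" by (rule bd(2)) (use D big in \<open>auto simp: wave_square_def\<close>)
  show lo: "a / (2 * sqrt (1 + w)) * r * h p L \<le> u p L" by (rule bd(3)) (use D big in \<open>auto simp: wave_square_def\<close>)
  show h1: "s \<in> {0..L} \<Longrightarrow> 1 \<le> h p s" for s by (rule bd(4)) (use D in \<open>auto simp: wave_square_def\<close>)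
  show "s \<in> {0..L} \<Longrightarrow> 0 \<le> u p s" by (rule bd(5)) (use D in \<open>auto simp: wave_square_def\<close>)
  show "s \<in> {0..L} \<Longrightarrow> h p s \<le> h p L" by (rule bd(6)) (use D in \<open>auto simp: wave_square_def\<close>)
  show "s \<in> {0..L} \<Longrightarrow> 0 \<le> \<rho> s * (wave_square w r B + B * c s)" by (rule bd(7)) (use D in \<open>auto simp: wave_square_def\<close>)
  have "0 < a / (2 * sqrt (1 + w)) * r * h p L" using D(1,2) w r h1[of L] by (intro mult_pos_pos) auto
  then show "0 < u p L" using lo by linarith
qed

text \<open>In the hypothesis of \<open>layer_compare\<close> the compressible terms
  \<open>B1 * B2 * c s\<close> cancel. What remains is that wave_square divided by B, that is r^2 /
  (B + w), decreases in B; with rotation the inequality becomes strict only through the shift by r >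
  0 when w = 0 as well, since B itself increases.\<close>

lemma is_layer_compare:
  assumes lay: "is_layer L a b C \<rho> c h u" and B: "1 \<le> B1" "B1 < B2" and r: "1 \<le> r" and w: "0 \<le> w"
    and big: "b * (1 + w) \<le> a * L\<^sup>2 * r\<^sup>2"
    and p: "p1 = (wave_square w r B1, B1)" "p2 = (wave_square w r B2, B2)"
  shows "B1 * (h p1 L / u p1 L) < B2 * (h p2 L / u p2 L)"
proof -
  have B2: "1 \<le> B2" using B by simp
  have D: "0 < L" "0 < a" "\<And>s. s \<in> {0..L} \<Longrightarrow> a \<le> \<rho> s \<and> \<rho> s \<le> b"
    and sol: "layer_solution L \<rho> (\<lambda>s. \<rho> s * (wave_square w r B1 + B1 * c s)) (h p1) (u p1)"
       "layer_solution L \<rho> (\<lambda>s. \<rho> s * (wave_square w r B2 + B2 * c s)) (h p2) (u p2)"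
    using lay spec[of "\<lambda>p. layer_solution L \<rho> (\<lambda>s. \<rho> s * (fst p + snd p * c s)) (h p) (u p)" p1]
      spec[of "\<lambda>p. layer_solution L \<rho> (\<lambda>s. \<rho> s * (fst p + snd p * c s)) (h p) (u p)" p2] by (auto simp: is_layer_def p)
  have "B1 * u p2 L * h p1 L < B2 * u p1 L * h p2 L"
  proof (rule layer_compare[of L a \<rho> b
        "\<lambda>s. \<rho> s * (wave_square w r B1 + B1 * c s)" "\<lambda>s. \<rho> s * (wave_square w r B2 + B2 * c s)"])
    fix s assume s: "s \<in> {0<..<L}"
    then have \<rho>s: "0 < \<rho> s" using D(2) D(3)[of s] by auto
    have "B1 * wave_square w r B2 < B2 * wave_square w r B1"
    proof -
      have "B1 * B2 * r\<^sup>2 / (B2 + w) < B1 * B2 * r\<^sup>2 / (B1 + w)"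
        using B B2 r w by (intro divide_strict_left_mono) auto
      then show ?thesis by (simp add: wave_square_def mult_ac)
    qed
    then have "\<rho> s * (B1 * wave_square w r B2 + B1 * B2 * c s) < \<rho> s * (B2 * wave_square w r B1 + B1 * B2 * c s)"
      using \<rho>s by simp
    then show "B1 * (\<rho> s * (wave_square w r B2 + B2 * c s)) < B2 * (\<rho> s * (wave_square w r B1 + B1 * c s))"
      by (simp add: algebra_simps)
  next
    fix s assume s: "s \<in> {0..L}"
    show "0 \<le> \<rho> s * (wave_square w r B1 + B1 * c s)" by (rule is_layerD(8)[OF lay B(1) r w big refl s])
    show "0 \<le> \<rho> s * (wave_square w r B2 + B2 * c s)" by (rule is_layerD(8)[OF lay B2 r w big refl s])
  qed (fact D sol B)+
  moreover have "0 < u p1 L" "0 < u p2 L"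
    using is_layerD(7)[OF lay B(1) r w big p(1)] is_layerD(7)[OF lay B2 r w big p(2)] .
  ultimately show ?thesis by (simp add: field_simps)
qed

lemma is_layer_continuous:
  assumes lay: "is_layer L a b C \<rho> c h u" and f: "continuous_on S f" and g: "continuous_on S g" "\<And>z. z \<in> S \<Longrightarrow> g z \<in> {0..L}"
  shows "continuous_on S (\<lambda>z. h (f z) (g z))" "continuous_on S (\<lambda>z. u (f z) (g z))"
proof -
  have hu: "continuous_on (UNIV \<times> {0..L}) (\<lambda>(p, s). h p s)" "continuous_on (UNIV \<times> {0..L}) (\<lambda>(p, s). u p s)"
    using lay by (auto simp: is_layer_def)
  have fg: "continuous_on S (\<lambda>z. (f z, g z))" using f g(1) by (intro continuous_intros)
  have im: "(\<lambda>z. (f z, g z)) ` S \<subseteq> UNIV \<times> {0..L}" using g(2) by auto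
  from continuous_on_compose2[OF hu(1) fg im] show "continuous_on S (\<lambda>z. h (f z) (g z))" by simp
  from continuous_on_compose2[OF hu(2) fg im] show "continuous_on S (\<lambda>z. u (f z) (g z))" by simp
qed

lemma continuous_on_wave_square:
  assumes "continuous_on S f" "continuous_on S g" "\<And>z. z \<in> S \<Longrightarrow> 1 \<le> g z" "0 \<le> w"
  shows "continuous_on S (\<lambda>z. (wave_square w (f z) (g z), g z))"
proof -
  have "g z + w \<noteq> 0" if "z \<in> S" for z using assms(3)[OF that] assms(4) by linarith
  then show ?thesis unfolding wave_square_def using assms by (intro continuous_intros) auto
qed

text \<open>Each quotient h / u is of order 1 / r. At B = \<theta> r the weighted sum is therefore
  bounded by a constant that a small \<theta> pushes below G, while at B = r^2 the lower layer alone
  contributes a^2 r / M. The root in between comes from the intermediate value theorem and depends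
  continuously on r by strict monotonicity in B.\<close>

lemma dispersion:
  assumes lay1: "is_layer m a b C \<rho>1 c1 h1 u1" and lay2: "is_layer l a b C \<rho>2 c2 h2 u2"
    and w: "0 \<le> w" and G: "0 < (G::real)" and x: "a \<le> x1" "a \<le> x2"
  obtains R \<theta> f where "1 \<le> R" "0 < \<theta>" "continuous_on {R..} f"
    "\<And>r. R \<le> r \<Longrightarrow> 1 < f r \<and> \<theta> * r \<le> f r \<and> f r \<le> r\<^sup>2"
    "\<And>r. R \<le> r \<Longrightarrow> b * (1 + w) \<le> a * m\<^sup>2 * r\<^sup>2" "\<And>r. R \<le> r \<Longrightarrow> b * (1 + w) \<le> a * l\<^sup>2 * r\<^sup>2"
    "\<And>r p. R \<le> r \<Longrightarrow> p = (wave_square w r (f r), f r) \<Longrightarrow>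
       f r * (x1\<^sup>2 * (h1 p m / u1 p m) + x2\<^sup>2 * (h2 p l / u2 p l)) = G"
proof -
  have pos: "0 < m" "0 < l" "0 < a" and ab: "a \<le> b" and C: "0 \<le> C"
    using lay1 lay2 by (auto simp: is_layer_def dest!: bspec[of _ _ 0])
  have b: "0 < b" using pos ab by simp
  define \<kappa> where "\<kappa> = a / (2 * sqrt (1 + w))"
  define M where "M = b * sqrt (1 + C)"
  define S where "S = x1\<^sup>2 + x2\<^sup>2"
  have \<kappa>: "0 < \<kappa>" and M: "0 < M" and S: "0 < S"
    using pos b C w x by (auto simp: \<kappa>_def M_def S_def intro!: add_pos_pos)
  \<comment> \<open>At \<open>B = \<theta> * r\<close> the sum is at most
    \<open>\<theta> * S / \<kappa>\<close>, which must not exceed \<open>G\<close>; the bound 1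
    keeps \<theta> r below r^2.\<close>
  define \<theta> where "\<theta> = min 1 (G * \<kappa> / S)"
  have \<theta>: "0 < \<theta>" "\<theta> \<le> 1" "\<theta> * S / \<kappa> \<le> G" using G \<kappa> S by (auto simp: \<theta>_def min_def field_simps)
  \<comment> \<open>One summand for each lower bound on r that is used in \<open>big\<close>; the
    leading 2 provides strictness.\<close>
  define R where "R = 2 + 1 / \<theta> + b * (1 + w) / (a * m\<^sup>2) + b * (1 + w) / (a * l\<^sup>2) + G * M / a\<^sup>2"
  have nn: "0 \<le> 1 / \<theta>" "0 \<le> b * (1 + w) / (a * m\<^sup>2)" "0 \<le> b * (1 + w) / (a * l\<^sup>2)" "0 \<le> G * M / a\<^sup>2"
    using \<theta> b w pos G M by simp_all
  have R1: "1 \<le> R" using nn by (simp add: R_def)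
  have big: "b * (1 + w) \<le> a * m\<^sup>2 * r\<^sup>2 \<and> b * (1 + w) \<le> a * l\<^sup>2 * r\<^sup>2 \<and> 1 < \<theta> * r \<and> G \<le> r * (a\<^sup>2 / M)" if r: "R \<le> r" for r
  proof -
    have r1: "1 \<le> r" using r R1 by simp
    have "r \<le> r\<^sup>2" using r1 mult_right_mono[of 1 r r] by (simp add: power2_eq_square)
    moreover have "b * (1 + w) / (a * m\<^sup>2) \<le> r" "b * (1 + w) / (a * l\<^sup>2) \<le> r" "1 / \<theta> < r" "G * M / a\<^sup>2 \<le> r"
      using r nn unfolding R_def by linarith+
    ultimately have "b * (1 + w) / (a * m\<^sup>2) \<le> r\<^sup>2" "b * (1 + w) / (a * l\<^sup>2) \<le> r\<^sup>2" "1 / \<theta> < r" "G * M / a\<^sup>2 \<le> r" by linarith+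
    then show ?thesis using pos \<theta> M by (simp add: field_simps)
  qed
  define X where "X = (\<lambda>r B. let p = (wave_square w r B, B) in B * (x1\<^sup>2 * (h1 p m / u1 p m) + x2\<^sup>2 * (h2 p l / u2 p l)))"
  have upos: "0 < u1 (wave_square w r B, B) m" "0 < u2 (wave_square w r B, B) l" if "R \<le> r" "1 \<le> B" for r B
    using is_layerD(7)[OF lay1 that(2) _ w _ refl] is_layerD(7)[OF lay2 that(2) _ w _ refl] big[OF that(1)] R1 that(1) by auto
  have mono: "X r y < X r z" if r: "R \<le> r" and yz: "1 \<le> y" "y < z" for r y z
  proof -
    have r1: "1 \<le> r" using r R1 by simp
    note b1 = conjunct1[OF big[OF r]] and b2 = conjunct1[OF conjunct2[OF big[OF r]]]
    have "x1\<^sup>2 * (y * (h1 (wave_square w r y, y) m / u1 (wave_square w r y, y) m)) < x1\<^sup>2 * (z * (h1 (wave_square w r z, z) m / u1 (wave_square w r z, z) m))"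
      using is_layer_compare[OF lay1 yz r1 w b1 refl refl] x pos by (intro mult_strict_left_mono) auto
    moreover have "x2\<^sup>2 * (y * (h2 (wave_square w r y, y) l / u2 (wave_square w r y, y) l)) < x2\<^sup>2 * (z * (h2 (wave_square w r z, z) l / u2 (wave_square w r z, z) l))"
      using is_layer_compare[OF lay2 yz r1 w b2 refl refl] x pos by (intro mult_strict_left_mono) auto
    ultimately show ?thesis unfolding X_def Let_def by (simp add: algebra_simps)
  qed
  have Xcont: "continuous_on T (\<lambda>z. X (\<phi> z) (\<psi> z))" if "continuous_on T \<phi>" "continuous_on T \<psi>" "\<And>z. z \<in> T \<Longrightarrow> R \<le> \<phi> z \<and> 1 \<le> \<psi> z" for T :: "real set" and \<phi> \<psi>
  proof -
    have pc: "continuous_on T (\<lambda>z. (wave_square w (\<phi> z) (\<psi> z), \<psi> z))"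
      using that w by (intro continuous_on_wave_square) auto
    have "continuous_on T (\<lambda>z. h1 (wave_square w (\<phi> z) (\<psi> z), \<psi> z) m)" "continuous_on T (\<lambda>z. u1 (wave_square w (\<phi> z) (\<psi> z), \<psi> z) m)"
      "continuous_on T (\<lambda>z. h2 (wave_square w (\<phi> z) (\<psi> z), \<psi> z) l)" "continuous_on T (\<lambda>z. u2 (wave_square w (\<phi> z) (\<psi> z), \<psi> z) l)"
      using is_layer_continuous[OF lay1 pc, of "\<lambda>_. m"] is_layer_continuous[OF lay2 pc, of "\<lambda>_. l"] pos by auto
    moreover have "u1 (wave_square w (\<phi> z) (\<psi> z), \<psi> z) m \<noteq> 0" "u2 (wave_square w (\<phi> z) (\<psi> z), \<psi> z) l \<noteq> 0" if "z \<in> T" for z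
      using upos[of "\<phi> z" "\<psi> z"] \<open>\<And>z. z \<in> T \<Longrightarrow> R \<le> \<phi> z \<and> 1 \<le> \<psi> z\<close>[OF that] by auto
    ultimately show ?thesis unfolding X_def Let_def using that(2) by (intro continuous_intros) auto
  qed
  have ex: "\<exists>B. \<theta> * r \<le> B \<and> B \<le> r\<^sup>2 \<and> X r B = G" if r: "R \<le> r" for r
  proof (rule IVT')
    have r1: "1 \<le> r" using r R1 by simp
    note bg = big[OF r]
    have lo: "h1 p m / u1 p m \<le> 1 / (\<kappa> * r)" "h2 p l / u2 p l \<le> 1 / (\<kappa> * r)" if "1 \<le> B" "p = (wave_square w r B, B)" for p B
    proof -
      have "\<kappa> * r * h1 p m \<le> u1 p m" "\<kappa> * r * h2 p l \<le> u2 p l"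
        using is_layerD(3)[OF lay1 that(1) r1 w _ that(2)] is_layerD(3)[OF lay2 that(1) r1 w _ that(2)] bg by (auto simp: \<kappa>_def)
      then show "h1 p m / u1 p m \<le> 1 / (\<kappa> * r)" "h2 p l / u2 p l \<le> 1 / (\<kappa> * r)"
        using upos[OF r that(1)] \<kappa> r1 unfolding that(2) by (simp_all add: field_simps)
    qed
    have t1: "1 \<le> \<theta> * r" using bg by simp
    have "X r (\<theta> * r) \<le> \<theta> * r * (x1\<^sup>2 * (1 / (\<kappa> * r)) + x2\<^sup>2 * (1 / (\<kappa> * r)))"
      unfolding X_def Let_def using lo[OF t1 refl] t1 by (intro mult_left_mono add_mono) auto
    also have "\<dots> = \<theta> * S / \<kappa>" using r1 \<kappa> by (simp add: S_def field_simps)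
    finally show "X r (\<theta> * r) \<le> G" using \<theta>(3) by simp
    have t2: "1 \<le> r\<^sup>2" using r1 by simp
    have "u1 (wave_square w r (r\<^sup>2), r\<^sup>2) m \<le> M * r * h1 (wave_square w r (r\<^sup>2), r\<^sup>2) m"
      using is_layerD(1)[OF lay1 t2 r1 w _ refl, of m] bg pos by (auto simp: M_def)
    then have hu: "1 / (M * r) \<le> h1 (wave_square w r (r\<^sup>2), r\<^sup>2) m / u1 (wave_square w r (r\<^sup>2), r\<^sup>2) m"
      using upos[OF r t2] M r1 by (simp add: field_simps)
    have h2nn: "0 \<le> h2 (wave_square w r (r\<^sup>2), r\<^sup>2) l"
      using is_layerD(2)[OF lay2 t2 r1 w _ refl] bg by auto
    have "G \<le> r\<^sup>2 * (a\<^sup>2 * (1 / (M * r)))" using bg r1 M by (simp add: field_simps power2_eq_square)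
    also have "\<dots> \<le> r\<^sup>2 * (x1\<^sup>2 * (h1 (wave_square w r (r\<^sup>2), r\<^sup>2) m / u1 (wave_square w r (r\<^sup>2), r\<^sup>2) m))"
      using hu x pos M r1 by (intro mult_left_mono mult_mono power_mono) auto
    also have "\<dots> \<le> X r (r\<^sup>2)"
      unfolding X_def Let_def using h2nn upos[OF r t2] by (intro mult_left_mono) auto
    finally show "G \<le> X r (r\<^sup>2)" .
    show "\<theta> * r \<le> r\<^sup>2" using \<theta>(2) r1 mult_right_mono[of \<theta> r r] by (simp add: power2_eq_square)
    show "continuous_on {\<theta> * r..r\<^sup>2} (X r)"
      using Xcont[of "{\<theta> * r..r\<^sup>2}" "\<lambda>_. r" "\<lambda>y. y"] r t1 by auto
  qed
  define f where "f = (\<lambda>r. SOME B. \<theta> * r \<le> B \<and> B \<le> r\<^sup>2 \<and> X r B = G)"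
  have f: "\<theta> * r \<le> f r \<and> f r \<le> r\<^sup>2 \<and> X r (f r) = G" if "R \<le> r" for r
    unfolding f_def by (rule someI_ex[OF ex[OF that]])
  have f1: "1 < f r" if "R \<le> r" for r using f[OF that] big[OF that] by linarith
  show ?thesis
  proof
    show "continuous_on {R..} f"
    proof (rule monotone_implicit_continuous[where X = X and G = G])
      show "continuous_on {R..} (\<lambda>r. X r y)" if "1 \<le> y" for y
        using Xcont[of "{R..}" "\<lambda>r. r" "\<lambda>_. y"] that by auto
    qed (use mono f f1 in auto)
    show "f r * (x1\<^sup>2 * (h1 p m / u1 p m) + x2\<^sup>2 * (h2 p l / u2 p l)) = G"
      if "R \<le> r" "p = (wave_square w r (f r), f r)" for r p
      using f[OF that(1)] unfolding that(2) X_def Let_def by simp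
  qed (use R1 \<theta> f f1 big in auto)
qed

lemma is_layer_DERIV:
  assumes "is_layer L a b C \<rho> c h u" "s \<in> {0<..<L}"
  shows "(h p has_real_derivative u p s / \<rho> s) (at s)"
    and "(u p has_real_derivative \<rho> s * (fst p + snd p * c s) * h p s) (at s)" and "u p 0 = 0"
proof -
  have "layer_solution L \<rho> (\<lambda>s. \<rho> s * (fst p + snd p * c s)) (h p) (u p)" for p
    using assms(1) unfolding is_layer_def by blast
  then show "(h p has_real_derivative u p s / \<rho> s) (at s)"
    "(u p has_real_derivative \<rho> s * (fst p + snd p * c s) * h p s) (at s)" "u p 0 = 0"
    using assms(2) unfolding layer_solution_def by blast+
qed

lemma is_layer_exists:
  fixes \<rho> c :: "real \<Rightarrow> real"
  assumes L: "0 < L" and a: "0 < a"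
    and \<rho>: "\<And>s. s \<in> {0..L} \<Longrightarrow> a \<le> \<rho> s \<and> \<rho> s \<le> b" and \<rho>_cont: "continuous_on {0..L} \<rho>"
    and c: "\<And>s. s \<in> {0..L} \<Longrightarrow> 0 \<le> c s \<and> c s \<le> C" and c_cont: "continuous_on {0..L} c"
  shows "\<exists>h u. is_layer L a b C \<rho> c h u"
proof -
  obtain h u :: "real \<times> real \<Rightarrow> real \<Rightarrow> real" where
    1: "\<And>p. layer_solution L \<rho> (\<lambda>s. \<rho> s * (fst p + snd p * c s)) (h p) (u p)" and
    2: "continuous_on (UNIV \<times> {0..L}) (\<lambda>(p, s). h p s)" and 3: "continuous_on (UNIV \<times> {0..L}) (\<lambda>(p, s). u p s)"
    by (rule layer_existence[of L a \<rho> b c C]) (use assms in blast)+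
  have "is_layer L a b C \<rho> c h u"
    unfolding is_layer_def using L a \<rho> c 1 2 3 by blast
  then show ?thesis by blast
qed

text \<open>Solutions of the normal mode equations with wave number \<open>r\<close> and squared growth rate \<open>f r\<close>:
  \<open>h\<close> is the enthalpy perturbation and \<open>u = \<rho> h'\<close> its flux.\<close>
lemma normal_modes:
  fixes \<rho>M cM \<rho>P cP :: "real \<Rightarrow> real"
  assumes g: "0 < g" and l: "0 < l" and m: "0 < m" and a: "0 < a" and w: "0 \<le> w"
    and contM: "continuous_on {-m..0} \<rho>M" "continuous_on {-m..0} cM"
    and contP: "continuous_on {0..l} \<rho>P" "continuous_on {0..l} cP"
    and bM: "\<And>s. s \<in> {-m..0} \<Longrightarrow> a \<le> \<rho>M s \<and> \<rho>M s \<le> b \<and> 0 \<le> cM s \<and> cM s \<le> C"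
    and bP: "\<And>s. s \<in> {0..l} \<Longrightarrow> a \<le> \<rho>P s \<and> \<rho>P s \<le> b \<and> 0 \<le> cP s \<and> cP s \<le> C"
    and jump: "\<rho>M 0 < \<rho>P 0"
  obtains R \<theta> K \<mu> and f :: "real \<Rightarrow> real" and HM UM HP UP :: "real \<Rightarrow> real \<Rightarrow> real"
  where "1 \<le> R" "0 < \<theta>" "0 < \<mu>" "continuous_on {R..} f"
    "\<And>r. R \<le> r \<Longrightarrow> 1 < f r \<and> \<theta> * r \<le> f r \<and> f r \<le> r\<^sup>2"
    "continuous_on ({R..} \<times> {-m..0}) (\<lambda>z. HM (fst z) (snd z))" "continuous_on ({R..} \<times> {-m..0}) (\<lambda>z. UM (fst z) (snd z))"
    "continuous_on ({R..} \<times> {0..l}) (\<lambda>z. HP (fst z) (snd z))" "continuous_on ({R..} \<times> {0..l}) (\<lambda>z. UP (fst z) (snd z))"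
    "\<And>r s. R \<le> r \<Longrightarrow> s \<in> {-m<..<0} \<Longrightarrow> (HM r has_real_derivative UM r s / \<rho>M s) (at s)"
    "\<And>r s. R \<le> r \<Longrightarrow> s \<in> {-m<..<0} \<Longrightarrow> (UM r has_real_derivative \<rho>M s * (wave_square w r (f r) + f r * cM s) * HM r s) (at s)"
    "\<And>r s. R \<le> r \<Longrightarrow> s \<in> {0<..<l} \<Longrightarrow> (HP r has_real_derivative UP r s / \<rho>P s) (at s)"
    "\<And>r s. R \<le> r \<Longrightarrow> s \<in> {0<..<l} \<Longrightarrow> (UP r has_real_derivative \<rho>P s * (wave_square w r (f r) + f r * cP s) * HP r s) (at s)"
    "\<And>r. R \<le> r \<Longrightarrow> UM r (-m) = 0" "\<And>r. R \<le> r \<Longrightarrow> UP r l = 0"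
    "\<And>r. R \<le> r \<Longrightarrow> UM r 0 / \<rho>M 0 = UP r 0 / \<rho>P 0"
    "\<And>r. R \<le> r \<Longrightarrow> \<rho>M 0 * HM r 0 + g * UM r 0 / f r = \<rho>P 0 * HP r 0 + g * UP r 0 / f r"
    "\<And>r s. R \<le> r \<Longrightarrow> s \<in> {-m..0} \<Longrightarrow> \<bar>HM r s\<bar> \<le> K * r \<and> \<bar>UM r s\<bar> \<le> K * r\<^sup>2"
    "\<And>r s. R \<le> r \<Longrightarrow> s \<in> {0..l} \<Longrightarrow> \<bar>HP r s\<bar> \<le> K * r \<and> \<bar>UP r s\<bar> \<le> K * r\<^sup>2"
    "\<And>r. R \<le> r \<Longrightarrow> \<mu> \<le> \<bar>HM r 0 - HM r (-m)\<bar>"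
proof -
  \<comment> \<open>Both layers are parametrised by the distance from their own wall, so that the
    same theory of layer solutions applies. The reflection of the upper layer reverses the sign of
    the flux.\<close>
  define \<rho>1 c1 where "\<rho>1 = (\<lambda>s. \<rho>M (s - m))" and "c1 = (\<lambda>s. cM (s - m))"
  define \<rho>2 c2 where "\<rho>2 = (\<lambda>s. \<rho>P (l - s))" and "c2 = (\<lambda>s. cP (l - s))"
  have cont1: "continuous_on {0..m} \<rho>1" "continuous_on {0..m} c1"
    unfolding \<rho>1_def c1_def
    by (rule continuous_on_compose2[OF contM(1)] continuous_on_compose2[OF contM(2)]; auto intro!: continuous_intros)+
  have cont2: "continuous_on {0..l} \<rho>2" "continuous_on {0..l} c2"
    unfolding \<rho>2_def c2_def
    by (rule continuous_on_compose2[OF contP(1)] continuous_on_compose2[OF contP(2)]; auto intro!: continuous_intros)+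
  have b1: "a \<le> \<rho>1 s \<and> \<rho>1 s \<le> b" "0 \<le> c1 s \<and> c1 s \<le> C" if "s \<in> {0..m}" for s
    using bM[of "s - m"] that by (auto simp: \<rho>1_def c1_def)
  have b2: "a \<le> \<rho>2 s \<and> \<rho>2 s \<le> b" "0 \<le> c2 s \<and> c2 s \<le> C" if "s \<in> {0..l}" for s
    using bP[of "l - s"] that by (auto simp: \<rho>2_def c2_def)
  obtain h1 u1 where lay1: "is_layer m a b C \<rho>1 c1 h1 u1"
    using is_layer_exists[of m a \<rho>1 b c1 C] m a b1 cont1 by blast
  obtain h2 u2 where lay2: "is_layer l a b C \<rho>2 c2 h2 u2"
    using is_layer_exists[of l a \<rho>2 b c2 C] l a b2 cont2 by blast
  define x1 x2 where "x1 = \<rho>M 0" and "x2 = \<rho>P 0"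
  have x: "a \<le> x1" "a \<le> x2" "x1 \<le> b" "x2 \<le> b" using bM[of 0] bP[of 0] l m by (auto simp: x1_def x2_def)
  have b: "0 < b" using x a by simp
  have C: "0 \<le> C" using bM[of 0] m by auto
  have G: "0 < g * (x2 - x1)" using g jump by (simp add: x1_def x2_def)
  obtain R \<theta> f where R: "1 \<le> R" and \<theta>: "0 < \<theta>" and f_cont: "continuous_on {R..} f"
    and f: "\<And>r. R \<le> r \<Longrightarrow> 1 < f r \<and> \<theta> * r \<le> f r \<and> f r \<le> r\<^sup>2"
    and big1: "\<And>r. R \<le> r \<Longrightarrow> b * (1 + w) \<le> a * m\<^sup>2 * r\<^sup>2" and big2: "\<And>r. R \<le> r \<Longrightarrow> b * (1 + w) \<le> a * l\<^sup>2 * r\<^sup>2"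
    and disp: "\<And>r p. R \<le> r \<Longrightarrow> p = (wave_square w r (f r), f r) \<Longrightarrow>
       f r * (x1\<^sup>2 * (h1 p m / u1 p m) + x2\<^sup>2 * (h2 p l / u2 p l)) = g * (x2 - x1)"
    using dispersion[OF lay1 lay2 w G x(1,2)] by metis
  define p where "p = (\<lambda>r. (wave_square w r (f r), f r))"
  define M where "M = b * sqrt (1 + C)"
  have M: "0 < M" using b C by (simp add: M_def)
  define \<kappa> where "\<kappa> = a / (2 * sqrt (1 + w))"
  have \<kappa>: "0 < \<kappa>" using a w by (simp add: \<kappa>_def)
  define W1 W2 where "W1 = (\<lambda>r. u1 (p r) m / h1 (p r) m)" and "W2 = (\<lambda>r. u2 (p r) l / h2 (p r) l)"
  have fr: "1 \<le> r" "1 \<le> f r" "f r \<le> r\<^sup>2" if "R \<le> r" for r using R f[OF that] that by auto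
  have L1: "u1 (p r) s \<le> M * r * h1 (p r) s" "1 \<le> h1 (p r) s" "0 \<le> u1 (p r) s" "h1 (p r) s \<le> h1 (p r) m"
    if r: "R \<le> r" and s: "s \<in> {0..m}" for r s
    using is_layerD(1,4,5,6)[OF lay1 fr(2)[OF r] fr(1)[OF r] w big1[OF r] refl] fr(3)[OF r] s by (auto simp: p_def M_def)
  have L2: "u2 (p r) s \<le> M * r * h2 (p r) s" "1 \<le> h2 (p r) s" "0 \<le> u2 (p r) s" "h2 (p r) s \<le> h2 (p r) l"
    if r: "R \<le> r" and s: "s \<in> {0..l}" for r s
    using is_layerD(1,4,5,6)[OF lay2 fr(2)[OF r] fr(1)[OF r] w big2[OF r] refl] fr(3)[OF r] s by (auto simp: p_def M_def)
  have E1: "3 / 2 \<le> h1 (p r) m" "\<kappa> * r * h1 (p r) m \<le> u1 (p r) m" "0 < u1 (p r) m" if r: "R \<le> r" for r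
    using is_layerD(2,3,7)[OF lay1 fr(2)[OF r] fr(1)[OF r] w big1[OF r] refl] by (auto simp: p_def \<kappa>_def)
  have E2: "3 / 2 \<le> h2 (p r) l" "\<kappa> * r * h2 (p r) l \<le> u2 (p r) l" "0 < u2 (p r) l" if r: "R \<le> r" for r
    using is_layerD(2,3,7)[OF lay2 fr(2)[OF r] fr(1)[OF r] w big2[OF r] refl] by (auto simp: p_def \<kappa>_def)
  have W1: "\<kappa> * r \<le> W1 r" "W1 r \<le> M * r" "0 < W1 r" if r: "R \<le> r" for r
    using E1[OF r] L1(1)[OF r, of m] m by (auto simp: W1_def field_simps)
  have W2: "\<kappa> * r \<le> W2 r" "W2 r \<le> M * r" "0 < W2 r" if r: "R \<le> r" for r
    using E2[OF r] L2(1)[OF r, of l] l by (auto simp: W2_def field_simps)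
  \<comment> \<open>Each layer is scaled by the quotient of the other one, so that U / \<rho> equals
    - W1 W2 on both sides of the interface and the vertical velocity is continuous. Continuity of
    the pressure then becomes the dispersion relation. Dividing by the interface value of h keeps
    the profiles polynomially bounded in r.\<close>
  define HM UM where "HM = (\<lambda>r s. - (W2 r * x1 / h1 (p r) m) * h1 (p r) (s + m))" and "UM = (\<lambda>r s. - (W2 r * x1 / h1 (p r) m) * u1 (p r) (s + m))"
  define HP UP where "HP = (\<lambda>r s. (W1 r * x2 / h2 (p r) l) * h2 (p r) (l - s))" and "UP = (\<lambda>r s. - (W1 r * x2 / h2 (p r) l) * u2 (p r) (l - s))"
  have p_cont: "continuous_on S (\<lambda>z. p (\<phi> z))" if "continuous_on S \<phi>" "\<And>z. z \<in> S \<Longrightarrow> R \<le> \<phi> z" for S :: "(real \<times> real) set" and \<phi>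
  proof -
    have fc: "continuous_on S (\<lambda>z. f (\<phi> z))" using that by (intro continuous_on_compose2[OF f_cont]) auto
    show ?thesis unfolding p_def
      using that fc w by (intro continuous_on_wave_square) (auto intro: fr)
  qed
  have cont: "continuous_on S (\<lambda>z. h1 (p (fst z)) (\<psi> z))" "continuous_on S (\<lambda>z. u1 (p (fst z)) (\<psi> z))"
    if "continuous_on S \<psi>" "\<And>z. z \<in> S \<Longrightarrow> R \<le> fst z \<and> \<psi> z \<in> {0..m}" for S :: "(real \<times> real) set" and \<psi>
  proof -
    have pc: "continuous_on S (\<lambda>z. p (fst z))"
      using p_cont[OF continuous_on_fst[OF continuous_on_id], of S] that(2) by blast
    show "continuous_on S (\<lambda>z. h1 (p (fst z)) (\<psi> z))" "continuous_on S (\<lambda>z. u1 (p (fst z)) (\<psi> z))"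
      by (rule is_layer_continuous[OF lay1 pc that(1)]; use that(2) in blast)+
  qed
  have cont': "continuous_on S (\<lambda>z. h2 (p (fst z)) (\<psi> z))" "continuous_on S (\<lambda>z. u2 (p (fst z)) (\<psi> z))"
    if "continuous_on S \<psi>" "\<And>z. z \<in> S \<Longrightarrow> R \<le> fst z \<and> \<psi> z \<in> {0..l}" for S :: "(real \<times> real) set" and \<psi>
  proof -
    have pc: "continuous_on S (\<lambda>z. p (fst z))"
      using p_cont[OF continuous_on_fst[OF continuous_on_id], of S] that(2) by blast
    show "continuous_on S (\<lambda>z. h2 (p (fst z)) (\<psi> z))" "continuous_on S (\<lambda>z. u2 (p (fst z)) (\<psi> z))"
      by (rule is_layer_continuous[OF lay2 pc that(1)]; use that(2) in blast)+
  qed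
  have W_cont: "continuous_on S (\<lambda>z. W1 (fst z))" "continuous_on S (\<lambda>z. W2 (fst z))"
    "continuous_on S (\<lambda>z. h1 (p (fst z)) m)" "continuous_on S (\<lambda>z. h2 (p (fst z)) l)"
    if S: "\<And>z. z \<in> S \<Longrightarrow> R \<le> fst z" for S :: "(real \<times> real) set"
  proof -
    show c1: "continuous_on S (\<lambda>z. h1 (p (fst z)) m)" and c2: "continuous_on S (\<lambda>z. h2 (p (fst z)) l)"
      using cont(1)[of S "\<lambda>_. m"] cont'(1)[of S "\<lambda>_. l"] S l m by auto
    have d: "continuous_on S (\<lambda>z. u1 (p (fst z)) m)" "continuous_on S (\<lambda>z. u2 (p (fst z)) l)"
      using cont(2)[of S "\<lambda>_. m"] cont'(2)[of S "\<lambda>_. l"] S l m by auto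
    show "continuous_on S (\<lambda>z. W1 (fst z))" "continuous_on S (\<lambda>z. W2 (fst z))"
      unfolding W1_def W2_def using c1 c2 d E1(1)[OF S] E2(1)[OF S] by (auto intro!: continuous_on_divide; force)+
  qed
  have hne: "h1 (p r) m \<noteq> 0" "h2 (p r) l \<noteq> 0" if "R \<le> r" for r using E1(1)[OF that] E2(1)[OF that] by auto
  have absM: "\<bar>W2 r * x1 / h1 (p r) m\<bar> = W2 r * x1 / h1 (p r) m" if "R \<le> r" for r
    using E1(1)[OF that] W2(3)[OF that] x a by simp
  have absP: "\<bar>W1 r * x2 / h2 (p r) l\<bar> = W1 r * x2 / h2 (p r) l" if "R \<le> r" for r
    using E2(1)[OF that] W1(3)[OF that] x a by simp
  define K where "K = M * b * (1 + M)"
  have K1: "M * b \<le> K" and K2: "M * b * M \<le> K" using M b by (simp_all add: K_def algebra_simps)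
  have bound: "W * y / hL * h \<le> K * r \<and> W * y / hL * u \<le> K * r\<^sup>2"
    if "1 \<le> r" "0 < W" "W \<le> M * r" "0 < y" "y \<le> b" "1 \<le> hL" "1 \<le> h" "h \<le> hL" "0 \<le> u" "u \<le> M * r * h" for r W y hL h u
  proof -
    have "W * y \<le> (M * r) * b" using that M by (intro mult_mono) auto
    moreover have q: "h / hL \<le> 1" "0 \<le> h / hL" using that by auto
    ultimately have "(W * y) * (h / hL) \<le> ((M * r) * b) * 1" using that M b by (intro mult_mono) auto
    then have 1: "W * y / hL * h \<le> M * b * r" by (simp add: mult_ac)
    also have "\<dots> \<le> K * r" using K1 that by (intro mult_right_mono) auto
    finally have H: "W * y / hL * h \<le> K * r" .
    have "W * y / hL * u \<le> W * y / hL * (M * r * h)" using that by (intro mult_left_mono) auto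
    also have "\<dots> = (W * y / hL * h) * (M * r)" by simp
    also have "\<dots> \<le> (M * b * r) * (M * r)" using 1 that M by (intro mult_right_mono) auto
    also have "\<dots> = M * b * M * r\<^sup>2" by (simp add: power2_eq_square)
    also have "\<dots> \<le> K * r\<^sup>2" using K2 by (intro mult_right_mono) auto
    finally show ?thesis using H by simp
  qed
  show ?thesis
  proof (rule that[of R \<theta> "\<kappa> * a / 3" f HM UM HP UP K])
    show "1 \<le> R" "0 < \<theta>" "0 < \<kappa> * a / 3" "continuous_on {R..} f" using R \<theta> \<kappa> a f_cont by auto
    show "1 < f r \<and> \<theta> * r \<le> f r \<and> f r \<le> r\<^sup>2" if "R \<le> r" for r by (rule f[OF that])
    show "continuous_on ({R..} \<times> {-m..0}) (\<lambda>z. HM (fst z) (snd z))" "continuous_on ({R..} \<times> {-m..0}) (\<lambda>z. UM (fst z) (snd z))"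
      unfolding HM_def UM_def using hne by (intro continuous_intros cont W_cont; force)+
    show "continuous_on ({R..} \<times> {0..l}) (\<lambda>z. HP (fst z) (snd z))" "continuous_on ({R..} \<times> {0..l}) (\<lambda>z. UP (fst z) (snd z))"
      unfolding HP_def UP_def using hne by (intro continuous_intros cont' W_cont; force)+
    fix r assume r: "R \<le> r"
    have p: "fst (p r) = wave_square w r (f r)" "snd (p r) = f r" by (simp_all add: p_def)
    show "(HM r has_real_derivative UM r s / \<rho>M s) (at s)"
      "(UM r has_real_derivative \<rho>M s * (wave_square w r (f r) + f r * cM s) * HM r s) (at s)" if s: "s \<in> {-m<..<0}" for s
    proof -
      have s': "s + m \<in> {0<..<m}" using s by auto
      have sh: "((\<lambda>s. s + m) has_real_derivative 1) (at s)" by (auto intro!: derivative_eq_intros)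
      show "(HM r has_real_derivative UM r s / \<rho>M s) (at s)"
        unfolding HM_def UM_def
        by (rule DERIV_cong[OF DERIV_cmult[OF DERIV_chain2[OF is_layer_DERIV(1)[OF lay1 s'] sh]]]) (simp add: \<rho>1_def)
      show "(UM r has_real_derivative \<rho>M s * (wave_square w r (f r) + f r * cM s) * HM r s) (at s)"
        unfolding HM_def UM_def
        by (rule DERIV_cong[OF DERIV_cmult[OF DERIV_chain2[OF is_layer_DERIV(2)[OF lay1 s'] sh]]]) (simp add: \<rho>1_def c1_def p)
    qed
    show "(HP r has_real_derivative UP r s / \<rho>P s) (at s)"
      "(UP r has_real_derivative \<rho>P s * (wave_square w r (f r) + f r * cP s) * HP r s) (at s)" if s: "s \<in> {0<..<l}" for s
    proof -
      have s': "l - s \<in> {0<..<l}" using s by auto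
      have sh: "((\<lambda>s. l - s) has_real_derivative -1) (at s)" by (auto intro!: derivative_eq_intros)
      show "(HP r has_real_derivative UP r s / \<rho>P s) (at s)"
        unfolding HP_def UP_def
        by (rule DERIV_cong[OF DERIV_cmult[OF DERIV_chain2[OF is_layer_DERIV(1)[OF lay2 s'] sh]]]) (simp add: \<rho>2_def)
      show "(UP r has_real_derivative \<rho>P s * (wave_square w r (f r) + f r * cP s) * HP r s) (at s)"
        unfolding HP_def UP_def
        by (rule DERIV_cong[OF DERIV_cmult[OF DERIV_chain2[OF is_layer_DERIV(2)[OF lay2 s'] sh]]]) (simp add: \<rho>2_def c2_def p)
    qed
    have "m / 2 \<in> {0<..<m}" "l / 2 \<in> {0<..<l}" using l m by auto
    from is_layer_DERIV(3)[OF lay1 this(1)] is_layer_DERIV(3)[OF lay2 this(2)]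
    show "UM r (-m) = 0" "UP r l = 0" by (simp_all add: UM_def UP_def)
    have UM0: "UM r 0 = - (W1 r * W2 r * x1)" and UP0: "UP r 0 = - (W1 r * W2 r * x2)"
      by (simp_all add: UM_def UP_def W1_def W2_def mult_ac)
    show "UM r 0 / \<rho>M 0 = UP r 0 / \<rho>P 0"
      using x a by (simp add: UM0 UP0 flip: x1_def x2_def)
    have HM0: "HM r 0 = - (W2 r * x1)" and HP0: "HP r 0 = W1 r * x2"
      using hne[OF r] by (simp_all add: HM_def HP_def)
    have "f r * (x1\<^sup>2 / W1 r + x2\<^sup>2 / W2 r) = g * (x2 - x1)"
      using disp[OF r, of "p r"] by (simp add: p_def W1_def W2_def)
    then have "f r * (x1\<^sup>2 * W2 r + x2\<^sup>2 * W1 r) = g * (x2 - x1) * (W1 r * W2 r)"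
      using W1(3)[OF r] W2(3)[OF r] by (simp add: field_simps)
    then have "x1\<^sup>2 * W2 r + x2\<^sup>2 * W1 r = g * (x2 - x1) * (W1 r * W2 r) / f r"
      using fr(2)[OF r] by (simp add: field_simps)
    then show "\<rho>M 0 * HM r 0 + g * UM r 0 / f r = \<rho>P 0 * HP r 0 + g * UP r 0 / f r"
      unfolding HM0 HP0 UM0 UP0 x1_def[symmetric] x2_def[symmetric]
      using fr(2)[OF r] by (simp add: field_simps power2_eq_square)
    show "\<bar>HM r s\<bar> \<le> K * r \<and> \<bar>UM r s\<bar> \<le> K * r\<^sup>2" if s: "s \<in> {-m..0}" for s
    proof -
      have s': "s + m \<in> {0..m}" using s by auto
      have "1 \<le> h1 (p r) m" using E1(1)[OF r] by simp
      then show ?thesis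
        unfolding HM_def UM_def abs_mult abs_minus_cancel absM[OF r]
        using bound[OF fr(1)[OF r] W2(3,2)[OF r] _ x(3) _ L1(2)[OF r s'] L1(4)[OF r s'] L1(3)[OF r s'] L1(1)[OF r s']] x a
          L1(2,3)[OF r s'] by simp
    qed
    show "\<bar>HP r s\<bar> \<le> K * r \<and> \<bar>UP r s\<bar> \<le> K * r\<^sup>2" if s: "s \<in> {0..l}" for s
    proof -
      have s': "l - s \<in> {0..l}" using s by auto
      have "1 \<le> h2 (p r) l" using E2(1)[OF r] by simp
      then show ?thesis
        unfolding HP_def UP_def abs_mult abs_minus_cancel absP[OF r]
        using bound[OF fr(1)[OF r] W1(3,2)[OF r] _ x(4) _ L2(2)[OF r s'] L2(4)[OF r s'] L2(3)[OF r s'] L2(1)[OF r s']] x a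
          L2(2,3)[OF r s'] by simp
    qed
    \<comment> \<open>In the lower layer h grows from 1 at the wall to at least 3/2 at the
      interface, so H changes by at least a third of its interface value. This oscillation later
      bounds the vertical displacement from below.\<close>
    show "\<kappa> * a / 3 \<le> \<bar>HM r 0 - HM r (-m)\<bar>"
    proof -
      have h0: "h1 (p r) 0 = 1" using lay1 unfolding is_layer_def layer_solution_def by blast
      have "1 / h1 (p r) m \<le> 2 / 3" using E1(1)[OF r] by (simp add: field_simps)
      then have A: "1 / 3 \<le> 1 - 1 / h1 (p r) m" by simp
      have B: "\<kappa> * a \<le> W2 r * x1"
      proof (rule mult_mono)
        have "\<kappa> * 1 \<le> \<kappa> * r" using \<kappa> fr(1)[OF r] by (intro mult_left_mono) auto
        then show "\<kappa> \<le> W2 r" using W2(1)[OF r] by simp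
      qed (use x a W2(3)[OF r] in auto)
      have "\<kappa> * a * (1 / 3) \<le> W2 r * x1 * (1 - 1 / h1 (p r) m)"
        by (rule mult_mono[OF B A]) (use W2(3)[OF r] x a in simp_all)
      moreover have "HM r 0 - HM r (-m) = - (W2 r * x1 * (1 - 1 / h1 (p r) m))"
        using hne[OF r] by (simp add: HM_def h0 field_simps)
      ultimately show ?thesis by simp
    qed
  qed
qed

section \<open>Regularity of the steady density and of the modes\<close>

text \<open>A zero of the continuous derivative would make its reciprocal exceed any given bound on
  an interval of positive length, against local essential boundedness.\<close>

lemma pressure_law_deriv_pos:
  assumes p: "pressure_law p" and z: "0 < z"
  shows "0 < deriv p z"
proof -
  have sm: "smooth_on {0<..} p" using p by (simp add: pressure_law_def)
  have D: "(p has_real_derivative deriv p y) (at y)" if "0 < y" for y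
    using smooth_on_DERIV[OF sm] that by simp
  have nn: "0 \<le> deriv p z"
  proof (rule mono_on_imp_deriv_nonneg[of "{0<..}" p])
    show "mono_on {0<..} p" using p by (auto simp: pressure_law_def intro: strict_mono_on_imp_mono_on)
    show "(p has_real_derivative deriv p z) (at z)" by (rule D[OF z])
    show "z \<in> interior {0<..}" using z by (simp add: interior_open)
  qed
  moreover have "deriv p z \<noteq> 0"
  proof
    assume 0: "deriv p z = 0"
    have sub: "compact {z / 2..2 * z} \<and> {z / 2..2 * z} \<subseteq> {0<..}" using z by auto
    then obtain C where C: "AE y in lborel. y \<in> {z / 2..2 * z} \<longrightarrow> deriv p y \<noteq> 0 \<and> \<bar>1 / deriv p y\<bar> \<le> C"
      using p unfolding pressure_law_def by blast
    \<comment> \<open>Where a nonzero derivative is smaller than \<open>e\<close> in absolute value,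
      its reciprocal exceeds \<bar>C\<bar> in absolute value.\<close>
    define e where "e = 1 / (\<bar>C\<bar> + 1)"
    have e: "0 < e" by (simp add: e_def)
    have "isCont (deriv p) z" using DERIV_isCont smooth_on_DERIV[OF smooth_on_deriv[OF sm]] z by auto
    then have "\<forall>\<^sub>F y in nhds z. dist (deriv p y) (deriv p z) < e"
      using e by (metis tendstoD isCont_def tendsto_at_iff_tendsto_nhds)
    then obtain d where d: "0 < d" "\<And>y. dist y z < d \<Longrightarrow> \<bar>deriv p y\<bar> < e"
      by (auto simp: eventually_nhds_metric 0 dist_real_def)
    define d' where "d' = min d (z / 2)"
    have d': "0 < d'" using d z by (simp add: d'_def)
    have "AE y in lborel. y \<notin> {z<..<z + d'}"
      using C
    proof eventually_elim
      case (elim y)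
      show ?case
      proof
        assume y: "y \<in> {z<..<z + d'}"
        then have "y \<in> {z / 2..2 * z}" "dist y z < d" using z by (auto simp: d'_def dist_real_def)
        then have "deriv p y \<noteq> 0" "\<bar>1 / deriv p y\<bar> \<le> C" "\<bar>deriv p y\<bar> < e" using elim d(2) by auto
        then have "1 \<le> C * \<bar>deriv p y\<bar>" by (simp add: field_simps)
        also have "\<dots> \<le> \<bar>C\<bar> * \<bar>deriv p y\<bar>" by (intro mult_right_mono) auto
        also have "\<dots> \<le> \<bar>C\<bar> * e" using \<open>\<bar>deriv p y\<bar> < e\<close> by (intro mult_left_mono) auto
        also have "\<dots> < 1" by (simp add: e_def)
        finally show False by simp
      qed
    qed
    then have "emeasure lborel {z<..<z + d'} = 0"
      by (subst (asm) AE_iff_measurable[of "{z<..<z + d'}"]) auto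
    then show False using d' by simp
  qed
  ultimately show ?thesis by simp
qed

text \<open>The steady density is given only inside the open layer, whereas the mode equations are
  solved up to wall and interface. Hydrostatic balance bounds its derivative, so it is Lipschitz and
  extends continuously to the closed layer with the same bounds.\<close>

lemma density_extension:
  fixes \<rho> p :: "real \<Rightarrow> real"
  assumes \<alpha>\<beta>: "\<alpha> < \<beta>" and a: "0 < a" and bd: "\<And>s. s \<in> {\<alpha><..<\<beta>} \<Longrightarrow> a \<le> \<rho> s \<and> \<rho> s \<le> b"
    and sm: "smooth_on {\<alpha><..<\<beta>} \<rho>" and p: "pressure_law p"
    and eq: "\<And>s. s \<in> {\<alpha><..<\<beta>} \<Longrightarrow> ((\<lambda>r. p (\<rho> r)) has_real_derivative (- g * \<rho> s)) (at s)"
  shows "\<And>s. s \<in> {\<alpha><..<\<beta>} \<Longrightarrow> (\<rho> has_real_derivative - g * inverse (deriv p (\<rho> s)) * \<rho> s) (at s)"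
    and "\<exists>\<rho>'. continuous_on {\<alpha>..\<beta>} \<rho>' \<and> (\<forall>s\<in>{\<alpha><..<\<beta>}. \<rho>' s = \<rho> s) \<and> (\<forall>s\<in>{\<alpha>..\<beta>}. a \<le> \<rho>' s \<and> \<rho>' s \<le> b)"
    and "\<exists>C. \<forall>z\<in>{a..b}. 0 \<le> inverse (deriv p z) \<and> inverse (deriv p z) \<le> C"
    and "smooth_on {0<..} (\<lambda>z. inverse (deriv p z))"
proof -
  have psm: "smooth_on {0<..} p" using p by (simp add: pressure_law_def)
  show inv_sm: "smooth_on {0<..} (\<lambda>z. inverse (deriv p z))"
    by (rule smooth_on_inverse) (use pressure_law_deriv_pos[OF p] psm in \<open>auto simp: less_imp_neq[symmetric]\<close>)
  show D: "(\<rho> has_real_derivative - g * inverse (deriv p (\<rho> s)) * \<rho> s) (at s)" if s: "s \<in> {\<alpha><..<\<beta>}" for s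
  proof -
    have \<rho>s: "0 < \<rho> s" using bd[OF s] a by simp
    have 1: "(\<rho> has_real_derivative deriv \<rho> s) (at s)" by (rule smooth_on_DERIV[OF sm s])
    have "(p has_real_derivative deriv p (\<rho> s)) (at (\<rho> s))" by (rule smooth_on_DERIV[OF psm]) (use \<rho>s in simp)
    from DERIV_unique[OF DERIV_chain2[OF this 1] eq[OF s]]
    have "deriv p (\<rho> s) * deriv \<rho> s = - g * \<rho> s" .
    then have "deriv \<rho> s = - g * inverse (deriv p (\<rho> s)) * \<rho> s"
      using pressure_law_deriv_pos[OF p \<rho>s] by (simp add: field_simps)
    with 1 show ?thesis by simp
  qed
  have "continuous_on {a..b} (\<lambda>z. inverse (deriv p z))"
    by (rule continuous_on_subset[OF smooth_on_imp_continuous_on[OF inv_sm]]) (use a in auto)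
  then have "bounded ((\<lambda>z. inverse (deriv p z)) ` {a..b})"
    by (intro compact_imp_bounded compact_continuous_image) auto
  then obtain C where C: "\<And>z. z \<in> {a..b} \<Longrightarrow> \<bar>inverse (deriv p z)\<bar> \<le> C" unfolding bounded_iff by (metis image_eqI real_norm_def)
  have C0: "0 \<le> inverse (deriv p z) \<and> inverse (deriv p z) \<le> C" if "z \<in> {a..b}" for z
    using C[OF that] pressure_law_deriv_pos[OF p, of z] a that by auto
  then show "\<exists>C. \<forall>z\<in>{a..b}. 0 \<le> inverse (deriv p z) \<and> inverse (deriv p z) \<le> C" by blast
  have lip: "\<bar>\<rho> s - \<rho> t\<bar> \<le> (\<bar>g\<bar> * \<bar>C\<bar> * \<bar>b\<bar>) * \<bar>s - t\<bar>" if "s \<in> {\<alpha><..<\<beta>}" "t \<in> {\<alpha><..<\<beta>}" for s t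
  proof -
    have "norm (\<rho> s - \<rho> t) \<le> (\<bar>g\<bar> * \<bar>C\<bar> * \<bar>b\<bar>) * norm (s - t)"
    proof (rule field_differentiable_bound[OF convex_real_interval(8)])
      fix x assume x: "x \<in> {\<alpha><..<\<beta>}"
      show "(\<rho> has_real_derivative - g * inverse (deriv p (\<rho> x)) * \<rho> x) (at x within {\<alpha><..<\<beta>})"
        by (rule has_field_derivative_at_within[OF D[OF x]])
      have "\<bar>inverse (deriv p (\<rho> x))\<bar> \<le> \<bar>C\<bar>" "\<bar>\<rho> x\<bar> \<le> \<bar>b\<bar>" using C[of "\<rho> x"] bd[OF x] a by auto
      then show "norm (- g * inverse (deriv p (\<rho> x)) * \<rho> x) \<le> \<bar>g\<bar> * \<bar>C\<bar> * \<bar>b\<bar>"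
        unfolding real_norm_def abs_mult abs_minus_cancel by (intro mult_mono) auto
    qed (use that in auto)
    then show ?thesis by simp
  qed
  have "uniformly_continuous_on {\<alpha><..<\<beta>} \<rho>"
  proof (rule lipschitz_on_uniformly_continuous[of "\<bar>g\<bar> * \<bar>C\<bar> * \<bar>b\<bar>"], rule lipschitz_onI)
    show "dist (\<rho> s) (\<rho> t) \<le> \<bar>g\<bar> * \<bar>C\<bar> * \<bar>b\<bar> * dist s t" if "s \<in> {\<alpha><..<\<beta>}" "t \<in> {\<alpha><..<\<beta>}" for s t
      using lip[OF that] by (simp add: dist_real_def)
  qed simp
  then obtain \<rho>' where \<rho>': "uniformly_continuous_on (closure {\<alpha><..<\<beta>}) \<rho>'" "\<And>s. s \<in> {\<alpha><..<\<beta>} \<Longrightarrow> \<rho> s = \<rho>' s"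
    using uniformly_continuous_on_extension_on_closure by metis
  have cl: "closure {\<alpha><..<\<beta>} = {\<alpha>..\<beta>}" using \<alpha>\<beta> by simp
  have cont: "continuous_on {\<alpha>..\<beta>} \<rho>'" using \<rho>'(1) uniformly_continuous_imp_continuous cl by metis
  have "\<rho>' ` closure {\<alpha><..<\<beta>} \<subseteq> {a..b}"
    by (rule image_closure_subset) (use cont cl bd \<rho>'(2) in force)+
  then have "\<forall>s\<in>{\<alpha>..\<beta>}. a \<le> \<rho>' s \<and> \<rho>' s \<le> b" unfolding cl by auto
  then show "\<exists>\<rho>'. continuous_on {\<alpha>..\<beta>} \<rho>' \<and> (\<forall>s\<in>{\<alpha><..<\<beta>}. \<rho>' s = \<rho> s) \<and> (\<forall>s\<in>{\<alpha>..\<beta>}. a \<le> \<rho>' s \<and> \<rho>' s \<le> b)"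
    using cont \<rho>'(2) by (intro exI[of _ \<rho>']) auto
qed

text \<open>The vertical derivatives of a mode are combinations of \<open>H\<close> and \<open>U\<close> whose coefficients are smooth
  functions of the density and polynomially bounded in the size \<open>N\<close> of the wave vector.\<close>
locale mode_profiles =
  fixes I :: "real set" and \<rho> q :: "real \<Rightarrow> real" and g a b :: real
    and N A B :: "'k \<Rightarrow> real" and H U :: "'k \<Rightarrow> real \<Rightarrow> real" and K :: real
  assumes \<rho>_D: "\<And>s. s \<in> I \<Longrightarrow> (\<rho> has_real_derivative - g * q (\<rho> s) * \<rho> s) (at s)"
    and q_smooth: "smooth_on {0<..} q"
    and a: "0 < a" and \<rho>_bd: "\<And>s. s \<in> I \<Longrightarrow> a \<le> \<rho> s \<and> \<rho> s \<le> b"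
    and N: "\<And>k. 1 \<le> N k" and AB: "\<And>k. \<bar>A k\<bar> \<le> (N k)\<^sup>2" "\<And>k. \<bar>B k\<bar> \<le> (N k)\<^sup>2"
    and H_D: "\<And>k s. s \<in> I \<Longrightarrow> (H k has_real_derivative U k s / \<rho> s) (at s)"
    and U_D: "\<And>k s. s \<in> I \<Longrightarrow> (U k has_real_derivative \<rho> s * (A k + B k * q (\<rho> s)) * H k s) (at s)"
    and HU_bd: "\<And>k s. s \<in> I \<Longrightarrow> \<bar>H k s\<bar> \<le> K * (N k)\<^sup>2 \<and> \<bar>U k s\<bar> \<le> K * (N k)\<^sup>2"
begin

definition poly_bounded :: "('k \<Rightarrow> real) \<Rightarrow> bool" where
  "poly_bounded f \<longleftrightarrow> (\<exists>C n. 0 \<le> C \<and> (\<forall>k. \<bar>f k\<bar> \<le> C * N k ^ n))"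

lemma poly_boundedI: "0 \<le> C \<Longrightarrow> (\<And>k. \<bar>f k\<bar> \<le> C * N k ^ n) \<Longrightarrow> poly_bounded f"
  unfolding poly_bounded_def by blast

lemma poly_bounded_mult: "poly_bounded f \<Longrightarrow> poly_bounded h \<Longrightarrow> poly_bounded (\<lambda>k. f k * h k)"
  unfolding poly_bounded_def
proof (elim exE conjE)
  fix C n D m assume C: "0 \<le> C" "\<forall>k. \<bar>f k\<bar> \<le> C * N k ^ n" and D: "0 \<le> D" "\<forall>k. \<bar>h k\<bar> \<le> D * N k ^ m"
  have "\<bar>f k * h k\<bar> \<le> (C * D) * N k ^ (n + m)" for k
  proof -
    have "\<bar>f k * h k\<bar> \<le> (C * N k ^ n) * (D * N k ^ m)"
      unfolding abs_mult using C D N[of k] by (intro mult_mono) (auto intro: order_trans[OF abs_ge_zero])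
    then show ?thesis by (simp add: power_add mult_ac)
  qed
  then show "\<exists>C n. 0 \<le> C \<and> (\<forall>k. \<bar>f k * h k\<bar> \<le> C * N k ^ n)" using C D by (intro exI[of _ "C * D"] exI[of _ "n + m"]) auto
qed

text \<open>The class is closed under differentiation because the derivative of \<rho> is a smooth
  function of \<rho> itself, and because differentiating U brings in only \<open>A\<close>,
  \<open>B\<close> and functions of \<rho>. Each derivative thus costs a fixed power of
  \<open>N\<close>.\<close>

inductive profile :: "('k \<Rightarrow> real \<Rightarrow> real) \<Rightarrow> bool" where
  H: "poly_bounded f \<Longrightarrow> smooth_on {0<..} \<phi> \<Longrightarrow> profile (\<lambda>k s. f k * \<phi> (\<rho> s) * H k s)"
| U: "poly_bounded f \<Longrightarrow> smooth_on {0<..} \<phi> \<Longrightarrow> profile (\<lambda>k s. f k * \<phi> (\<rho> s) * U k s)"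
| add: "profile u \<Longrightarrow> profile v \<Longrightarrow> profile (\<lambda>k s. u k s + v k s)"

lemma profile_bounded:
  assumes "profile u"
  shows "\<exists>C n. 0 \<le> C \<and> (\<forall>k. \<forall>s\<in>I. \<bar>u k s\<bar> \<le> C * N k ^ n)"
  using assms
proof induction
  have base: "\<exists>C n. 0 \<le> C \<and> (\<forall>k. \<forall>s\<in>I. \<bar>f k * \<phi> (\<rho> s) * V k s\<bar> \<le> C * N k ^ n)"
    if f: "poly_bounded f" and \<phi>: "smooth_on {0<..} \<phi>" and V: "\<And>k s. s \<in> I \<Longrightarrow> \<bar>V k s\<bar> \<le> K * (N k)\<^sup>2" for f \<phi> V
  proof -
    obtain C n where C: "0 \<le> C" "\<And>k. \<bar>f k\<bar> \<le> C * N k ^ n" using f by (auto simp: poly_bounded_def)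
    have "continuous_on {a..b} \<phi>"
      by (rule continuous_on_subset[OF smooth_on_imp_continuous_on[OF \<phi>]]) (use a in auto)
    then have "bounded (\<phi> ` {a..b})" by (intro compact_imp_bounded compact_continuous_image) auto
    then obtain D where D: "\<And>z. z \<in> {a..b} \<Longrightarrow> \<bar>\<phi> z\<bar> \<le> D" unfolding bounded_iff by (metis image_eqI real_norm_def)
    have "\<bar>f k * \<phi> (\<rho> s) * V k s\<bar> \<le> (C * \<bar>D\<bar> * \<bar>K\<bar>) * N k ^ (n + 2)" if s: "s \<in> I" for k s
    proof -
      have 1: "\<bar>\<phi> (\<rho> s)\<bar> \<le> \<bar>D\<bar>" using D[of "\<rho> s"] \<rho>_bd[OF s] by auto
      have "\<bar>V k s\<bar> \<le> \<bar>K\<bar> * (N k)\<^sup>2" using V[OF s, of k] mult_right_mono[OF abs_ge_self[of K], of "(N k)\<^sup>2"] by simp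
      then have "\<bar>f k * \<phi> (\<rho> s) * V k s\<bar> \<le> ((C * N k ^ n) * \<bar>D\<bar>) * (\<bar>K\<bar> * (N k)\<^sup>2)"
        unfolding abs_mult using C(1) C(2)[of k] N[of k] 1 by (intro mult_mono) auto
      then show ?thesis by (simp add: power_add power2_eq_square mult_ac)
    qed
    then show ?thesis using C(1) by (intro exI[of _ "C * \<bar>D\<bar> * \<bar>K\<bar>"] exI[of _ "n + 2"]) auto
  qed
  show "\<exists>C n. 0 \<le> C \<and> (\<forall>k. \<forall>s\<in>I. \<bar>f k * \<phi> (\<rho> s) * H k s\<bar> \<le> C * N k ^ n)" if "poly_bounded f" "smooth_on {0<..} \<phi>" for f \<phi>
    by (rule base[OF that]) (use HU_bd in blast)
  show "\<exists>C n. 0 \<le> C \<and> (\<forall>k. \<forall>s\<in>I. \<bar>f k * \<phi> (\<rho> s) * U k s\<bar> \<le> C * N k ^ n)" if "poly_bounded f" "smooth_on {0<..} \<phi>" for f \<phi>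
    by (rule base[OF that]) (use HU_bd in blast)
next
  case (add u v)
  then obtain C n D m where C: "0 \<le> C" "\<forall>k. \<forall>s\<in>I. \<bar>u k s\<bar> \<le> C * N k ^ n" and D: "0 \<le> D" "\<forall>k. \<forall>s\<in>I. \<bar>v k s\<bar> \<le> D * N k ^ m"
    by auto
  have "\<bar>u k s + v k s\<bar> \<le> (C + D) * N k ^ (n + m)" if s: "s \<in> I" for k s
  proof -
    have "\<bar>u k s + v k s\<bar> \<le> C * N k ^ n + D * N k ^ m" using C D s by (meson abs_triangle_ineq add_mono order_trans)
    also have "\<dots> \<le> C * N k ^ (n + m) + D * N k ^ (n + m)"
      using C D N[of k] by (intro add_mono mult_left_mono power_increasing) auto
    finally show ?thesis by (simp add: distrib_right)
  qed
  then show ?case using C D by (intro exI[of _ "C + D"] exI[of _ "n + m"]) auto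
qed

lemma profile_derivative:
  assumes "profile u"
  shows "\<exists>u'. profile u' \<and> (\<forall>k. \<forall>s\<in>I. (u k has_real_derivative u' k s) (at s))"
  using assms
proof induction
  have open0: "open {0::real<..}" by simp
  have \<phi>D: "((\<lambda>s. \<phi> (\<rho> s)) has_real_derivative deriv \<phi> (\<rho> s) * (- g * q (\<rho> s) * \<rho> s)) (at s)"
    if "smooth_on {0<..} \<phi>" "s \<in> I" for \<phi> s
    by (rule DERIV_chain2[OF smooth_on_DERIV[OF that(1)] \<rho>_D[OF that(2)]]) (use \<rho>_bd[OF that(2)] a in auto)
  have sm': "smooth_on {0<..} (\<lambda>z. deriv \<phi> z * ((- g * q z) * z))" if "smooth_on {0<..} \<phi>" for \<phi>
    using that q_smooth open0 by (intro smooth_on_mult smooth_on_const smooth_on_ident smooth_on_deriv)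
  have inv: "smooth_on {0<..} (\<lambda>z. \<phi> z * inverse z)" if "smooth_on {0<..} \<phi>" for \<phi>
    by (intro smooth_on_mult that smooth_on_inverse open0 smooth_on_ident) auto
  {
    case (H f \<phi>)
    have "profile (\<lambda>k s. f k * (deriv \<phi> (\<rho> s) * ((- g * q (\<rho> s)) * \<rho> s)) * H k s + f k * (\<phi> (\<rho> s) * inverse (\<rho> s)) * U k s)"
      by (rule profile.add[OF profile.H[OF H(1) sm'[OF H(2)]] profile.U[OF H(1) inv[OF H(2)]]])
    moreover have "((\<lambda>s. f k * \<phi> (\<rho> s) * H k s) has_real_derivative
       f k * (deriv \<phi> (\<rho> s) * ((- g * q (\<rho> s)) * \<rho> s)) * H k s + f k * (\<phi> (\<rho> s) * inverse (\<rho> s)) * U k s) (at s)" if "s \<in> I" for k s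
      by (rule DERIV_cong[OF DERIV_mult[OF DERIV_cmult[OF \<phi>D[OF H(2) that]] H_D[OF that]]]) (simp add: divide_inverse algebra_simps)
    ultimately show ?case by blast
  next
    case (U f \<phi>)
    have pA: "poly_bounded (\<lambda>k. f k * A k)" "poly_bounded (\<lambda>k. f k * B k)"
      by (rule poly_bounded_mult[OF U(1) poly_boundedI[of 1 _ 2]]; use AB in simp)+
    have s1: "smooth_on {0<..} (\<lambda>z. \<phi> z * z)" "smooth_on {0<..} (\<lambda>z. \<phi> z * (z * q z))"
      using U(2) q_smooth open0 by (auto intro!: smooth_on_mult smooth_on_ident)
    have "profile (\<lambda>k s. f k * (deriv \<phi> (\<rho> s) * ((- g * q (\<rho> s)) * \<rho> s)) * U k s
        + ((f k * A k) * (\<phi> (\<rho> s) * \<rho> s) * H k s + (f k * B k) * (\<phi> (\<rho> s) * (\<rho> s * q (\<rho> s))) * H k s))"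
      by (rule profile.add[OF profile.U[OF U(1) sm'[OF U(2)]] profile.add[OF profile.H[OF pA(1) s1(1)] profile.H[OF pA(2) s1(2)]]])
    moreover have "((\<lambda>s. f k * \<phi> (\<rho> s) * U k s) has_real_derivative
       f k * (deriv \<phi> (\<rho> s) * ((- g * q (\<rho> s)) * \<rho> s)) * U k s
        + ((f k * A k) * (\<phi> (\<rho> s) * \<rho> s) * H k s + (f k * B k) * (\<phi> (\<rho> s) * (\<rho> s * q (\<rho> s))) * H k s)) (at s)" if "s \<in> I" for k s
      by (rule DERIV_cong[OF DERIV_mult[OF DERIV_cmult[OF \<phi>D[OF U(2) that]] U_D[OF that]]]) (simp add: algebra_simps)
    ultimately show ?case by blast
  next
    case (add u v)
    then obtain u' v' where "profile u'" "profile v'" "\<forall>k. \<forall>s\<in>I. (u k has_real_derivative u' k s) (at s)" "\<forall>k. \<forall>s\<in>I. (v k has_real_derivative v' k s) (at s)"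
      by auto
    then show ?case by (intro exI[of _ "\<lambda>k s. u' k s + v' k s"]) (auto intro!: profile.add DERIV_add)
  }
qed

text \<open>Dependent choice turns the existence of a derivative within the class into a whole
  sequence of derivatives, each of them polynomially bounded.\<close>

lemma profile_derivatives:
  assumes "profile u"
  obtains D where "D 0 = u" "\<And>i. profile (D i)" "\<And>i k s. s \<in> I \<Longrightarrow> (D i k has_real_derivative D (Suc i) k s) (at s)"
proof -
  have "\<exists>D. \<forall>i::nat. (profile (D i) \<and> (i = 0 \<longrightarrow> D i = u)) \<and> (\<forall>k. \<forall>s\<in>I. (D i k has_real_derivative D (Suc i) k s) (at s))"
  proof (rule dependent_nat_choice)
    show "\<exists>x. profile x \<and> (0 = (0::nat) \<longrightarrow> x = u)" using assms by blast
    show "\<exists>y. (profile y \<and> (Suc n = 0 \<longrightarrow> y = u)) \<and> (\<forall>k. \<forall>s\<in>I. (x k has_real_derivative y k s) (at s))"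
      if "profile x \<and> (n = 0 \<longrightarrow> x = u)" for x n
      using profile_derivative[of x] that by blast
  qed
  then show ?thesis using that by blast
qed

end

section \<open>Wave packets\<close>

locale wave_packet =
  fixes amp gam :: "real^2 \<Rightarrow> real" and rad :: real
  assumes amp_cont: "continuous_on UNIV amp" and gam_cont: "continuous_on UNIV gam"
    and amp_supp: "\<And>\<xi>. \<xi> \<notin> cball 0 rad \<Longrightarrow> amp \<xi> = 0"
begin

text \<open>A box around the support of \<open>amp\<close>, because integrals over
  \<open>cbox\<close> can be differentiated under the integral sign.\<close>

definition wbox :: "(real^2) set" where
  "wbox = cbox (\<chi> i. - rad) (\<chi> i. rad)"

definition phase :: "real^2 \<Rightarrow> real^3 \<Rightarrow> real" where
  "phase \<xi> x = \<xi> $ 1 * x $ 1 + \<xi> $ 2 * x $ 2"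

text \<open>A real superposition with a free phase: \<delta> = 0 gives cosines, \<delta> = - pi/2
  gives sines, and a horizontal derivative multiplies the profile by a component of \<xi> and raises
  the phase by pi/2.\<close>

definition wave :: "(real^2 \<Rightarrow> real \<Rightarrow> real) \<Rightarrow> real \<Rightarrow> real \<Rightarrow> real^3 \<Rightarrow> real" where
  "wave b \<delta> t x = integral wbox (\<lambda>\<xi>. amp \<xi> * exp (gam \<xi> * t) * b \<xi> (x $ 3) * cos (phase \<xi> x + \<delta>))"

definition profile_cont :: "real set \<Rightarrow> (real^2 \<Rightarrow> real \<Rightarrow> real) \<Rightarrow> bool" where
  "profile_cont J b \<longleftrightarrow> continuous_on (UNIV \<times> J) (\<lambda>z. b (fst z) (snd z))"

lemma amp_supp_wbox: "\<xi> \<notin> wbox \<Longrightarrow> amp \<xi> = 0"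
proof (rule amp_supp)
  assume "\<xi> \<notin> wbox"
  then obtain i where "\<not> (- rad \<le> \<xi> $ i \<and> \<xi> $ i \<le> rad)" by (auto simp: wbox_def mem_box_cart)
  moreover have "\<bar>\<xi> $ i\<bar> \<le> norm \<xi>" by (rule component_le_norm_cart)
  ultimately show "\<xi> \<notin> cball 0 rad" by auto
qed

lemma wave_integrand_cont:
  assumes b: "profile_cont J b"
  shows "continuous_on ((UNIV \<times> slab J) \<times> S) (\<lambda>(z, \<xi>). amp \<xi> * exp (gam \<xi> * fst z) * b \<xi> (snd z $ 3) * cos (phase \<xi> (snd z) + \<delta>))"
proof -
  have 1: "continuous_on ((UNIV \<times> slab J) \<times> S) (\<lambda>w::(real \<times> (real^3)) \<times> (real^2). b (snd w) (snd (fst w) $ 3))"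
  proof -
    have "continuous_on ((UNIV \<times> slab J) \<times> S) (\<lambda>w::(real \<times> (real^3)) \<times> (real^2). (\<lambda>z. b (fst z) (snd z)) (snd w, snd (fst w) $ 3))"
      by (rule continuous_on_compose2[OF b[unfolded profile_cont_def]]) (auto intro!: continuous_intros simp: slab_def)
    then show ?thesis by simp
  qed
  have 2: "continuous_on ((UNIV \<times> slab J) \<times> S) (\<lambda>w::(real \<times> (real^3)) \<times> (real^2). amp (snd w))"
    "continuous_on ((UNIV \<times> slab J) \<times> S) (\<lambda>w::(real \<times> (real^3)) \<times> (real^2). gam (snd w))"
    by (rule continuous_on_compose2[OF amp_cont] continuous_on_compose2[OF gam_cont]; auto intro!: continuous_intros)+
  show ?thesis
    unfolding case_prod_unfold phase_def
    by (intro continuous_intros 1 2)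
qed

lemma wave_continuous:
  assumes b: "profile_cont J b"
  shows "continuous_on (UNIV \<times> slab J) (\<lambda>z. wave b \<delta> (fst z) (snd z))"
  unfolding wave_def wbox_def by (rule integral_continuous_on_param[OF wave_integrand_cont[OF b]])

lemma wave_continuous_x:
  assumes b: "profile_cont J b"
  shows "continuous_on (slab J) (\<lambda>x. wave b \<delta> t x)"
proof -
  have "continuous_on (slab J) (\<lambda>x. (\<lambda>z. wave b \<delta> (fst z) (snd z)) (t, x))"
    by (rule continuous_on_compose2[OF wave_continuous[OF b]]) (auto intro!: continuous_intros)
  then show ?thesis by simp
qed

lemma wave_integrable:
  assumes b: "profile_cont J b" and x: "x \<in> slab J"
  shows "(\<lambda>\<xi>. amp \<xi> * exp (gam \<xi> * t) * b \<xi> (x $ 3) * cos (phase \<xi> x + \<delta>)) integrable_on wbox"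
proof -
  have "continuous_on wbox (\<lambda>\<xi>. (\<lambda>(z, \<xi>). amp \<xi> * exp (gam \<xi> * fst z) * b \<xi> (snd z $ 3) * cos (phase \<xi> (snd z) + \<delta>)) ((t, x), \<xi>))"
    by (rule continuous_on_compose2[OF wave_integrand_cont[OF b, of wbox]]) (use x in \<open>auto intro!: continuous_intros\<close>)
  then show ?thesis unfolding wbox_def by (intro integrable_continuous) simp
qed

lemma wave_cong:
  assumes "\<And>\<xi>. amp \<xi> \<noteq> 0 \<Longrightarrow> b \<xi> (x $ 3) = b' \<xi> (x $ 3)"
  shows "wave b \<delta> t x = wave b' \<delta> t x"
  unfolding wave_def
proof (rule Henstock_Kurzweil_Integration.integral_cong)
  fix \<xi>
  show "amp \<xi> * exp (gam \<xi> * t) * b \<xi> (x $ 3) * cos (phase \<xi> x + \<delta>) = amp \<xi> * exp (gam \<xi> * t) * b' \<xi> (x $ 3) * cos (phase \<xi> x + \<delta>)"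
    using assms[of \<xi>] by (cases "amp \<xi> = 0") auto
qed

lemma wave_scale: "wave (\<lambda>\<xi> s. c s * b \<xi> s) \<delta> t x = c (x $ 3) * wave b \<delta> t x"
  unfolding wave_def by (subst integral_mult_right[symmetric]) (simp add: mult_ac)

text \<open>Horizontal derivatives of waves of phase 0 have phase pi/2 and must be compared with
  horizontal components of phase - pi/2.\<close>

lemma wave_half_turn: "wave b (pi / 2) t x = - wave b (- (pi / 2)) t x"
proof -
  have "cos (y + pi / 2) = - cos (y - pi / 2)" for y by (simp add: cos_add cos_diff)
  then show ?thesis unfolding wave_def by (simp flip: integral_neg)
qed

definition d_t :: "(real \<times> (real^3)) \<Rightarrow>\<^sub>L real" where "d_t = Blinfun fst"
definition d_x :: "3 \<Rightarrow> (real \<times> (real^3)) \<Rightarrow>\<^sub>L real" where "d_x i = Blinfun (\<lambda>d. snd d $ i)"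

lemma d_t_apply [simp]: "blinfun_apply d_t d = fst d"
  and d_x_apply [simp]: "blinfun_apply (d_x i) d = snd d $ i"
  unfolding d_t_def d_x_def
  by (subst bounded_linear_Blinfun_apply; auto intro!: bounded_linear_intros bounded_linear_compose[OF bounded_linear_vec_nth])+

definition wave_D :: "(real^2 \<Rightarrow> real \<Rightarrow> real) \<Rightarrow> (real^2 \<Rightarrow> real \<Rightarrow> real) \<Rightarrow> real \<Rightarrow> real \<times> (real^3) \<Rightarrow> (real \<times> (real^3)) \<Rightarrow>\<^sub>L real" where
  "wave_D b b' \<delta> z =
     wave (\<lambda>\<xi> s. gam \<xi> * b \<xi> s) \<delta> (fst z) (snd z) *\<^sub>R d_t +
     wave (\<lambda>\<xi> s. \<xi> $ 1 * b \<xi> s) (\<delta> + pi / 2) (fst z) (snd z) *\<^sub>R d_x 1 +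
     wave (\<lambda>\<xi> s. \<xi> $ 2 * b \<xi> s) (\<delta> + pi / 2) (fst z) (snd z) *\<^sub>R d_x 2 +
     wave b' \<delta> (fst z) (snd z) *\<^sub>R d_x 3"

lemma profile_cont_mult_gam: "profile_cont J b \<Longrightarrow> profile_cont J (\<lambda>\<xi> s. gam \<xi> * b \<xi> s)"
  and profile_cont_mult_nth: "profile_cont J b \<Longrightarrow> profile_cont J (\<lambda>\<xi> s. \<xi> $ i * b \<xi> s)"
  unfolding profile_cont_def
  by (auto intro!: continuous_intros continuous_on_compose2[OF gam_cont])

lemma wave_D_continuous:
  assumes "profile_cont J b" "profile_cont J b'"
  shows "continuous_on (UNIV \<times> slab J) (wave_D b b' \<delta>)"
  unfolding wave_D_def
  by (intro continuous_intros wave_continuous profile_cont_mult_gam profile_cont_mult_nth assms)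

lemma profile_cont_subset: "profile_cont J b \<Longrightarrow> I \<subseteq> J \<Longrightarrow> profile_cont I b"
  unfolding profile_cont_def by (erule continuous_on_subset) auto

lemma wave_has_derivative:
  assumes J: "open J" and b: "profile_cont J b" and b': "profile_cont J b'"
    and D: "\<And>\<xi> s. s \<in> J \<Longrightarrow> (b \<xi> has_real_derivative b' \<xi> s) (at s)"
    and x: "x \<in> slab J"
  shows "((\<lambda>z. wave b \<delta> (fst z) (snd z)) has_derivative blinfun_apply (wave_D b b' \<delta> (t, x))) (at (t, x))"
proof -
  \<comment> \<open>Differentiation under the integral is carried out over a convex domain, but
    \<open>J\<close> will be the disconnected union of two layers; hence the restriction to a ball
    around the vertical coordinate.\<close>
  obtain e where e: "0 < e" "ball (x $ 3) e \<subseteq> J" using J x by (auto simp: slab_def open_contains_ball)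
  define I where "I = ball (x $ 3) e"
  have IJ: "I \<subseteq> J" using e by (simp add: I_def)
  have bI: "profile_cont I b" "profile_cont I b'" using b b' IJ profile_cont_subset by blast+
  define U where "U = (UNIV :: real set) \<times> slab I"
  have "convex (slab I)"
  proof -
    have "slab I = (\<lambda>x. x $ 3) -` I" by (auto simp: slab_def)
    then show ?thesis unfolding I_def
      by (simp only:) (intro convex_linear_vimage convex_ball bounded_linear.linear bounded_linear_vec_nth)
  qed
  then have convex: "convex U" unfolding U_def by (intro convex_Times convex_UNIV)
  have openU: "open U" unfolding U_def I_def by (intro open_Times open_slab open_ball open_UNIV)
  have xU: "(t, x) \<in> U" using e by (simp add: U_def I_def slab_def)
  define E where "E = (\<lambda>z \<xi>. amp \<xi> * exp (gam \<xi> * fst z))"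
  define h where "h = (\<lambda>b \<delta> (z::real \<times> (real^3)) \<xi>. amp \<xi> * exp (gam \<xi> * fst z) * b \<xi> (snd z $ 3) * cos (phase \<xi> (snd z) + \<delta>))"
  define D' where "D' = (\<lambda>z \<xi>.
     h (\<lambda>\<xi> s. gam \<xi> * b \<xi> s) \<delta> z \<xi> *\<^sub>R d_t +
     h (\<lambda>\<xi> s. \<xi> $ 1 * b \<xi> s) (\<delta> + pi / 2) z \<xi> *\<^sub>R d_x 1 +
     h (\<lambda>\<xi> s. \<xi> $ 2 * b \<xi> s) (\<delta> + pi / 2) z \<xi> *\<^sub>R d_x 2 +
     h b' \<delta> z \<xi> *\<^sub>R d_x 3)"
  have "((\<lambda>z. integral wbox (h b \<delta> z)) has_derivative integral wbox (D' (t, x))) (at (t, x) within U)"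
    unfolding wbox_def
  proof (rule leibniz_rule[OF _ _ _ xU convex])
    fix z \<xi> assume z: "z \<in> U"
    then have s: "snd z $ 3 \<in> J" using IJ by (auto simp: U_def slab_def)
    have bs: "((\<lambda>z. b \<xi> (snd z $ 3)) has_derivative (\<lambda>d. snd d $ 3 * b' \<xi> (snd z $ 3))) (at z within U)"
    proof (rule DERIV_compose_FDERIV[where f = "b \<xi>" and g = "\<lambda>z. snd z $ 3" and x = z])
      show "(b \<xi> has_real_derivative b' \<xi> (snd z $ 3)) (at (snd z $ 3))" by (rule D[OF s])
      show "((\<lambda>z. snd z $ 3) has_derivative (\<lambda>d. snd d $ 3)) (at z within U)"
        by (auto intro!: derivative_eq_intros bounded_linear.has_derivative[OF bounded_linear_vec_nth])
    qed
    have ph: "((\<lambda>z. phase \<xi> (snd z) + \<delta>) has_derivative (\<lambda>d. \<xi> $ 1 * snd d $ 1 + \<xi> $ 2 * snd d $ 2)) (at z within U)"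
      unfolding phase_def by (auto intro!: derivative_eq_intros bounded_linear.has_derivative[OF bounded_linear_vec_nth])
    have co: "((\<lambda>z. cos (phase \<xi> (snd z) + \<delta>)) has_derivative (\<lambda>d. (\<xi> $ 1 * snd d $ 1 + \<xi> $ 2 * snd d $ 2) * - sin (phase \<xi> (snd z) + \<delta>))) (at z within U)"
      by (rule DERIV_compose_FDERIV[OF DERIV_cos ph])
    have ex: "((\<lambda>z. amp \<xi> * exp (gam \<xi> * fst z)) has_derivative (\<lambda>d. amp \<xi> * (fst d * (gam \<xi> * exp (gam \<xi> * fst z))))) (at z within U)"
      by (auto intro!: derivative_eq_intros)
    have sn: "cos (phase \<xi> (snd z) + (\<delta> + pi / 2)) = - sin (phase \<xi> (snd z) + \<delta>)"
      by (simp add: cos_add[of "phase \<xi> (snd z) + \<delta>" "pi / 2", simplified add.assoc])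
    show "((\<lambda>z. h b \<delta> z \<xi>) has_derivative blinfun_apply (D' z \<xi>)) (at z within U)"
      unfolding h_def
      by (rule has_derivative_eq_rhs[OF has_derivative_mult[OF has_derivative_mult[OF ex bs] co]])
        (simp only: fun_eq_iff D'_def h_def blinfun.add_left blinfun.scaleR_left d_t_apply d_x_apply sn real_scaleR_def,
          simp add: algebra_simps)
  next
    fix z assume z: "z \<in> U"
    then have "snd z \<in> slab I" by (auto simp: U_def)
    from wave_integrable[OF bI(1) this, of "fst z" \<delta>]
    show "h b \<delta> z integrable_on cbox (\<chi> i. - rad) (\<chi> i. rad)" by (simp add: h_def wbox_def)
  next
    have hc: "continuous_on (U \<times> cbox (\<chi> i. - rad) (\<chi> i. rad)) (\<lambda>(z, \<xi>). h b \<delta> z \<xi>)" if "profile_cont I b" for b \<delta>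
      unfolding h_def U_def by (rule wave_integrand_cont[OF that])
    show "continuous_on (U \<times> cbox (\<chi> i. - rad) (\<chi> i. rad)) (\<lambda>(z, \<xi>). D' z \<xi>)"
      unfolding D'_def case_prod_unfold
      by (intro continuous_intros hc[unfolded case_prod_unfold] profile_cont_mult_gam profile_cont_mult_nth bI)
  qed
  moreover have "integral wbox (D' (t, x)) = wave_D b b' \<delta> (t, x)"
  proof -
    have xI: "x \<in> slab I" using xU by (simp add: U_def)
    have hi: "(h b \<delta> (t, x) has_integral wave b \<delta> t x) wbox" if "profile_cont I b" for b \<delta>
      using integrable_integral[OF wave_integrable[OF that xI, of t \<delta>]] by (simp add: h_def wave_def)
    have "(D' (t, x) has_integral wave_D b b' \<delta> (t, x)) wbox"
      unfolding D'_def wave_D_def fst_conv snd_conv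
      by (intro has_integral_add has_integral_scaleR_left hi profile_cont_mult_gam profile_cont_mult_nth bI)
    then show ?thesis by (rule integral_unique)
  qed
  ultimately show ?thesis
    using at_within_open[OF xU openU] by (simp add: h_def wave_def[abs_def])
qed

text \<open>Hypothesis \<open>sym\<close> is the Hermitian symmetry of the coefficients. It makes
  the complex inverse Fourier integral real, and its real part is the cosine integral.\<close>

lemma wave_LINT:
  assumes cont: "continuous_on UNIV (\<lambda>\<xi>. b \<xi> s)"
    and sym: "\<And>\<xi>. complex_of_real (amp (- \<xi>) * exp (gam (- \<xi>) * t) * b (- \<xi>) s) * cis \<delta>
       = complex_of_real (amp \<xi> * exp (gam \<xi> * t) * b \<xi> s) * cis (- \<delta>)"
  shows "complex_of_real (wave b \<delta> t (point x' s)) =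
     (LINT \<xi>|lborel. complex_of_real (amp \<xi> * exp (gam \<xi> * t) * b \<xi> s) * cis \<delta> * cis (x' \<bullet> \<xi>))"
proof -
  define A where "A = (\<lambda>\<xi>. amp \<xi> * exp (gam \<xi> * t) * b \<xi> s)"
  have A_cont: "continuous_on UNIV A" unfolding A_def by (intro continuous_intros amp_cont gam_cont cont)
  have A0: "\<xi> \<notin> wbox \<Longrightarrow> A \<xi> = 0" for \<xi> using amp_supp_wbox[of \<xi>] by (simp add: A_def)
  define G where "G = (\<lambda>\<xi>. complex_of_real (A \<xi>) * cis \<delta> * cis (x' \<bullet> \<xi>))"
  have G_cont: "continuous_on UNIV G" unfolding G_def by (intro continuous_intros A_cont)
  have G_ind: "indicator wbox \<xi> *\<^sub>R G \<xi> = G \<xi>" for \<xi> using A0[of \<xi>] by (cases "\<xi> \<in> wbox") (auto simp: G_def)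
  have G_int: "integrable lborel G"
    using borel_integrable_compact[of wbox G] continuous_on_subset[OF G_cont] by (simp add: G_ind wbox_def[symmetric]) (simp add: wbox_def)
  have "G (- \<xi>) = cnj (G \<xi>)" for \<xi>
  proof -
    have "G (- \<xi>) = complex_of_real (A \<xi>) * cis (- \<delta>) * cis (- (x' \<bullet> \<xi>))"
      unfolding G_def A_def by (simp only: sym inner_minus_right)
    then show ?thesis by (simp add: G_def cis_cnj)
  qed
  moreover have [measurable]: "G \<in> borel_measurable borel" using G_cont by (rule borel_measurable_continuous_onI)
  ultimately have "(LINT \<xi>|lborel. G \<xi>) = (LINT \<xi>|lborel. cnj (G \<xi>))"
    using lborel_integral_uminus[of G] by simp
  also have "\<dots> = cnj (LINT \<xi>|lborel. G \<xi>)" by (rule Bochner_Integration.integral_cnj)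
  finally have "(LINT \<xi>|lborel. G \<xi>) \<in> \<real>" by (metis complex_cnj_cancel_iff Reals_cnj_iff)
  then have "(LINT \<xi>|lborel. G \<xi>) = complex_of_real (Re (LINT \<xi>|lborel. G \<xi>))" by simp
  also have "Re (LINT \<xi>|lborel. G \<xi>) = (LINT \<xi>|lborel. Re (G \<xi>))" by (rule Bochner_Integration.integral_Re[OF G_int, symmetric])
  also have "(LINT \<xi>|lborel. Re (G \<xi>)) = (LINT \<xi>:wbox|lborel. A \<xi> * cos (phase \<xi> (point x' s) + \<delta>))"
    unfolding set_lebesgue_integral_def
  proof (rule Bochner_Integration.integral_cong[OF refl])
    fix \<xi>
    have "Re (G \<xi>) = A \<xi> * cos (\<delta> + x' \<bullet> \<xi>)" by (simp add: G_def mult.assoc cis_mult)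
    also have "\<delta> + x' \<bullet> \<xi> = phase \<xi> (point x' s) + \<delta>" by (simp add: phase_def inner_vec_def sum_2 mult.commute)
    finally show "Re (G \<xi>) = indicator wbox \<xi> *\<^sub>R (A \<xi> * cos (phase \<xi> (point x' s) + \<delta>))"
      using A0[of \<xi>] by (cases "\<xi> \<in> wbox") auto
  qed
  also have "\<dots> = integral wbox (\<lambda>\<xi>. A \<xi> * cos (phase \<xi> (point x' s) + \<delta>))"
  proof (rule set_borel_integral_eq_integral(2))
    have "continuous_on UNIV (\<lambda>\<xi>. A \<xi> * cos (phase \<xi> (point x' s) + \<delta>))"
      unfolding phase_def by (intro continuous_intros A_cont)
    then show "set_integrable lborel wbox (\<lambda>\<xi>. A \<xi> * cos (phase \<xi> (point x' s) + \<delta>))"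
      unfolding set_integrable_def wbox_def by (intro borel_integrable_compact compact_cbox) (rule continuous_on_subset, auto)
  qed
  finally show ?thesis by (simp add: G_def A_def wave_def)
qed

text \<open>\<open>slab_synthesis\<close> identifies the horizontal transform of the packet as
  \<open>(2 * pi)\<^sup>2\<close> times its coefficient, and \<open>Hk_slab_characterisation\<close>
  admits the classical derivatives \<open>Db\<close>. The phase \<delta> has modulus 1 and drops
  out.\<close>

theorem wave_Hk:
  fixes Db :: "nat \<Rightarrow> real^2 \<Rightarrow> real \<Rightarrow> real" and a0 b0 :: real
  defines "I \<equiv> {a0<..<b0}"
  assumes cont: "profile_cont I (Db 0)"
    and bd: "\<And>\<xi> s. s \<in> I \<Longrightarrow> \<bar>amp \<xi> * exp (gam \<xi> * t) * Db 0 \<xi> s\<bar> \<le> C"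
    and D: "\<And>i \<xi> s. s \<in> I \<Longrightarrow> (Db i \<xi> has_real_derivative Db (Suc i) \<xi> s) (at s)"
    and sym: "\<And>\<xi> s. s \<in> I \<Longrightarrow> complex_of_real (amp (- \<xi>) * exp (gam (- \<xi>) * t) * Db 0 (- \<xi>) s) * cis \<delta>
       = complex_of_real (amp \<xi> * exp (gam \<xi> * t) * Db 0 \<xi> s) * cis (- \<delta>)"
    and f: "\<And>x. x \<in> slab I \<Longrightarrow> f x = wave (Db 0) \<delta> t x"
  shows "Hk_slab_sqnorm I k f = (\<Sum>j\<le>k. \<integral>\<^sup>+\<xi>. ennreal ((1 + (norm \<xi>)\<^sup>2) ^ (k - j)) *
        (\<integral>\<^sup>+s\<in>I. ennreal (((2 * pi)\<^sup>2 * (amp \<xi> * exp (gam \<xi> * t) * Db j \<xi> s))\<^sup>2) \<partial>lborel) \<partial>lborel)"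
    and "Hk_slab_sqnorm I k f < \<infinity> \<Longrightarrow> in_Hk_slab I k f"
proof -
  define F where "F = (\<lambda>\<xi> s. complex_of_real (amp \<xi> * exp (gam \<xi> * t) * Db 0 \<xi> s) * cis \<delta>)"
  have sect: "continuous_on UNIV (\<lambda>\<xi>. Db 0 \<xi> s)" if "s \<in> I" for s
  proof -
    have "continuous_on UNIV (\<lambda>\<xi>. (\<lambda>z. Db 0 (fst z) (snd z)) (\<xi>, s))"
      by (rule continuous_on_compose2[OF cont[unfolded profile_cont_def]]) (use that in \<open>auto intro!: continuous_intros\<close>)
    then show ?thesis by simp
  qed
  have F_cont: "continuous_on (UNIV \<times> I) (\<lambda>z. F (fst z) (snd z))"
    unfolding F_def
    by (intro continuous_intros continuous_on_compose2[OF amp_cont] continuous_on_compose2[OF gam_cont] cont[unfolded profile_cont_def]) auto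
  have F_bd: "norm (F \<xi> s) \<le> C" if "s \<in> I" for \<xi> s using bd[OF that, of \<xi>] by (simp add: F_def norm_mult abs_mult)
  have F0: "F \<xi> s = 0" if "\<xi> \<notin> cball 0 rad" for \<xi> s using amp_supp[OF that] by (simp add: F_def)
  have fc: "continuous_on (slab I) f"
    by (rule continuous_on_eq[OF wave_continuous_x[OF cont]]) (simp add: f)
  have fF: "complex_of_real (f (point x' s)) = (LINT \<xi>|lborel. F \<xi> s * cis (x' \<bullet> \<xi>))" if s: "s \<in> I" for x' s
    using wave_LINT[of "Db 0" s t \<delta> x', OF sect[OF s] sym[OF s]] s by (simp add: f F_def)
  have I: "open I" "bounded I" by (simp_all add: I_def)
  note syn = slab_synthesis[OF I F_cont F_bd F0 fc fF]
  define DD where "DD = (\<lambda>\<xi> i s. complex_of_real ((2 * pi)\<^sup>2 * (amp \<xi> * exp (gam \<xi> * t) * Db i \<xi> s)) * cis \<delta>)"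
  have DD: "(DD \<xi> i has_vector_derivative DD \<xi> (Suc i) s) (at s)" if s: "s \<in> I" for \<xi> i s
  proof -
    have "((\<lambda>s. (2 * pi)\<^sup>2 * (amp \<xi> * exp (gam \<xi> * t) * Db i \<xi> s)) has_real_derivative (2 * pi)\<^sup>2 * (amp \<xi> * exp (gam \<xi> * t) * Db (Suc i) \<xi> s)) (at s)"
      by (intro DERIV_cmult D[OF s])
    then show ?thesis unfolding DD_def
      by (intro has_vector_derivative_mult_left has_vector_derivative_of_real) (simp add: has_real_derivative_iff_has_vector_derivative)
  qed
  have nD: "(cmod (DD \<xi> j s))\<^sup>2 = ((2 * pi)\<^sup>2 * (amp \<xi> * exp (gam \<xi> * t) * Db j \<xi> s))\<^sup>2" for \<xi> j s
    unfolding DD_def norm_mult norm_cis norm_of_real by simp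
  have "L2_slab I f" "is_horizontal_ft I f (\<lambda>\<xi> s. indicator I s *\<^sub>R (complex_of_real ((2 * pi)\<^sup>2) * F \<xi> s))"
    by (rule syn; assumption)+
  note char = Hk_slab_characterisation[OF this[unfolded I_def], of DD k, folded I_def]
  have e: "indicator I s *\<^sub>R (complex_of_real ((2 * pi)\<^sup>2) * F \<xi> s) = DD \<xi> 0 s" if "s \<in> I" for \<xi> s
    using that by (simp add: F_def DD_def)
  show "Hk_slab_sqnorm I k f = (\<Sum>j\<le>k. \<integral>\<^sup>+\<xi>. ennreal ((1 + (norm \<xi>)\<^sup>2) ^ (k - j)) *
        (\<integral>\<^sup>+s\<in>I. ennreal (((2 * pi)\<^sup>2 * (amp \<xi> * exp (gam \<xi> * t) * Db j \<xi> s))\<^sup>2) \<partial>lborel) \<partial>lborel)"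
    unfolding nD[symmetric] by (rule char(1)) (use e DD in auto)
  show "Hk_slab_sqnorm I k f < \<infinity> \<Longrightarrow> in_Hk_slab I k f"
    by (rule char(2)) (use e DD in auto)
qed

end

section \<open>Differential equations and traces for wave packets\<close>

definition vec3 :: "real \<Rightarrow> real \<Rightarrow> real \<Rightarrow> real^3" where
  "vec3 p q r = p *\<^sub>R axis 1 1 + q *\<^sub>R axis 2 1 + r *\<^sub>R axis 3 1"

lemma vec3_nth [simp]: "vec3 p q r $ 1 = p" "vec3 p q r $ 2 = q" "vec3 p q r $ 3 = r"
  by (simp_all add: vec3_def axis_def)

lemma C1_on_vec3:
  assumes "C1_on S f1" "C1_on S f2" "C1_on S f3"
  shows "C1_on S (\<lambda>z. vec3 (f1 z) (f2 z) (f3 z))"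
proof -
  obtain D1 D2 D3 where c: "continuous_on S D1" "continuous_on S D2" "continuous_on S D3"
    and d: "\<And>z. z \<in> S \<Longrightarrow> (f1 has_derivative blinfun_apply (D1 z)) (at z within S)"
      "\<And>z. z \<in> S \<Longrightarrow> (f2 has_derivative blinfun_apply (D2 z)) (at z within S)"
      "\<And>z. z \<in> S \<Longrightarrow> (f3 has_derivative blinfun_apply (D3 z)) (at z within S)"
    using assms unfolding C1_on_def by metis
  define V :: "3 \<Rightarrow> real \<Rightarrow>\<^sub>L (real^3)" where "V = (\<lambda>i. Blinfun (\<lambda>r. r *\<^sub>R axis i 1))"
  have V: "blinfun_apply (V i) r = r *\<^sub>R axis i 1" for i r
    unfolding V_def by (subst bounded_linear_Blinfun_apply) (auto intro: bounded_linear_scaleR_left)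
  show ?thesis
    unfolding C1_on_def
  proof (intro exI conjI ballI)
    show "continuous_on S (\<lambda>z. (V 1 o\<^sub>L D1 z) + (V 2 o\<^sub>L D2 z) + (V 3 o\<^sub>L D3 z))"
      by (intro continuous_on_add bounded_bilinear.continuous_on[OF bounded_bilinear_blinfun_compose] continuous_on_const c)
    fix z assume z: "z \<in> S"
    show "((\<lambda>z. vec3 (f1 z) (f2 z) (f3 z)) has_derivative blinfun_apply ((V 1 o\<^sub>L D1 z) + (V 2 o\<^sub>L D2 z) + (V 3 o\<^sub>L D3 z))) (at z within S)"
      unfolding vec3_def
      by (rule has_derivative_eq_rhs[OF has_derivative_add[OF has_derivative_add[OF has_derivative_scaleR_left[OF d(1)[OF z]] has_derivative_scaleR_left[OF d(2)[OF z]]] has_derivative_scaleR_left[OF d(3)[OF z]]]])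
        (simp add: fun_eq_iff blinfun.add_left V)
  qed
qed

lemma has_vector_derivative_vec3:
  assumes "(f1 has_real_derivative d1) F" "(f2 has_real_derivative d2) F" "(f3 has_real_derivative d3) F" and F: "F = at t within S"
  shows "((\<lambda>\<tau>. vec3 (f1 \<tau>) (f2 \<tau>) (f3 \<tau>)) has_vector_derivative vec3 d1 d2 d3) F"
proof -
  have s: "((\<lambda>\<tau>. h \<tau> *\<^sub>R v) has_vector_derivative d *\<^sub>R v) (at t within S)" if "(h has_real_derivative d) F" for h d and v :: "real^3"
    using has_vector_derivative_scaleR[OF that[unfolded F] has_vector_derivative_const[of v]] by simp
  show ?thesis unfolding vec3_def F
    by (intro has_vector_derivative_add s assms)
qed

lemma partial_deriv_eqI:
  assumes "open S" "x \<in> S" "\<And>y. y \<in> S \<Longrightarrow> h y = f y" "(f has_derivative f') (at x)"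
  shows "partial_deriv i h x = f' (axis i 1)"
proof -
  have "(h has_derivative f') (at x)"
    by (rule has_derivative_transform_within_open[OF assms(4,1,2)]) (simp add: assms(3))
  from frechet_derivative_at[OF this] show ?thesis by (simp add: partial_deriv_def)
qed

context wave_packet
begin

lemma wave_C1:
  assumes J: "open J" and b: "profile_cont J b" and b': "profile_cont J b'"
    and D: "\<And>\<xi> s. s \<in> J \<Longrightarrow> (b \<xi> has_real_derivative b' \<xi> s) (at s)"
  shows "C1_on ({0..} \<times> slab J) (\<lambda>z. wave b \<delta> (fst z) (snd z))"
  unfolding C1_on_def
proof (intro exI conjI ballI)
  show "continuous_on ({0..} \<times> slab J) (wave_D b b' \<delta>)"
    by (rule continuous_on_subset[OF wave_D_continuous[OF b b']]) auto
  fix z assume z: "z \<in> ({0..} \<times> slab J :: (real \<times> (real^3)) set)"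
  then have "snd z \<in> slab J" by auto
  from wave_has_derivative[OF J b b' D this, of \<delta> "fst z"]
  show "((\<lambda>z. wave b \<delta> (fst z) (snd z)) has_derivative blinfun_apply (wave_D b b' \<delta> z)) (at z within {0..} \<times> slab J)"
    by (auto intro: has_derivative_at_withinI)
qed

lemma wave_DERIV_t:
  assumes J: "open J" and b: "profile_cont J b" and b': "profile_cont J b'"
    and D: "\<And>\<xi> s. s \<in> J \<Longrightarrow> (b \<xi> has_real_derivative b' \<xi> s) (at s)" and x: "x \<in> slab J"
  shows "((\<lambda>\<tau>. wave b \<delta> \<tau> x) has_real_derivative wave (\<lambda>\<xi> s. gam \<xi> * b \<xi> s) \<delta> t x) (at t within S)"
proof -
  have p: "((\<lambda>\<tau>. (\<tau>, x)) has_derivative (\<lambda>d. (d, 0))) (at t)" by (auto intro!: derivative_eq_intros)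
  from has_derivative_compose[OF p wave_has_derivative[OF J b b' D x, of \<delta> t]]
  have "((\<lambda>\<tau>. wave b \<delta> \<tau> x) has_derivative (\<lambda>d. blinfun_apply (wave_D b b' \<delta> (t, x)) (d, 0))) (at t)" by simp
  moreover have "blinfun_apply (wave_D b b' \<delta> (t, x)) (d, 0) = wave (\<lambda>\<xi> s. gam \<xi> * b \<xi> s) \<delta> t x * d" for d
    by (simp add: wave_D_def blinfun.add_left blinfun.scaleR_left)
  ultimately have "((\<lambda>\<tau>. wave b \<delta> \<tau> x) has_real_derivative wave (\<lambda>\<xi> s. gam \<xi> * b \<xi> s) \<delta> t x) (at t)"
    unfolding has_field_derivative_def by (simp add: mult_commute_abs)
  then show ?thesis by (rule has_field_derivative_at_within)
qed

lemma wave_partial: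
  assumes J: "open J" and b: "profile_cont J b" and b': "profile_cont J b'"
    and D: "\<And>\<xi> s. s \<in> J \<Longrightarrow> (b \<xi> has_real_derivative b' \<xi> s) (at s)" and x: "x \<in> slab J"
    and h: "\<And>y. y \<in> slab J \<Longrightarrow> h y = wave b \<delta> t y"
  shows "partial_deriv 1 h x = wave (\<lambda>\<xi> s. \<xi> $ 1 * b \<xi> s) (\<delta> + pi / 2) t x"
    and "partial_deriv 2 h x = wave (\<lambda>\<xi> s. \<xi> $ 2 * b \<xi> s) (\<delta> + pi / 2) t x"
    and "partial_deriv 3 h x = wave b' \<delta> t x"
proof -
  have p: "((\<lambda>y. (t, y)) has_derivative (\<lambda>d. (0, d))) (at x)" by (auto intro!: derivative_eq_intros)
  from has_derivative_compose[OF p wave_has_derivative[OF J b b' D x, of \<delta> t]]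
  have d: "((\<lambda>y. wave b \<delta> t y) has_derivative (\<lambda>d. blinfun_apply (wave_D b b' \<delta> (t, x)) (0, d))) (at x)" by simp
  note e = partial_deriv_eqI[OF open_slab[OF J] x h d]
  show "partial_deriv 1 h x = wave (\<lambda>\<xi> s. \<xi> $ 1 * b \<xi> s) (\<delta> + pi / 2) t x"
    "partial_deriv 2 h x = wave (\<lambda>\<xi> s. \<xi> $ 2 * b \<xi> s) (\<delta> + pi / 2) t x"
    "partial_deriv 3 h x = wave b' \<delta> t x"
    by (subst e, assumption, simp add: wave_D_def blinfun.add_left blinfun.scaleR_left axis_def)+
qed

lemma wave_list:
  assumes x: "x \<in> slab J" and "\<forall>(k, b)\<in>set L. profile_cont J b"
  shows "((\<lambda>\<xi>. sum_list (map (\<lambda>(k, b). k * (amp \<xi> * exp (gam \<xi> * t) * b \<xi> (x $ 3) * cos (phase \<xi> x + \<delta>))) L))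
    has_integral sum_list (map (\<lambda>(k, b). k * wave b \<delta> t x) L)) wbox"
  using assms(2)
proof (induction L)
  case (Cons p L)
  obtain k b where p: "p = (k, b)" by (cases p)
  have "((\<lambda>\<xi>. amp \<xi> * exp (gam \<xi> * t) * b \<xi> (x $ 3) * cos (phase \<xi> x + \<delta>)) has_integral wave b \<delta> t x) wbox"
    unfolding wave_def by (rule integrable_integral[OF wave_integrable[OF _ x]]) (use Cons.prems p in auto)
  then show ?case using Cons unfolding p by (auto intro!: has_integral_add has_integral_mult_right)
qed simp

text \<open>Reduces a linear differential equation for packets to an algebraic identity between
  profiles, to be checked at each wave vector in the support of the amplitude.\<close>

lemma wave_list_eq_0:
  assumes x: "x \<in> slab J" and L: "\<forall>(k, b)\<in>set L. profile_cont J b"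
    and 0: "\<And>\<xi>. amp \<xi> \<noteq> 0 \<Longrightarrow> sum_list (map (\<lambda>(k, b). k * b \<xi> (x $ 3)) L) = 0"
  shows "sum_list (map (\<lambda>(k, b). k * wave b \<delta> t x) L) = 0"
proof -
  have eq: "sum_list (map (\<lambda>(k, b). k * (amp \<xi> * exp (gam \<xi> * t) * b \<xi> (x $ 3) * cos (phase \<xi> x + \<delta>))) L)
     = amp \<xi> * exp (gam \<xi> * t) * cos (phase \<xi> x + \<delta>) * sum_list (map (\<lambda>(k, b). k * b \<xi> (x $ 3)) L)" for \<xi>
    by (induction L) (auto simp: algebra_simps)
  have "sum_list (map (\<lambda>(k, b). k * (amp \<xi> * exp (gam \<xi> * t) * b \<xi> (x $ 3) * cos (phase \<xi> x + \<delta>))) L) = 0" for \<xi>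
    unfolding eq using 0[of \<xi>] by (cases "amp \<xi> = 0") auto
  then have "((\<lambda>_. 0) has_integral sum_list (map (\<lambda>(k, b). k * wave b \<delta> t x) L)) wbox"
    using wave_list[OF x L, of t \<delta>] by simp
  then show ?thesis using has_integral_unique has_integral_0 by blast
qed

lemma wave_trace:
  assumes b: "profile_cont T b" and I: "I \<subseteq> T" and y: "y \<in> slab T"
    and h: "\<And>x. x \<in> slab I \<Longrightarrow> h x = wave b \<delta> t x"
  shows "(h \<longlongrightarrow> wave b \<delta> t y) (at y within slab I)"
proof -
  have "(wave b \<delta> t \<longlongrightarrow> wave b \<delta> t y) (at y within slab T)"
    using wave_continuous_x[OF b, of \<delta> t] y by (auto simp: continuous_on_def)
  then have "(wave b \<delta> t \<longlongrightarrow> wave b \<delta> t y) (at y within slab I)"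
    by (rule tendsto_within_subset) (use I in \<open>auto simp: slab_def\<close>)
  then show ?thesis
    by (rule Lim_transform_eventually) (auto simp: eventually_at_filter h)
qed

lemma wave_0: "wave (\<lambda>\<xi> s. 0) \<delta> t x = 0"
  by (simp add: wave_def)

end

section \<open>Superposed Rayleigh-Taylor modes solve the linear problem\<close>

text \<open>The profiles come twice: \<open>H\<close> and \<open>U\<close> on the two open layers,
  where the equations hold, and a pair for each layer that is continuous up to its boundary, since
  the interface has separate values from above and below. The coefficient \<open>c\<close> is 1 /
  p'(\<rho>). The relation that defines \<open>A\<close> is imposed on the support of the amplitude,
  whereas \<open>lam\<close> is bounded below everywhere so that divisions make sense.\<close>

locale rt_wave = wave_packet amp lam rad for amp lam :: "real^2 \<Rightarrow> real" and rad :: real +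
  fixes g \<omega> l m :: real and \<rho> c c' \<rho>M \<rho>P :: "real \<Rightarrow> real" and A :: "real^2 \<Rightarrow> real"
    and H U HM UM HP UP :: "real^2 \<Rightarrow> real \<Rightarrow> real"
  assumes l: "0 < l" and m: "0 < m" and lam: "\<And>\<xi>. 1 \<le> lam \<xi>"
    and \<rho>_pos: "\<And>s. s \<in> {-m<..<0} \<union> {0<..<l} \<Longrightarrow> 0 < \<rho> s"
    and \<rho>_D: "\<And>s. s \<in> {-m<..<0} \<union> {0<..<l} \<Longrightarrow> (\<rho> has_real_derivative - g * c s * \<rho> s) (at s)"
    and c_D: "\<And>s. s \<in> {-m<..<0} \<union> {0<..<l} \<Longrightarrow> (c has_real_derivative c' s) (at s)"
    and c'_cont: "continuous_on ({-m<..<0} \<union> {0<..<l}) c'"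
    and H_D: "\<And>\<xi> s. s \<in> {-m<..<0} \<union> {0<..<l} \<Longrightarrow> (H \<xi> has_real_derivative U \<xi> s / \<rho> s) (at s)"
    and U_D: "\<And>\<xi> s. s \<in> {-m<..<0} \<union> {0<..<l} \<Longrightarrow> (U \<xi> has_real_derivative \<rho> s * (A \<xi> + (lam \<xi>)\<^sup>2 * c s) * H \<xi> s) (at s)"
    and A_cont: "continuous_on UNIV A"
    and A: "\<And>\<xi>. amp \<xi> \<noteq> 0 \<Longrightarrow> A \<xi> * ((lam \<xi>)\<^sup>2 + 4 * \<omega>\<^sup>2) = (lam \<xi>)\<^sup>2 * (norm \<xi>)\<^sup>2"
    and contM: "profile_cont {-m..0} HM" "profile_cont {-m..0} UM" "continuous_on {-m..0} \<rho>M"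
    and contP: "profile_cont {0..l} HP" "profile_cont {0..l} UP" "continuous_on {0..l} \<rho>P"
    and posM: "\<And>s. s \<in> {-m..0} \<Longrightarrow> 0 < \<rho>M s" and posP: "\<And>s. s \<in> {0..l} \<Longrightarrow> 0 < \<rho>P s"
    and eqM: "\<And>\<xi> s. s \<in> {-m<..<0} \<Longrightarrow> H \<xi> s = HM \<xi> s \<and> U \<xi> s = UM \<xi> s \<and> \<rho> s = \<rho>M s"
    and eqP: "\<And>\<xi> s. s \<in> {0<..<l} \<Longrightarrow> H \<xi> s = HP \<xi> s \<and> U \<xi> s = UP \<xi> s \<and> \<rho> s = \<rho>P s"
    and walls: "\<And>\<xi>. UM \<xi> (- m) = 0" "\<And>\<xi>. UP \<xi> l = 0"
    and match: "\<And>\<xi>. UM \<xi> 0 / \<rho>M 0 = UP \<xi> 0 / \<rho>P 0"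
      "\<And>\<xi>. \<rho>M 0 * HM \<xi> 0 + g * UM \<xi> 0 / (lam \<xi>)\<^sup>2 = \<rho>P 0 * HP \<xi> 0 + g * UP \<xi> 0 / (lam \<xi>)\<^sup>2"
begin

definition J :: "real set" where "J = {-m<..<0} \<union> {0<..<l}"

text \<open>With \<open>b2\<close> this solves the 2 by 2 system of horizontal momentum under
  Coriolis force: lam^2 b1 - 2 \<omega> lam b2 = \<xi>_1 H and lam^2 b2 + 2 \<omega> lam b1 =
  \<xi>_2 H.\<close>

definition b1 :: "real^2 \<Rightarrow> real \<Rightarrow> real" where
  "b1 \<xi> s = H \<xi> s * ((\<xi> $ 1 + 2 * \<omega> / lam \<xi> * \<xi> $ 2) / ((lam \<xi>)\<^sup>2 + 4 * \<omega>\<^sup>2))"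
definition b2 :: "real^2 \<Rightarrow> real \<Rightarrow> real" where
  "b2 \<xi> s = H \<xi> s * ((\<xi> $ 2 - 2 * \<omega> / lam \<xi> * \<xi> $ 1) / ((lam \<xi>)\<^sup>2 + 4 * \<omega>\<^sup>2))"
text \<open>Vertical momentum, lam^2 b3 = - H'.\<close>

definition b3 :: "real^2 \<Rightarrow> real \<Rightarrow> real" where
  "b3 \<xi> s = - (U \<xi> s / \<rho> s) / (lam \<xi>)\<^sup>2"
text \<open>The pressure perturbation p'(\<rho>) q, recovered from the enthalpy as \<rho> (H - g
  b3).\<close>

definition bp :: "real^2 \<Rightarrow> real \<Rightarrow> real" where
  "bp \<xi> s = \<rho> s * H \<xi> s + g * U \<xi> s / (lam \<xi>)\<^sup>2"
definition bq :: "real^2 \<Rightarrow> real \<Rightarrow> real" where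
  "bq \<xi> s = c s * bp \<xi> s"

text \<open>The horizontal components are a quarter period out of phase with the vertical one,
  because they are driven by horizontal derivatives of the enthalpy.\<close>

definition eta :: "real \<Rightarrow> real^3 \<Rightarrow> real^3" where
  "eta t x = vec3 (wave b1 (- (pi / 2)) t x) (wave b2 (- (pi / 2)) t x) (wave b3 0 t x)"
definition vel :: "real \<Rightarrow> real^3 \<Rightarrow> real^3" where
  "vel t x = vec3 (wave (\<lambda>\<xi> s. lam \<xi> * b1 \<xi> s) (- (pi / 2)) t x) (wave (\<lambda>\<xi> s. lam \<xi> * b2 \<xi> s) (- (pi / 2)) t x)
     (wave (\<lambda>\<xi> s. lam \<xi> * b3 \<xi> s) 0 t x)"
definition dens :: "real \<Rightarrow> real^3 \<Rightarrow> real" where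
  "dens t x = wave bq 0 t x"

lemma J_open: "open J" unfolding J_def by (intro open_Un open_greaterThanLessThan)

lemma lam_pos: "0 < lam \<xi>" "lam \<xi> \<noteq> 0" "(lam \<xi>)\<^sup>2 + 4 * \<omega>\<^sup>2 \<noteq> 0"
proof -
  show p: "0 < lam \<xi>" using lam[of \<xi>] by simp
  then show "lam \<xi> \<noteq> 0" by simp
  have "0 < (lam \<xi>)\<^sup>2 + 4 * \<omega>\<^sup>2" using p by (intro add_pos_nonneg) auto
  then show "(lam \<xi>)\<^sup>2 + 4 * \<omega>\<^sup>2 \<noteq> 0" by simp
qed

lemma profile_cont_fst: "continuous_on UNIV f \<Longrightarrow> profile_cont T (\<lambda>\<xi> s. f \<xi>)"
  unfolding profile_cont_def by (rule continuous_on_compose2) (auto intro!: continuous_intros)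

lemma profile_cont_snd: "continuous_on T f \<Longrightarrow> profile_cont T (\<lambda>\<xi> s. f s)"
  unfolding profile_cont_def by (rule continuous_on_compose2) (auto intro!: continuous_intros)

lemma profile_cont_arith:
  assumes "profile_cont T f" "profile_cont T h"
  shows "profile_cont T (\<lambda>\<xi> s. f \<xi> s + h \<xi> s)" "profile_cont T (\<lambda>\<xi> s. f \<xi> s - h \<xi> s)"
    "profile_cont T (\<lambda>\<xi> s. f \<xi> s * h \<xi> s)"
    "(\<And>\<xi> s. s \<in> T \<Longrightarrow> h \<xi> s \<noteq> 0) \<Longrightarrow> profile_cont T (\<lambda>\<xi> s. f \<xi> s / h \<xi> s)"
  using assms unfolding profile_cont_def by (auto intro!: continuous_intros)

lemma profile_cont_minus: "profile_cont T f \<Longrightarrow> profile_cont T (\<lambda>\<xi> s. - f \<xi> s)"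
  unfolding profile_cont_def by (intro continuous_intros)

lemma profile_cont_J:
  assumes "profile_cont {-m<..<0} f" "profile_cont {0<..<l} f"
  shows "profile_cont J f"
proof -
  have "continuous_on (UNIV \<times> {-m<..<0} \<union> UNIV \<times> {0<..<l}) (\<lambda>z. f (fst z) (snd z))"
    using assms unfolding profile_cont_def
    by (intro continuous_on_open_Un open_Times open_UNIV open_greaterThanLessThan)
  moreover have "UNIV \<times> {-m<..<0} \<union> UNIV \<times> {0<..<l} = (UNIV :: (real^2) set) \<times> J" by (auto simp: J_def)
  ultimately show ?thesis by (simp add: profile_cont_def)
qed

lemma profile_cont_eq: "profile_cont T f \<Longrightarrow> (\<And>\<xi> s. s \<in> T \<Longrightarrow> h \<xi> s = f \<xi> s) \<Longrightarrow> profile_cont T h"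
  unfolding profile_cont_def by (erule continuous_on_eq) auto

lemma base_cont: "profile_cont J H" "profile_cont J U" "profile_cont J (\<lambda>\<xi> s. \<rho> s)" "profile_cont J (\<lambda>\<xi> s. c s)"
  "profile_cont J (\<lambda>\<xi> s. c' s)"
  "profile_cont T (\<lambda>\<xi> s. lam \<xi>)" "profile_cont T (\<lambda>\<xi> s. (lam \<xi>)\<^sup>2)" "profile_cont T (\<lambda>\<xi> s. A \<xi>)"
  "profile_cont T (\<lambda>\<xi> s. (lam \<xi>)\<^sup>2 + 4 * \<omega>\<^sup>2)" "profile_cont T (\<lambda>\<xi> s. \<xi> $ i)" "profile_cont T (\<lambda>\<xi> s. k)"
proof -
  have sub: "{-m<..<0} \<subseteq> {-m..0}" "{0<..<l} \<subseteq> {0..l}" by auto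
  show "profile_cont J H"
    by (rule profile_cont_J; rule profile_cont_eq[OF profile_cont_subset[OF contM(1) sub(1)]] profile_cont_eq[OF profile_cont_subset[OF contP(1) sub(2)]]; use eqM eqP in blast)
  show "profile_cont J U"
    by (rule profile_cont_J; rule profile_cont_eq[OF profile_cont_subset[OF contM(2) sub(1)]] profile_cont_eq[OF profile_cont_subset[OF contP(2) sub(2)]]; use eqM eqP in blast)
  show "profile_cont J (\<lambda>\<xi> s. \<rho> s)" "profile_cont J (\<lambda>\<xi> s. c s)"
    by (rule profile_cont_snd, rule continuous_at_imp_continuous_on, blast intro: DERIV_isCont \<rho>_D[folded J_def] c_D[folded J_def])+
  show "profile_cont J (\<lambda>\<xi> s. c' s)" by (rule profile_cont_snd[OF c'_cont[folded J_def]])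
  show "profile_cont T (\<lambda>\<xi> s. lam \<xi>)" "profile_cont T (\<lambda>\<xi> s. (lam \<xi>)\<^sup>2)" "profile_cont T (\<lambda>\<xi> s. A \<xi>)"
  "profile_cont T (\<lambda>\<xi> s. (lam \<xi>)\<^sup>2 + 4 * \<omega>\<^sup>2)" "profile_cont T (\<lambda>\<xi> s. \<xi> $ i)" "profile_cont T (\<lambda>\<xi> s. k)"
    by (intro profile_cont_fst continuous_intros gam_cont A_cont)+
qed

lemmas pc = profile_cont_arith profile_cont_minus base_cont

lemma \<rho>_ne: "s \<in> J \<Longrightarrow> \<rho> s \<noteq> 0" using \<rho>_pos by (force simp: J_def)

lemma lam2_ne: "(lam \<xi>)\<^sup>2 \<noteq> 0" using lam_pos(2) by simp

text \<open>This and the next definitions are vertical derivatives in closed form, with the first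
  order system inserted. In \<open>bp'\<close> the terms containing \<open>c\<close> cancel, another
  trace of hydrostatic balance.\<close>

definition b3' :: "real^2 \<Rightarrow> real \<Rightarrow> real" where
  "b3' \<xi> s = - ((A \<xi> + (lam \<xi>)\<^sup>2 * c s) * H \<xi> s + g * c s * U \<xi> s / \<rho> s) / (lam \<xi>)\<^sup>2"
definition bp' :: "real^2 \<Rightarrow> real \<Rightarrow> real" where
  "bp' \<xi> s = U \<xi> s + g * A \<xi> * \<rho> s * H \<xi> s / (lam \<xi>)\<^sup>2"
definition b1' :: "real^2 \<Rightarrow> real \<Rightarrow> real" where
  "b1' \<xi> s = U \<xi> s / \<rho> s * ((\<xi> $ 1 + 2 * \<omega> / lam \<xi> * \<xi> $ 2) / ((lam \<xi>)\<^sup>2 + 4 * \<omega>\<^sup>2))"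
definition b2' :: "real^2 \<Rightarrow> real \<Rightarrow> real" where
  "b2' \<xi> s = U \<xi> s / \<rho> s * ((\<xi> $ 2 - 2 * \<omega> / lam \<xi> * \<xi> $ 1) / ((lam \<xi>)\<^sup>2 + 4 * \<omega>\<^sup>2))"
definition bq' :: "real^2 \<Rightarrow> real \<Rightarrow> real" where
  "bq' \<xi> s = c' s * bp \<xi> s + c s * bp' \<xi> s"

lemma b_cont: "profile_cont J b1" "profile_cont J b2" "profile_cont J b3" "profile_cont J bp" "profile_cont J bq"
  "profile_cont J b1'" "profile_cont J b2'" "profile_cont J b3'" "profile_cont J bp'" "profile_cont J bq'"
  unfolding b1_def[abs_def] b2_def[abs_def] b3_def[abs_def] bp_def[abs_def] bq_def[abs_def]
    b1'_def[abs_def] b2'_def[abs_def] b3'_def[abs_def] bp'_def[abs_def] bq'_def[abs_def]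
  by (intro pc lam_pos lam2_ne \<rho>_ne; assumption)+

lemma lam_b_cont: "profile_cont T b \<Longrightarrow> profile_cont T (\<lambda>\<xi> s. lam \<xi> * b \<xi> s)"
  by (intro pc)

lemma b_D:
  assumes s: "s \<in> J"
  shows "(b1 \<xi> has_real_derivative b1' \<xi> s) (at s)" "(b2 \<xi> has_real_derivative b2' \<xi> s) (at s)"
    "(b3 \<xi> has_real_derivative b3' \<xi> s) (at s)" "(bp \<xi> has_real_derivative bp' \<xi> s) (at s)"
    "(bq \<xi> has_real_derivative bq' \<xi> s) (at s)"
proof -
  note D = \<rho>_D[folded J_def, OF s] H_D[folded J_def, OF s] U_D[folded J_def, OF s] c_D[folded J_def, OF s]
  note ne = \<rho>_ne[OF s] lam_pos(2,3)
  show "(b1 \<xi> has_real_derivative b1' \<xi> s) (at s)" "(b2 \<xi> has_real_derivative b2' \<xi> s) (at s)"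
    unfolding b1_def[abs_def] b2_def[abs_def] b1'_def b2'_def by (intro DERIV_cmult_right D)+
  show "(b3 \<xi> has_real_derivative b3' \<xi> s) (at s)"
    unfolding b3_def[abs_def]
    by (rule DERIV_cong[OF DERIV_cdivide[OF DERIV_minus[OF DERIV_divide[OF D(3) D(1) ne(1)]]]])
      (use ne in \<open>simp add: b3'_def divide_simps, simp add: algebra_simps power2_eq_square\<close>)
  show p: "(bp \<xi> has_real_derivative bp' \<xi> s) (at s)"
    unfolding bp_def[abs_def]
    by (rule DERIV_cong[OF DERIV_add[OF DERIV_mult[OF D(1) D(2)] DERIV_cdivide[OF DERIV_cmult[OF D(3)]]]])
      (use ne in \<open>simp add: bp'_def divide_simps, simp add: algebra_simps power2_eq_square\<close>)
  show "(bq \<xi> has_real_derivative bq' \<xi> s) (at s)"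
    unfolding bq_def[abs_def] bq'_def
    by (rule DERIV_cong[OF DERIV_mult[OF D(4) p]]) (simp add: algebra_simps)
qed

lemma lam_b_D:
  assumes s: "s \<in> J"
  shows "((\<lambda>s. lam \<xi> * b1 \<xi> s) has_real_derivative lam \<xi> * b1' \<xi> s) (at s)"
    "((\<lambda>s. lam \<xi> * b2 \<xi> s) has_real_derivative lam \<xi> * b2' \<xi> s) (at s)"
    "((\<lambda>s. lam \<xi> * b3 \<xi> s) has_real_derivative lam \<xi> * b3' \<xi> s) (at s)"
  by (intro DERIV_cmult b_D s)+

lemma wave_eq_0I: "\<forall>(k, b)\<in>set L. profile_cont J b \<Longrightarrow> x \<in> slab J \<Longrightarrow>
    (\<And>\<xi>. amp \<xi> \<noteq> 0 \<Longrightarrow> sum_list (map (\<lambda>(k, b). k * b \<xi> (x $ 3)) L) = 0) \<Longrightarrow>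
    sum_list (map (\<lambda>(k, b). k * wave b \<delta> t x) L) = 0"
  by (rule wave_list_eq_0)

lemma norm2: "(norm (\<xi> :: real^2))\<^sup>2 = \<xi> $ 1 * \<xi> $ 1 + \<xi> $ 2 * \<xi> $ 2"
  unfolding power2_norm_eq_inner by (simp add: inner_vec_def sum_2)

lemma A_eq: "amp \<xi> \<noteq> 0 \<Longrightarrow> A \<xi> = (lam \<xi>)\<^sup>2 * (\<xi> $ 1 * \<xi> $ 1 + \<xi> $ 2 * \<xi> $ 2) / ((lam \<xi>)\<^sup>2 + 4 * \<omega>\<^sup>2)"
  using A[of \<xi>] lam_pos(3)[of \<xi>] unfolding norm2 by (simp add: eq_divide_eq)

text \<open>The point where the effective wave number comes from: the horizontal divergence of the
  displacement turned by the Coriolis force is A H / lam^2.\<close>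

lemma continuity_mode:
  assumes "amp \<xi> \<noteq> 0" "s \<in> J"
  shows "bq \<xi> s + \<rho> s * (\<xi> $ 1 * b1 \<xi> s + \<xi> $ 2 * b2 \<xi> s + b3' \<xi> s) = 0"
proof -
  have 1: "\<xi> $ 1 * b1 \<xi> s + \<xi> $ 2 * b2 \<xi> s = A \<xi> * H \<xi> s / (lam \<xi>)\<^sup>2"
    unfolding A_eq[OF assms(1)] b1_def b2_def using lam_pos(2,3)[of \<xi>]
    by (simp add: divide_simps) (simp add: algebra_simps)
  show ?thesis
    unfolding 1 b3'_def bq_def bp_def using lam_pos(2)[of \<xi>] \<rho>_ne[OF assms(2)]
    by (simp add: divide_simps) (simp add: algebra_simps power2_eq_square)
qed

lemma vertical_mode:
  assumes "s \<in> J"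
  shows "\<rho> s * (lam \<xi> * (lam \<xi> * b3 \<xi> s)) + bp' \<xi> s + g * bq \<xi> s + g * \<rho> s * b3' \<xi> s = 0"
  unfolding b3_def bp'_def bq_def bp_def b3'_def using lam_pos(2)[of \<xi>] \<rho>_ne[OF assms]
  by (simp add: divide_simps) (simp add: algebra_simps power2_eq_square)

lemma horizontal_mode:
  assumes "s \<in> J"
  shows "\<rho> s * (lam \<xi> * (lam \<xi> * b1 \<xi> s)) - \<xi> $ 1 * bp \<xi> s - g * \<rho> s * (\<xi> $ 1 * b3 \<xi> s) - 2 * \<rho> s * \<omega> * (lam \<xi> * b2 \<xi> s) = 0"
    and "\<rho> s * (lam \<xi> * (lam \<xi> * b2 \<xi> s)) - \<xi> $ 2 * bp \<xi> s - g * \<rho> s * (\<xi> $ 2 * b3 \<xi> s) + 2 * \<rho> s * \<omega> * (lam \<xi> * b1 \<xi> s) = 0"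
proof -
  define d where "d = (lam \<xi>)\<^sup>2 + 4 * \<omega>\<^sup>2"
  have d: "d \<noteq> 0" using lam_pos(3) by (simp add: d_def)
  have x: "bp \<xi> s + g * \<rho> s * b3 \<xi> s = \<rho> s * H \<xi> s"
    unfolding bp_def b3_def using \<rho>_ne[OF assms] by simp
  have e1: "lam \<xi> * (lam \<xi> * b1 \<xi> s) - 2 * \<omega> * (lam \<xi> * b2 \<xi> s) = \<xi> $ 1 * H \<xi> s"
  proof -
    have "lam \<xi> * (lam \<xi> * b1 \<xi> s) - 2 * \<omega> * (lam \<xi> * b2 \<xi> s) = H \<xi> s * (d * \<xi> $ 1) / d"
      unfolding b1_def b2_def d_def[symmetric] using lam_pos(2)[of \<xi>] d
      by (simp add: divide_simps) (simp add: d_def algebra_simps power2_eq_square)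
    then show ?thesis using d by simp
  qed
  have e2: "lam \<xi> * (lam \<xi> * b2 \<xi> s) + 2 * \<omega> * (lam \<xi> * b1 \<xi> s) = \<xi> $ 2 * H \<xi> s"
  proof -
    have "lam \<xi> * (lam \<xi> * b2 \<xi> s) + 2 * \<omega> * (lam \<xi> * b1 \<xi> s) = H \<xi> s * (d * \<xi> $ 2) / d"
      unfolding b1_def b2_def d_def[symmetric] using lam_pos(2)[of \<xi>] d
      by (simp add: divide_simps) (simp add: d_def algebra_simps power2_eq_square)
    then show ?thesis using d by simp
  qed
  have "\<rho> s * (lam \<xi> * (lam \<xi> * b1 \<xi> s)) - \<xi> $ 1 * bp \<xi> s - g * \<rho> s * (\<xi> $ 1 * b3 \<xi> s) - 2 * \<rho> s * \<omega> * (lam \<xi> * b2 \<xi> s)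
    = \<rho> s * (lam \<xi> * (lam \<xi> * b1 \<xi> s) - 2 * \<omega> * (lam \<xi> * b2 \<xi> s)) - \<xi> $ 1 * (bp \<xi> s + g * \<rho> s * b3 \<xi> s)"
    by (simp add: algebra_simps)
  then show "\<rho> s * (lam \<xi> * (lam \<xi> * b1 \<xi> s)) - \<xi> $ 1 * bp \<xi> s - g * \<rho> s * (\<xi> $ 1 * b3 \<xi> s) - 2 * \<rho> s * \<omega> * (lam \<xi> * b2 \<xi> s) = 0"
    unfolding x e1 by simp
  have "\<rho> s * (lam \<xi> * (lam \<xi> * b2 \<xi> s)) - \<xi> $ 2 * bp \<xi> s - g * \<rho> s * (\<xi> $ 2 * b3 \<xi> s) + 2 * \<rho> s * \<omega> * (lam \<xi> * b1 \<xi> s)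
    = \<rho> s * (lam \<xi> * (lam \<xi> * b2 \<xi> s) + 2 * \<omega> * (lam \<xi> * b1 \<xi> s)) - \<xi> $ 2 * (bp \<xi> s + g * \<rho> s * b3 \<xi> s)"
    by (simp add: algebra_simps)
  then show "\<rho> s * (lam \<xi> * (lam \<xi> * b2 \<xi> s)) - \<xi> $ 2 * bp \<xi> s - g * \<rho> s * (\<xi> $ 2 * b3 \<xi> s) + 2 * \<rho> s * \<omega> * (lam \<xi> * b1 \<xi> s) = 0"
    unfolding x e2 by simp
qed

lemma slab_J: "slab J = slab {0<..<l} \<union> slab {-m<..<0}"
  by (auto simp: slab_def J_def)

lemma traces:
  fixes x' :: "real^2"
  shows "zero_jump l m (\<lambda>x. vel t x $ 3)"
    and "(\<And>x. x \<in> slab J \<Longrightarrow> h x = wave bp 0 t x) \<Longrightarrow> zero_jump l m h"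
    and "((\<lambda>x. vel t x $ 3) \<longlongrightarrow> 0) (at (point x' (- m)) within slab {-m<..<0})"
    and "((\<lambda>x. vel t x $ 3) \<longlongrightarrow> 0) (at (point x' l) within slab {0<..<l})"
proof -
  have sub: "{-m<..<0} \<subseteq> {-m..0}" "{0<..<l} \<subseteq> {0..l}" by auto
  \<comment> \<open>Versions of the vertical velocity and pressure profiles that are continuous up
    to the boundary of each layer; the traces are their values there, and \<open>match\<close> and
    \<open>walls\<close> apply to these.\<close>
  define vM vP pM pP where "vM = (\<lambda>\<xi> s. lam \<xi> * (- (UM \<xi> s / \<rho>M s) / (lam \<xi>)\<^sup>2))" and "vP = (\<lambda>\<xi> s. lam \<xi> * (- (UP \<xi> s / \<rho>P s) / (lam \<xi>)\<^sup>2))"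
    and "pM = (\<lambda>\<xi> s. \<rho>M s * HM \<xi> s + g * UM \<xi> s / (lam \<xi>)\<^sup>2)" and "pP = (\<lambda>\<xi> s. \<rho>P s * HP \<xi> s + g * UP \<xi> s / (lam \<xi>)\<^sup>2)"
  have neM: "s \<in> {-m..0} \<Longrightarrow> \<rho>M s \<noteq> 0" and neP: "s \<in> {0..l} \<Longrightarrow> \<rho>P s \<noteq> 0" for s using posM[of s] posP[of s] by auto
  have cM: "profile_cont {-m..0} vM" "profile_cont {-m..0} pM"
    unfolding vM_def pM_def by (intro pc contM profile_cont_snd neM lam_pos lam2_ne; assumption)+
  have cP: "profile_cont {0..l} vP" "profile_cont {0..l} pP"
    unfolding vP_def pP_def by (intro pc contP profile_cont_snd neP lam_pos lam2_ne; assumption)+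
  have eM: "wave (\<lambda>\<xi> s. lam \<xi> * b3 \<xi> s) 0 t x = wave vM 0 t x" "wave bp 0 t x = wave pM 0 t x" if "x \<in> slab {-m<..<0}" for x
    using eqM that by (auto intro!: wave_cong simp: b3_def bp_def vM_def pM_def slab_def)
  have eP: "wave (\<lambda>\<xi> s. lam \<xi> * b3 \<xi> s) 0 t x = wave vP 0 t x" "wave bp 0 t x = wave pP 0 t x" if "x \<in> slab {0<..<l}" for x
    using eqP that by (auto intro!: wave_cong simp: b3_def bp_def vP_def pP_def slab_def)
  have v3: "vel t x $ 3 = wave (\<lambda>\<xi> s. lam \<xi> * b3 \<xi> s) 0 t x" for x by (simp add: vel_def)
  have jump_v: "wave vM 0 t (point y 0) = wave vP 0 t (point y 0)" for y
    by (rule wave_cong) (simp only: vM_def vP_def point_nth match(1))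
  have jump_p: "wave pM 0 t (point y 0) = wave pP 0 t (point y 0)" for y
    by (rule wave_cong) (simp only: pM_def pP_def point_nth match(2))
  have in0: "point y 0 \<in> slab {-m..0}" "point y 0 \<in> slab {0..l}" for y using l m by auto
  show "zero_jump l m (\<lambda>x. vel t x $ 3)"
    unfolding zero_jump_def
  proof (intro allI exI conjI)
    fix y
    show "((\<lambda>x. vel t x $ 3) \<longlongrightarrow> wave vP 0 t (point y 0)) (at (point y 0) within slab {0<..<l})"
      by (rule wave_trace[OF cP(1) sub(2) in0(2)]) (simp add: v3 eP)
    show "((\<lambda>x. vel t x $ 3) \<longlongrightarrow> wave vP 0 t (point y 0)) (at (point y 0) within slab {-m<..<0})"
      unfolding jump_v[symmetric] by (rule wave_trace[OF cM(1) sub(1) in0(1)]) (simp add: v3 eM)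
  qed
  show "zero_jump l m h" if h: "\<And>x. x \<in> slab J \<Longrightarrow> h x = wave bp 0 t x"
    unfolding zero_jump_def
  proof (intro allI exI conjI)
    fix y
    show "(h \<longlongrightarrow> wave pP 0 t (point y 0)) (at (point y 0) within slab {0<..<l})"
      by (rule wave_trace[OF cP(2) sub(2) in0(2)]) (simp add: h slab_J eP)
    show "(h \<longlongrightarrow> wave pP 0 t (point y 0)) (at (point y 0) within slab {-m<..<0})"
      unfolding jump_p[symmetric] by (rule wave_trace[OF cM(2) sub(1) in0(1)]) (simp add: h slab_J eM)
  qed
  have "wave vM 0 t (point x' (- m)) = wave (\<lambda>\<xi> s. 0) 0 t (point x' (- m))"
    by (rule wave_cong) (simp add: vM_def walls)
  moreover have "((\<lambda>x. vel t x $ 3) \<longlongrightarrow> wave vM 0 t (point x' (- m))) (at (point x' (- m)) within slab {-m<..<0})"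
    by (rule wave_trace[OF cM(1) sub(1)]) (use m in \<open>auto simp: v3 eM\<close>)
  ultimately show "((\<lambda>x. vel t x $ 3) \<longlongrightarrow> 0) (at (point x' (- m)) within slab {-m<..<0})"
    by (simp add: wave_0)
  have "wave vP 0 t (point x' l) = wave (\<lambda>\<xi> s. 0) 0 t (point x' l)"
    by (rule wave_cong) (simp add: vP_def walls)
  moreover have "((\<lambda>x. vel t x $ 3) \<longlongrightarrow> wave vP 0 t (point x' l)) (at (point x' l) within slab {0<..<l})"
    by (rule wave_trace[OF cP(1) sub(2)]) (use l in \<open>auto simp: v3 eP\<close>)
  ultimately show "((\<lambda>x. vel t x $ 3) \<longlongrightarrow> 0) (at (point x' l) within slab {0<..<l})"
    by (simp add: wave_0)
qed

theorem solves:
  assumes cdp: "\<And>s. s \<in> {-m<..<0} \<union> {0<..<l} \<Longrightarrow> dp pp pm \<rho> s * c s = 1"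
  shows "solves_linear_problem g \<omega> pp pm l m \<rho> eta vel dens"
proof -
  note W = wave_C1[OF J_open]
  have C1e: "C1_on ({0..} \<times> slab J) (\<lambda>z. eta (fst z) (snd z))"
    unfolding eta_def by (intro C1_on_vec3 W[OF b_cont(1,6) b_D(1)] W[OF b_cont(2,7) b_D(2)] W[OF b_cont(3,8) b_D(3)]; assumption)
  have C1v: "C1_on ({0..} \<times> slab J) (\<lambda>z. vel (fst z) (snd z))"
    unfolding vel_def
    by (intro C1_on_vec3 W[OF lam_b_cont[OF b_cont(1)] lam_b_cont[OF b_cont(6)] lam_b_D(1)] W[OF lam_b_cont[OF b_cont(2)] lam_b_cont[OF b_cont(7)] lam_b_D(2)]
        W[OF lam_b_cont[OF b_cont(3)] lam_b_cont[OF b_cont(8)] lam_b_D(3)]; assumption)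
  have C1q: "C1_on ({0..} \<times> slab J) (\<lambda>z. dens (fst z) (snd z))"
    unfolding dens_def by (rule W[OF b_cont(5,10) b_D(5)])
  have pq: "dp pp pm \<rho> (y $ 3) * dens t y = wave bp 0 t y" if "y \<in> slab J" for t y
  proof -
    have "dens t y = c (y $ 3) * wave bp 0 t y" unfolding dens_def bq_def[abs_def] by (rule wave_scale)
    then show ?thesis using cdp[of "y $ 3"] that by (simp add: slab_def J_def mult.assoc[symmetric])
  qed
  have pde: "((\<lambda>\<tau>. eta \<tau> x) has_vector_derivative vel t x) (at t within {0..}) \<and>
          (\<exists>qt. ((\<lambda>\<tau>. dens \<tau> x) has_real_derivative qt) (at t within {0..}) \<and>
             qt + \<rho> (x $ 3) * divergence (vel t) x = 0) \<and>
          (\<exists>vt. ((\<lambda>\<tau>. vel \<tau> x) has_vector_derivative vt) (at t within {0..}) \<and>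
             \<rho> (x $ 3) *\<^sub>R vt + gradient (\<lambda>y. dp pp pm \<rho> (y $ 3) * dens t y) x =
               - (g * dens t x) *\<^sub>R axis 3 1
               - (g * \<rho> (x $ 3)) *\<^sub>R gradient (\<lambda>y. eta t y $ 3) x
               + (2 * \<rho> (x $ 3) * \<omega> * (vel t x $ 2)) *\<^sub>R axis 1 1
               - (2 * \<rho> (x $ 3) * \<omega> * (vel t x $ 1)) *\<^sub>R axis 2 1)"
    if x: "x \<in> slab J" for t x
  proof -
    define s where "s = x $ 3"
    have s: "s \<in> J" using x by (simp add: s_def slab_def)
    note Dt = wave_DERIV_t[OF J_open _ _ _ x]
    have et: "((\<lambda>\<tau>. eta \<tau> x) has_vector_derivative vel t x) (at t within {0..})"
      unfolding eta_def vel_def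
      by (rule has_vector_derivative_vec3[OF Dt[OF b_cont(1,6) b_D(1)] Dt[OF b_cont(2,7) b_D(2)] Dt[OF b_cont(3,8) b_D(3)] refl]; assumption)
    define vt where "vt = vec3 (wave (\<lambda>\<xi> s. lam \<xi> * (lam \<xi> * b1 \<xi> s)) (- (pi / 2)) t x) (wave (\<lambda>\<xi> s. lam \<xi> * (lam \<xi> * b2 \<xi> s)) (- (pi / 2)) t x)
       (wave (\<lambda>\<xi> s. lam \<xi> * (lam \<xi> * b3 \<xi> s)) 0 t x)"
    have vt: "((\<lambda>\<tau>. vel \<tau> x) has_vector_derivative vt) (at t within {0..})"
      unfolding vel_def vt_def
      by (rule has_vector_derivative_vec3[OF Dt[OF lam_b_cont[OF b_cont(1)] lam_b_cont[OF b_cont(6)] lam_b_D(1)] Dt[OF lam_b_cont[OF b_cont(2)] lam_b_cont[OF b_cont(7)] lam_b_D(2)]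
          Dt[OF lam_b_cont[OF b_cont(3)] lam_b_cont[OF b_cont(8)] lam_b_D(3)] refl]; assumption)
    have qt: "((\<lambda>\<tau>. dens \<tau> x) has_real_derivative wave (\<lambda>\<xi> s. lam \<xi> * bq \<xi> s) 0 t x) (at t within {0..})"
      unfolding dens_def by (rule Dt[OF b_cont(5,10) b_D(5)])
    have d1: "partial_deriv 1 (\<lambda>y. vel t y $ 1) x = wave (\<lambda>\<xi> s. \<xi> $ 1 * (lam \<xi> * b1 \<xi> s)) 0 t x"
      using wave_partial(1)[OF J_open lam_b_cont[OF b_cont(1)] lam_b_cont[OF b_cont(6)] lam_b_D(1) x, of "\<lambda>y. vel t y $ 1" "- (pi / 2)" t] by (simp add: vel_def)
    have d2: "partial_deriv 2 (\<lambda>y. vel t y $ 2) x = wave (\<lambda>\<xi> s. \<xi> $ 2 * (lam \<xi> * b2 \<xi> s)) 0 t x"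
      using wave_partial(2)[OF J_open lam_b_cont[OF b_cont(2)] lam_b_cont[OF b_cont(7)] lam_b_D(2) x, of "\<lambda>y. vel t y $ 2" "- (pi / 2)" t] by (simp add: vel_def)
    have d3: "partial_deriv 3 (\<lambda>y. vel t y $ 3) x = wave (\<lambda>\<xi> s. lam \<xi> * b3' \<xi> s) 0 t x"
      using wave_partial(3)[OF J_open lam_b_cont[OF b_cont(3)] lam_b_cont[OF b_cont(8)] lam_b_D(3) x, of "\<lambda>y. vel t y $ 3" 0 t] by (simp add: vel_def)
    have e3: "partial_deriv 1 (\<lambda>y. eta t y $ 3) x = - wave (\<lambda>\<xi> s. \<xi> $ 1 * b3 \<xi> s) (- (pi / 2)) t x"
      "partial_deriv 2 (\<lambda>y. eta t y $ 3) x = - wave (\<lambda>\<xi> s. \<xi> $ 2 * b3 \<xi> s) (- (pi / 2)) t x"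
      "partial_deriv 3 (\<lambda>y. eta t y $ 3) x = wave b3' 0 t x"
      using wave_partial[OF J_open b_cont(3,8) b_D(3) x, of "\<lambda>y. eta t y $ 3" 0 t] by (simp_all add: eta_def wave_half_turn)
    have p: "partial_deriv 1 (\<lambda>y. dp pp pm \<rho> (y $ 3) * dens t y) x = - wave (\<lambda>\<xi> s. \<xi> $ 1 * bp \<xi> s) (- (pi / 2)) t x"
      "partial_deriv 2 (\<lambda>y. dp pp pm \<rho> (y $ 3) * dens t y) x = - wave (\<lambda>\<xi> s. \<xi> $ 2 * bp \<xi> s) (- (pi / 2)) t x"
      "partial_deriv 3 (\<lambda>y. dp pp pm \<rho> (y $ 3) * dens t y) x = wave bp' 0 t x"
      using wave_partial[OF J_open b_cont(4,9) b_D(4) x, of "\<lambda>y. dp pp pm \<rho> (y $ 3) * dens t y" 0 t] pq[of _ t] by (simp_all add: wave_half_turn)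
    have cont_eq: "wave (\<lambda>\<xi> s. lam \<xi> * bq \<xi> s) 0 t x + \<rho> s * divergence (vel t) x = 0"
    proof -
      have "sum_list (map (\<lambda>(k, b). k * wave b 0 t x) [(1, \<lambda>\<xi> s. lam \<xi> * bq \<xi> s), (\<rho> s, \<lambda>\<xi> s. \<xi> $ 1 * (lam \<xi> * b1 \<xi> s)),
          (\<rho> s, \<lambda>\<xi> s. \<xi> $ 2 * (lam \<xi> * b2 \<xi> s)), (\<rho> s, \<lambda>\<xi> s. lam \<xi> * b3' \<xi> s)]) = 0"
      proof (rule wave_eq_0I[OF _ x])
        fix \<xi> assume "amp \<xi> \<noteq> 0"
        have "lam \<xi> * (bq \<xi> s + \<rho> s * (\<xi> $ 1 * b1 \<xi> s + \<xi> $ 2 * b2 \<xi> s + b3' \<xi> s)) = 0"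
          using continuity_mode[OF \<open>amp \<xi> \<noteq> 0\<close> s] by simp
        then show "sum_list (map (\<lambda>(k, b). k * b \<xi> (x $ 3)) [(1, \<lambda>\<xi> s. lam \<xi> * bq \<xi> s), (\<rho> s, \<lambda>\<xi> s. \<xi> $ 1 * (lam \<xi> * b1 \<xi> s)),
          (\<rho> s, \<lambda>\<xi> s. \<xi> $ 2 * (lam \<xi> * b2 \<xi> s)), (\<rho> s, \<lambda>\<xi> s. lam \<xi> * b3' \<xi> s)]) = 0"
          by (simp add: s_def algebra_simps)
      qed (simp, intro conjI pc b_cont)
      then show ?thesis by (simp add: divergence_def sum_3 d1 d2 d3 algebra_simps)
    qed
    have z3: "\<rho> s * vt $ 3 + wave bp' 0 t x + g * dens t x + g * \<rho> s * wave b3' 0 t x = 0"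
    proof -
      have "sum_list (map (\<lambda>(k, b). k * wave b 0 t x) [(\<rho> s, \<lambda>\<xi> s. lam \<xi> * (lam \<xi> * b3 \<xi> s)), (1, bp'), (g, bq), (g * \<rho> s, b3')]) = 0"
        by (rule wave_eq_0I[OF _ x]) (use vertical_mode[OF s] in \<open>simp_all add: s_def add.assoc, intro conjI pc b_cont\<close>)
      then show ?thesis by (simp add: vt_def dens_def)
    qed
    have z1: "\<rho> s * vt $ 1 - wave (\<lambda>\<xi> s. \<xi> $ 1 * bp \<xi> s) (- (pi / 2)) t x - g * \<rho> s * wave (\<lambda>\<xi> s. \<xi> $ 1 * b3 \<xi> s) (- (pi / 2)) t x - 2 * \<rho> s * \<omega> * vel t x $ 2 = 0"
    proof -
      have "sum_list (map (\<lambda>(k, b). k * wave b (- (pi / 2)) t x) [(\<rho> s, \<lambda>\<xi> s. lam \<xi> * (lam \<xi> * b1 \<xi> s)), (- 1, \<lambda>\<xi> s. \<xi> $ 1 * bp \<xi> s),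
         (- (g * \<rho> s), \<lambda>\<xi> s. \<xi> $ 1 * b3 \<xi> s), (- (2 * \<rho> s * \<omega>), \<lambda>\<xi> s. lam \<xi> * b2 \<xi> s)]) = 0"
        by (rule wave_eq_0I[OF _ x]) (use horizontal_mode(1)[OF s] in \<open>simp_all add: s_def algebra_simps, intro conjI pc b_cont\<close>)
      then show ?thesis by (simp add: vt_def vel_def algebra_simps)
    qed
    have z2: "\<rho> s * vt $ 2 - wave (\<lambda>\<xi> s. \<xi> $ 2 * bp \<xi> s) (- (pi / 2)) t x - g * \<rho> s * wave (\<lambda>\<xi> s. \<xi> $ 2 * b3 \<xi> s) (- (pi / 2)) t x + 2 * \<rho> s * \<omega> * vel t x $ 1 = 0"
    proof -
      have "sum_list (map (\<lambda>(k, b). k * wave b (- (pi / 2)) t x) [(\<rho> s, \<lambda>\<xi> s. lam \<xi> * (lam \<xi> * b2 \<xi> s)), (- 1, \<lambda>\<xi> s. \<xi> $ 2 * bp \<xi> s),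
         (- (g * \<rho> s), \<lambda>\<xi> s. \<xi> $ 2 * b3 \<xi> s), (2 * \<rho> s * \<omega>, \<lambda>\<xi> s. lam \<xi> * b1 \<xi> s)]) = 0"
        by (rule wave_eq_0I[OF _ x]) (use horizontal_mode(2)[OF s] in \<open>simp_all add: s_def algebra_simps, intro conjI pc b_cont\<close>)
      then show ?thesis by (simp add: vt_def vel_def algebra_simps)
    qed
    have "\<rho> s *\<^sub>R vt + gradient (\<lambda>y. dp pp pm \<rho> (y $ 3) * dens t y) x =
               - (g * dens t x) *\<^sub>R axis 3 1
               - (g * \<rho> s) *\<^sub>R gradient (\<lambda>y. eta t y $ 3) x
               + (2 * \<rho> s * \<omega> * (vel t x $ 2)) *\<^sub>R axis 1 1
               - (2 * \<rho> s * \<omega> * (vel t x $ 1)) *\<^sub>R axis 2 1"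
      unfolding vec_eq_iff forall_3 gradient_def using z1 z2 z3
      by (simp add: p e3 axis_def)
    then show ?thesis using et vt qt cont_eq unfolding s_def by blast
  qed
  show ?thesis
    unfolding solves_linear_problem_def Let_def slab_J[symmetric]
    using C1e C1v C1q pde traces(1,3,4) traces(2)[OF pq] by blast
qed

end

section \<open>Growth of the Sobolev norms\<close>

definition mode_sqnorm :: "real set \<Rightarrow> nat \<Rightarrow> (real^2 \<Rightarrow> real) \<Rightarrow> (real^2 \<Rightarrow> real) \<Rightarrow> real \<Rightarrow> (nat \<Rightarrow> real^2 \<Rightarrow> real \<Rightarrow> real) \<Rightarrow> ennreal" where
  "mode_sqnorm I k amp lam t D = (\<Sum>j\<le>k. \<integral>\<^sup>+\<xi>. ennreal ((1 + (norm \<xi>)\<^sup>2) ^ (k - j)) *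
        (\<integral>\<^sup>+s\<in>I. ennreal (((2 * pi)\<^sup>2 * (amp \<xi> * exp (lam \<xi> * t) * D j \<xi> s))\<^sup>2) \<partial>lborel) \<partial>lborel)"

text \<open>Evenness keeps the packets real. On the support \<open>rad\<close> dominates both the
  wave vector and its size \<open>N\<close>, so that powers of \<open>N\<close> become powers of
  \<open>rad\<close>. The amplitude bound \<tau> stays separate because squared norms scale with its
  square and it is chosen last.\<close>

definition admissible :: "(real^2 \<Rightarrow> real) \<Rightarrow> (real^2 \<Rightarrow> real) \<Rightarrow> real \<Rightarrow> real \<Rightarrow> bool" where
  "admissible N amp rad \<tau> \<longleftrightarrow> continuous_on UNIV amp \<and> 1 \<le> rad \<and> 0 \<le> \<tau> \<and>
     (\<forall>\<xi>. amp (- \<xi>) = amp \<xi> \<and> \<bar>amp \<xi>\<bar> \<le> \<tau> \<and> (amp \<xi> \<noteq> 0 \<longrightarrow> norm \<xi> \<le> rad \<and> N \<xi> \<le> rad))"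

text \<open>A single \<open>n\<close> serves as constant and as exponent, and every large
  \<open>n\<close> is allowed. Finitely many bounds, for different components, layers and orders,
  can then be combined by taking one common \<open>n\<close>.\<close>

lemma mode_sqnorm_le:
  fixes N lam amp :: "real^2 \<Rightarrow> real"
  assumes ab: "a0 < b0"
    and bd: "\<And>j. \<exists>C n. 0 \<le> C \<and> (\<forall>\<xi>. \<forall>s\<in>{a0<..<b0}. \<bar>D j \<xi> s\<bar> \<le> C * N \<xi> ^ n)"
    and N: "\<And>\<xi>. 1 \<le> N \<xi>" and lam: "\<And>\<xi>. lam \<xi> \<le> N \<xi>"
  shows "\<forall>\<^sub>F n in sequentially. \<forall>amp rad \<tau> t. admissible N amp rad \<tau> \<longrightarrow> 0 \<le> t \<longrightarrow>
     mode_sqnorm {a0<..<b0} k amp lam t D \<le> ennreal (\<tau>\<^sup>2 * exp (2 * rad * t) * (real n * rad ^ n))"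
proof -
  obtain C p where C: "\<And>j. 0 \<le> C j" "\<And>j \<xi> s. s \<in> {a0<..<b0} \<Longrightarrow> \<bar>D j \<xi> s\<bar> \<le> C j * N \<xi> ^ p j"
    using bd by metis
  define C0 where "C0 = (\<Sum>j\<le>k. C j)"
  define p0 where "p0 = (\<Sum>j\<le>k. p j)"
  have C0: "0 \<le> C0" using C(1) by (simp add: C0_def sum_nonneg)
  have D: "\<bar>D j \<xi> s\<bar> \<le> C0 * N \<xi> ^ p0" if "j \<le> k" "s \<in> {a0<..<b0}" for j \<xi> s
  proof -
    have "C j \<le> C0" unfolding C0_def using C(1) that by (intro member_le_sum) auto
    moreover have "p j \<le> p0" unfolding p0_def using that by (intro member_le_sum) auto
    ultimately have "C j * N \<xi> ^ p j \<le> C0 * N \<xi> ^ p0"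
      using C0 N[of \<xi>] by (intro mult_mono power_increasing) auto
    then show ?thesis using C(2)[OF that(2)] by (meson order_trans)
  qed
  define E where "E = real (Suc k) * (2 ^ k * 4 * (b0 - a0) * ((2 * pi)\<^sup>2 * C0)\<^sup>2)"
  \<comment> \<open>\<open>E\<close> absorbs the constants. In the exponent, 2 k comes from the
    frequency weights, 2 from the area of the box, and 2 p0 from the squared profile.\<close>
  define n0 where "n0 = nat \<lceil>E\<rceil> + (2 * k + 2 + 2 * p0)"
  have E0: "0 \<le> E" using ab by (auto simp: E_def)
  have main: "mode_sqnorm {a0<..<b0} k amp lam t D \<le> ennreal (\<tau>\<^sup>2 * exp (2 * rad * t) * (real n * rad ^ n))"
    if n: "n0 \<le> n" and adm: "admissible N amp rad \<tau>" and t: "0 \<le> t" for n amp rad \<tau> t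
  proof -
    have rad: "1 \<le> rad" and \<tau>: "0 \<le> \<tau>" and amp: "\<And>\<xi>. \<bar>amp \<xi>\<bar> \<le> \<tau>"
      and supp: "\<And>\<xi>. amp \<xi> \<noteq> 0 \<Longrightarrow> norm \<xi> \<le> rad \<and> N \<xi> \<le> rad"
      using adm by (auto simp: admissible_def)
    define B where "B = (2 * pi)\<^sup>2 * (\<tau> * exp (rad * t) * (C0 * rad ^ p0))"
    define S :: "(real^2) set" where "S = cbox (\<chi> i. - rad) (\<chi> i. rad)"
    have B0: "0 \<le> B" using \<tau> C0 rad by (simp add: B_def)
    have pt: "((2 * pi)\<^sup>2 * (amp \<xi> * exp (lam \<xi> * t) * D j \<xi> s))\<^sup>2 \<le> B\<^sup>2" if "j \<le> k" "s \<in> {a0<..<b0}" for j \<xi> s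
    proof (cases "amp \<xi> = 0")
      case False
      then have le: "N \<xi> \<le> rad" using supp by blast
      then have "lam \<xi> * t \<le> rad * t" using lam[of \<xi>] t by (intro mult_right_mono) auto
      moreover have "\<bar>D j \<xi> s\<bar> \<le> C0 * rad ^ p0"
        using D[OF that, of \<xi>] le N[of \<xi>] C0 by (meson mult_left_mono power_mono order_trans zero_le_one)
      ultimately have "\<bar>amp \<xi> * exp (lam \<xi> * t) * D j \<xi> s\<bar> \<le> \<tau> * exp (rad * t) * (C0 * rad ^ p0)"
        unfolding abs_mult using amp[of \<xi>] \<tau> by (intro mult_mono) auto
      then have "\<bar>(2 * pi)\<^sup>2 * (amp \<xi> * exp (lam \<xi> * t) * D j \<xi> s)\<bar> \<le> B"
        unfolding B_def abs_mult[of "(2 * pi)\<^sup>2"] by (simp add: mult_left_mono)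
      then show ?thesis using B0 by (metis abs_le_square_iff abs_of_nonneg)
    qed (simp add: B0)
    have inner: "(\<integral>\<^sup>+s\<in>{a0<..<b0}. ennreal (((2 * pi)\<^sup>2 * (amp \<xi> * exp (lam \<xi> * t) * D j \<xi> s))\<^sup>2) \<partial>lborel)
        \<le> ennreal (B\<^sup>2 * (b0 - a0))" if "j \<le> k" for j \<xi>
    proof -
      have "(\<integral>\<^sup>+s\<in>{a0<..<b0}. ennreal (((2 * pi)\<^sup>2 * (amp \<xi> * exp (lam \<xi> * t) * D j \<xi> s))\<^sup>2) \<partial>lborel)
         \<le> (\<integral>\<^sup>+s. ennreal (B\<^sup>2) * indicator {a0<..<b0} s \<partial>lborel)"
        using pt[OF that] by (intro nn_integral_mono) (auto simp: indicator_def intro!: ennreal_leI)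
      also have "\<dots> = ennreal (B\<^sup>2 * (b0 - a0))"
        using ab by (simp add: nn_integral_cmult_indicator ennreal_mult')
      finally show ?thesis .
    qed
    have vol: "emeasure lborel S = ennreal (4 * rad\<^sup>2)"
      unfolding S_def using rad
      by (subst emeasure_lborel_cbox_eq)
         (auto simp: mem_box Basis_vec_def inner_axis axis_eq_axis prod.UNION_disjoint UNIV_2 power2_eq_square)
    have outer: "(\<integral>\<^sup>+\<xi>. ennreal ((1 + (norm \<xi>)\<^sup>2) ^ (k - j)) *
        (\<integral>\<^sup>+s\<in>{a0<..<b0}. ennreal (((2 * pi)\<^sup>2 * (amp \<xi> * exp (lam \<xi> * t) * D j \<xi> s))\<^sup>2) \<partial>lborel) \<partial>lborel)
        \<le> ennreal ((2 * rad\<^sup>2) ^ k * (B\<^sup>2 * (b0 - a0)) * (4 * rad\<^sup>2))" if j: "j \<le> k" for j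
    proof -
      have "ennreal ((1 + (norm \<xi>)\<^sup>2) ^ (k - j)) *
        (\<integral>\<^sup>+s\<in>{a0<..<b0}. ennreal (((2 * pi)\<^sup>2 * (amp \<xi> * exp (lam \<xi> * t) * D j \<xi> s))\<^sup>2) \<partial>lborel)
        \<le> ennreal ((2 * rad\<^sup>2) ^ k * (B\<^sup>2 * (b0 - a0))) * indicator S \<xi>" for \<xi>
      proof (cases "amp \<xi> = 0")
        case False
        then have nr: "norm \<xi> \<le> rad" using supp by blast
        have "\<bar>\<xi> $ i\<bar> \<le> rad" for i using component_le_norm_cart[of \<xi> i] nr by linarith
        then have "\<xi> \<in> S" by (auto simp: S_def mem_box_cart abs_le_iff) (metis minus_le_iff)
        have "(norm \<xi>)\<^sup>2 \<le> rad\<^sup>2" "1 \<le> rad\<^sup>2" using nr rad by (auto intro: power_mono)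
        then have "(1 + (norm \<xi>)\<^sup>2) ^ (k - j) \<le> (2 * rad\<^sup>2) ^ (k - j)" by (intro power_mono) auto
        also have "\<dots> \<le> (2 * rad\<^sup>2) ^ k" using \<open>1 \<le> rad\<^sup>2\<close> by (intro power_increasing) auto
        finally have "ennreal ((1 + (norm \<xi>)\<^sup>2) ^ (k - j)) \<le> ennreal ((2 * rad\<^sup>2) ^ k)" by (rule ennreal_leI)
        from mult_mono[OF this inner[OF j, of \<xi>]]
        show ?thesis using \<open>\<xi> \<in> S\<close> ab by (simp add: ennreal_mult'')
      qed simp
      then have "(\<integral>\<^sup>+\<xi>. ennreal ((1 + (norm \<xi>)\<^sup>2) ^ (k - j)) *
        (\<integral>\<^sup>+s\<in>{a0<..<b0}. ennreal (((2 * pi)\<^sup>2 * (amp \<xi> * exp (lam \<xi> * t) * D j \<xi> s))\<^sup>2) \<partial>lborel) \<partial>lborel)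
        \<le> (\<integral>\<^sup>+\<xi>. ennreal ((2 * rad\<^sup>2) ^ k * (B\<^sup>2 * (b0 - a0))) * indicator S \<xi> \<partial>lborel)"
        by (rule nn_integral_mono)
      also have "\<dots> = ennreal ((2 * rad\<^sup>2) ^ k * (B\<^sup>2 * (b0 - a0)) * (4 * rad\<^sup>2))"
        using ab by (subst nn_integral_cmult_indicator) (simp_all add: vol ennreal_mult''[symmetric] del: ennreal_power ennreal_numeral, simp_all add: S_def)
      finally show ?thesis .
    qed
    have "mode_sqnorm {a0<..<b0} k amp lam t D \<le> (\<Sum>j\<le>k. ennreal ((2 * rad\<^sup>2) ^ k * (B\<^sup>2 * (b0 - a0)) * (4 * rad\<^sup>2)))"
      unfolding mode_sqnorm_def by (intro sum_mono outer) simp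
    also have "\<dots> = ennreal (real (Suc k) * ((2 * rad\<^sup>2) ^ k * (B\<^sup>2 * (b0 - a0)) * (4 * rad\<^sup>2)))"
      using ab by (subst sum_ennreal) auto
    also have "real (Suc k) * ((2 * rad\<^sup>2) ^ k * (B\<^sup>2 * (b0 - a0)) * (4 * rad\<^sup>2)) = \<tau>\<^sup>2 * exp (2 * rad * t) * (E * rad ^ (2 * k + 2 + 2 * p0))"
    proof -
      have "exp (2 * rad * t) = (exp (rad * t))\<^sup>2" by (simp add: power2_eq_square exp_add[symmetric])
      then show ?thesis
        unfolding B_def E_def by (simp add: power_mult_distrib power_add power_mult power_even_eq mult_ac)
          (simp add: power2_eq_square power_mult_distrib mult_ac)
    qed
    also have "ennreal \<dots> \<le> ennreal (\<tau>\<^sup>2 * exp (2 * rad * t) * (real n * rad ^ n))"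
    proof (intro ennreal_leI mult_left_mono mult_mono power_increasing)
      show "E \<le> real n" "2 * k + 2 + 2 * p0 \<le> n" using n E0 unfolding n0_def by linarith+
    qed (use rad in auto)
    finally show ?thesis .
  qed
  then show ?thesis unfolding eventually_sequentially by blast
qed


text \<open>The last conjunct drops the weights, all vertical derivatives and the factor \<open>(2 * pi)\<^sup>4\<close>.\<close>
definition controlled :: "(real^2 \<Rightarrow> real) \<Rightarrow> (real^2 \<Rightarrow> real) \<Rightarrow> real set \<Rightarrow> real \<Rightarrow> (real^2 \<Rightarrow> real \<Rightarrow> real) \<Rightarrow> nat \<Rightarrow> nat \<Rightarrow> bool" where
  "controlled lam N I \<delta> b k n \<longleftrightarrow> (\<forall>amp rad \<tau> t f h. admissible N amp rad \<tau> \<longrightarrow> 0 \<le> t \<longrightarrow>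
     (\<forall>x\<in>slab I. f x = wave_packet.wave amp lam rad b \<delta> t x) \<longrightarrow>
     (\<forall>x\<in>slab I. h x = wave_packet.wave amp lam rad (\<lambda>\<xi> s. lam \<xi> * b \<xi> s) \<delta> t x) \<longrightarrow>
     in_Hk_slab I k f \<and> in_Hk_slab I k h \<and> Hk_slab_sqnorm I k f \<le> Hk_slab_sqnorm I k h \<and>
     Hk_slab_sqnorm I k h \<le> ennreal (\<tau>\<^sup>2 * exp (2 * rad * t) * (real n * rad ^ n)) \<and>
     (\<integral>\<^sup>+\<xi>. (\<integral>\<^sup>+s\<in>I. ennreal ((amp \<xi> * exp (lam \<xi> * t) * b \<xi> s)\<^sup>2) \<partial>lborel) \<partial>lborel) \<le> Hk_slab_sqnorm I k f)"

locale layer_modes = mode_profiles I \<rho> q g a b N A "\<lambda>\<xi>. (lam \<xi>)\<^sup>2" H U K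
  for I and \<rho> q and g a b and N A lam :: "real^2 \<Rightarrow> real" and H U and K +
  fixes a0 b0 :: real
  assumes I: "I = {a0<..<b0}" and ab: "a0 < b0"
    and lam: "\<And>\<xi>. 1 \<le> lam \<xi> \<and> lam \<xi> \<le> N \<xi>" and lam_cont: "continuous_on UNIV lam"
    and norm_N: "\<And>\<xi>. norm \<xi> \<le> N \<xi>"
    and lam_even: "\<And>\<xi>. lam (- \<xi>) = lam \<xi>"
begin

text \<open>\<open>u'\<close> is the expression recognised as a \<open>profile\<close>,
  \<open>u\<close> the formula that occurs in the solution; they need to agree only inside the
  layer. Symmetry \<open>sym\<close> is imposed on \<open>u\<close> alone, since amplitude and
  growth rate are even.\<close>

lemma eventually_controlled:
  assumes p: "profile u'" and eq: "\<And>\<xi> s. s \<in> I \<Longrightarrow> u' \<xi> s = u \<xi> s"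
    and cont: "continuous_on (UNIV \<times> I) (\<lambda>z. u (fst z) (snd z))"
    and sym: "\<And>\<xi> s. s \<in> I \<Longrightarrow> complex_of_real (u (- \<xi>) s) * cis \<delta> = complex_of_real (u \<xi> s) * cis (- \<delta>)"
  shows "\<forall>\<^sub>F n in sequentially. controlled lam N I \<delta> u k n"
proof -
  obtain D where D: "D 0 = u'" "\<And>i. profile (D i)" "\<And>i \<xi> s. s \<in> I \<Longrightarrow> (D i \<xi> has_real_derivative D (Suc i) \<xi> s) (at s)"
    using profile_derivatives[OF p] by metis
  define L where "L = (\<lambda>j \<xi> s. lam \<xi> * D j \<xi> s)"
  have L_bd: "\<exists>C n. 0 \<le> C \<and> (\<forall>\<xi>. \<forall>s\<in>{a0<..<b0}. \<bar>L j \<xi> s\<bar> \<le> C * N \<xi> ^ n)" for j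
  proof -
    obtain C n where C: "0 \<le> C" "\<And>\<xi> s. s \<in> I \<Longrightarrow> \<bar>D j \<xi> s\<bar> \<le> C * N \<xi> ^ n" using profile_bounded[OF D(2)] by blast
    have "\<bar>L j \<xi> s\<bar> \<le> C * N \<xi> ^ Suc n" if "s \<in> I" for \<xi> s
    proof -
      have "\<bar>L j \<xi> s\<bar> \<le> N \<xi> * (C * N \<xi> ^ n)"
        unfolding L_def abs_mult using C(2)[OF that, of \<xi>] lam[of \<xi>] by (intro mult_mono) auto
      then show ?thesis by (simp add: mult_ac)
    qed
    then show ?thesis using C(1) I by blast
  qed
  have ev: "\<forall>\<^sub>F n in sequentially. \<forall>amp rad \<tau> t. admissible N amp rad \<tau> \<longrightarrow> 0 \<le> t \<longrightarrow>
     mode_sqnorm {a0<..<b0} k amp lam t L \<le> ennreal (\<tau>\<^sup>2 * exp (2 * rad * t) * (real n * rad ^ n))"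
    by (rule mode_sqnorm_le[OF ab L_bd N]) (use lam in blast)+
  show ?thesis
    using ev
  proof eventually_elim
    case (elim n)
    show ?case unfolding controlled_def
    proof (intro allI impI)
      fix amp rad \<tau> t f h
      assume adm: "admissible N amp rad \<tau>" and t: "0 \<le> t"
        and f: "\<forall>x\<in>slab I. f x = wave_packet.wave amp lam rad u \<delta> t x"
        and h: "\<forall>x\<in>slab I. h x = wave_packet.wave amp lam rad (\<lambda>\<xi> s. lam \<xi> * u \<xi> s) \<delta> t x"
      have amp: "continuous_on UNIV amp" "1 \<le> rad" "0 \<le> \<tau>" "\<And>\<xi>. amp (- \<xi>) = amp \<xi>" "\<And>\<xi>. \<bar>amp \<xi>\<bar> \<le> \<tau>"
        "\<And>\<xi>. amp \<xi> \<noteq> 0 \<Longrightarrow> norm \<xi> \<le> rad \<and> N \<xi> \<le> rad"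
        using adm by (auto simp: admissible_def)
      interpret wave_packet amp lam rad
        by unfold_locales (use amp lam_cont in force)+
      have Db: "D 0 \<xi> s = u \<xi> s" if "s \<in> I" for \<xi> s using D(1) eq[OF that] by simp
      have cD: "profile_cont {a0<..<b0} (D 0)"
        unfolding profile_cont_def by (rule continuous_on_eq[OF cont[unfolded I]]) (auto simp: Db I)
      have cL: "profile_cont {a0<..<b0} (L 0)"
        unfolding L_def by (rule profile_cont_mult_gam[OF cD])
      have bL: "\<exists>C. \<forall>\<xi>. \<forall>s\<in>I. \<bar>amp \<xi> * exp (lam \<xi> * t) * L 0 \<xi> s\<bar> \<le> C"
      proof -
        obtain C n where C: "0 \<le> C" "\<And>\<xi> s. s \<in> I \<Longrightarrow> \<bar>L 0 \<xi> s\<bar> \<le> C * N \<xi> ^ n" using L_bd[of 0] I by blast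
        have "\<bar>amp \<xi> * exp (lam \<xi> * t) * L 0 \<xi> s\<bar> \<le> \<tau> * exp (rad * t) * (C * rad ^ n)" if "s \<in> I" for \<xi> s
        proof (cases "amp \<xi> = 0")
          case False
          then have r: "N \<xi> \<le> rad" using amp(6) by blast
          then have "lam \<xi> * t \<le> rad * t" using lam[of \<xi>] t by (intro mult_right_mono) auto
          moreover have "\<bar>L 0 \<xi> s\<bar> \<le> C * rad ^ n"
            using C(2)[OF that, of \<xi>] r N[of \<xi>] C(1) by (meson mult_left_mono power_mono order_trans zero_le_one)
          ultimately show ?thesis unfolding abs_mult using amp(3) amp(5)[of \<xi>] by (intro mult_mono) auto
        qed (use amp C in simp)
        then show ?thesis by blast
      qed
      then obtain C where C: "\<And>\<xi> s. s \<in> I \<Longrightarrow> \<bar>amp \<xi> * exp (lam \<xi> * t) * L 0 \<xi> s\<bar> \<le> C" by blast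
      \<comment> \<open>Since lam \<ge> 1, passing from displacement to velocity enlarges every
        vertical derivative at every wave vector; this orders their Sobolev norms at all
        times.\<close>
      have DL: "\<bar>D j \<xi> s\<bar> \<le> \<bar>L j \<xi> s\<bar>" for j \<xi> s
        using lam[of \<xi>] mult_right_mono[of 1 "lam \<xi>" "\<bar>D j \<xi> s\<bar>"] by (simp add: L_def abs_mult)
      have C': "\<bar>amp \<xi> * exp (lam \<xi> * t) * D 0 \<xi> s\<bar> \<le> C" if "s \<in> I" for \<xi> s
      proof -
        have "\<bar>amp \<xi> * exp (lam \<xi> * t) * D 0 \<xi> s\<bar> \<le> \<bar>amp \<xi> * exp (lam \<xi> * t) * L 0 \<xi> s\<bar>"
          unfolding abs_mult by (intro mult_left_mono DL) auto
        also have "\<dots> \<le> C" by (rule C[OF that])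
        finally show ?thesis .
      qed
      have symD: "complex_of_real (amp (- \<xi>) * exp (lam (- \<xi>) * t) * D 0 (- \<xi>) s) * cis \<delta>
         = complex_of_real (amp \<xi> * exp (lam \<xi> * t) * D 0 \<xi> s) * cis (- \<delta>)" if "s \<in> {a0<..<b0}" for \<xi> s
        using arg_cong[OF sym[of s \<xi>], of "\<lambda>z. complex_of_real (amp \<xi> * exp (lam \<xi> * t)) * z"] that
        by (simp add: Db amp(4) lam_even I mult_ac)
      have symL: "complex_of_real (amp (- \<xi>) * exp (lam (- \<xi>) * t) * L 0 (- \<xi>) s) * cis \<delta>
         = complex_of_real (amp \<xi> * exp (lam \<xi> * t) * L 0 \<xi> s) * cis (- \<delta>)" if "s \<in> {a0<..<b0}" for \<xi> s
        using arg_cong[OF symD[OF that, of \<xi>], of "\<lambda>z. complex_of_real (lam \<xi>) * z"]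
        by (simp add: L_def lam_even mult_ac)
      have fD: "f x = wave (D 0) \<delta> t x" if "x \<in> slab {a0<..<b0}" for x
      proof -
        have "wave u \<delta> t x = wave (D 0) \<delta> t x" by (rule wave_cong) (use Db that in \<open>simp add: slab_def I\<close>)
        then show ?thesis using f that by (simp add: I)
      qed
      have hL: "h x = wave (L 0) \<delta> t x" if "x \<in> slab {a0<..<b0}" for x
      proof -
        have "wave (\<lambda>\<xi> s. lam \<xi> * u \<xi> s) \<delta> t x = wave (L 0) \<delta> t x" by (rule wave_cong) (use Db that in \<open>simp add: slab_def I L_def\<close>)
        then show ?thesis using h that by (simp add: I)
      qed
      have DD: "(D i \<xi> has_real_derivative D (Suc i) \<xi> s) (at s)" if "s \<in> {a0<..<b0}" for i \<xi> s
        using D(3) that I by blast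
      have DLd: "(L i \<xi> has_real_derivative L (Suc i) \<xi> s) (at s)" if "s \<in> {a0<..<b0}" for i \<xi> s
        unfolding L_def by (intro DERIV_cmult DD that)
      note HD = wave_Hk[where Db = D and ?a0.0 = a0 and ?b0.0 = b0 and \<delta> = \<delta> and t = t and f = f and C = C and k = k, OF cD C'[unfolded I] DD symD fD]
      note HL = wave_Hk[where Db = L and ?a0.0 = a0 and ?b0.0 = b0 and \<delta> = \<delta> and t = t and f = h and C = C and k = k, OF cL C[unfolded I] DLd symL hL]
      have eD: "Hk_slab_sqnorm I k f = mode_sqnorm I k amp lam t D"
        unfolding mode_sqnorm_def I by (rule HD(1))
      have eL: "Hk_slab_sqnorm I k h = mode_sqnorm I k amp lam t L"
        unfolding mode_sqnorm_def I by (rule HL(1))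
      have le: "mode_sqnorm I k amp lam t D \<le> mode_sqnorm I k amp lam t L"
        unfolding mode_sqnorm_def
      proof (intro sum_mono nn_integral_mono mult_left_mono mult_right_mono ennreal_leI)
        fix j \<xi> s
        have "\<bar>(2 * pi)\<^sup>2 * (amp \<xi> * exp (lam \<xi> * t) * D j \<xi> s)\<bar> \<le> \<bar>(2 * pi)\<^sup>2 * (amp \<xi> * exp (lam \<xi> * t) * L j \<xi> s)\<bar>"
          unfolding abs_mult by (intro mult_left_mono DL) auto
        then show "((2 * pi)\<^sup>2 * (amp \<xi> * exp (lam \<xi> * t) * D j \<xi> s))\<^sup>2 \<le> ((2 * pi)\<^sup>2 * (amp \<xi> * exp (lam \<xi> * t) * L j \<xi> s))\<^sup>2"
          by (rule abs_le_square_iff[THEN iffD1])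
      qed auto
      have up: "mode_sqnorm I k amp lam t L \<le> ennreal (\<tau>\<^sup>2 * exp (2 * rad * t) * (real n * rad ^ n))"
        using elim adm t I by blast
      have low: "(\<integral>\<^sup>+\<xi>. (\<integral>\<^sup>+s\<in>I. ennreal ((amp \<xi> * exp (lam \<xi> * t) * u \<xi> s)\<^sup>2) \<partial>lborel) \<partial>lborel) \<le> mode_sqnorm I k amp lam t D"
      proof -
        have "(\<integral>\<^sup>+\<xi>. (\<integral>\<^sup>+s\<in>I. ennreal ((amp \<xi> * exp (lam \<xi> * t) * u \<xi> s)\<^sup>2) \<partial>lborel) \<partial>lborel)
          \<le> (\<integral>\<^sup>+\<xi>. ennreal ((1 + (norm \<xi>)\<^sup>2) ^ (k - 0)) *
            (\<integral>\<^sup>+s\<in>I. ennreal (((2 * pi)\<^sup>2 * (amp \<xi> * exp (lam \<xi> * t) * D 0 \<xi> s))\<^sup>2) \<partial>lborel) \<partial>lborel)"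
        proof (rule nn_integral_mono)
          fix \<xi>
          have "(\<integral>\<^sup>+s\<in>I. ennreal ((amp \<xi> * exp (lam \<xi> * t) * u \<xi> s)\<^sup>2) \<partial>lborel)
            \<le> (\<integral>\<^sup>+s\<in>I. ennreal (((2 * pi)\<^sup>2 * (amp \<xi> * exp (lam \<xi> * t) * D 0 \<xi> s))\<^sup>2) \<partial>lborel)"
          proof (rule nn_integral_mono)
            fix s
            have pi1: "1 \<le> (2 * pi)\<^sup>2" using pi_gt3 by (intro one_le_power) linarith
            have "(y :: real)\<^sup>2 \<le> ((2 * pi)\<^sup>2 * y)\<^sup>2" for y
              using mult_right_mono[OF one_le_power[OF pi1, of 2], of "y\<^sup>2"] by (simp add: power_mult_distrib)
            then show "ennreal ((amp \<xi> * exp (lam \<xi> * t) * u \<xi> s)\<^sup>2) * indicator I s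
              \<le> ennreal (((2 * pi)\<^sup>2 * (amp \<xi> * exp (lam \<xi> * t) * D 0 \<xi> s))\<^sup>2) * indicator I s"
              using Db[of s \<xi>] by (auto simp: indicator_def intro!: ennreal_leI)
          qed
          also have "\<dots> = 1 * \<dots>" by simp
          also have "\<dots> \<le> ennreal ((1 + (norm \<xi>)\<^sup>2) ^ (k - 0)) *
            (\<integral>\<^sup>+s\<in>I. ennreal (((2 * pi)\<^sup>2 * (amp \<xi> * exp (lam \<xi> * t) * D 0 \<xi> s))\<^sup>2) \<partial>lborel)"
            by (rule mult_right_mono) (auto intro: one_le_power)
          finally show "(\<integral>\<^sup>+s\<in>I. ennreal ((amp \<xi> * exp (lam \<xi> * t) * u \<xi> s)\<^sup>2) \<partial>lborel) \<le> ennreal ((1 + (norm \<xi>)\<^sup>2) ^ (k - 0)) *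
            (\<integral>\<^sup>+s\<in>I. ennreal (((2 * pi)\<^sup>2 * (amp \<xi> * exp (lam \<xi> * t) * D 0 \<xi> s))\<^sup>2) \<partial>lborel)" .
        qed
        also have "\<dots> \<le> mode_sqnorm I k amp lam t D"
          unfolding mode_sqnorm_def by (rule member_le_sum) auto
        finally show ?thesis .
      qed
      have fin: "Hk_slab_sqnorm I k h < \<infinity>" "Hk_slab_sqnorm I k f < \<infinity>"
        unfolding eD eL by (rule le_less_trans[OF up] le_less_trans[OF order_trans[OF le up]]; simp)+
      have "in_Hk_slab I k f" using HD(2) fin(2) unfolding I by blast
      moreover have "in_Hk_slab I k h" using HL(2) fin(1) unfolding I by blast
      ultimately show "in_Hk_slab I k f \<and> in_Hk_slab I k h \<and> Hk_slab_sqnorm I k f \<le> Hk_slab_sqnorm I k h \<and>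
         Hk_slab_sqnorm I k h \<le> ennreal (\<tau>\<^sup>2 * exp (2 * rad * t) * (real n * rad ^ n)) \<and>
         (\<integral>\<^sup>+\<xi>. (\<integral>\<^sup>+s\<in>I. ennreal ((amp \<xi> * exp (lam \<xi> * t) * u \<xi> s)\<^sup>2) \<partial>lborel) \<partial>lborel) \<le> Hk_slab_sqnorm I k f"
        using le up low unfolding eD eL by blast
    qed
  qed
qed

end

context layer_modes
begin

context
  fixes \<omega> :: real
  assumes cont: "continuous_on (UNIV \<times> I) (\<lambda>z. H (fst z) (snd z))" "continuous_on (UNIV \<times> I) (\<lambda>z. U (fst z) (snd z))"
    and even: "\<And>\<xi> s. H (- \<xi>) s = H \<xi> s" "\<And>\<xi> s. U (- \<xi>) s = U \<xi> s"
begin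

lemma lam_ne: "lam \<xi> \<noteq> 0" "(lam \<xi>)\<^sup>2 + 4 * \<omega>\<^sup>2 \<noteq> 0" "1 \<le> (lam \<xi>)\<^sup>2 + 4 * \<omega>\<^sup>2" "1 \<le> (lam \<xi>)\<^sup>2"
proof -
  show "lam \<xi> \<noteq> 0" using lam[of \<xi>] by auto
  show "1 \<le> (lam \<xi>)\<^sup>2" using lam[of \<xi>] by (simp add: one_le_power)
  then show "1 \<le> (lam \<xi>)\<^sup>2 + 4 * \<omega>\<^sup>2" by (simp add: add_increasing2)
  then show "(lam \<xi>)\<^sup>2 + 4 * \<omega>\<^sup>2 \<noteq> 0" by linarith
qed

lemma cont_fst: "continuous_on UNIV f \<Longrightarrow> continuous_on (UNIV \<times> I) (\<lambda>z::(real^2) \<times> real. f (fst z) :: real)"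
  using continuous_on_compose2[of UNIV f "(UNIV :: (real^2) set) \<times> I" fst] by (simp add: continuous_on_fst continuous_on_id)

lemma \<rho>_cont: "continuous_on (UNIV \<times> I) (\<lambda>z::(real^2) \<times> real. \<rho> (snd z))"
proof -
  have "continuous_on I \<rho>" using \<rho>_D by (blast intro: continuous_at_imp_continuous_on DERIV_isCont)
  from continuous_on_compose2[OF this, of "(UNIV :: (real^2) set) \<times> I" snd]
  show ?thesis by (simp add: continuous_on_snd continuous_on_id)
qed

text \<open>The sign \<sigma> covers both horizontal components at once. The factor is odd in \<xi>,
  which is the symmetry that the phase - pi/2 demands.\<close>

lemma horizontal_controlled:
  fixes i j :: 2 and \<sigma> :: real
  assumes \<sigma>: "\<bar>\<sigma>\<bar> = 1"
  shows "\<forall>\<^sub>F n in sequentially. controlled lam N I (- (pi / 2)) (\<lambda>\<xi> s. H \<xi> s * ((\<xi> $ i + \<sigma> * (2 * \<omega> / lam \<xi> * \<xi> $ j)) / ((lam \<xi>)\<^sup>2 + 4 * \<omega>\<^sup>2))) k n"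
proof -
  define f where "f = (\<lambda>\<xi>. (\<xi> $ i + \<sigma> * (2 * \<omega> / lam \<xi> * \<xi> $ j)) / ((lam \<xi>)\<^sup>2 + 4 * \<omega>\<^sup>2))"
  have "\<bar>f \<xi>\<bar> \<le> (1 + 2 * \<bar>\<omega>\<bar>) * N \<xi> ^ 1" for \<xi>
  proof -
    have c: "\<bar>\<xi> $ i'\<bar> \<le> N \<xi>" for i' using component_le_norm_cart[of \<xi> i'] norm_N[of \<xi>] by linarith
    have "\<bar>2 * \<omega> / lam \<xi>\<bar> \<le> 2 * \<bar>\<omega>\<bar>"
      using lam[of \<xi>] mult_left_mono[of 1 "lam \<xi>" "\<bar>\<omega>\<bar>"] by (simp add: abs_mult field_simps)
    then have "\<bar>2 * \<omega> / lam \<xi> * \<xi> $ j\<bar> \<le> 2 * \<bar>\<omega>\<bar> * N \<xi>"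
      unfolding abs_mult[of "2 * \<omega> / lam \<xi>"] using c[of j] by (intro mult_mono) auto
    then have "\<bar>\<sigma> * (2 * \<omega> / lam \<xi> * \<xi> $ j)\<bar> \<le> 2 * \<bar>\<omega>\<bar> * N \<xi>" using \<sigma> by (simp only: abs_mult[of \<sigma>] mult_1)
    with c[of i] have "\<bar>\<xi> $ i + \<sigma> * (2 * \<omega> / lam \<xi> * \<xi> $ j)\<bar> \<le> N \<xi> + 2 * \<bar>\<omega>\<bar> * N \<xi>"
      by (intro order_trans[OF abs_triangle_ineq add_mono])
    then have "\<bar>\<xi> $ i + \<sigma> * (2 * \<omega> / lam \<xi> * \<xi> $ j)\<bar> \<le> (1 + 2 * \<bar>\<omega>\<bar>) * N \<xi>"
      by (simp only: distrib_right mult_1)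
    moreover have "\<bar>f \<xi>\<bar> \<le> \<bar>\<xi> $ i + \<sigma> * (2 * \<omega> / lam \<xi> * \<xi> $ j)\<bar> / 1"
      unfolding f_def abs_divide using lam_ne(3)[of \<xi>] by (intro divide_left_mono) auto
    ultimately show ?thesis by simp
  qed
  then have "poly_bounded f" by (rule poly_boundedI[rotated]) auto
  then have "profile (\<lambda>\<xi> s. f \<xi> * 1 * H \<xi> s)" by (rule profile.H) (simp add: smooth_on_const)
  then show ?thesis
  proof (rule eventually_controlled)
    show "f \<xi> * 1 * H \<xi> s = H \<xi> s * ((\<xi> $ i + \<sigma> * (2 * \<omega> / lam \<xi> * \<xi> $ j)) / ((lam \<xi>)\<^sup>2 + 4 * \<omega>\<^sup>2))" for \<xi> s
      by (simp add: f_def)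
    show "continuous_on (UNIV \<times> I) (\<lambda>z. H (fst z) (snd z) * ((fst z $ i + \<sigma> * (2 * \<omega> / lam (fst z) * fst z $ j)) / ((lam (fst z))\<^sup>2 + 4 * \<omega>\<^sup>2)))"
      by (intro continuous_intros cont cont_fst lam_cont ballI lam_ne)
    show "complex_of_real (H (- \<xi>) s * (((- \<xi>) $ i + \<sigma> * (2 * \<omega> / lam (- \<xi>) * (- \<xi>) $ j)) / ((lam (- \<xi>))\<^sup>2 + 4 * \<omega>\<^sup>2))) * cis (- (pi / 2))
      = complex_of_real (H \<xi> s * ((\<xi> $ i + \<sigma> * (2 * \<omega> / lam \<xi> * \<xi> $ j)) / ((lam \<xi>)\<^sup>2 + 4 * \<omega>\<^sup>2))) * cis (- (- (pi / 2)))" for \<xi> s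
      by (simp add: complex_eq_iff even lam_even) (simp add: divide_simps lam_ne, simp add: algebra_simps)
  qed
qed

lemma vertical_controlled:
  "\<forall>\<^sub>F n in sequentially. controlled lam N I 0 (\<lambda>\<xi> s. - (U \<xi> s / \<rho> s) / (lam \<xi>)\<^sup>2) k n"
proof -
  have ne: "\<rho> s \<noteq> 0" if "s \<in> I" for s using \<rho>_bd[OF that] a by auto
  have "poly_bounded (\<lambda>\<xi>. - 1 / (lam \<xi>)\<^sup>2)"
    by (rule poly_boundedI[of 1 _ 0]) (use lam_ne(4) in \<open>auto simp: divide_le_eq\<close>)
  then have "profile (\<lambda>\<xi> s. (- 1 / (lam \<xi>)\<^sup>2) * inverse (\<rho> s) * U \<xi> s)"
    by (rule profile.U) (rule smooth_on_inverse; auto intro!: smooth_on_ident open_greaterThan)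
  then show ?thesis
  proof (rule eventually_controlled)
    show "continuous_on (UNIV \<times> I) (\<lambda>z. - (U (fst z) (snd z) / \<rho> (snd z)) / (lam (fst z))\<^sup>2)"
      by (intro continuous_intros cont cont_fst lam_cont ballI \<rho>_cont) (use ne lam_ne in auto)
  qed (auto simp: even lam_even field_simps)
qed

lemma density_controlled:
  assumes c: "\<And>s. s \<in> I \<Longrightarrow> c s = q (\<rho> s)"
  shows "\<forall>\<^sub>F n in sequentially. controlled lam N I 0 (\<lambda>\<xi> s. c s * (\<rho> s * H \<xi> s + g * U \<xi> s / (lam \<xi>)\<^sup>2)) k n"
proof -
  have o: "open {0::real<..}" by simp
  have 1: "poly_bounded (\<lambda>\<xi>. 1)" by (rule poly_boundedI[of 1 _ 0]) auto
  have 2: "poly_bounded (\<lambda>\<xi>. g / (lam \<xi>)\<^sup>2)"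
    by (rule poly_boundedI[of "\<bar>g\<bar>" _ 0]) (use lam_ne(4) in \<open>auto simp: divide_le_eq mult_left_le abs_mult\<close>, smt (verit) abs_ge_zero lam_ne(4) mult_le_cancel_left1)
  have "profile (\<lambda>\<xi> s. 1 * (q (\<rho> s) * \<rho> s) * H \<xi> s + (g / (lam \<xi>)\<^sup>2) * q (\<rho> s) * U \<xi> s)"
    by (intro profile.add profile.H[OF 1, where \<phi> = "\<lambda>z. q z * z"] profile.U[OF 2] q_smooth smooth_on_mult[OF o] smooth_on_ident[OF o])
  then show ?thesis
  proof (rule eventually_controlled)
    have "continuous_on {a..b} q"
      by (rule continuous_on_subset[OF smooth_on_imp_continuous_on[OF q_smooth]]) (use a in auto)
    then have "continuous_on (UNIV \<times> I) (\<lambda>z::(real^2) \<times> real. q (\<rho> (snd z)))"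
      by (rule continuous_on_compose2[OF _ \<rho>_cont]) (use \<rho>_bd in auto)
    then have "continuous_on (UNIV \<times> I) (\<lambda>z::(real^2) \<times> real. c (snd z))"
      by (rule continuous_on_eq) (auto simp: c)
    then show "continuous_on (UNIV \<times> I) (\<lambda>z. c (snd z) * (\<rho> (snd z) * H (fst z) (snd z) + g * U (fst z) (snd z) / (lam (fst z))\<^sup>2))"
      by (intro continuous_intros cont cont_fst lam_cont ballI \<rho>_cont) (use lam_ne in auto)
  qed (auto simp: even lam_even c algebra_simps)
qed

end

end

section \<open>A lower bound for the growing component\<close>

text \<open>The Cauchy-Schwarz inequality for an increment, obtained by integrating (V - \<kappa>)^2
  \<ge> 0 with \<kappa> the mean slope. It turns the oscillation of H in the lower layer into a
  lower bound for the vertical displacement, whose profile is proportional to H'.\<close>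

lemma nn_integral_deriv_square_ge:
  fixes h V :: "real \<Rightarrow> real"
  assumes ab: "a0 < b0" and h: "continuous_on {a0..b0} h" and V: "continuous_on {a0..b0} V"
    and D: "\<And>s. s \<in> {a0<..<b0} \<Longrightarrow> (h has_real_derivative V s) (at s)"
  shows "ennreal ((h b0 - h a0)\<^sup>2 / (b0 - a0)) \<le> (\<integral>\<^sup>+s\<in>{a0<..<b0}. ennreal ((V s)\<^sup>2) \<partial>lborel)"
proof -
  define \<kappa> where "\<kappa> = (h b0 - h a0) / (b0 - a0)"
  have 1: "(V has_integral h b0 - h a0) {a0..b0}"
    by (rule fundamental_theorem_of_calculus_interior) (use ab h D in \<open>auto simp: has_real_derivative_iff_has_vector_derivative\<close>)
  have "((\<lambda>s. 2 * \<kappa> * V s - \<kappa>\<^sup>2) has_integral 2 * \<kappa> * (h b0 - h a0) - (b0 - a0) * \<kappa>\<^sup>2) {a0..b0}"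
    by (intro has_integral_diff has_integral_mult_right 1) (use has_integral_const_real[of "\<kappa>\<^sup>2" a0 b0] ab in simp)
  moreover have sq: "((\<lambda>s. (V s)\<^sup>2) has_integral integral {a0..b0} (\<lambda>s. (V s)\<^sup>2)) {a0..b0}"
    by (intro integrable_integral integrable_continuous_interval continuous_intros V)
  moreover have "2 * \<kappa> * V s - \<kappa>\<^sup>2 \<le> (V s)\<^sup>2" for s
    using zero_le_power2[of "V s - \<kappa>"] by (simp add: power2_diff mult_ac)
  ultimately have "2 * \<kappa> * (h b0 - h a0) - (b0 - a0) * \<kappa>\<^sup>2 \<le> integral {a0..b0} (\<lambda>s. (V s)\<^sup>2)"
    by (rule has_integral_le)
  moreover have "2 * \<kappa> * (h b0 - h a0) - (b0 - a0) * \<kappa>\<^sup>2 = (h b0 - h a0)\<^sup>2 / (b0 - a0)"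
  proof -
    have "2 * (x / d) * x - d * (x / d)\<^sup>2 = x\<^sup>2 / d" if "0 < d" for x d :: real
      using that by (simp add: field_simps power2_eq_square)
    from this[of "b0 - a0" "h b0 - h a0"] show ?thesis using ab by (simp only: \<kappa>_def diff_gt_0_iff_gt)
  qed
  ultimately have le: "(h b0 - h a0)\<^sup>2 / (b0 - a0) \<le> integral {a0..b0} (\<lambda>s. (V s)\<^sup>2)" by simp
  have "((\<lambda>s. indicator {a0<..<b0} s * (V s)\<^sup>2) has_integral integral {a0..b0} (\<lambda>s. (V s)\<^sup>2)) UNIV"
  proof -
    have "((\<lambda>s. if s \<in> {a0<..<b0} then (V s)\<^sup>2 else 0) has_integral integral {a0..b0} (\<lambda>s. (V s)\<^sup>2)) UNIV"
      using sq by (simp only: has_integral_Icc_iff_Ioo has_integral_restrict_UNIV)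
    moreover have "(if s \<in> {a0<..<b0} then (V s)\<^sup>2 else 0) = indicator {a0<..<b0} s * (V s)\<^sup>2" for s by simp
    ultimately show ?thesis by (simp only:)
  qed
  moreover have "(\<lambda>s. indicator {a0<..<b0} s * (V s)\<^sup>2) \<in> borel_measurable borel"
  proof -
    have "continuous_on {a0<..<b0} (\<lambda>s. (V s)\<^sup>2)"
      by (intro continuous_intros continuous_on_subset[OF V]) auto
    then have "(\<lambda>s. indicator {a0<..<b0} s *\<^sub>R (V s)\<^sup>2) \<in> borel_measurable borel"
      by (intro borel_measurable_continuous_on_indicator) auto
    then show ?thesis by simp
  qed
  ultimately have "(\<integral>\<^sup>+s. ennreal (indicator {a0<..<b0} s * (V s)\<^sup>2) \<partial>lborel) = ennreal (integral {a0..b0} (\<lambda>s. (V s)\<^sup>2))"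
    by (intro nn_integral_has_integral_lborel) auto
  moreover have "(\<integral>\<^sup>+s. ennreal (indicator {a0<..<b0} s * (V s)\<^sup>2) \<partial>lborel) = (\<integral>\<^sup>+s\<in>{a0<..<b0}. ennreal ((V s)\<^sup>2) \<partial>lborel)"
    by (intro nn_integral_cong) (simp add: indicator_def)
  ultimately show ?thesis using le by (simp add: ennreal_leI)
qed

text \<open>A tent rather than an indicator, since packets need continuous amplitudes; it still has
  at least half its height on the middle half of the annulus.\<close>

definition ring_bump :: "real \<Rightarrow> real \<Rightarrow> real^2 \<Rightarrow> real" where
  "ring_bump r \<tau> \<xi> = \<tau> * max 0 (1 - \<bar>norm \<xi> - (r + 1)\<bar>)"

lemma ring_bump_nonzero: "ring_bump r \<tau> \<xi> \<noteq> 0 \<Longrightarrow> r < norm \<xi> \<and> norm \<xi> < r + 2"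
  by (auto simp: ring_bump_def max_def split: if_splits)

lemma ring_bump_admissible:
  assumes "1 \<le> R" "R \<le> r" "0 \<le> \<tau>"
  shows "admissible (\<lambda>\<xi>. max R (norm \<xi>)) (ring_bump r \<tau>) (r + 2) \<tau>"
proof -
  have "continuous_on UNIV (ring_bump r \<tau>)" unfolding ring_bump_def by (intro continuous_intros)
  moreover have "\<bar>ring_bump r \<tau> \<xi>\<bar> \<le> \<tau>" for \<xi>
    using assms(3) mult_left_mono[of "max 0 (1 - \<bar>norm \<xi> - (r + 1)\<bar>)" 1 \<tau>] by (simp add: ring_bump_def abs_mult)
  moreover have "ring_bump r \<tau> (- \<xi>) = ring_bump r \<tau> \<xi>" for \<xi> by (simp add: ring_bump_def)
  ultimately show ?thesis using ring_bump_nonzero[of r \<tau>] assms unfolding admissible_def by force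
qed

text \<open>The middle half of the annulus contains a disc of radius 1/2, of area pi / 4. There the
  amplitude is at least \<tau> / 2, the growth rate at least \<open>L\<close>, and the divisor at
  most \<open>(r + 2)\<^sup>2\<close>.\<close>

lemma ring_bump_lower:
  fixes lam :: "real^2 \<Rightarrow> real" and V :: "real^2 \<Rightarrow> real \<Rightarrow> real"
  assumes \<tau>: "0 \<le> \<tau>" and r: "0 \<le> r" and t: "0 \<le> t" and L: "0 < L" and M: "0 \<le> M"
    and lam: "\<And>\<xi>. r < norm \<xi> \<Longrightarrow> norm \<xi> < r + 2 \<Longrightarrow> L \<le> lam \<xi> \<and> lam \<xi> \<le> r + 2"
    and V: "\<And>\<xi>. r < norm \<xi> \<Longrightarrow> ennreal M \<le> (\<integral>\<^sup>+s\<in>I. ennreal ((V \<xi> s)\<^sup>2) \<partial>lborel)" 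
    and Vm: "\<And>\<xi>. (\<lambda>s. ennreal ((V \<xi> s)\<^sup>2) * indicator I s) \<in> borel_measurable borel"
  shows "ennreal ((\<tau> / 2 * exp (L * t) / (r + 2)\<^sup>2)\<^sup>2 * M * (pi / 4))
     \<le> (\<integral>\<^sup>+\<xi>. (\<integral>\<^sup>+s\<in>I. ennreal ((ring_bump r \<tau> \<xi> * exp (lam \<xi> * t) * (- V \<xi> s / (lam \<xi>)\<^sup>2))\<^sup>2) \<partial>lborel) \<partial>lborel)"
proof -
  define c :: "real^2" where "c = (r + 1) *\<^sub>R axis 1 1"
  define E where "E = \<tau> / 2 * exp (L * t) / (r + 2)\<^sup>2"
  have E0: "0 \<le> E" using \<tau> by (simp add: E_def)
  have nc: "norm c = r + 1" using r by (simp add: c_def norm_axis_1)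
  have "ennreal (E\<^sup>2 * M * (pi / 4)) = ennreal (E\<^sup>2 * M) * emeasure lborel (cball c (1 / 2))"
    using M by (subst emeasure_cball) (auto simp: unit_ball_vol_2 power2_eq_square ennreal_mult''[symmetric] mult_ac)
  also have "\<dots> = (\<integral>\<^sup>+\<xi>. ennreal (E\<^sup>2 * M) * indicator (cball c (1 / 2)) \<xi> \<partial>lborel)"
    by (simp add: nn_integral_cmult_indicator)
  also have "\<dots> \<le> (\<integral>\<^sup>+\<xi>. (\<integral>\<^sup>+s\<in>I. ennreal ((ring_bump r \<tau> \<xi> * exp (lam \<xi> * t) * (- V \<xi> s / (lam \<xi>)\<^sup>2))\<^sup>2) \<partial>lborel) \<partial>lborel)"
  proof (rule nn_integral_mono)
    fix \<xi> :: "real^2"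
    show "ennreal (E\<^sup>2 * M) * indicator (cball c (1 / 2)) \<xi> \<le> (\<integral>\<^sup>+s\<in>I. ennreal ((ring_bump r \<tau> \<xi> * exp (lam \<xi> * t) * (- V \<xi> s / (lam \<xi>)\<^sup>2))\<^sup>2) \<partial>lborel)"
    proof (cases "\<xi> \<in> cball c (1 / 2)")
      case True
      then have "\<bar>norm \<xi> - (r + 1)\<bar> \<le> 1 / 2"
        using norm_triangle_ineq3[of \<xi> c] nc by (simp add: dist_norm norm_minus_commute)
      then have n: "r < norm \<xi>" "norm \<xi> < r + 2" and b: "\<tau> / 2 \<le> ring_bump r \<tau> \<xi>"
        using \<tau> mult_left_mono[of "1 / 2" "max 0 (1 - \<bar>norm \<xi> - (r + 1)\<bar>)" \<tau>] by (auto simp: ring_bump_def abs_if split: if_splits)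
      have la: "L \<le> lam \<xi>" "lam \<xi> \<le> r + 2" "0 < lam \<xi>" using lam[OF n] L by auto
      define B where "B = ring_bump r \<tau> \<xi> * exp (lam \<xi> * t) / (lam \<xi>)\<^sup>2"
      have "E \<le> B"
        unfolding E_def B_def using b \<tau> la t by (intro frac_le mult_mono power_mono) (auto intro: mult_right_mono)
      then have "E\<^sup>2 \<le> B\<^sup>2" using E0 by (intro power_mono)
      then have "ennreal (E\<^sup>2 * M) \<le> ennreal (B\<^sup>2) * ennreal M" using M by (simp add: ennreal_mult''[symmetric] mult_right_mono ennreal_leI)
      also have "\<dots> \<le> ennreal (B\<^sup>2) * (\<integral>\<^sup>+s\<in>I. ennreal ((V \<xi> s)\<^sup>2) \<partial>lborel)" by (rule mult_left_mono[OF V[OF n(1)]]) simp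
      also have "\<dots> = (\<integral>\<^sup>+s. ennreal (B\<^sup>2) * (ennreal ((V \<xi> s)\<^sup>2) * indicator I s) \<partial>lborel)"
        by (rule nn_integral_cmult[symmetric]) (use Vm in simp)
      also have "\<dots> = (\<integral>\<^sup>+s\<in>I. ennreal ((ring_bump r \<tau> \<xi> * exp (lam \<xi> * t) * (- V \<xi> s / (lam \<xi>)\<^sup>2))\<^sup>2) \<partial>lborel)"
        by (intro nn_integral_cong) (simp add: B_def ennreal_mult'[symmetric] indicator_def power_mult_distrib power_divide)
      finally show ?thesis using True by simp
    qed simp
  qed
  finally show ?thesis unfolding E_def .
qed

lemma controlledD:
  assumes "controlled lam N I \<delta> b k n" "admissible N amp rad \<tau>" "0 \<le> t"
    and "\<And>x. f x = wave_packet.wave amp lam rad b \<delta> t x"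
    and "\<And>x. h x = wave_packet.wave amp lam rad (\<lambda>\<xi> s. lam \<xi> * b \<xi> s) \<delta> t x"
  shows "in_Hk_slab I k f" "in_Hk_slab I k h" "Hk_slab_sqnorm I k f \<le> Hk_slab_sqnorm I k h"
    "Hk_slab_sqnorm I k h \<le> ennreal (\<tau>\<^sup>2 * exp (2 * rad * t) * (real n * rad ^ n))"
    "(\<integral>\<^sup>+\<xi>. (\<integral>\<^sup>+s\<in>I. ennreal ((amp \<xi> * exp (lam \<xi> * t) * b \<xi> s)\<^sup>2) \<partial>lborel) \<partial>lborel) \<le> Hk_slab_sqnorm I k f"
  using assms(1)[unfolded controlled_def, rule_format, OF assms(2,3), of f h] assms(4,5) by blast+

text \<open>Identifies the interface value of the extended density with the one-sided limit in
  \<open>steady_density\<close>, so that the density jump is available to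
  \<open>normal_modes\<close>.\<close>

lemma continuous_extension_limit:
  fixes \<rho> \<rho>' :: "real \<Rightarrow> real"
  assumes "(\<rho> \<longlongrightarrow> L) F" "F \<noteq> bot" "F = at x within S" "continuous_on T \<rho>'" "x \<in> T" "S \<subseteq> T" "\<forall>\<^sub>F s in F. \<rho>' s = \<rho> s"
  shows "\<rho>' x = L"
proof -
  have "(\<rho>' \<longlongrightarrow> \<rho>' x) (at x within S)"
    by (rule tendsto_within_subset[of _ _ _ T]) (use assms(4,5,6) in \<open>auto simp: continuous_on_def\<close>)
  then have "(\<rho> \<longlongrightarrow> \<rho>' x) F" using assms(3,7) by (metis Lim_transform_eventually)
  then show ?thesis using tendsto_unique[OF assms(2) _ assms(1)] by blast
qed

text \<open>Everything the final argument uses about the solutions at order \<open>k\<close>. The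
  lower bound has constants independent of \<open>k\<close>, because it rests on the unweighted L2
  part of the norm of one component.\<close>

definition growing_family :: "real \<Rightarrow> real \<Rightarrow> real \<Rightarrow> real \<Rightarrow> real \<Rightarrow> (real \<Rightarrow> real \<Rightarrow> real \<Rightarrow> real^3 \<Rightarrow> real^3) \<Rightarrow>
   (real \<Rightarrow> real \<Rightarrow> real \<Rightarrow> real^3 \<Rightarrow> real^3) \<Rightarrow> (real \<Rightarrow> real \<Rightarrow> real \<Rightarrow> real^3 \<Rightarrow> real) \<Rightarrow> nat \<Rightarrow> nat \<Rightarrow> bool" where
  "growing_family l m R \<theta> \<kappa> \<eta> v q k n \<longleftrightarrow> (\<forall>r\<ge>R. \<forall>\<tau>\<ge>0. \<forall>t\<ge>0.
       (\<forall>I\<in>{{0<..<l}, {-m<..<0}}.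
         (\<forall>i. in_Hk_slab I k (\<lambda>x. \<eta> r \<tau> t x $ i) \<and> in_Hk_slab I k (\<lambda>x. v r \<tau> t x $ i) \<and>
           Hk_slab_sqnorm I k (\<lambda>x. \<eta> r \<tau> t x $ i) \<le> Hk_slab_sqnorm I k (\<lambda>x. v r \<tau> t x $ i) \<and>
           Hk_slab_sqnorm I k (\<lambda>x. v r \<tau> t x $ i) \<le> ennreal (\<tau>\<^sup>2 * exp (2 * (r + 2) * t) * (real n * (r + 2) ^ n))) \<and>
         in_Hk_slab I k (q r \<tau> t) \<and> Hk_slab_sqnorm I k (q r \<tau> t) \<le> ennreal (\<tau>\<^sup>2 * exp (2 * (r + 2) * t) * (real n * (r + 2) ^ n))) \<and>
       ennreal ((\<tau> / 2 * exp (sqrt (\<theta> * r) * t) / (r + 2)\<^sup>2)\<^sup>2 * \<kappa>) \<le> Hk_slab_sqnorm {-m<..<0} k (\<lambda>x. \<eta> r \<tau> t x $ 3))"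

lemma growing_modes:
  fixes g \<omega> l m :: real
  assumes g: "0 < g" and l: "0 < l" and m: "0 < m" and pp: "pressure_law pp" and pm: "pressure_law pm"
    and steady: "steady_density g pp pm l m \<rho>0"
  obtains R \<theta> \<kappa> and \<eta> v :: "real \<Rightarrow> real \<Rightarrow> real \<Rightarrow> real^3 \<Rightarrow> real^3" and q :: "real \<Rightarrow> real \<Rightarrow> real \<Rightarrow> real^3 \<Rightarrow> real"
  where "1 \<le> R" "0 < \<theta>" "0 < \<kappa>"
    "\<And>r \<tau>. R \<le> r \<Longrightarrow> 0 \<le> \<tau> \<Longrightarrow> solves_linear_problem g \<omega> pp pm l m \<rho>0 (\<eta> r \<tau>) (v r \<tau>) (q r \<tau>)"
    "\<And>k. \<forall>\<^sub>F n in sequentially. growing_family l m R \<theta> \<kappa> \<eta> v q k n"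
proof -
  define IM where "IM = {-m<..<0}"
  define IP where "IP = {0<..<l}"
  obtain a b where a: "0 < a" and bd: "\<And>s. s \<in> IM \<union> IP \<Longrightarrow> a \<le> \<rho>0 s \<and> \<rho>0 s \<le> b"
    using steady unfolding steady_density_def IM_def IP_def by blast
  have sm: "smooth_on {-m<..<0} \<rho>0" "smooth_on {0<..<l} \<rho>0" using steady by (auto simp: steady_density_def)
  have DP: "\<And>s. s \<in> {0<..<l} \<Longrightarrow> ((\<lambda>r. pp (\<rho>0 r)) has_real_derivative (- g * \<rho>0 s)) (at s)"
    and DM: "\<And>s. s \<in> {-m<..<0} \<Longrightarrow> ((\<lambda>r. pm (\<rho>0 r)) has_real_derivative (- g * \<rho>0 s)) (at s)"
    using steady unfolding steady_density_def by blast+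
  obtain rp rm where lim: "(\<rho>0 \<longlongrightarrow> rp) (at_right 0)" "(\<rho>0 \<longlongrightarrow> rm) (at_left 0)" "rm < rp"
    using steady unfolding steady_density_def by auto
  have bdP: "\<And>s. s \<in> {0<..<l} \<Longrightarrow> a \<le> \<rho>0 s \<and> \<rho>0 s \<le> b" and bdM: "\<And>s. s \<in> {-m<..<0} \<Longrightarrow> a \<le> \<rho>0 s \<and> \<rho>0 s \<le> b"
    using bd by (auto simp: IM_def IP_def)
  have m0: "- m < 0" using m by simp
  note extP = density_extension[of 0 l a \<rho>0 b pp g, OF l a bdP sm(2) pp DP]
  note extM = density_extension[of "-m" 0 a \<rho>0 b pm g, OF m0 a bdM sm(1) pm DM]
  define qP where "qP = (\<lambda>z. inverse (deriv pp z))"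
  define qM where "qM = (\<lambda>z. inverse (deriv pm z))"
  obtain \<rho>P where \<rho>P: "continuous_on {0..l} \<rho>P" "\<And>s. s \<in> {0<..<l} \<Longrightarrow> \<rho>P s = \<rho>0 s" "\<And>s. s \<in> {0..l} \<Longrightarrow> a \<le> \<rho>P s \<and> \<rho>P s \<le> b"
    using extP(2) by blast
  obtain \<rho>M where \<rho>M: "continuous_on {-m..0} \<rho>M" "\<And>s. s \<in> {-m<..<0} \<Longrightarrow> \<rho>M s = \<rho>0 s" "\<And>s. s \<in> {-m..0} \<Longrightarrow> a \<le> \<rho>M s \<and> \<rho>M s \<le> b"
    using extM(2) by blast
  obtain CP CM where CP: "\<And>z. z \<in> {a..b} \<Longrightarrow> 0 \<le> qP z \<and> qP z \<le> CP" and CM: "\<And>z. z \<in> {a..b} \<Longrightarrow> 0 \<le> qM z \<and> qM z \<le> CM"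
    using extP(3) extM(3) unfolding qP_def qM_def by blast
  have q_smooth: "smooth_on {0<..} qP" "smooth_on {0<..} qM" using extP(4) extM(4) by (simp_all add: qP_def qM_def)
  have q_cont: "continuous_on {a..b} qP" "continuous_on {a..b} qM"
    by (rule continuous_on_subset[OF smooth_on_imp_continuous_on[OF q_smooth(1)]] continuous_on_subset[OF smooth_on_imp_continuous_on[OF q_smooth(2)]]; use a in auto)+
  have \<rho>0_D: "\<And>s. s \<in> {0<..<l} \<Longrightarrow> (\<rho>0 has_real_derivative - g * qP (\<rho>0 s) * \<rho>0 s) (at s)"
    "\<And>s. s \<in> {-m<..<0} \<Longrightarrow> (\<rho>0 has_real_derivative - g * qM (\<rho>0 s) * \<rho>0 s) (at s)"
    using extP(1) extM(1) unfolding qP_def qM_def by blast+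
  have "\<rho>P 0 = rp"
  proof (rule continuous_extension_limit[OF lim(1) _ _ \<rho>P(1)])
    show "at_right 0 = at 0 within {0..l}" using l by (simp add: at_within_Icc_at_right)
    show "\<forall>\<^sub>F s in at_right 0. \<rho>P s = \<rho>0 s" using l \<rho>P(2) by (auto simp: eventually_at_right_field)
  qed (use l in auto)
  moreover have "\<rho>M 0 = rm"
  proof (rule continuous_extension_limit[OF lim(2) _ _ \<rho>M(1)])
    show "at_left 0 = at 0 within {-m..0}" using m0 by (simp add: at_within_Icc_at_left)
    show "\<forall>\<^sub>F s in at_left 0. \<rho>M s = \<rho>0 s" using m0 \<rho>M(2) by (auto simp: eventually_at_left_field intro!: exI[of _ "- m"])
  qed (use m in auto)
  ultimately have jump: "\<rho>M 0 < \<rho>P 0" using lim(3) by simp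
  define cP where "cP = (\<lambda>s. qP (\<rho>P s))"
  define cM where "cM = (\<lambda>s. qM (\<rho>M s))"
  have c_cont: "continuous_on {-m..0} cM" "continuous_on {0..l} cP"
    unfolding cP_def cM_def
    by (rule continuous_on_compose2[OF q_cont(1) \<rho>P(1)] continuous_on_compose2[OF q_cont(2) \<rho>M(1)]; use \<rho>P(3) \<rho>M(3) in auto)+
  have w0: "0 \<le> 4 * \<omega>\<^sup>2" by simp
  have bM: "a \<le> \<rho>M s \<and> \<rho>M s \<le> b \<and> 0 \<le> cM s \<and> cM s \<le> max CP CM" if "s \<in> {-m..0}" for s
    using \<rho>M(3)[OF that] CM[of "\<rho>M s"] by (auto simp: cM_def)
  have bP: "a \<le> \<rho>P s \<and> \<rho>P s \<le> b \<and> 0 \<le> cP s \<and> cP s \<le> max CP CM" if "s \<in> {0..l}" for s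
    using \<rho>P(3)[OF that] CP[of "\<rho>P s"] by (auto simp: cP_def)
  obtain R \<theta> K \<mu> f HM UM HP UP where R: "1 \<le> R" and \<theta>: "0 < \<theta>" and \<mu>: "0 < \<mu>" and f_cont: "continuous_on {R..} f"
    and f: "\<And>r. R \<le> r \<Longrightarrow> 1 < f r \<and> \<theta> * r \<le> f r \<and> f r \<le> r\<^sup>2"
    and HM_cont: "continuous_on ({R..} \<times> {-m..0}) (\<lambda>z. HM (fst z) (snd z))" and UM_cont: "continuous_on ({R..} \<times> {-m..0}) (\<lambda>z. UM (fst z) (snd z))"
    and HP_cont: "continuous_on ({R..} \<times> {0..l}) (\<lambda>z. HP (fst z) (snd z))" and UP_cont: "continuous_on ({R..} \<times> {0..l}) (\<lambda>z. UP (fst z) (snd z))"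
    and HM_D: "\<And>r s. R \<le> r \<Longrightarrow> s \<in> {-m<..<0} \<Longrightarrow> (HM r has_real_derivative UM r s / \<rho>M s) (at s)"
    and UM_D: "\<And>r s. R \<le> r \<Longrightarrow> s \<in> {-m<..<0} \<Longrightarrow> (UM r has_real_derivative \<rho>M s * (wave_square (4 * \<omega>\<^sup>2) r (f r) + f r * cM s) * HM r s) (at s)"
    and HP_D: "\<And>r s. R \<le> r \<Longrightarrow> s \<in> {0<..<l} \<Longrightarrow> (HP r has_real_derivative UP r s / \<rho>P s) (at s)"
    and UP_D: "\<And>r s. R \<le> r \<Longrightarrow> s \<in> {0<..<l} \<Longrightarrow> (UP r has_real_derivative \<rho>P s * (wave_square (4 * \<omega>\<^sup>2) r (f r) + f r * cP s) * HP r s) (at s)"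
    and walls: "\<And>r. R \<le> r \<Longrightarrow> UM r (-m) = 0" "\<And>r. R \<le> r \<Longrightarrow> UP r l = 0"
    and match: "\<And>r. R \<le> r \<Longrightarrow> UM r 0 / \<rho>M 0 = UP r 0 / \<rho>P 0"
      "\<And>r. R \<le> r \<Longrightarrow> \<rho>M 0 * HM r 0 + g * UM r 0 / f r = \<rho>P 0 * HP r 0 + g * UP r 0 / f r"
    and M_bd: "\<And>r s. R \<le> r \<Longrightarrow> s \<in> {-m..0} \<Longrightarrow> \<bar>HM r s\<bar> \<le> K * r \<and> \<bar>UM r s\<bar> \<le> K * r\<^sup>2"
    and P_bd: "\<And>r s. R \<le> r \<Longrightarrow> s \<in> {0..l} \<Longrightarrow> \<bar>HP r s\<bar> \<le> K * r \<and> \<bar>UP r s\<bar> \<le> K * r\<^sup>2"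
    and osc: "\<And>r. R \<le> r \<Longrightarrow> \<mu> \<le> \<bar>HM r 0 - HM r (-m)\<bar>"
    by (rule normal_modes[where \<rho>M = \<rho>M and cM = cM and \<rho>P = \<rho>P and cP = cP and b = b and C = "max CP CM",
          OF g l m a w0 \<rho>M(1) c_cont(1) \<rho>P(1) c_cont(2) bM bP jump]; (assumption | rule that))
  \<comment> \<open>Wave numbers below \<open>R\<close> are clamped to \<open>R\<close>, which makes
    growth rate and profiles continuous on the whole plane. On the support of the amplitude, beyond
    \<open>R\<close>, this is the true wave number.\<close>
  define rr :: "real^2 \<Rightarrow> real" where "rr = (\<lambda>\<xi>. max R (norm \<xi>))"
  have rr: "R \<le> rr \<xi>" "1 \<le> rr \<xi>" "norm \<xi> \<le> rr \<xi>" "rr (- \<xi>) = rr \<xi>" for \<xi> using R by (auto simp: rr_def)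
  have rr_cont: "continuous_on S rr" for S unfolding rr_def by (intro continuous_intros)
  define lam where "lam = (\<lambda>\<xi>. sqrt (f (rr \<xi>)))"
  define A where "A = (\<lambda>\<xi>. wave_square (4 * \<omega>\<^sup>2) (rr \<xi>) (f (rr \<xi>)))"
  define H where "H = (\<lambda>\<xi> s. if 0 < s then HP (rr \<xi>) s else HM (rr \<xi>) s)"
  define U where "U = (\<lambda>\<xi> s. if 0 < s then UP (rr \<xi>) s else UM (rr \<xi>) s)"
  have lam2: "(lam \<xi>)\<^sup>2 = f (rr \<xi>)" for \<xi> using f[OF rr(1), of \<xi>] by (simp add: lam_def)
  have lam_bd: "1 \<le> lam \<xi> \<and> lam \<xi> \<le> rr \<xi>" for \<xi>
    using f[OF rr(1), of \<xi>] rr(2)[of \<xi>] by (auto simp: lam_def intro: real_le_lsqrt)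
  have frr_cont: "continuous_on UNIV (\<lambda>\<xi>. f (rr \<xi>))"
    by (rule continuous_on_compose2[OF f_cont rr_cont]) (use rr in auto)
  have lam_cont: "continuous_on UNIV lam" unfolding lam_def by (intro continuous_intros frr_cont)
  have A_cont: "continuous_on UNIV A"
  proof -
    have "f (rr \<xi>) + 4 * \<omega>\<^sup>2 \<noteq> 0" for \<xi> using f[OF rr(1), of \<xi>] w0 by linarith
    then show ?thesis unfolding A_def wave_square_def by (intro continuous_intros frr_cont rr_cont ballI)
  qed
  have A_bd: "\<bar>A \<xi>\<bar> \<le> (rr \<xi>)\<^sup>2" for \<xi>
  proof -
    have p: "0 < f (rr \<xi>)" using f[OF rr(1), of \<xi>] by simp
    then have "f (rr \<xi>) * (rr \<xi>)\<^sup>2 \<le> (rr \<xi>)\<^sup>2 * (f (rr \<xi>) + 4 * \<omega>\<^sup>2)" by (simp add: algebra_simps)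
    then show ?thesis using p add_pos_nonneg[OF p w0] by (simp add: A_def wave_square_def divide_le_eq abs_mult)
  qed
  have two: "continuous_on (UNIV \<times> T) (\<lambda>z::(real^2) \<times> real. h (rr (fst z)) (snd z))"
    if "continuous_on ({R..} \<times> T) (\<lambda>z. h (fst z) (snd z))" for h :: "real \<Rightarrow> real \<Rightarrow> real" and T
  proof -
    have "continuous_on (UNIV \<times> T) (\<lambda>z::(real^2) \<times> real. (\<lambda>z. h (fst z) (snd z)) (rr (fst z), snd z))"
      by (rule continuous_on_compose2[OF that]) (use rr in \<open>auto intro!: continuous_intros continuous_on_compose2[OF rr_cont]\<close>)
    then show ?thesis by simp
  qed
  have HU_M: "s \<in> {-m<..<0} \<Longrightarrow> H \<xi> s = HM (rr \<xi>) s" "s \<in> {-m<..<0} \<Longrightarrow> U \<xi> s = UM (rr \<xi>) s"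
    and HU_P: "s \<in> {0<..<l} \<Longrightarrow> H \<xi> s = HP (rr \<xi>) s" "s \<in> {0<..<l} \<Longrightarrow> U \<xi> s = UP (rr \<xi>) s" for \<xi> s
    by (auto simp: H_def U_def)
  have locM: "(h has_real_derivative d) (at s) \<Longrightarrow> (\<And>s. s \<in> {-m<..<0} \<Longrightarrow> h s = h' s) \<Longrightarrow> s \<in> {-m<..<0} \<Longrightarrow> (h' has_real_derivative d) (at s)" for h h' d s
    by (rule has_field_derivative_transform_within_open[of h d s "{-m<..<0}"]) auto
  have locP: "(h has_real_derivative d) (at s) \<Longrightarrow> (\<And>s. s \<in> {0<..<l} \<Longrightarrow> h s = h' s) \<Longrightarrow> s \<in> {0<..<l} \<Longrightarrow> (h' has_real_derivative d) (at s)" for h h' d s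
    by (rule has_field_derivative_transform_within_open[of h d s "{0<..<l}"]) auto
  have H_DM: "(H \<xi> has_real_derivative U \<xi> s / \<rho>0 s) (at s)"
    and U_DM: "(U \<xi> has_real_derivative \<rho>0 s * (A \<xi> + (lam \<xi>)\<^sup>2 * qM (\<rho>0 s)) * H \<xi> s) (at s)" if s: "s \<in> {-m<..<0}" for \<xi> s
    using locM[OF HM_D[OF rr(1) s, of \<xi>], of "H \<xi>"] locM[OF UM_D[OF rr(1) s, of \<xi>], of "U \<xi>"] s
    by (simp_all add: HU_M \<rho>M(2) A_def lam2 cM_def)
  have H_DP: "(H \<xi> has_real_derivative U \<xi> s / \<rho>0 s) (at s)"
    and U_DP: "(U \<xi> has_real_derivative \<rho>0 s * (A \<xi> + (lam \<xi>)\<^sup>2 * qP (\<rho>0 s)) * H \<xi> s) (at s)" if s: "s \<in> {0<..<l}" for \<xi> s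
    using locP[OF HP_D[OF rr(1) s, of \<xi>], of "H \<xi>"] locP[OF UP_D[OF rr(1) s, of \<xi>], of "U \<xi>"] s
    by (simp_all add: HU_P \<rho>P(2) A_def lam2 cP_def)
  have Kr: "\<bar>h\<bar> \<le> K * rr \<xi> \<Longrightarrow> \<bar>h\<bar> \<le> \<bar>K\<bar> * (rr \<xi>)\<^sup>2" "\<bar>h\<bar> \<le> K * (rr \<xi>)\<^sup>2 \<Longrightarrow> \<bar>h\<bar> \<le> \<bar>K\<bar> * (rr \<xi>)\<^sup>2" for h \<xi>
  proof -
    have 1: "rr \<xi> \<le> (rr \<xi>)\<^sup>2" "0 \<le> rr \<xi>" using rr(2)[of \<xi>] by (simp_all add: self_le_power)
    have "K * rr \<xi> \<le> \<bar>K\<bar> * (rr \<xi>)\<^sup>2" using 1 by (intro mult_mono) auto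
    then show "\<bar>h\<bar> \<le> K * rr \<xi> \<Longrightarrow> \<bar>h\<bar> \<le> \<bar>K\<bar> * (rr \<xi>)\<^sup>2" by linarith
    have "K * (rr \<xi>)\<^sup>2 \<le> \<bar>K\<bar> * (rr \<xi>)\<^sup>2" by (intro mult_right_mono) auto
    then show "\<bar>h\<bar> \<le> K * (rr \<xi>)\<^sup>2 \<Longrightarrow> \<bar>h\<bar> \<le> \<bar>K\<bar> * (rr \<xi>)\<^sup>2" by linarith
  qed
  have lam2_bd: "\<bar>(lam \<xi>)\<^sup>2\<bar> \<le> (rr \<xi>)\<^sup>2" for \<xi> using f[OF rr(1), of \<xi>] by (simp add: lam2)
  interpret M: layer_modes "{-m<..<0}" \<rho>0 qM g a b rr A lam H U "\<bar>K\<bar>" "-m" 0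
  proof unfold_locales
    show "\<bar>H \<xi> s\<bar> \<le> \<bar>K\<bar> * (rr \<xi>)\<^sup>2 \<and> \<bar>U \<xi> s\<bar> \<le> \<bar>K\<bar> * (rr \<xi>)\<^sup>2" if "s \<in> {-m<..<0}" for \<xi> s
      using M_bd[OF rr(1), of s \<xi>] that Kr by (auto simp: HU_M)
    show "lam (- \<xi>) = lam \<xi>" for \<xi> by (simp add: lam_def rr)
  qed (use \<rho>0_D(2) q_smooth(2) a bdM rr A_bd lam2_bd H_DM U_DM m0 lam_bd lam_cont in auto)
  interpret P: layer_modes "{0<..<l}" \<rho>0 qP g a b rr A lam H U "\<bar>K\<bar>" 0 l
  proof unfold_locales
    show "\<bar>H \<xi> s\<bar> \<le> \<bar>K\<bar> * (rr \<xi>)\<^sup>2 \<and> \<bar>U \<xi> s\<bar> \<le> \<bar>K\<bar> * (rr \<xi>)\<^sup>2" if "s \<in> {0<..<l}" for \<xi> s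
      using P_bd[OF rr(1), of s \<xi>] that Kr by (auto simp: HU_P)
    show "lam (- \<xi>) = lam \<xi>" for \<xi> by (simp add: lam_def rr)
  qed (use \<rho>0_D(1) q_smooth(1) a bdP rr A_bd lam2_bd H_DP U_DP l lam_bd lam_cont in auto)
  define c where "c = (\<lambda>s. if 0 < s then qP (\<rho>0 s) else qM (\<rho>0 s))"
  define c' where "c' = (\<lambda>s. if 0 < s then deriv qP (\<rho>0 s) * (- g * qP (\<rho>0 s) * \<rho>0 s) else deriv qM (\<rho>0 s) * (- g * qM (\<rho>0 s) * \<rho>0 s))"
  have c_M: "c s = qM (\<rho>0 s)" if "s \<in> {-m<..<0}" for s using that by (simp add: c_def)
  have c_P: "c s = qP (\<rho>0 s)" if "s \<in> {0<..<l}" for s using that by (simp add: c_def)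
  have pos: "0 < \<rho>0 s" if "s \<in> {-m<..<0} \<union> {0<..<l}" for s using bd[of s] a that by (auto simp: IM_def IP_def)
  have cdp: "dp pp pm \<rho>0 s * c s = 1" if "s \<in> {-m<..<0} \<union> {0<..<l}" for s
    using pressure_law_deriv_pos[OF pp pos[OF that]] pressure_law_deriv_pos[OF pm pos[OF that]] that
    by (auto simp: dp_def c_def qP_def qM_def)
  have c_DM: "(c has_real_derivative c' s) (at s)" if s: "s \<in> {-m<..<0}" for s
  proof (rule locM[OF _ _ s])
    show "((\<lambda>s. qM (\<rho>0 s)) has_real_derivative c' s) (at s)"
      using DERIV_chain2[OF smooth_on_DERIV[OF q_smooth(2)] \<rho>0_D(2)[OF s]] pos[of s] s by (simp add: c'_def)
  qed (simp add: c_M)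
  have c_DP: "(c has_real_derivative c' s) (at s)" if s: "s \<in> {0<..<l}" for s
  proof (rule locP[OF _ _ s])
    show "((\<lambda>s. qP (\<rho>0 s)) has_real_derivative c' s) (at s)"
      using DERIV_chain2[OF smooth_on_DERIV[OF q_smooth(1)] \<rho>0_D(1)[OF s]] pos[of s] s by (simp add: c'_def)
  qed (simp add: c_P)
  have \<rho>0_cont: "continuous_on {-m<..<0} \<rho>0" "continuous_on {0<..<l} \<rho>0"
    using sm by (auto intro: smooth_on_imp_continuous_on)
  have comp: "continuous_on S (\<lambda>s. \<phi> (\<rho>0 s))" if "smooth_on {0<..} \<phi>" "continuous_on S \<rho>0" "S \<subseteq> {-m<..<0} \<union> {0<..<l}" for \<phi> S
    by (rule continuous_on_compose2[OF smooth_on_imp_continuous_on[OF that(1)] that(2)]) (use that(3) pos in auto)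
  have c'_cont: "continuous_on ({-m<..<0} \<union> {0<..<l}) c'"
  proof (rule continuous_on_open_Un)
    have "continuous_on {-m<..<0} (\<lambda>s. deriv qM (\<rho>0 s))" "continuous_on {-m<..<0} (\<lambda>s. qM (\<rho>0 s))"
      using comp[OF smooth_on_deriv[OF q_smooth(2)] \<rho>0_cont(1)] comp[OF q_smooth(2) \<rho>0_cont(1)] by auto
    then have "continuous_on {-m<..<0} (\<lambda>s. deriv qM (\<rho>0 s) * (- g * qM (\<rho>0 s) * \<rho>0 s))"
      by (intro continuous_on_mult continuous_on_const \<rho>0_cont)
    then show "continuous_on {-m<..<0} c'" by (rule continuous_on_cong[THEN iffD1, OF refl, rotated]) (simp add: c'_def)
    have "continuous_on {0<..<l} (\<lambda>s. deriv qP (\<rho>0 s))" "continuous_on {0<..<l} (\<lambda>s. qP (\<rho>0 s))"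
      using comp[OF smooth_on_deriv[OF q_smooth(1)] \<rho>0_cont(2)] comp[OF q_smooth(1) \<rho>0_cont(2)] by auto
    then have "continuous_on {0<..<l} (\<lambda>s. deriv qP (\<rho>0 s) * (- g * qP (\<rho>0 s) * \<rho>0 s))"
      by (intro continuous_on_mult continuous_on_const \<rho>0_cont)
    then show "continuous_on {0<..<l} c'" by (rule continuous_on_cong[THEN iffD1, OF refl, rotated]) (simp add: c'_def)
  qed auto
  define u1 where "u1 = (\<lambda>\<xi> s. H \<xi> s * ((\<xi> $ 1 + 2 * \<omega> / lam \<xi> * \<xi> $ 2) / ((lam \<xi>)\<^sup>2 + 4 * \<omega>\<^sup>2)))"
  define u2 where "u2 = (\<lambda>\<xi> s. H \<xi> s * ((\<xi> $ 2 - 2 * \<omega> / lam \<xi> * \<xi> $ 1) / ((lam \<xi>)\<^sup>2 + 4 * \<omega>\<^sup>2)))"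
  define u3 where "u3 = (\<lambda>\<xi> s. - (U \<xi> s / \<rho>0 s) / (lam \<xi>)\<^sup>2)"
  define uq where "uq = (\<lambda>\<xi> s. c s * (\<rho>0 s * H \<xi> s + g * U \<xi> s / (lam \<xi>)\<^sup>2))"
  define W where "W = (\<lambda>r \<tau>. wave_packet.wave (ring_bump r \<tau>) lam (r + 2))"
  have adm: "admissible rr (ring_bump r \<tau>) (r + 2) \<tau>" if "R \<le> r" "0 \<le> \<tau>" for r \<tau>
    unfolding rr_def by (rule ring_bump_admissible[OF R that])
  \<comment> \<open>The interpretation below lives inside a proof with fixed r and \<tau>. Its
    solution is therefore exported as an existence statement, together with the wave formulas, and
    then chosen as a function of r and \<tau>.\<close>
  define mode where "mode = (\<lambda>r \<tau> (\<eta> :: real \<Rightarrow> real^3 \<Rightarrow> real^3) v q. solves_linear_problem g \<omega> pp pm l m \<rho>0 \<eta> v q \<and>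
      (\<forall>t x. \<eta> t x $ 1 = W r \<tau> u1 (- (pi / 2)) t x \<and> \<eta> t x $ 2 = W r \<tau> u2 (- (pi / 2)) t x \<and> \<eta> t x $ 3 = W r \<tau> u3 0 t x \<and>
        v t x $ 1 = W r \<tau> (\<lambda>\<xi> s. lam \<xi> * u1 \<xi> s) (- (pi / 2)) t x \<and> v t x $ 2 = W r \<tau> (\<lambda>\<xi> s. lam \<xi> * u2 \<xi> s) (- (pi / 2)) t x \<and>
        v t x $ 3 = W r \<tau> (\<lambda>\<xi> s. lam \<xi> * u3 \<xi> s) 0 t x \<and> q t x = W r \<tau> uq 0 t x))"
  have "\<exists>\<eta> v q. mode r \<tau> \<eta> v q" if r: "R \<le> r" and \<tau>: "0 \<le> \<tau>" for r \<tau>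
  proof -
    have ad: "continuous_on UNIV (ring_bump r \<tau>)" "\<And>\<xi>. ring_bump r \<tau> \<xi> \<noteq> 0 \<Longrightarrow> norm \<xi> \<le> r + 2"
      using adm[OF r \<tau>] by (auto simp: admissible_def)
    interpret w: wave_packet "ring_bump r \<tau>" lam "r + 2"
      by unfold_locales (use ad lam_cont in force)+
    interpret rt_wave "ring_bump r \<tau>" lam "r + 2" g \<omega> l m \<rho>0 c c' \<rho>M \<rho>P A H U "\<lambda>\<xi>. HM (rr \<xi>)" "\<lambda>\<xi>. UM (rr \<xi>)" "\<lambda>\<xi>. HP (rr \<xi>)" "\<lambda>\<xi>. UP (rr \<xi>)"
    proof unfold_locales
      show "A \<xi> * ((lam \<xi>)\<^sup>2 + 4 * \<omega>\<^sup>2) = (lam \<xi>)\<^sup>2 * (norm \<xi>)\<^sup>2" if "ring_bump r \<tau> \<xi> \<noteq> 0" for \<xi>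
      proof -
        have "rr \<xi> = norm \<xi>" using ring_bump_nonzero[OF that] r by (simp add: rr_def)
        moreover have "f (rr \<xi>) + 4 * \<omega>\<^sup>2 \<noteq> 0" using f[OF rr(1), of \<xi>] w0 by linarith
        ultimately show ?thesis by (simp add: A_def wave_square_def lam2)
      qed
      show "w.profile_cont {-m..0} (\<lambda>\<xi>. HM (rr \<xi>))" "w.profile_cont {-m..0} (\<lambda>\<xi>. UM (rr \<xi>))"
        "w.profile_cont {0..l} (\<lambda>\<xi>. HP (rr \<xi>))" "w.profile_cont {0..l} (\<lambda>\<xi>. UP (rr \<xi>))"
        unfolding w.profile_cont_def by (rule two[OF HM_cont] two[OF UM_cont] two[OF HP_cont] two[OF UP_cont])+
      show "(\<rho>0 has_real_derivative - g * c s * \<rho>0 s) (at s)" "(c has_real_derivative c' s) (at s)"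
        if "s \<in> {-m<..<0} \<union> {0<..<l}" for s using that \<rho>0_D c_M c_P c_DM c_DP by auto
      show "(H \<xi> has_real_derivative U \<xi> s / \<rho>0 s) (at s)"
        "(U \<xi> has_real_derivative \<rho>0 s * (A \<xi> + (lam \<xi>)\<^sup>2 * c s) * H \<xi> s) (at s)"
        if "s \<in> {-m<..<0} \<union> {0<..<l}" for \<xi> s using that H_DM H_DP U_DM U_DP c_M c_P by auto
      show "H \<xi> s = HM (rr \<xi>) s \<and> U \<xi> s = UM (rr \<xi>) s \<and> \<rho>0 s = \<rho>M s" if "s \<in> {-m<..<0}" for \<xi> s
        using that by (simp add: HU_M \<rho>M(2))
      show "H \<xi> s = HP (rr \<xi>) s \<and> U \<xi> s = UP (rr \<xi>) s \<and> \<rho>0 s = \<rho>P s" if "s \<in> {0<..<l}" for \<xi> s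
        using that by (simp add: HU_P \<rho>P(2))
      show "\<rho>M 0 * HM (rr \<xi>) 0 + g * UM (rr \<xi>) 0 / (lam \<xi>)\<^sup>2 = \<rho>P 0 * HP (rr \<xi>) 0 + g * UP (rr \<xi>) 0 / (lam \<xi>)\<^sup>2" for \<xi>
        unfolding lam2 by (rule match(2)[OF rr(1)])
      show "0 < \<rho>M s" if "s \<in> {-m..0}" for s using \<rho>M(3)[OF that] a by simp
      show "0 < \<rho>P s" if "s \<in> {0..l}" for s using \<rho>P(3)[OF that] a by simp
    qed (use l m lam_bd pos c'_cont A_cont \<rho>M(1) \<rho>P(1) walls match(1) rr(1) in auto)
    have b: "b1 = u1" "b2 = u2" "b3 = u3" "bq = uq"
      by (simp_all add: fun_eq_iff b1_def b2_def b3_def bp_def bq_def u1_def u2_def u3_def uq_def)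
    have "solves_linear_problem g \<omega> pp pm l m \<rho>0 eta vel dens" by (rule solves) (rule cdp)
    then have "mode r \<tau> eta vel dens"
      unfolding mode_def W_def eta_def vel_def dens_def b vec3_nth by blast
    then show ?thesis by blast
  qed
  then obtain \<eta> v q where mode: "\<And>r \<tau>. R \<le> r \<Longrightarrow> 0 \<le> \<tau> \<Longrightarrow> mode r \<tau> (\<eta> r \<tau>) (v r \<tau>) (q r \<tau>)"
    by metis
  have sol: "\<And>r \<tau>. R \<le> r \<Longrightarrow> 0 \<le> \<tau> \<Longrightarrow> solves_linear_problem g \<omega> pp pm l m \<rho>0 (\<eta> r \<tau>) (v r \<tau>) (q r \<tau>)"
    and \<eta>: "\<And>r \<tau> t x. R \<le> r \<Longrightarrow> 0 \<le> \<tau> \<Longrightarrow> \<eta> r \<tau> t x $ 1 = W r \<tau> u1 (- (pi / 2)) t x \<and> \<eta> r \<tau> t x $ 2 = W r \<tau> u2 (- (pi / 2)) t x \<and> \<eta> r \<tau> t x $ 3 = W r \<tau> u3 0 t x"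
    and v: "\<And>r \<tau> t x. R \<le> r \<Longrightarrow> 0 \<le> \<tau> \<Longrightarrow> v r \<tau> t x $ 1 = W r \<tau> (\<lambda>\<xi> s. lam \<xi> * u1 \<xi> s) (- (pi / 2)) t x \<and> v r \<tau> t x $ 2 = W r \<tau> (\<lambda>\<xi> s. lam \<xi> * u2 \<xi> s) (- (pi / 2)) t x \<and>
        v r \<tau> t x $ 3 = W r \<tau> (\<lambda>\<xi> s. lam \<xi> * u3 \<xi> s) 0 t x"
    and q: "\<And>r \<tau> t x. R \<le> r \<Longrightarrow> 0 \<le> \<tau> \<Longrightarrow> q r \<tau> t x = W r \<tau> uq 0 t x"
    using mode unfolding mode_def by blast+
  have even: "H (- \<xi>) s = H \<xi> s" "U (- \<xi>) s = U \<xi> s" for \<xi> s by (simp_all add: H_def U_def rr)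
  have HU_cont: "continuous_on (UNIV \<times> {-m<..<0}) (\<lambda>z. H (fst z) (snd z))" "continuous_on (UNIV \<times> {-m<..<0}) (\<lambda>z. U (fst z) (snd z))"
    "continuous_on (UNIV \<times> {0<..<l}) (\<lambda>z. H (fst z) (snd z))" "continuous_on (UNIV \<times> {0<..<l}) (\<lambda>z. U (fst z) (snd z))"
  proof -
    have sub: "UNIV \<times> {-m<..<0} \<subseteq> (UNIV \<times> {-m..0} :: ((real^2) \<times> real) set)" "UNIV \<times> {0<..<l} \<subseteq> (UNIV \<times> {0..l} :: ((real^2) \<times> real) set)"
      by auto
    show "continuous_on (UNIV \<times> {-m<..<0}) (\<lambda>z. H (fst z) (snd z))" "continuous_on (UNIV \<times> {-m<..<0}) (\<lambda>z. U (fst z) (snd z))"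
      by (rule continuous_on_eq[OF continuous_on_subset[OF two[OF HM_cont] sub(1)]] continuous_on_eq[OF continuous_on_subset[OF two[OF UM_cont] sub(1)]];
          auto simp: HU_M)+
    show "continuous_on (UNIV \<times> {0<..<l}) (\<lambda>z. H (fst z) (snd z))" "continuous_on (UNIV \<times> {0<..<l}) (\<lambda>z. U (fst z) (snd z))"
      by (rule continuous_on_eq[OF continuous_on_subset[OF two[OF HP_cont] sub(2)]] continuous_on_eq[OF continuous_on_subset[OF two[OF UP_cont] sub(2)]];
          auto simp: HU_P)+
  qed
  have s1: "\<bar>1 :: real\<bar> = 1" "\<bar>- 1 :: real\<bar> = 1" by simp_all
  have ctl: "\<forall>\<^sub>F n in sequentially.
      controlled lam rr I (- (pi / 2)) u1 k n \<and> controlled lam rr I (- (pi / 2)) u2 k n \<and> controlled lam rr I 0 u3 k n \<and> controlled lam rr I 0 uq k n"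
    if "I \<in> {{0<..<l}, {-m<..<0}}" for I k
    using that
      M.horizontal_controlled[OF HU_cont(1,2) even s1(1), where i = 1 and j = 2 and \<omega> = \<omega> and k = k] M.horizontal_controlled[OF HU_cont(1,2) even s1(2), where i = 2 and j = 1 and \<omega> = \<omega> and k = k]
      M.vertical_controlled[OF HU_cont(1,2) even, where k = k] M.density_controlled[OF HU_cont(1,2) even c_M, where k = k]
      P.horizontal_controlled[OF HU_cont(3,4) even s1(1), where i = 1 and j = 2 and \<omega> = \<omega> and k = k] P.horizontal_controlled[OF HU_cont(3,4) even s1(2), where i = 2 and j = 1 and \<omega> = \<omega> and k = k]
      P.vertical_controlled[OF HU_cont(3,4) even, where k = k] P.density_controlled[OF HU_cont(3,4) even c_P, where k = k]
    by (auto simp: eventually_conj_iff u1_def u2_def u3_def uq_def)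
  \<comment> \<open>The oscillation \<mu> over a layer of thickness \<open>m\<close> gives the first
    factor, the disc inside the annulus the factor pi / 4.\<close>
  define \<kappa> where "\<kappa> = \<mu>\<^sup>2 / m * (pi / 4)"
  have low: "ennreal ((\<tau> / 2 * exp (sqrt (\<theta> * r) * t) / (r + 2)\<^sup>2)\<^sup>2 * \<kappa>)
      \<le> (\<integral>\<^sup>+\<xi>. (\<integral>\<^sup>+s\<in>{-m<..<0}. ennreal ((ring_bump r \<tau> \<xi> * exp (lam \<xi> * t) * u3 \<xi> s)\<^sup>2) \<partial>lborel) \<partial>lborel)"
    if r: "R \<le> r" and \<tau>: "0 \<le> \<tau>" and t: "0 \<le> t" for r \<tau> t
    unfolding \<kappa>_def u3_def mult.assoc[of _ "\<mu>\<^sup>2 / m", symmetric]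
  proof (rule ring_bump_lower[where V = "\<lambda>\<xi> s. U \<xi> s / \<rho>0 s" and I = "{-m<..<0}", OF \<tau> _ t])
    show "0 \<le> r" using r R by simp
    then show "0 < sqrt (\<theta> * r)" using \<theta> r R by simp
    show "0 \<le> \<mu>\<^sup>2 / m" using m by simp
    show "sqrt (\<theta> * r) \<le> lam \<xi> \<and> lam \<xi> \<le> r + 2" if "r < norm \<xi>" "norm \<xi> < r + 2" for \<xi>
    proof -
      have e: "rr \<xi> = norm \<xi>" using that r by (simp add: rr_def)
      have "\<theta> * r \<le> \<theta> * rr \<xi>" using \<theta> that e by simp
      then have "sqrt (\<theta> * r) \<le> lam \<xi>" using f[OF rr(1), of \<xi>] by (simp add: lam_def)
      then show ?thesis using lam_bd[of \<xi>] e that by simp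
    qed
    show "ennreal (\<mu>\<^sup>2 / m) \<le> (\<integral>\<^sup>+s\<in>{-m<..<0}. ennreal ((U \<xi> s / \<rho>0 s)\<^sup>2) \<partial>lborel)" for \<xi>
    proof -
      have sec: "continuous_on {-m..0} (HM (rr \<xi>))" "continuous_on {-m..0} (UM (rr \<xi>))"
      proof -
        have "continuous_on {-m..0} (\<lambda>s. (rr \<xi>, s))" "(\<lambda>s. (rr \<xi>, s)) ` {-m..0} \<subseteq> {R..} \<times> {-m..0}"
          using rr(1)[of \<xi>] by (auto intro!: continuous_intros)
        from continuous_on_compose2[OF HM_cont this] continuous_on_compose2[OF UM_cont this]
        show "continuous_on {-m..0} (HM (rr \<xi>))" "continuous_on {-m..0} (UM (rr \<xi>))" by simp_all
      qed
      have "\<mu>\<^sup>2 \<le> (HM (rr \<xi>) 0 - HM (rr \<xi>) (- m))\<^sup>2"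
        using osc[OF rr(1), of \<xi>] \<mu> by (simp add: abs_le_square_iff[symmetric])
      then have "ennreal (\<mu>\<^sup>2 / m) \<le> ennreal ((HM (rr \<xi>) 0 - HM (rr \<xi>) (- m))\<^sup>2 / (0 - (- m)))"
        using m by (intro ennreal_leI) (simp add: divide_right_mono)
      also have "\<dots> \<le> (\<integral>\<^sup>+s\<in>{-m<..<0}. ennreal ((UM (rr \<xi>) s / \<rho>M s)\<^sup>2) \<partial>lborel)"
      proof (rule nn_integral_deriv_square_ge[OF m0 sec(1)])
        show "continuous_on {-m..0} (\<lambda>s. UM (rr \<xi>) s / \<rho>M s)"
          by (intro continuous_intros sec \<rho>M(1)) (use \<rho>M(3) a in force)
      qed (rule HM_D[OF rr(1)])
      also have "\<dots> = (\<integral>\<^sup>+s\<in>{-m<..<0}. ennreal ((U \<xi> s / \<rho>0 s)\<^sup>2) \<partial>lborel)"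
        by (intro nn_integral_cong) (auto simp: indicator_def HU_M \<rho>M(2))
      finally show ?thesis .
    qed
    show "(\<lambda>s. ennreal ((U \<xi> s / \<rho>0 s)\<^sup>2) * indicator {-m<..<0} s) \<in> borel_measurable borel" for \<xi>
    proof -
      have U_cont: "continuous_on {-m<..<0} (U \<xi>)" using U_DM by (blast intro: continuous_at_imp_continuous_on DERIV_isCont)
      have "\<forall>s\<in>{-m<..<0}. \<rho>0 s \<noteq> 0" using pos by (metis UnI1 less_irrefl)
      then have "continuous_on {-m<..<0} (\<lambda>s. (U \<xi> s / \<rho>0 s)\<^sup>2)"
        by (intro continuous_on_power continuous_on_divide \<rho>0_cont U_cont)
      then have [measurable]: "(\<lambda>s. indicator {-m<..<0} s *\<^sub>R (U \<xi> s / \<rho>0 s)\<^sup>2) \<in> borel_measurable borel"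
        by (intro borel_measurable_continuous_on_indicator) auto
      have "(\<lambda>s. ennreal ((U \<xi> s / \<rho>0 s)\<^sup>2) * indicator {-m<..<0} s) = (\<lambda>s. ennreal (indicator {-m<..<0} s *\<^sub>R (U \<xi> s / \<rho>0 s)\<^sup>2))"
        by (auto simp: fun_eq_iff indicator_def)
      then show ?thesis by (simp only:) measurable
    qed
  qed
  have main: "\<forall>\<^sub>F n in sequentially. growing_family l m R \<theta> \<kappa> \<eta> v q k n" for k
    using ctl[of "{0<..<l}" k, simplified] ctl[of "{-m<..<0}" k, simplified]
  proof eventually_elim
    case (elim n)
    show ?case
      unfolding growing_family_def
    proof (intro allI impI)
      fix r \<tau> t :: real assume r: "R \<le> r" and \<tau>: "0 \<le> \<tau>" and t: "0 \<le> t"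
      note ad = adm[OF r \<tau>]
      have all: "(\<forall>i. in_Hk_slab I k (\<lambda>x. \<eta> r \<tau> t x $ i) \<and> in_Hk_slab I k (\<lambda>x. v r \<tau> t x $ i) \<and>
           Hk_slab_sqnorm I k (\<lambda>x. \<eta> r \<tau> t x $ i) \<le> Hk_slab_sqnorm I k (\<lambda>x. v r \<tau> t x $ i) \<and>
           Hk_slab_sqnorm I k (\<lambda>x. v r \<tau> t x $ i) \<le> ennreal (\<tau>\<^sup>2 * exp (2 * (r + 2) * t) * (real n * (r + 2) ^ n))) \<and>
         in_Hk_slab I k (q r \<tau> t) \<and> Hk_slab_sqnorm I k (q r \<tau> t) \<le> ennreal (\<tau>\<^sup>2 * exp (2 * (r + 2) * t) * (real n * (r + 2) ^ n))"
        if I: "controlled lam rr I (- (pi / 2)) u1 k n" "controlled lam rr I (- (pi / 2)) u2 k n" "controlled lam rr I 0 u3 k n" "controlled lam rr I 0 uq k n" for I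
      proof -
        have 1: "\<eta> r \<tau> t x $ 1 = wave_packet.wave (ring_bump r \<tau>) lam (r + 2) u1 (- (pi / 2)) t x"
          "\<eta> r \<tau> t x $ 2 = wave_packet.wave (ring_bump r \<tau>) lam (r + 2) u2 (- (pi / 2)) t x"
          "\<eta> r \<tau> t x $ 3 = wave_packet.wave (ring_bump r \<tau>) lam (r + 2) u3 0 t x"
          "v r \<tau> t x $ 1 = wave_packet.wave (ring_bump r \<tau>) lam (r + 2) (\<lambda>\<xi> s. lam \<xi> * u1 \<xi> s) (- (pi / 2)) t x"
          "v r \<tau> t x $ 2 = wave_packet.wave (ring_bump r \<tau>) lam (r + 2) (\<lambda>\<xi> s. lam \<xi> * u2 \<xi> s) (- (pi / 2)) t x"
          "v r \<tau> t x $ 3 = wave_packet.wave (ring_bump r \<tau>) lam (r + 2) (\<lambda>\<xi> s. lam \<xi> * u3 \<xi> s) 0 t x"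
          "q r \<tau> t x = wave_packet.wave (ring_bump r \<tau>) lam (r + 2) uq 0 t x" for x
          using \<eta>[OF r \<tau>, of t x] v[OF r \<tau>, of t x] q[OF r \<tau>, of t x] by (simp_all add: W_def)
        note C = controlledD[OF I(1) ad t 1(1,4)] controlledD[OF I(2) ad t 1(2,5)] controlledD[OF I(3) ad t 1(3,6)] controlledD[OF I(4) ad t 1(7) refl]
        show ?thesis unfolding forall_3 using C(1-4,6-9,11-14,16) order_trans[OF C(18,19)] by blast
      qed
      have e3: "\<eta> r \<tau> t x $ 3 = wave_packet.wave (ring_bump r \<tau>) lam (r + 2) u3 0 t x" for x
        using \<eta>[OF r \<tau>, of t x] by (simp add: W_def)
      have u3: "controlled lam rr {-m<..<0} 0 u3 k n" using elim(2) by blast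
      have "(\<integral>\<^sup>+\<xi>. (\<integral>\<^sup>+s\<in>{-m<..<0}. ennreal ((ring_bump r \<tau> \<xi> * exp (lam \<xi> * t) * u3 \<xi> s)\<^sup>2) \<partial>lborel) \<partial>lborel)
        \<le> Hk_slab_sqnorm {-m<..<0} k (\<lambda>x. \<eta> r \<tau> t x $ 3)"
        by (rule controlledD(5)[OF u3 ad t e3 refl])
      from order_trans[OF low[OF r \<tau> t] this]
      show "(\<forall>I\<in>{{0<..<l}, {-m<..<0}}.
         (\<forall>i. in_Hk_slab I k (\<lambda>x. \<eta> r \<tau> t x $ i) \<and> in_Hk_slab I k (\<lambda>x. v r \<tau> t x $ i) \<and>
           Hk_slab_sqnorm I k (\<lambda>x. \<eta> r \<tau> t x $ i) \<le> Hk_slab_sqnorm I k (\<lambda>x. v r \<tau> t x $ i) \<and>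
           Hk_slab_sqnorm I k (\<lambda>x. v r \<tau> t x $ i) \<le> ennreal (\<tau>\<^sup>2 * exp (2 * (r + 2) * t) * (real n * (r + 2) ^ n))) \<and>
         in_Hk_slab I k (q r \<tau> t) \<and> Hk_slab_sqnorm I k (q r \<tau> t) \<le> ennreal (\<tau>\<^sup>2 * exp (2 * (r + 2) * t) * (real n * (r + 2) ^ n))) \<and>
       ennreal ((\<tau> / 2 * exp (sqrt (\<theta> * r) * t) / (r + 2)\<^sup>2)\<^sup>2 * \<kappa>) \<le> Hk_slab_sqnorm {-m<..<0} k (\<lambda>x. \<eta> r \<tau> t x $ 3)"
        using all elim by blast
    qed
  qed
  have \<kappa>0: "0 < \<kappa>" using \<mu> m by (simp add: \<kappa>_def)
  show ?thesis by (rule that[OF R \<theta> \<kappa>0 sol main])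
qed

section \<open>Choice of wave numbers and amplitudes\<close>

lemma exp_sqrt_dominates:
  fixes \<theta> T C :: real
  assumes "0 < \<theta>" "0 < T"
  shows "\<exists>r\<ge>R. C * (r + 2) ^ p \<le> exp (2 * (sqrt (\<theta> * r) * T))"
proof -
  define c where "c = 2 * (sqrt \<theta> * T)"
  have c: "0 < c" using assms by (simp add: c_def)
  have "((\<lambda>r. C * (r + 2) powr real p / exp (c * sqrt r)) \<longlongrightarrow> 0) at_top"
    using c by real_asymp
  then have "\<forall>\<^sub>F r in at_top. C * (r + 2) powr real p / exp (c * sqrt r) < 1"
    by (rule order_tendstoD) simp
  then have "\<forall>\<^sub>F r in at_top. R \<le> r \<and> 0 \<le> r \<and> C * (r + 2) powr real p / exp (c * sqrt r) < 1"
    by (intro eventually_conj eventually_ge_at_top)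
  then obtain r where "R \<le> r" "0 \<le> r" "C * (r + 2) powr real p / exp (c * sqrt r) < 1"
    by (auto simp: eventually_at_top_linorder)
  then show ?thesis
    using assms by (intro exI[of _ r]) (simp add: powr_realpow divide_less_eq c_def real_sqrt_mult mult_ac less_imp_le)
qed

lemma Hk_norm_le:
  assumes "Hk_slab_sqnorm {0<..<l} k f \<le> ennreal B" "Hk_slab_sqnorm {-m<..<0} k f \<le> ennreal B" "0 \<le> B"
  shows "Hk_norm l m k f \<le> sqrt (2 * B)"
proof -
  have "Hk_slab_sqnorm {0<..<l} k f + Hk_slab_sqnorm {-m<..<0} k f \<le> ennreal (2 * B)"
    using add_mono[OF assms(1,2)] assms(3) by (simp add: ennreal_plus[symmetric] del: ennreal_plus)
  then have "enn2real (Hk_slab_sqnorm {0<..<l} k f + Hk_slab_sqnorm {-m<..<0} k f) \<le> 2 * B"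
    using assms(3) by (intro enn2real_leI) auto
  then show ?thesis by (simp add: Hk_norm_def)
qed

lemma Hk_norm_vec_le:
  assumes "\<And>i. Hk_slab_sqnorm {0<..<l} k (\<lambda>x. f x $ i) \<le> ennreal B" "\<And>i. Hk_slab_sqnorm {-m<..<0} k (\<lambda>x. f x $ i) \<le> ennreal B" "0 \<le> B"
  shows "Hk_norm_vec l m k f \<le> sqrt (6 * B)"
proof -
  have "(Hk_norm l m k (\<lambda>x. f x $ i))\<^sup>2 \<le> 2 * B" for i
    using power_mono[OF Hk_norm_le[OF assms(1,2,3)], of i 2] assms(3) by (simp add: Hk_norm_def)
  from this[of 1] this[of 2] this[of 3] show ?thesis by (simp add: Hk_norm_vec_def sum_3)
qed

text \<open>The upper bounds ensure finiteness: \<open>enn2real\<close> sends infinity to 0, so it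
  is monotone only below infinity.\<close>

lemma Hk_norm_mono:
  assumes "Hk_slab_sqnorm {0<..<l} k f \<le> Hk_slab_sqnorm {0<..<l} k h" "Hk_slab_sqnorm {-m<..<0} k f \<le> Hk_slab_sqnorm {-m<..<0} k h"
    and "Hk_slab_sqnorm {0<..<l} k h \<le> ennreal B" "Hk_slab_sqnorm {-m<..<0} k h \<le> ennreal B"
  shows "Hk_norm l m k f \<le> Hk_norm l m k h"
proof -
  have "Hk_slab_sqnorm {0<..<l} k h < top" "Hk_slab_sqnorm {-m<..<0} k h < top"
    using assms(3,4) by (auto intro: le_less_trans)
  then show ?thesis unfolding Hk_norm_def
    by (intro real_sqrt_le_mono enn2real_mono add_mono assms) simp
qed

lemma Hk_norm_vec_mono:
  assumes "\<And>i. Hk_norm l m k (\<lambda>x. f x $ i) \<le> Hk_norm l m k (\<lambda>x. h x $ i)"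
  shows "Hk_norm_vec l m k f \<le> Hk_norm_vec l m k h"
  unfolding Hk_norm_vec_def
  by (intro real_sqrt_le_mono sum_mono power_mono assms) (simp add: Hk_norm_def)

lemma Hk_norm_vec_ge:
  assumes "ennreal A \<le> Hk_slab_sqnorm {-m<..<0} k (\<lambda>x. f x $ i)" "0 \<le> A"
    and "Hk_slab_sqnorm {0<..<l} k (\<lambda>x. f x $ i) \<le> ennreal B" "Hk_slab_sqnorm {-m<..<0} k (\<lambda>x. f x $ i) \<le> ennreal B"
  shows "sqrt A \<le> Hk_norm_vec l m k f"
proof -
  let ?S = "Hk_slab_sqnorm {0<..<l} k (\<lambda>x. f x $ i) + Hk_slab_sqnorm {-m<..<0} k (\<lambda>x. f x $ i)"
  have fin: "?S < top" using assms(3,4) by (auto intro: le_less_trans)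
  have "ennreal A \<le> ?S" using assms(1) by (simp add: add_increasing)
  then have "A \<le> enn2real ?S" using enn2real_mono[of "ennreal A" ?S] fin assms(2) by simp
  also have "\<dots> = (Hk_norm l m k (\<lambda>x. f x $ i))\<^sup>2" by (simp add: Hk_norm_def)
  also have "\<dots> \<le> (\<Sum>i\<in>UNIV. (Hk_norm l m k (\<lambda>x. f x $ i))\<^sup>2)" by (rule member_le_sum) auto
  finally show ?thesis by (simp add: Hk_norm_vec_def)
qed

theorem theorem1p1:
  fixes g \<omega> l m T0 \<alpha> :: real
    and pp pm \<rho>0 :: "real \<Rightarrow> real"
    and k j :: nat
  assumes "g > 0" and "l > 0" and "m > 0"
    and "pressure_law pp" and "pressure_law pm"
    and "{z \<in> {0<..}. pm z > pp z \<and> pm z \<in> pp ` {0<..}} \<noteq> {}"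
    and "steady_density g pp pm l m \<rho>0"
    and "j \<ge> k" and "T0 > 0" and "\<alpha> > 0"
  shows "\<exists>(\<eta> :: nat \<Rightarrow> real \<Rightarrow> real^3 \<Rightarrow> real^3)
          (v :: nat \<Rightarrow> real \<Rightarrow> real^3 \<Rightarrow> real^3)
          (q :: nat \<Rightarrow> real \<Rightarrow> real^3 \<Rightarrow> real).
    \<forall>n\<ge>1.
      solves_linear_problem g \<omega> pp pm l m \<rho>0 (\<eta> n) (v n) (q n) \<and>
      (\<forall>t\<ge>0. in_Hk_vec l m k (\<eta> n t) \<and> in_Hk_vec l m k (v n t) \<and> in_Hk l m k (q n t)) \<and>
      in_Hk_vec l m j (\<eta> n 0) \<and> in_Hk_vec l m j (v n 0) \<and> in_Hk l m j (q n 0) \<and>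
      Hk_norm_vec l m j (\<eta> n 0) + Hk_norm_vec l m j (v n 0) + Hk_norm l m j (q n 0)
        \<le> 1 / real n \<and>
      (\<forall>t\<ge>T0. Hk_norm_vec l m k (v n t) \<ge> Hk_norm_vec l m k (\<eta> n t) \<and>
               Hk_norm_vec l m k (\<eta> n t) \<ge> \<alpha>)"
proof -
  obtain R \<theta> \<kappa> and \<eta> v :: "real \<Rightarrow> real \<Rightarrow> real \<Rightarrow> real^3 \<Rightarrow> real^3" and q :: "real \<Rightarrow> real \<Rightarrow> real \<Rightarrow> real^3 \<Rightarrow> real"
    where R: "1 \<le> R" and \<theta>: "0 < \<theta>" and \<kappa>: "0 < \<kappa>"
    and sol: "\<And>r \<tau>. R \<le> r \<Longrightarrow> 0 \<le> \<tau> \<Longrightarrow> solves_linear_problem g \<omega> pp pm l m \<rho>0 (\<eta> r \<tau>) (v r \<tau>) (q r \<tau>)"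
    and ev: "\<And>k. \<forall>\<^sub>F n in sequentially. growing_family l m R \<theta> \<kappa> \<eta> v q k n"
    by (rule growing_modes[OF assms(1-5) assms(7), of \<omega>]; rule that)
  have "\<forall>\<^sub>F n in sequentially. growing_family l m R \<theta> \<kappa> \<eta> v q k n \<and> growing_family l m R \<theta> \<kappa> \<eta> v q j n \<and> 1 \<le> n" by (intro eventually_conj eventually_ge_at_top ev)
  \<comment> \<open>One \<open>N\<close> for both Sobolev orders, so that the same amplitude
    controls the initial data at order \<open>j\<close> and enters the lower bound at order
    \<open>k\<close>.\<close>
  then obtain N where N: "growing_family l m R \<theta> \<kappa> \<eta> v q k N" "growing_family l m R \<theta> \<kappa> \<eta> v q j N" "1 \<le> N" using eventually_happens'[OF sequentially_bot] by blast
  have slab: "in_Hk_slab I k' (\<lambda>x. \<eta> r \<tau> t x $ i) \<and> in_Hk_slab I k' (\<lambda>x. v r \<tau> t x $ i) \<and>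
       Hk_slab_sqnorm I k' (\<lambda>x. \<eta> r \<tau> t x $ i) \<le> Hk_slab_sqnorm I k' (\<lambda>x. v r \<tau> t x $ i) \<and>
       Hk_slab_sqnorm I k' (\<lambda>x. v r \<tau> t x $ i) \<le> ennreal (\<tau>\<^sup>2 * exp (2 * (r + 2) * t) * (real N * (r + 2) ^ N)) \<and>
       in_Hk_slab I k' (q r \<tau> t) \<and> Hk_slab_sqnorm I k' (q r \<tau> t) \<le> ennreal (\<tau>\<^sup>2 * exp (2 * (r + 2) * t) * (real N * (r + 2) ^ N))"
    if k': "growing_family l m R \<theta> \<kappa> \<eta> v q k' N" and r: "R \<le> r" and \<tau>: "0 \<le> \<tau>" and t: "0 \<le> t" and I: "I \<in> {{0<..<l}, {-m<..<0}}" for k' r \<tau> t I i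
    using bspec[OF conjunct1[OF k'[unfolded growing_family_def, rule_format, OF r \<tau> t]] I] by blast
  have K_low: "ennreal ((\<tau> / 2 * exp (sqrt (\<theta> * r) * t) / (r + 2)\<^sup>2)\<^sup>2 * \<kappa>) \<le> Hk_slab_sqnorm {-m<..<0} k (\<lambda>x. \<eta> r \<tau> t x $ 3)"
    if r: "R \<le> r" and \<tau>: "0 \<le> \<tau>" and t: "0 \<le> t" for r \<tau> t
    by (rule conjunct2[OF N(1)[unfolded growing_family_def, rule_format, OF r \<tau> t]])
  \<comment> \<open>The constants anticipate the lower bound at time T0: the squared amplitude is 1
    / (64 n^2 Q) and the halved tent contributes another 1/4, hence 256. Of the exponent, N comes
    from Q and 4 from the divisor (r + 2)^2 squared.\<close>
  have "\<exists>r. R \<le> r \<and> (256 * \<alpha>\<^sup>2 * (real n)\<^sup>2 * real N / \<kappa>) * (r + 2) ^ (N + 4) \<le> exp (2 * (sqrt (\<theta> * r) * T0))" for n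
    using exp_sqrt_dominates[OF \<theta> assms(9)] by blast
  then obtain r where r: "\<And>n. R \<le> r n" and
    big: "\<And>n. (256 * \<alpha>\<^sup>2 * (real n)\<^sup>2 * real N / \<kappa>) * (r n + 2) ^ (N + 4) \<le> exp (2 * (sqrt (\<theta> * r n) * T0))"
    by metis
  define Q where "Q = (\<lambda>n. real N * (r n + 2) ^ N)"
  \<comment> \<open>With this amplitude each component starts in each layer with norm at most 1 / (8
    n); the three initial norms then add up to at most (2 sqrt 6 + sqrt 2) / (8 n), which is below 1
    / n. At n = 0 division by zero makes the amplitude 0.\<close>
  define \<tau> where "\<tau> = (\<lambda>n. 1 / (8 * real n * sqrt (Q n)))"
  have r2: "0 < r n + 2" for n using r[of n] R by simp
  have Q: "0 < Q n" for n using N(3) r2[of n] by (simp add: Q_def)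
  have \<tau>0: "0 \<le> \<tau> n" for n using Q[of n] by (simp add: \<tau>_def)
  have \<tau>2: "(\<tau> n)\<^sup>2 * Q n = (1 / (8 * real n))\<^sup>2" for n
    using Q[of n] by (simp add: \<tau>_def power_divide power_mult_distrib)
  show ?thesis
  proof (rule exI[of _ "\<lambda>n. \<eta> (r n) (\<tau> n)"], rule exI[of _ "\<lambda>n. v (r n) (\<tau> n)"], rule exI[of _ "\<lambda>n. q (r n) (\<tau> n)"], intro allI impI conjI)
    fix n :: nat assume n: "1 \<le> n"
    note K' = slab[OF N(1) r[of n] \<tau>0[of n]]
    note J' = slab[OF N(2) r[of n] \<tau>0[of n] order_refl]
    show "solves_linear_problem g \<omega> pp pm l m \<rho>0 (\<eta> (r n) (\<tau> n)) (v (r n) (\<tau> n)) (q (r n) (\<tau> n))"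
      by (rule sol[OF r \<tau>0])
    show "in_Hk_vec l m j (\<eta> (r n) (\<tau> n) 0)" "in_Hk_vec l m j (v (r n) (\<tau> n) 0)" "in_Hk l m j (q (r n) (\<tau> n) 0)"
      using J' by (simp_all add: in_Hk_vec_def in_Hk_def)
    define B where "B = (1 / (8 * real n))\<^sup>2"
    have B: "(\<tau> n)\<^sup>2 * exp (2 * (r n + 2) * 0) * (real N * (r n + 2) ^ N) = B"
      using \<tau>2[of n] by (simp add: B_def Q_def)
    have B0: "0 \<le> B" by (simp add: B_def)
    have v_le: "Hk_slab_sqnorm I j (\<lambda>x. v (r n) (\<tau> n) 0 x $ i) \<le> ennreal B" if "I \<in> {{0<..<l}, {-m<..<0}}" for I i
      using J'[OF that, of i] unfolding B by blast
    have \<eta>_le: "Hk_slab_sqnorm I j (\<lambda>x. \<eta> (r n) (\<tau> n) 0 x $ i) \<le> ennreal B" if "I \<in> {{0<..<l}, {-m<..<0}}" for I i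
      using J'[OF that, of i] v_le[OF that, of i] by (meson order_trans)
    have q_le: "Hk_slab_sqnorm I j (q (r n) (\<tau> n) 0) \<le> ennreal B" if "I \<in> {{0<..<l}, {-m<..<0}}" for I
      using J'[OF that] unfolding B by blast
    have sB: "sqrt B = 1 / (8 * real n)" by (simp add: B_def)
    have s6: "sqrt 6 \<le> 5 / 2" "sqrt 2 \<le> 3 / 2" by (rule real_le_lsqrt; simp add: power2_eq_square)+
    have "Hk_norm_vec l m j (\<eta> (r n) (\<tau> n) 0) \<le> sqrt (6 * B)" "Hk_norm_vec l m j (v (r n) (\<tau> n) 0) \<le> sqrt (6 * B)"
      by (rule Hk_norm_vec_le[OF _ _ B0]; rule \<eta>_le v_le; simp)+
    moreover have "Hk_norm l m j (q (r n) (\<tau> n) 0) \<le> sqrt (2 * B)"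
      by (rule Hk_norm_le[OF _ _ B0]; rule q_le; simp)
    ultimately have "Hk_norm_vec l m j (\<eta> (r n) (\<tau> n) 0) + Hk_norm_vec l m j (v (r n) (\<tau> n) 0) + Hk_norm l m j (q (r n) (\<tau> n) 0)
      \<le> (sqrt 6 + sqrt 6 + sqrt 2) * sqrt B" by (simp add: real_sqrt_mult distrib_right)
    also have "\<dots> \<le> 8 * sqrt B" using s6 B0 by (intro mult_right_mono) auto
    also have "\<dots> = 1 / real n" using n by (simp add: sB)
    finally show "Hk_norm_vec l m j (\<eta> (r n) (\<tau> n) 0) + Hk_norm_vec l m j (v (r n) (\<tau> n) 0) + Hk_norm l m j (q (r n) (\<tau> n) 0) \<le> 1 / real n" .
    show "in_Hk_vec l m k (\<eta> (r n) (\<tau> n) t)" "in_Hk_vec l m k (v (r n) (\<tau> n) t)" "in_Hk l m k (q (r n) (\<tau> n) t)" if t: "0 \<le> t" for t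
      using K'[OF t] by (simp_all add: in_Hk_vec_def in_Hk_def)
    fix t assume t: "T0 \<le> t"
    then have t0: "0 \<le> t" using assms(9) by simp
    have in0: "{0<..<l} \<in> {{0<..<l}, {-m<..<0}}" "{-m<..<0} \<in> {{0<..<l}, {-m<..<0}}" by simp_all
    note KP = K'[OF t0 in0(1)] and KM = K'[OF t0 in0(2)]
    show "Hk_norm_vec l m k (\<eta> (r n) (\<tau> n) t) \<le> Hk_norm_vec l m k (v (r n) (\<tau> n) t)"
      by (rule Hk_norm_vec_mono, rule Hk_norm_mono) (use KP KM in blast)+
    define A where "A = (\<tau> n / 2 * exp (sqrt (\<theta> * r n) * t) / (r n + 2)\<^sup>2)\<^sup>2 * \<kappa>"
    have "\<alpha> \<le> sqrt A"
    proof (rule real_le_rsqrt)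
      have e: "exp (2 * (sqrt (\<theta> * r n) * T0)) \<le> (exp (sqrt (\<theta> * r n) * t))\<^sup>2"
      proof -
        have "sqrt (\<theta> * r n) * T0 \<le> sqrt (\<theta> * r n) * t"
          using t \<theta> r[of n] R by (intro mult_left_mono) auto
        then show ?thesis by (simp add: exp_double[symmetric])
      qed
      have "\<alpha>\<^sup>2 = (256 * \<alpha>\<^sup>2 * (real n)\<^sup>2 * real N / \<kappa>) * (r n + 2) ^ (N + 4) * (\<kappa> / (256 * (real n)\<^sup>2 * Q n * (r n + 2) ^ 4))"
        using n N(3) \<kappa> r2[of n] by (simp add: Q_def power_add)
      also have "\<dots> \<le> (exp (sqrt (\<theta> * r n) * t))\<^sup>2 * (\<kappa> / (256 * (real n)\<^sup>2 * Q n * (r n + 2) ^ 4))"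
        by (rule mult_right_mono[OF order_trans[OF big e]]) (use \<kappa> Q[of n] r2[of n] in simp)
      also have "\<dots> = A"
        using Q[of n] by (simp add: A_def \<tau>_def power_divide power_mult_distrib power_mult[symmetric])
      finally show "\<alpha>\<^sup>2 \<le> A" .
    qed
    also have "sqrt A \<le> Hk_norm_vec l m k (\<eta> (r n) (\<tau> n) t)"
      unfolding A_def
      by (rule Hk_norm_vec_ge[where i = 3, OF K_low[OF r \<tau>0 t0]])
        (use \<kappa> KP[of 3] KM[of 3] in \<open>auto intro: order_trans\<close>)
    finally show "\<alpha> \<le> Hk_norm_vec l m k (\<eta> (r n) (\<tau> n) t)" .
  qed
qed

end
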